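(* Let $(\mathsf{X},\mathsf{d})$ be a proper geodesic metric space and let $f^h:\mathsf{X}\to\mathbb{R}\cup\{+\infty\}$, $h\in\mathbb{N}$, be lower semicontinuous functions such that $f^h$ $\Gamma$-converges to $f:\mathsf{X}\to\mathbb{R}\cup\{+\infty\}$, with $f$ proper and lower semicontinuous. Assume moreover that there exists $\lambda\in\mathbb{R}$ such that each $g\in\{f^h: h\in\mathbb{N}\}\cup\{f\}$ satisfies the following condition (with that value of $\lambda$): for any $y,x_0,x_1\in D(g)$ there exists a curve $\gamma:[0,1]\to\mathsf{X}$ joining $x_0$ to $x_1$ such that the map $$x\mapsto g(x)+\frac{\mathsf{d}(x,y)^2}{2\tau}$$ is $(\lambda+\tau^{-1})$-convex along $\gamma$ for every $\tau\in\left(0,\frac{1}{\lambda^-}\right)$. Assume also that $\overline{D(f^h)}=\mathsf{X}$ for every $h$. Let $\{x_0^h\}_h,\{x_1^h\}_h\subseteq\mathsf{X}$ be two sequences with $x_0^h\to x_0$ and $x_1^h\to x_1$, and assume that $$\limsup_h |\partial f^h|(x_0^h)<+\infty\quad\text{and}\quad \limsup_h |\partial f^h|(x_1^h)<+\infty.$$ Then the functionals $\Theta^{f^h}_{x_0^h,x_1^h}$ $\Gamma$-converge to $\Theta^f_{x_0,x_1}$ with respect to the topology of $\mathrm{C}([0,1],\mathsf{X})$ (uniform convergence).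
   Context: A metric space is proper if its closed bounded subsets are compact, and geodesic if any two points are joined by a constant speed geodesic. $D(f)=\{x: f(x)<+\infty\}$ is the effective domain; $f$ is proper if $D(f)\ne\emptyset$. $\lambda^-=\max\{-\lambda,0\}$, with $1/0=+\infty$. A function $\phi:\mathsf{X}\to\mathbb{R}\cup\{+\infty\}$ is $\mu$-convex along a curve $\gamma:[0,1]\to\mathsf{X}$ if $\phi(\gamma(t))\le(1-t)\phi(\gamma(0))+t\phi(\gamma(1))-\frac{\mu}{2}t(1-t)\mathsf{d}(\gamma(0),\gamma(1))^2$ for all $t\in[0,1]$. In the convexity condition of the claim, the curve $\gamma$ may depend on $y,x_0,x_1$ but not on $\tau$. Descending slope: $|\partial f|(x)=+\infty$ if $x\notin D(f)$; $|\partial f|(x)=0$ if $x\in D(f)$ is isolated; otherwise $|\partial f|(x)=\limsup_{y\to x}\frac{(f(y)-f(x))^-}{\mathsf{d}(y,x)}$, where $a^-=\max\{-a,0\}$. For $x_0,x_1\in\mathsf{X}$ the functional $\Theta^f_{x_0,x_1}:\mathrm{C}([0,1],\mathsf{X})\to[0,+\infty]$ is $$\Theta^f_{x_0,x_1}(\gamma)=\int_0^1 |\dot\gamma|^2(t)+|\partial f|^2(\gamma(t))\,dt$$ if $\gamma$ is absolutely continuous with $\gamma(0)=x_0$, $\gamma(1)=x_1$, and $\Theta^f_{x_0,x_1}(\gamma)=+\infty$ otherwise. Here $|\dot\gamma|$ is the metric derivative. $\Gamma$-convergence of functions $F^h$ to $F$ on a metric space $Y$ (used both for $Y=\mathsf{X}$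 and for $Y=\mathrm{C}([0,1],\mathsf{X})$ with the uniform distance) means: (i) if $y^h\to y$ then $F(y)\le\liminf_h F^h(y^h)$; (ii) for every $y\in Y$ there is $y^h\to y$ with $\limsup_h F^h(y^h)\le F(y)$. *)

theory Defs
  imports "HOL-Analysis.Analysis"
begin

definition eff_dom :: "('a \<Rightarrow> ereal) \<Rightarrow> 'a set" where
  "eff_dom f = {x. f x < \<infinity>}"

definition lsc :: "('a::topological_space \<Rightarrow> ereal) \<Rightarrow> bool" where
  "lsc f \<longleftrightarrow> (\<forall>x. f x \<le> Liminf (at x) f)"

definition constant_speed_geodesic :: "(real \<Rightarrow> 'a::metric_space) \<Rightarrow> bool" where
  "constant_speed_geodesic \<gamma> \<longleftrightarrow>
     (\<forall>s\<in>{0..1}. \<forall>t\<in>{0..1}. dist (\<gamma> s) (\<gamma> t) = \<bar>s - t\<bar> * dist (\<gamma> 0) (\<gamma> 1))"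

definition convex_along ::
    "real \<Rightarrow> ('a::metric_space \<Rightarrow> ereal) \<Rightarrow> (real \<Rightarrow> 'a) \<Rightarrow> bool" where
  "convex_along \<mu> \<phi> \<gamma> \<longleftrightarrow>
     (\<forall>t\<in>{0..1}. \<phi> (\<gamma> t) \<le> ereal (1 - t) * \<phi> (\<gamma> 0) + ereal t * \<phi> (\<gamma> 1)
                            - ereal (\<mu> / 2 * t * (1 - t) * (dist (\<gamma> 0) (\<gamma> 1))\<^sup>2))"

(* The curve is chosen before \<tau>. It is an arbitrary map on [0,1]; no continuity is imposed.
   In ereal, 1 / 0 = \<infinity>, so for lam \<ge> 0 every \<tau> > 0 is admissible. *)
definition convexity_condition :: "real \<Rightarrow> ('a::metric_space \<Rightarrow> ereal) \<Rightarrow> bool" where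
  "convexity_condition lam g \<longleftrightarrow>
     (\<forall>y\<in>eff_dom g. \<forall>x0\<in>eff_dom g. \<forall>x1\<in>eff_dom g.
        \<exists>\<gamma>. \<gamma> 0 = x0 \<and> \<gamma> 1 = x1 \<and>
          (\<forall>\<tau>>0. ereal \<tau> < 1 / ereal (max (- lam) 0) \<longrightarrow>
             convex_along (lam + inverse \<tau>) (\<lambda>x. g x + ereal ((dist x y)\<^sup>2 / (2 * \<tau>))) \<gamma>))"

definition descending_slope :: "('a::metric_space \<Rightarrow> ereal) \<Rightarrow> 'a \<Rightarrow> ennreal" where
  "descending_slope f x =
     (if x \<notin> eff_dom f then \<infinity>
      else if open {x} then 0
      else Limsup (at x) (\<lambda>y. e2ennreal (max (- (f y - f x)) 0 / ereal (dist y x))))"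

definition abs_cont_curve :: "(real \<Rightarrow> 'a::metric_space) \<Rightarrow> bool" where
  "abs_cont_curve \<gamma> \<longleftrightarrow>
     (\<exists>m :: real \<Rightarrow> real. set_integrable lborel {0..1} m \<and>
        (\<forall>s t. 0 \<le> s \<and> s \<le> t \<and> t \<le> 1 \<longrightarrow>
           dist (\<gamma> s) (\<gamma> t) \<le> set_lebesgue_integral lborel {s..t} m))"

(* For an absolutely continuous curve this limit exists for almost every t in [0,1];
   the unspecified value elsewhere does not affect the integral below. *)
definition metric_derivative :: "(real \<Rightarrow> 'a::metric_space) \<Rightarrow> real \<Rightarrow> real" where
  "metric_derivative \<gamma> t = Lim (at t within {0..1}) (\<lambda>s. dist (\<gamma> s) (\<gamma> t) / \<bar>s - t\<bar>)"

definition Theta ::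
    "('a::metric_space \<Rightarrow> ereal) \<Rightarrow> 'a \<Rightarrow> 'a \<Rightarrow> (real \<Rightarrow> 'a) \<Rightarrow> ennreal" where
  "Theta f x0 x1 \<gamma> =
     (if abs_cont_curve \<gamma> \<and> \<gamma> 0 = x0 \<and> \<gamma> 1 = x1
      then \<integral>\<^sup>+t\<in>{0..1}. (ennreal ((metric_derivative \<gamma> t)\<^sup>2)
                              + (descending_slope f (\<gamma> t))\<^sup>2) \<partial>lborel
      else \<infinity>)"

definition Gamma_converges ::
    "'y metric \<Rightarrow> (nat \<Rightarrow> 'y \<Rightarrow> 'b::complete_linorder) \<Rightarrow> ('y \<Rightarrow> 'b) \<Rightarrow> bool" where
  "Gamma_converges Y Fh F \<longleftrightarrow>
     (\<forall>y\<in>mspace Y. \<forall>yh. (\<forall>h. yh h \<in> mspace Y) \<and> limitin (mtopology_of Y) yh y sequentially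
          \<longrightarrow> F y \<le> liminf (\<lambda>h. Fh h (yh h))) \<and>
     (\<forall>y\<in>mspace Y. \<exists>yh. (\<forall>h. yh h \<in> mspace Y) \<and> limitin (mtopology_of Y) yh y sequentially
          \<and> limsup (\<lambda>h. Fh h (yh h)) \<le> F y)"

(* C([0,1],X) with the uniform distance; elements of cfunspace are extensional, that is, they are
   normalised to the value undefined outside [0,1]. *)
abbreviation curve_space :: "(real \<Rightarrow> 'a::metric_space) metric" where
  "curve_space \<equiv> cfunspace (top_of_set {0..1}) euclidean_metric"

end

theory Submission
  imports Defs "HOL-Analysis.Analysis"
begin

text \<open>
  Semiconvexity turns the descending slope, a local quantity, into a global one. Replacing the
  convexity constant by some \<open>-K\<close> with \<open>K > 0\<close>, the slope of \<open>g\<close> at \<open>x\<close> is at most \<open>M\<close> if and only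
  if \<open>g x - g y \<le> M * d + K / 2 * d\<^sup>2\<close> for all \<open>y\<close> at distance \<open>d\<close> from \<open>x\<close>
  (\<open>descending_slope_le_iff\<close>). This inequality compares energies at two points only, so a bound on
  slopes passes to \<open>\<Gamma>\<close>-limits (\<open>gamma_along_slope_le\<close>).

  Lower bound. Slopes are lower semicontinuous along converging curves by the preceding remark, and
  Fatou's lemma gives the slope part. For the kinetic part, the squared difference quotients with a
  fixed time step are bounded by the kinetic energy (\<open>diffq_square_integral_le\<close>), converge pointwise
  with the curves, and recover the kinetic energy as the step tends to \<open>0\<close>, because the metric
  derivative of an absolutely continuous curve exists almost everywhere
  (\<open>metric_derivative_exists\<close>). That the limit curve is absolutely continuous follows from the
  compactness of the primitives of the speeds (\<open>abs_cont_curve_limit\<close>). Together these give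
  \<open>Theta_lower_bound\<close>.

  Upper bound. A given curve \<open>c\<close> cannot serve as its own recovery sequence: the slopes of \<open>f\<^sup>h\<close> along
  \<open>c\<close> may be infinite although the slopes of \<open>f\<close> are not. It is therefore moved by the gradient flow
  of \<open>f\<^sup>h\<close> for a short time \<open>\<epsilon>\<close>. The time-\<open>\<epsilon>\<close> map \<open>S\<close> is obtained as a
  pointwise cluster point of iterated resolvents \<open>J\<^bsub>\<epsilon>/n\<^esub> \<circ> \<dots> \<circ> J\<^bsub>\<epsilon>/n\<^esub>\<close>
  (\<open>flow_maps\<close>, \<open>smoothing_maps\<close>). It has three properties, with \<open>\<kappa> = 1 - 4 * K * \<epsilon>\<close>.
  It is \<open>1 / sqrt \<kappa>\<close>-Lipschitz, so kinetic energy hardly increases. It satisfies an evolution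
  variational inequality that bounds the slope of \<open>f\<^sup>h\<close> at \<open>S x\<close> (\<open>regularizes\<close>); testing it with a recovery
  sequence of \<open>x\<close> shows that, in the limit \<open>h \<longlonglongrightarrow> \<infinity>\<close>, the slope of \<open>f\<^sup>h\<close> at \<open>S x\<close> exceeds that of \<open>f\<close> at
  \<open>x\<close> at most by the factor \<open>1 / (1 - 5 * K * \<epsilon>)\<close> (\<open>smoothing_limit\<close>). Finally a point of bounded
  slope is joined to its image by a curve of bounded speed and slope (\<open>reach\<close>).

  The recovery curve runs from \<open>x\<^sub>0\<^sup>h\<close> to \<open>S x\<^sub>0\<^sup>h\<close> along the flow, then to \<open>S x\<^sub>0\<close> along the image of a
  geodesic, then follows \<open>S \<circ> c\<close> at a slightly increased speed, and ends with the mirror image of the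
  first two pieces. The outer pieces last \<open>4 * \<epsilon>\<close> in total and cost a multiple of \<open>\<epsilon>\<close> in the limit,
  so letting first \<open>h \<longlonglongrightarrow> \<infinity>\<close> and then \<open>\<epsilon> \<longlonglongrightarrow> 0\<close> proves the upper bound
  (\<open>Theta_recovery_approx\<close> and a diagonal choice of \<open>\<epsilon>\<close>).
\<close>

section \<open>Lebesgue differentiation and monotone absolutely continuous functions\<close>

text \<open>
  The Lebesgue differentiation theorem for the Henstock--Kurzweil integral averages over cubes that
  have the point as their lower corner, hence a one-sided derivative on the line.
\<close>
lemma indefinite_integral_right_derivative_AE:
  fixes f :: "real \<Rightarrow> real"
  assumes f: "integrable lborel f"
  shows "AE x in lborel. ((\<lambda>h. (LINT u:{x..x+h}|lborel. f u) / h) \<longlongrightarrow> f x) (at_right 0)"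
proof -
  have int: "set_integrable lborel {a..b} f" for a b
    unfolding set_integrable_def using f by (rule integrable_mult_indicator[rotated]) auto
  have "f integrable_on cbox a b" for a b
    using set_borel_integral_eq_integral(1)[OF int] by simp
  from integrable_ccontinuous_explicit[OF this] obtain N where N: "negligible N"
    "\<And>x e. \<lbrakk>x \<notin> N; 0 < e\<rbrakk> \<Longrightarrow> \<exists>d>0. \<forall>h. 0 < h \<and> h < d \<longrightarrow>
       norm (integral (cbox x (x + h *\<^sub>R One)) f /\<^sub>R h ^ DIM(real) - f x) < e"
    by metis
  have "AE x in lborel. x \<notin> N"
    using AE_not_in[of N lebesgue] N(1) by (simp add: negligible_iff_null_sets AE_completion_iff)
  moreover have "((\<lambda>h. (LINT u:{x..x+h}|lborel. f u) / h) \<longlongrightarrow> f x) (at_right 0)" if xN: "x \<notin> N" for x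
  proof (rule tendstoI)
    fix e :: real assume "e > 0"
    then obtain d where d: "d > 0" "\<And>h. 0 < h \<Longrightarrow> h < d \<Longrightarrow>
        norm (integral (cbox x (x + h *\<^sub>R One)) f /\<^sub>R h ^ DIM(real) - f x) < e"
      using N(2)[OF xN] by blast
    show "eventually (\<lambda>h. dist ((LINT u:{x..x+h}|lborel. f u) / h) (f x) < e) (at_right 0)"
      unfolding eventually_at_right_field
    proof (intro exI[of _ d] conjI allI impI)
      fix h :: real assume h: "0 < h" "h < d"
      show "dist ((LINT u:{x..x+h}|lborel. f u) / h) (f x) < e"
        using d(2)[OF h] set_borel_integral_eq_integral(2)[OF int, of x "x+h"]
        by (simp add: dist_real_def divide_inverse mult.commute)
    qed (use d in auto)
  qed
  ultimately show ?thesis by (auto elim: eventually_mono)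
qed

lemma lborel_AE_uminus:
  assumes "AE x in lborel. P (x::real)"
  shows "AE x in lborel. P (- x)"
proof -
  obtain N where N: "{x. \<not> P x} \<subseteq> N" "N \<in> sets lborel" "emeasure lborel N = 0"
    using assms by (auto elim!: AE_E)
  have "emeasure lborel (uminus -` N) = emeasure (distr lborel borel uminus) N"
    using N by (subst emeasure_distr) auto
  also have "\<dots> = 0" using N by (simp add: lborel_distr_uminus)
  finally have "emeasure lborel (uminus -` N) = 0" .
  moreover have "uminus -` N \<in> sets lborel"
    using measurable_sets[of "uminus :: real \<Rightarrow> real" borel borel N] N by simp
  ultimately show ?thesis
    using N(1) by (intro AE_I[of _ _ "uminus -` N"]) auto
qed

text \<open>
  The left derivative is the right derivative of the reflected function.
\<close>
lemma Lebesgue_differentiation_real: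
  fixes f :: "real \<Rightarrow> real"
  assumes f: "integrable lborel f"
  shows "AE x in lborel. ((\<lambda>y. (LINT u:{min x y..max x y}|lborel. f u) / \<bar>y - x\<bar>) \<longlongrightarrow> f x) (at x)"
proof -
  have f': "integrable lborel (\<lambda>x. f (- x))"
    using lborel_integrable_real_affine[OF f, of "-1" 0] by simp
  have L: "AE x in lborel. ((\<lambda>h. (LINT u:{-x..-x+h}|lborel. f (- u)) / h) \<longlongrightarrow> f x) (at_right 0)"
    using lborel_AE_uminus[OF indefinite_integral_right_derivative_AE[OF f']] by simp
  have refl: "(LINT u:{-x..-x+h}|lborel. f (- u)) = (LINT u:{x-h..x}|lborel. f u)" for x h
  proof -
    have "indicator {-x..-x+h} (-u) = (indicator {x-h..x} u :: real)" for u
      by (auto simp: indicator_def)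
    thus ?thesis
      using lborel_integral_real_affine[of "-1" "\<lambda>u. indicator {-x..-x+h} u *\<^sub>R f (- u)" 0]
      by (simp add: set_lebesgue_integral_def)
  qed
  show ?thesis
    using indefinite_integral_right_derivative_AE[OF f] L
  proof eventually_elim
    fix x
    assume R: "((\<lambda>h. (LINT u:{x..x+h}|lborel. f u) / h) \<longlongrightarrow> f x) (at_right 0)"
    assume L: "((\<lambda>h. (LINT u:{-x..-x+h}|lborel. f (- u)) / h) \<longlongrightarrow> f x) (at_right 0)"
    have "((\<lambda>y. (LINT u:{min x y..max x y}|lborel. f u) / \<bar>y - x\<bar>) \<longlongrightarrow> f x) (at_right x)"
      unfolding at_right_to_0[of x] filterlim_filtermap
    proof (rule Lim_transform_eventually[OF R])
      show "\<forall>\<^sub>F h in at_right 0. (LINT u:{x..x+h}|lborel. f u) / h =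
          (LINT u:{min x (h+x)..max x (h+x)}|lborel. f u) / \<bar>h + x - x\<bar>"
        using eventually_at_right_less[of "0::real"]
        by eventually_elim (simp add: add.commute)
    qed
    moreover have "((\<lambda>y. (LINT u:{min x y..max x y}|lborel. f u) / \<bar>y - x\<bar>) \<longlongrightarrow> f x) (at_left x)"
      unfolding at_left_minus[of x] filterlim_filtermap at_right_to_0[of "- x"]
    proof (rule Lim_transform_eventually[OF L[unfolded refl]])
      show "\<forall>\<^sub>F h in at_right 0. (LINT u:{x-h..x}|lborel. f u) / h =
          (LINT u:{min x (- (h + - x))..max x (- (h + - x))}|lborel. f u) / \<bar>- (h + - x) - x\<bar>"
        using eventually_at_right_less[of "0::real"]
        by eventually_elim (simp add: min_def max_def)
    qed
    ultimately show "((\<lambda>y. (LINT u:{min x y..max x y}|lborel. f u) / \<bar>y - x\<bar>) \<longlongrightarrow> f x) (at x)"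
      by (intro filterlim_split_at)
  qed
qed

text \<open>
  Absolute continuity in \<open>\<epsilon>\<close>-\<open>\<delta>\<close> form for nondecreasing functions. The families of intervals are sets
  of nonoverlapping intervals because that is the form of the coverings used to find a density.
\<close>
definition small_variation :: "(real \<Rightarrow> real) \<Rightarrow> bool" where
  "small_variation V \<longleftrightarrow> (\<forall>e>0. \<exists>d>0. \<forall>\<D>. finite \<D> \<longrightarrow>
      (\<forall>K\<in>\<D>. \<exists>a b. 0 \<le> a \<and> a \<le> b \<and> b \<le> 1 \<and> K = {a..b}) \<longrightarrow>
      pairwise (\<lambda>A B. interior A \<inter> interior B = {}) \<D> \<longrightarrow>
      measure lebesgue (\<Union>\<D>) < d \<longrightarrow> (\<Sum>K\<in>\<D>. V (Sup K) - V (Inf K)) \<le> e)"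

text \<open>
  The density is the Radon--Nikodym derivative of the Stieltjes measure \<open>\<mu>\<close> of \<open>V\<close>. For absolute
  continuity of \<open>\<mu>\<close>, a Lebesgue null set is covered by nonoverlapping intervals of small total length,
  on which \<open>V\<close> increases only a little. Constancy outside the unit interval makes \<open>\<mu>\<close> vanish there.
\<close>
lemma mono_absolutely_continuous_density:
  fixes V :: "real \<Rightarrow> real"
  assumes mono: "mono V" and cont: "continuous_on UNIV V"
    and const: "\<And>x. x \<le> 0 \<Longrightarrow> V x = V 0" "\<And>x. x \<ge> 1 \<Longrightarrow> V x = V 1"
    and ac: "small_variation V"
  obtains v :: "real \<Rightarrow> ennreal" where "v \<in> borel_measurable borel"
    "\<And>s t. s \<le> t \<Longrightarrow> (\<integral>\<^sup>+x\<in>{s..t}. v x \<partial>lborel) = ennreal (V t - V s)"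
proof -
  define \<mu> where "\<mu> = interval_measure V"
  have mV: "V x \<le> V y" if "x \<le> y" for x y by (rule monoD[OF mono that])
  have \<mu>Icc: "emeasure \<mu> {a..b} = ennreal (V b - V a)" if "a \<le> b" for a b
    unfolding \<mu>_def using emeasure_interval_measure_Icc[OF that mV cont] by simp
  have sets\<mu>: "sets \<mu> = sets borel" by (simp add: \<mu>_def)
  have out: "emeasure \<mu> (- {0..1}) = 0"
  proof -
    have 1: "- {0..1::real} \<subseteq> (\<Union>n::nat. {- real n .. 0}) \<union> (\<Union>n::nat. {1..1+real n})" (is "_ \<subseteq> ?A \<union> ?B")
    proof
      fix x :: real assume "x \<in> - {0..1}"
      then consider "x < 0" | "x > 1" by fastforce
      then show "x \<in> ?A \<union> ?B"
      proof cases
        case 1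
        obtain n :: nat where "- x \<le> real n" using real_arch_simple by blast
        hence "x \<in> {- real n..0}" using 1 by auto
        then show ?thesis by blast
      next
        case 2
        obtain n :: nat where "x - 1 \<le> real n" using real_arch_simple by blast
        hence "x \<in> {1..1+real n}" using 2 by auto
        then show ?thesis by blast
      qed
    qed
    have "?A \<in> null_sets \<mu>"
      using const(1)[of "- real n" for n] by (intro null_sets_UN) (auto simp: null_sets_def sets\<mu> \<mu>Icc)
    moreover have "?B \<in> null_sets \<mu>"
      using const(2)[of "1 + real n" for n] by (intro null_sets_UN) (auto simp: null_sets_def sets\<mu> \<mu>Icc)
    ultimately have "?A \<union> ?B \<in> null_sets \<mu>" by blast
    from null_sets_subset[OF this _ 1] have "- {0..1} \<in> null_sets \<mu>" by (simp add: sets\<mu>)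
    thus ?thesis by blast
  qed
  \<comment> \<open>The covering is countable; finite subfamilies are estimated first and exhaust it from below.\<close>
  have null: "emeasure \<mu> A = 0" if A: "A \<in> sets borel" "emeasure lborel A = 0" "A \<subseteq> {0..1}" for A
  proof -
    have "emeasure \<mu> A \<le> 0 + ennreal e" if e: "e > 0" for e
    proof -
      obtain d where d: "d > 0" "\<And>\<D>. finite \<D> \<Longrightarrow>
        (\<forall>K\<in>\<D>. \<exists>a b. 0 \<le> a \<and> a \<le> b \<and> b \<le> 1 \<and> K = {a..b}) \<Longrightarrow>
        pairwise (\<lambda>A B. interior A \<inter> interior B = {}) \<D> \<Longrightarrow>
        measure lebesgue (\<Union>\<D>) < d \<Longrightarrow> (\<Sum>K\<in>\<D>. V (Sup K) - V (Inf K)) \<le> e"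
        using ac e unfolding small_variation_def by blast
      have Al: "A \<in> lmeasurable" "measure lebesgue A = 0"
        using A by (auto simp: fmeasurable_def measure_def)
      have A01: "A \<subseteq> cbox 0 1" "d/2 > 0" using A d(1) by auto
      obtain \<D> where D: "countable \<D>"
        "\<And>K. K \<in> \<D> \<Longrightarrow> K \<subseteq> cbox 0 1 \<and> K \<noteq> {} \<and> (\<exists>c d. K = cbox c d)"
        "pairwise (\<lambda>A B. interior A \<inter> interior B = {}) \<D>"
        "\<And>u v. cbox u v \<in> \<D> \<Longrightarrow> \<exists>n. \<forall>i \<in> Basis. v \<bullet> i - u \<bullet> i = (1 \<bullet> i - 0 \<bullet> i)/2^n"
        "\<And>K. \<lbrakk>K \<in> \<D>; box (0::real) 1 \<noteq> {}\<rbrakk> \<Longrightarrow> interior K \<noteq> {}"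
        "A \<subseteq> \<Union>\<D>" "\<Union>\<D> \<in> lmeasurable" "measure lebesgue (\<Union>\<D>) \<le> measure lebesgue A + d/2"
        by (fact measurable_outer_intervals_bounded[OF Al(1) A01])
      have Dint: "\<exists>a b. 0 \<le> a \<and> a \<le> b \<and> b \<le> 1 \<and> K = {a..b}" if "K \<in> \<D>" for K
        using D(2)[OF that] by fastforce
      have Db: "K \<in> sets borel" if "K \<in> \<D>" for K using Dint[OF that] by auto
      have fin: "emeasure \<mu> (\<Union>E) \<le> e" if E: "finite E" "E \<subseteq> \<D>" for E
      proof -
        have "emeasure \<mu> (\<Union>E) \<le> (\<Sum>K\<in>E. emeasure \<mu> K)"
          using emeasure_subadditive_finite[of E "\<lambda>K. K" \<mu>] E Db by (auto simp: sets\<mu>)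
        also have "\<dots> = (\<Sum>K\<in>E. ennreal (V (Sup K) - V (Inf K)))"
        proof (rule sum.cong[OF refl])
          fix K assume "K \<in> E"
          then obtain a b where "a \<le> b" "K = {a..b}" using Dint E by blast
          thus "emeasure \<mu> K = ennreal (V (Sup K) - V (Inf K))" by (simp add: \<mu>Icc)
        qed
        also have "\<dots> = ennreal (\<Sum>K\<in>E. V (Sup K) - V (Inf K))"
        proof (rule sum_ennreal)
          fix K assume "K \<in> E"
          then obtain a b where "a \<le> b" "K = {a..b}" using Dint E by blast
          thus "0 \<le> V (Sup K) - V (Inf K)" by (simp add: mV)
        qed
        also have "\<dots> \<le> ennreal e"
        proof (rule ennreal_leI, rule d(2))
          have "\<Union>E \<in> sets borel" using E Db by (intro sets.finite_Union) auto
          hence "\<Union>E \<in> sets lebesgue" by simp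
          hence "measure lebesgue (\<Union>E) \<le> measure lebesgue (\<Union>\<D>)"
            using E D(7) by (intro measure_mono_fmeasurable) auto
          thus "measure lebesgue (\<Union>E) < d" using D(8) Al d(1) by linarith
        qed (use E D(3) Dint in \<open>auto intro: pairwise_subset\<close>)
        finally show ?thesis .
      qed
      have "emeasure \<mu> A \<le> emeasure \<mu> (\<Union>\<D>)"
        using D(1,6) Db by (intro emeasure_mono) (auto simp: sets\<mu> intro!: sets.countable_Union)
      also have "\<dots> \<le> e"
      proof (cases "\<D> = {}")
        case False
        have rng: "range (from_nat_into \<D>) = \<D>"
          by (rule range_from_nat_into[OF False D(1)])
        have "(\<Union>n. \<Union>(from_nat_into \<D> ` {..n})) = \<Union>(range (from_nat_into \<D>))"
          by blast
        hence U: "\<Union>\<D> = (\<Union>n. \<Union>(from_nat_into \<D> ` {..n}))" by (simp add: rng)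
        have "emeasure \<mu> (\<Union>n. \<Union>(from_nat_into \<D> ` {..n})) = (SUP n. emeasure \<mu> (\<Union>(from_nat_into \<D> ` {..n})))"
        proof (rule SUP_emeasure_incseq[symmetric])
          have "\<Union>(from_nat_into \<D> ` {..n}) \<in> sets borel" for n
            using False Db from_nat_into[OF False] by (intro sets.finite_Union) auto
          thus "range (\<lambda>n. \<Union>(from_nat_into \<D> ` {..n})) \<subseteq> sets \<mu>" by (auto simp: sets\<mu>)
          show "incseq (\<lambda>n. \<Union>(from_nat_into \<D> ` {..n}))"
            by (intro incseq_SucI Union_mono image_mono) auto
        qed
        also have "\<dots> \<le> e"
          using from_nat_into[OF False] by (intro SUP_least fin) auto
        finally show ?thesis using U by simp
      qed auto
      finally show ?thesis by simp
    qed
    hence "emeasure \<mu> A \<le> 0" by (rule ennreal_le_epsilon)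
    thus ?thesis by simp
  qed
  have "absolutely_continuous lborel \<mu>"
    unfolding absolutely_continuous_def
  proof
    fix A assume A: "A \<in> null_sets (lborel :: real measure)"
    have "emeasure \<mu> (A \<inter> {0..1}) = 0"
    proof (rule null)
      show "emeasure lborel (A \<inter> {0..1}) = 0"
        using null_sets_subset[OF A, of "A \<inter> {0..1}"] null_setsD2[OF A] by (auto intro: null_setsD1)
    qed (use A in auto)
    moreover have "emeasure \<mu> A \<le> emeasure \<mu> (A \<inter> {0..1}) + emeasure \<mu> (- {0..1})"
      using A by (intro order_trans[OF emeasure_mono emeasure_subadditive]) (auto simp: sets\<mu>)
    ultimately show "A \<in> null_sets \<mu>" using out A by (auto simp: null_sets_def sets\<mu>)
  qed
  then obtain v where v: "v \<in> borel_measurable lborel" "density lborel v = \<mu>"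
    using sigma_finite_measure.Radon_Nikodym[OF sigma_finite_lborel, of \<mu>] sets\<mu> by auto
  show ?thesis
  proof
    show "v \<in> borel_measurable borel" using v by simp
    show "(\<integral>\<^sup>+x\<in>{s..t}. v x \<partial>lborel) = ennreal (V t - V s)" if "s \<le> t" for s t
      using emeasure_density[OF v(1), of "{s..t}"] \<mu>Icc[OF that] v(2) by simp
  qed
qed

text \<open>
  Tychonoff's theorem, in the form of a single filter along which the maps converge at every point at
  once. It replaces diagonal sequences and Cauchy estimates throughout: the filter refines the given
  one, so every limit that is already known persists.
\<close>
lemma pointwise_cluster:
  fixes f :: "'i \<Rightarrow> 'a \<Rightarrow> 'b::topological_space"
  assumes F: "F \<noteq> bot" and K: "\<And>x. \<exists>K. compact K \<and> (\<forall>i. f i x \<in> K)"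
  obtains G g where "G \<le> F" "G \<noteq> bot" "\<And>x. ((\<lambda>i. f i x) \<longlongrightarrow> g x) G"
proof -
  obtain K where K: "\<And>x. compact (K x)" "\<And>x i. f i x \<in> K x"
    using K by metis
  have "compactin (product_topology (\<lambda>_. euclidean) UNIV) (PiE UNIV K)"
    using K(1) by (subst compactin_PiE) auto
  hence cpt: "compact (PiE UNIV K)"
    by (simp add: euclidean_product_topology)
  have ne: "filtermap f F \<noteq> bot" using F by (simp add: filtermap_bot_iff)
  have ev: "eventually (\<lambda>x. x \<in> PiE UNIV K) (filtermap f F)"
    using K(2) by (simp add: eventually_filtermap PiE_def Pi_def)
  obtain g where g: "inf (nhds g) (filtermap f F) \<noteq> bot"
    using cpt[unfolded compact_filter] ne ev by blast
  define G where "G = inf (filtercomap f (nhds g)) F"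
  have "G \<noteq> bot"
  proof
    assume "G = bot"
    hence "eventually (\<lambda>_. False) G" by simp
    then obtain P Q where PQ: "eventually P (filtercomap f (nhds g))" "eventually Q F" "\<And>i. P i \<Longrightarrow> Q i \<Longrightarrow> False"
      unfolding G_def eventually_inf by auto
    obtain P' where P': "eventually P' (nhds g)" "\<And>i. P' (f i) \<Longrightarrow> P i"
      using PQ(1) unfolding eventually_filtercomap by blast
    have "eventually (\<lambda>y. \<not> P' y) (filtermap f F)"
      using PQ(2) unfolding eventually_filtermap by eventually_elim (use P' PQ(3) in blast)
    with P'(1) have "eventually (\<lambda>_. False) (inf (nhds g) (filtermap f F))"
      unfolding eventually_inf by blast
    thus False using g by simp
  qed
  moreover have "((\<lambda>i. f i x) \<longlongrightarrow> g x) G" for x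
  proof -
    have "filterlim f (nhds g) (filtercomap f (nhds g))" by (rule filterlim_filtercomap)
    hence "filterlim f (nhds g) G" unfolding G_def by (rule filterlim_mono) auto
    thus ?thesis
      using continuous_on_tendsto_compose[OF continuous_on_product_coordinates[of x], of f g G]
      by simp
  qed
  moreover have "G \<le> F" by (simp add: G_def)
  ultimately show ?thesis using that by blast
qed

text \<open>
  Truncate \<open>m\<close> at a height \<open>n\<close> so large that the truncation loses at most \<open>e / 2\<close>; on small sets the
  truncated function has small integral.
\<close>
lemma nn_integral_absolutely_continuous:
  fixes m :: "'a \<Rightarrow> ennreal"
  assumes m[measurable]: "m \<in> borel_measurable M" and fin: "(\<integral>\<^sup>+x. m x \<partial>M) < \<infinity>" and e: "e > (0::real)"
  shows "\<exists>d>0. \<forall>A\<in>sets M. emeasure M A \<le> ennreal d \<longrightarrow> (\<integral>\<^sup>+x\<in>A. m x \<partial>M) \<le> ennreal e"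
proof -
  have sup: "(SUP n. \<integral>\<^sup>+x. min (m x) (of_nat n) \<partial>M) = (\<integral>\<^sup>+x. (SUP n. min (m x) (of_nat n)) \<partial>M)"
    by (rule nn_integral_monotone_convergence_SUP[symmetric])
       (auto simp: incseq_def le_fun_def min.coboundedI2 intro!: min.mono)
  have "(SUP n. min y (of_nat n)) = y" for y :: ennreal
  proof (cases "y = top")
    case True
    then show ?thesis by (simp add: ennreal_SUP_of_nat_eq_top)
  next
    case False
    then obtain n where "y < of_nat n" using ennreal_Ex_less_of_nat[of y] by (auto simp: less_top)
    hence "min y (of_nat n) = y" by simp
    hence "y \<le> (SUP n. min y (of_nat n))" by (metis SUP_upper UNIV_I)
    moreover have "(SUP n. min y (of_nat n)) \<le> y" by (intro SUP_least) simp
    ultimately show ?thesis by (rule antisym[rotated])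
  qed
  hence eq: "(SUP n. \<integral>\<^sup>+x. min (m x) (of_nat n) \<partial>M) = (\<integral>\<^sup>+x. m x \<partial>M)" using sup by simp
  have "\<exists>n. (\<integral>\<^sup>+x. m x \<partial>M) \<le> (\<integral>\<^sup>+x. min (m x) (of_nat n) \<partial>M) + ennreal (e/2)"
  proof (cases "(\<integral>\<^sup>+x. m x \<partial>M) = 0")
    case False
    hence "(\<integral>\<^sup>+x. m x \<partial>M) - ennreal (e/2) < (\<integral>\<^sup>+x. m x \<partial>M)"
      using e fin by (intro ennreal_between) (auto simp: zero_less_iff_neq_zero)
    then obtain n where "(\<integral>\<^sup>+x. m x \<partial>M) - ennreal (e/2) < (\<integral>\<^sup>+x. min (m x) (of_nat n) \<partial>M)"
      unfolding eq[symmetric] less_SUP_iff by auto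
    thus ?thesis by (intro exI[of _ n]) (metis add.commute ennreal_minus_le_iff less_imp_le)
  qed auto
  then obtain n :: nat where n: "(\<integral>\<^sup>+x. m x \<partial>M) \<le> (\<integral>\<^sup>+x. min (m x) (of_nat n) \<partial>M) + ennreal (e/2)" by blast
  define d where "d = e / (2 * (real n + 1))"
  have d: "d > 0" using e by (simp add: d_def)
  have "(\<integral>\<^sup>+x\<in>A. m x \<partial>M) \<le> ennreal e" if A[measurable]: "A \<in> sets M" and Ad: "emeasure M A \<le> ennreal d" for A
  proof -
    let ?m = "\<lambda>x. min (m x) (of_nat n)"
    have split: "(\<integral>\<^sup>+x. u x \<partial>M) = (\<integral>\<^sup>+x\<in>A. u x \<partial>M) + (\<integral>\<^sup>+x\<in>space M - A. u x \<partial>M)"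
      if [measurable]: "u \<in> borel_measurable M" for u
      by (subst nn_integral_add[symmetric]) (auto intro!: nn_integral_cong simp: indicator_def)
    \<comment> \<open>Subtraction is avoided: the integral over the complement of \<open>A\<close> is finite and cancels.\<close>
    have "(\<integral>\<^sup>+x\<in>A. m x \<partial>M) + (\<integral>\<^sup>+x\<in>space M - A. ?m x \<partial>M) \<le> (\<integral>\<^sup>+x. m x \<partial>M)"
      unfolding split[OF m] by (intro add_left_mono nn_integral_mono) (auto simp: indicator_def)
    also have "\<dots> \<le> (\<integral>\<^sup>+x\<in>A. ?m x \<partial>M) + (\<integral>\<^sup>+x\<in>space M - A. ?m x \<partial>M) + ennreal (e/2)"
      using n split[of ?m] by simp
    also have "\<dots> = ((\<integral>\<^sup>+x\<in>A. ?m x \<partial>M) + ennreal (e/2)) + (\<integral>\<^sup>+x\<in>space M - A. ?m x \<partial>M)"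
      by (simp add: ac_simps)
    finally have *: "(\<integral>\<^sup>+x\<in>A. m x \<partial>M) + (\<integral>\<^sup>+x\<in>space M - A. ?m x \<partial>M) \<le>
        ((\<integral>\<^sup>+x\<in>A. ?m x \<partial>M) + ennreal (e/2)) + (\<integral>\<^sup>+x\<in>space M - A. ?m x \<partial>M)" .
    have "(\<integral>\<^sup>+x\<in>space M - A. ?m x \<partial>M) \<le> (\<integral>\<^sup>+x. m x \<partial>M)"
      by (intro nn_integral_mono) (auto simp: indicator_def)
    hence "(\<integral>\<^sup>+x\<in>space M - A. ?m x \<partial>M) \<noteq> top" using fin by (auto simp: top_unique)
    with * have "(\<integral>\<^sup>+x\<in>A. m x \<partial>M) \<le> (\<integral>\<^sup>+x\<in>A. ?m x \<partial>M) + ennreal (e/2)"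
      using ennreal_add_left_cancel_le[of "\<integral>\<^sup>+x\<in>space M - A. ?m x \<partial>M"]
      by (simp only: add.commute[of _ "\<integral>\<^sup>+x\<in>space M - A. ?m x \<partial>M"]) (simp add: top_unique)
    also have "(\<integral>\<^sup>+x\<in>A. ?m x \<partial>M) \<le> (\<integral>\<^sup>+x\<in>A. of_nat n \<partial>M)"
      by (intro nn_integral_mono) (auto simp: indicator_def)
    also have "(\<integral>\<^sup>+x\<in>A. of_nat n \<partial>M) = of_nat n * emeasure M A"
      by (simp add: nn_integral_cmult_indicator)
    also have "\<dots> \<le> of_nat n * ennreal d" by (intro mult_left_mono Ad) auto
    also have "\<dots> = ennreal (real n * d)" using d by (simp add: ennreal_mult ennreal_of_nat_eq_real_of_nat)
    also have "\<dots> \<le> ennreal (e/2)" using e by (intro ennreal_leI) (simp add: d_def field_simps)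
    also have "ennreal (e/2) + ennreal (e/2) = ennreal e" using e by (simp flip: ennreal_plus)
    finally show ?thesis by (simp add: add_right_mono)
  qed
  thus ?thesis using d by blast
qed

lemma sum_nn_integral_nonoverlapping:
  fixes m :: "real \<Rightarrow> ennreal"
  assumes m[measurable]: "m \<in> borel_measurable borel" and fin: "finite \<D>"
    and D: "\<forall>K\<in>\<D>. \<exists>a b. K = {a..b}"
    and disj: "pairwise (\<lambda>A B. interior A \<inter> interior B = {}) \<D>"
  shows "(\<Sum>K\<in>\<D>. \<integral>\<^sup>+x\<in>K. m x \<partial>lborel) \<le> (\<integral>\<^sup>+x\<in>\<Union>\<D>. m x \<partial>lborel)"
proof -
  define N where "N = density lborel m"
  have N: "(\<integral>\<^sup>+x\<in>A. m x \<partial>lborel) = emeasure N A" if "A \<in> sets borel" for A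
    using that by (simp add: N_def emeasure_density)
  have b: "K \<in> sets borel" if "K \<in> \<D>" for K using D that by auto
  have int: "emeasure N K = emeasure N (interior K)" if K: "K \<in> \<D>" for K
  proof -
    obtain a b where ab: "K = {a..b}" using D K by blast
    have "AE x in lborel. x \<noteq> a \<and> x \<noteq> b" using AE_lborel_singleton[of a] AE_lborel_singleton[of b] by auto
    hence "(\<integral>\<^sup>+x\<in>{a..b}. m x \<partial>lborel) = (\<integral>\<^sup>+x\<in>{a<..<b}. m x \<partial>lborel)"
      by (intro nn_integral_cong_AE) (auto simp: indicator_def)
    thus ?thesis by (simp add: ab N)
  qed
  have "(\<Sum>K\<in>\<D>. \<integral>\<^sup>+x\<in>K. m x \<partial>lborel) = (\<Sum>K\<in>\<D>. emeasure N (interior K))"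
    using b int N by (intro sum.cong) auto
  also have "\<dots> = emeasure N (\<Union>K\<in>\<D>. interior K)"
    using fin disj by (intro sum_emeasure) (auto simp: N_def disjoint_family_on_def pairwise_def)
  also have "\<dots> \<le> emeasure N (\<Union>\<D>)"
    using b fin interior_subset by (intro emeasure_mono UN_mono[of \<D> \<D> interior "\<lambda>K. K", simplified]) (auto simp: N_def intro!: sets.finite_Union)
  also have "\<dots> = (\<integral>\<^sup>+x\<in>\<Union>\<D>. m x \<partial>lborel)"
    using b fin by (subst N) (auto intro!: sets.finite_Union)
  finally show ?thesis .
qed

section \<open>Majorants and the metric derivative\<close>

text \<open>
  Curves are given on the unit interval only; composing with this retraction extends them constantly
  to the line, which removes boundary cases from continuity, measurability and translations.
\<close>
definition clamp01 :: "real \<Rightarrow> real" where "clamp01 t = max 0 (min 1 t)"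

lemma clamp01_in [simp]: "clamp01 t \<in> {0..1}" "0 \<le> clamp01 t" "clamp01 t \<le> 1"
  by (auto simp: clamp01_def)

lemma clamp01_id: "t \<in> {0..1} \<Longrightarrow> clamp01 t = t"
  by (auto simp: clamp01_def)

lemma clamp01_mono: "s \<le> t \<Longrightarrow> clamp01 s \<le> clamp01 t"
  by (auto simp: clamp01_def)

text \<open>
  The densities allowed in the definition of an absolutely continuous curve, taken nonnegative and
  extended-valued, so that integrability becomes a separate condition.
\<close>
definition majorant :: "(real \<Rightarrow> ennreal) \<Rightarrow> (real \<Rightarrow> 'a::metric_space) \<Rightarrow> bool" where
  "majorant m c \<longleftrightarrow> m \<in> borel_measurable borel \<and>
     (\<forall>s t. 0 \<le> s \<and> s \<le> t \<and> t \<le> 1 \<longrightarrow> ennreal (dist (c s) (c t)) \<le> (\<integral>\<^sup>+x\<in>{s..t}. m x \<partial>lborel))"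

lemma majorant_measurable: "majorant m c \<Longrightarrow> m \<in> borel_measurable borel"
  by (simp add: majorant_def)

lemma majorantD: "majorant m c \<Longrightarrow> 0 \<le> s \<Longrightarrow> s \<le> t \<Longrightarrow> t \<le> 1 \<Longrightarrow>
    ennreal (dist (c s) (c t)) \<le> (\<integral>\<^sup>+x\<in>{s..t}. m x \<partial>lborel)"
  by (simp add: majorant_def)

lemma majorant_clamp:
  assumes "majorant m c" "s \<le> t"
  shows "ennreal (dist (c (clamp01 s)) (c (clamp01 t))) \<le> (\<integral>\<^sup>+x\<in>{s..t}. m x \<partial>lborel)"
proof (cases "clamp01 s = clamp01 t")
  case False
  hence "{clamp01 s..clamp01 t} \<subseteq> {s..t}" using assms(2) by (auto simp: clamp01_def)
  hence "(\<integral>\<^sup>+x\<in>{clamp01 s..clamp01 t}. m x \<partial>lborel) \<le> (\<integral>\<^sup>+x\<in>{s..t}. m x \<partial>lborel)"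
    by (intro nn_integral_mono) (auto simp: indicator_def)
  thus ?thesis
    using majorantD[OF assms(1), of "clamp01 s" "clamp01 t"] clamp01_mono[OF assms(2)]
    by (auto intro: order_trans)
qed auto

lemma AE_lborel_neq: "AE x in lborel. x \<noteq> (a::real)"
  by (rule AE_lborel_singleton)

lemma majorant_restrict:
  assumes m: "majorant m c"
  shows "majorant (\<lambda>x. m x * indicator {0<..<1} x) c"
proof -
  have [measurable]: "m \<in> borel_measurable borel" using m by (rule majorant_measurable)
  have "(\<integral>\<^sup>+x\<in>{s..t}. m x * indicator {0<..<1} x \<partial>lborel) = (\<integral>\<^sup>+x\<in>{s..t}. m x \<partial>lborel)"
    if "0 \<le> s" "t \<le> 1" for s t
  proof (rule nn_integral_cong_AE)
    show "AE x in lborel. m x * indicator {0<..<1} x * indicator {s..t} x = m x * indicator {s..t} x"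
      using AE_lborel_neq[of 0] AE_lborel_neq[of 1]
      by eventually_elim (use that in \<open>auto simp: indicator_def\<close>)
  qed
  thus ?thesis using m by (auto simp: majorant_def)
qed

lemma abs_cont_curve_majorant:
  assumes "abs_cont_curve c"
  obtains m where "majorant m c" "(\<integral>\<^sup>+x. m x \<partial>lborel) < \<infinity>"
proof -
  obtain m where m: "set_integrable lborel {0..1} m"
    "\<And>s t. 0 \<le> s \<Longrightarrow> s \<le> t \<Longrightarrow> t \<le> 1 \<Longrightarrow> dist (c s) (c t) \<le> (LINT x:{s..t}|lborel. m x)"
    using assms unfolding abs_cont_curve_def by blast
  let ?m = "\<lambda>x. ennreal (norm (indicator {0..1} x *\<^sub>R m x))"
  have int: "integrable lborel (\<lambda>x. indicator {0..1} x *\<^sub>R m x)"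
    using m(1) by (simp add: set_integrable_def)
  hence meas[measurable]: "(\<lambda>x. indicator {0..1} x *\<^sub>R m x) \<in> borel_measurable borel"
    using borel_measurable_integrable by fastforce
  show ?thesis
  proof
    show "(\<integral>\<^sup>+x. ?m x \<partial>lborel) < \<infinity>" using int by (simp add: integrable_iff_bounded)
    have "ennreal (dist (c s) (c t)) \<le> (\<integral>\<^sup>+x\<in>{s..t}. ?m x \<partial>lborel)"
      if st: "0 \<le> s" "s \<le> t" "t \<le> 1" for s t
    proof -
      have "set_integrable lborel {s..t} m"
        by (rule set_integrable_subset[OF m(1)]) (use st in auto)
      hence i: "integrable lborel (\<lambda>x. indicator {s..t} x *\<^sub>R m x)" by (simp add: set_integrable_def)
      have "ennreal (dist (c s) (c t)) \<le> ennreal (norm (\<integral>x. indicator {s..t} x *\<^sub>R m x \<partial>lborel))"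
        using m(2)[OF st] by (intro ennreal_leI) (simp add: set_lebesgue_integral_def)
      also have "\<dots> \<le> (\<integral>\<^sup>+x. norm (indicator {s..t} x *\<^sub>R m x) \<partial>lborel)"
        by (rule integral_norm_bound_ennreal[OF i])
      also have "\<dots> \<le> (\<integral>\<^sup>+x\<in>{s..t}. ?m x \<partial>lborel)"
        using st by (intro nn_integral_mono) (auto simp: indicator_def)
      finally show ?thesis .
    qed
    moreover have "?m \<in> borel_measurable borel" by measurable
    ultimately show "majorant ?m c" unfolding majorant_def by blast
  qed
qed

lemma set_nn_integral_finite_subset:
  "(\<integral>\<^sup>+x. m x \<partial>M) < \<infinity> \<Longrightarrow> (\<integral>\<^sup>+x\<in>A. m x \<partial>M) < (\<infinity>::ennreal)"
  by (rule le_less_trans[OF nn_integral_mono]) (auto simp: indicator_def)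

lemma LINT_enn2real:
  fixes m :: "real \<Rightarrow> ennreal"
  assumes [measurable]: "m \<in> borel_measurable borel" "A \<in> sets borel"
    and fin: "(\<integral>\<^sup>+x\<in>A. m x \<partial>lborel) < \<infinity>"
  shows "set_integrable lborel A (\<lambda>x. enn2real (m x))"
    "ennreal (LINT x:A|lborel. enn2real (m x)) = (\<integral>\<^sup>+x\<in>A. m x \<partial>lborel)"
proof -
  have "AE x in lborel. m x * indicator A x \<noteq> \<infinity>"
    using fin by (intro nn_integral_PInf_AE) auto
  hence ae: "AE x in lborel. ennreal (indicator A x *\<^sub>R enn2real (m x)) = m x * indicator A x"
    by eventually_elim (auto simp: indicator_def less_top)
  hence eq: "(\<integral>\<^sup>+x. ennreal (indicator A x *\<^sub>R enn2real (m x)) \<partial>lborel) = (\<integral>\<^sup>+x\<in>A. m x \<partial>lborel)"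
    by (rule nn_integral_cong_AE)
  have int: "integrable lborel (\<lambda>x. indicator A x *\<^sub>R enn2real (m x))"
    using fin eq by (intro integrableI_nonneg) (auto simp: indicator_def)
  thus "set_integrable lborel A (\<lambda>x. enn2real (m x))" by (simp add: set_integrable_def)
  show "ennreal (LINT x:A|lborel. enn2real (m x)) = (\<integral>\<^sup>+x\<in>A. m x \<partial>lborel)"
    using nn_integral_eq_integral[OF int] eq by (simp add: set_lebesgue_integral_def indicator_def)
qed

lemma abs_cont_curveI:
  assumes m: "majorant m c" and fin: "(\<integral>\<^sup>+x\<in>{0..1}. m x \<partial>lborel) < \<infinity>"
  shows "abs_cont_curve c"
  unfolding abs_cont_curve_def
proof (intro exI conjI allI impI)
  have [measurable]: "m \<in> borel_measurable borel" using m by (rule majorant_measurable)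
  show "set_integrable lborel {0..1} (\<lambda>x. enn2real (m x))"
    using fin by (intro LINT_enn2real) auto
  fix s t :: real assume st: "0 \<le> s \<and> s \<le> t \<and> t \<le> 1"
  have "(\<integral>\<^sup>+x\<in>{s..t}. m x \<partial>lborel) \<le> (\<integral>\<^sup>+x\<in>{0..1}. m x \<partial>lborel)"
    using st by (intro nn_integral_mono) (auto simp: indicator_def)
  hence "ennreal (LINT x:{s..t}|lborel. enn2real (m x)) = (\<integral>\<^sup>+x\<in>{s..t}. m x \<partial>lborel)"
    using fin by (intro LINT_enn2real) auto
  with majorantD[OF m] st have "ennreal (dist (c s) (c t)) \<le> ennreal (LINT x:{s..t}|lborel. enn2real (m x))"
    by simp
  moreover have "0 \<le> (LINT x:{s..t}|lborel. enn2real (m x))"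
    unfolding set_lebesgue_integral_def by (intro integral_nonneg_AE) auto
  ultimately show "dist (c s) (c t) \<le> (LINT x:{s..t}|lborel. enn2real (m x))"
    by (simp add: ennreal_le_iff)
qed

text \<open>
  Integrals over intervals are increments of a real-valued primitive, which can be subtracted.
\<close>
lemma primitive_nn_integral:
  fixes m :: "real \<Rightarrow> ennreal"
  assumes [measurable]: "m \<in> borel_measurable borel" and fin: "(\<integral>\<^sup>+x. m x \<partial>lborel) < \<infinity>" and st: "s \<le> t"
  shows "ennreal (enn2real (\<integral>\<^sup>+x\<in>{..t}. m x \<partial>lborel) - enn2real (\<integral>\<^sup>+x\<in>{..s}. m x \<partial>lborel)) =
     (\<integral>\<^sup>+x\<in>{s..t}. m x \<partial>lborel)"
    "enn2real (\<integral>\<^sup>+x\<in>{..s}. m x \<partial>lborel) \<le> enn2real (\<integral>\<^sup>+x\<in>{..t}. m x \<partial>lborel)"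
proof -
  note fin' = set_nn_integral_finite_subset[OF fin]
  have "(\<integral>\<^sup>+x\<in>{s..t}. m x \<partial>lborel) + (\<integral>\<^sup>+x\<in>{..s}. m x \<partial>lborel) = (\<integral>\<^sup>+x. m x * indicator {s..t} x + m x * indicator {..s} x \<partial>lborel)"
    by (subst nn_integral_add) auto
  also have "\<dots> = (\<integral>\<^sup>+x\<in>{..t}. m x \<partial>lborel)"
  proof (rule nn_integral_cong_AE)
    show "AE x in lborel. m x * indicator {s..t} x + m x * indicator {..s} x = m x * indicator {..t} x"
      using AE_lborel_neq[of s] by eventually_elim (use st in \<open>auto simp: indicator_def\<close>)
  qed
  finally have eq: "(\<integral>\<^sup>+x\<in>{s..t}. m x \<partial>lborel) + (\<integral>\<^sup>+x\<in>{..s}. m x \<partial>lborel) = (\<integral>\<^sup>+x\<in>{..t}. m x \<partial>lborel)" .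
  have "enn2real (\<integral>\<^sup>+x\<in>{..t}. m x \<partial>lborel) =
      enn2real (\<integral>\<^sup>+x\<in>{s..t}. m x \<partial>lborel) + enn2real (\<integral>\<^sup>+x\<in>{..s}. m x \<partial>lborel)"
    unfolding eq[symmetric] using fin' by (intro enn2real_plus) auto
  thus "ennreal (enn2real (\<integral>\<^sup>+x\<in>{..t}. m x \<partial>lborel) - enn2real (\<integral>\<^sup>+x\<in>{..s}. m x \<partial>lborel)) =
     (\<integral>\<^sup>+x\<in>{s..t}. m x \<partial>lborel)"
    "enn2real (\<integral>\<^sup>+x\<in>{..s}. m x \<partial>lborel) \<le> enn2real (\<integral>\<^sup>+x\<in>{..t}. m x \<partial>lborel)"
    using fin'[of "{s..t}"] by auto
qed

text \<open>
  If \<open>M\<close> is a primitive of the majorant, then \<open>F + M\<close> is nondecreasing and its increments are at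
  most twice those of \<open>M\<close>, so it has a density by the monotone case.
\<close>
lemma real_absolutely_continuous_primitive:
  fixes F :: "real \<Rightarrow> real"
  assumes m0: "majorant m0 F" and fin0: "(\<integral>\<^sup>+x. m0 x \<partial>lborel) < \<infinity>"
  obtains \<psi> where "integrable lborel \<psi>"
    "\<And>s t. 0 \<le> s \<Longrightarrow> s \<le> t \<Longrightarrow> t \<le> 1 \<Longrightarrow> F t - F s = (LINT x:{s..t}|lborel. \<psi> x)"
proof -
  \<comment> \<open>Cutting off outside the open interval makes \<open>F + M\<close> constant there.\<close>
  define m where "m = (\<lambda>x. m0 x * indicator {0<..<1} x)"
  have m: "majorant m F" unfolding m_def using m0 by (rule majorant_restrict)
  have [measurable]: "m \<in> borel_measurable borel" using m by (rule majorant_measurable)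
  have fin: "(\<integral>\<^sup>+x. m x \<partial>lborel) < \<infinity>" unfolding m_def by (rule set_nn_integral_finite_subset[OF fin0])
  note fin' = set_nn_integral_finite_subset[OF fin]
  define M where "M t = enn2real (\<integral>\<^sup>+x\<in>{..t}. m x \<partial>lborel)" for t
  have M: "ennreal (M t - M s) = (\<integral>\<^sup>+x\<in>{s..t}. m x \<partial>lborel)" and Mm: "M s \<le> M t" if "s \<le> t" for s t
    unfolding M_def using primitive_nn_integral[OF _ fin that] by auto
  define V where "V t = F (clamp01 t) + M t" for t
  have FM: "\<bar>F (clamp01 t) - F (clamp01 s)\<bar> \<le> M t - M s" if "s \<le> t" for s t
  proof -
    have "ennreal (dist (F (clamp01 s)) (F (clamp01 t))) \<le> ennreal (M t - M s)"
      using majorant_clamp[OF m that] M[OF that] by simp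
    thus ?thesis using Mm[OF that] by (simp add: dist_real_def abs_minus_commute ennreal_le_iff)
  qed
  have V: "V s \<le> V t" "V t - V s \<le> 2 * (M t - M s)" if "s \<le> t" for s t
    using FM[OF that] by (auto simp: V_def)
  have ac: "\<exists>d>0. \<forall>A\<in>sets borel. emeasure lborel A \<le> ennreal d \<longrightarrow> (\<integral>\<^sup>+x\<in>A. m x \<partial>lborel) \<le> ennreal e" if "e > 0" for e
    using nn_integral_absolutely_continuous[of m lborel, OF _ fin that] by auto
  have cont: "continuous_on UNIV V"
    unfolding continuous_on_iff
  proof (intro ballI allI impI)
    fix x e :: real assume e: "e > 0"
    obtain d where d: "d > 0" "\<And>A. A \<in> sets borel \<Longrightarrow> emeasure lborel A \<le> ennreal d \<Longrightarrow> (\<integral>\<^sup>+x\<in>A. m x \<partial>lborel) \<le> ennreal (e/3)"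
      using ac[of "e/3"] e by auto
    have *: "V t - V s < e" if "s \<le> t" "t - s < d" for s t
    proof -
      have "ennreal (M t - M s) \<le> ennreal (e/3)"
        unfolding M[OF that(1)] using that by (intro d(2)) (auto intro: ennreal_leI)
      hence "M t - M s \<le> e/3" using e by (simp add: ennreal_le_iff)
      have "V t - V s \<le> 2 * (M t - M s)" by (rule V(2)[OF that(1)])
      also have "\<dots> \<le> 2 * (e/3)" using \<open>M t - M s \<le> e/3\<close> by (intro mult_left_mono) auto
      also have "\<dots> < e" using e by simp
      finally show ?thesis .
    qed
    show "\<exists>d>0. \<forall>x'\<in>UNIV. dist x' x < d \<longrightarrow> dist (V x') (V x) < e"
    proof (intro exI[of _ d] conjI ballI impI d(1))
      fix y assume "dist y x < d"
      thus "dist (V y) (V x) < e"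
        using *[of x y] *[of y x] V(1)[of x y] V(1)[of y x] by (cases "x \<le> y") (auto simp: dist_real_def)
    qed
  qed
  have z: "M t - M s = 0" if "s \<le> t" "t \<le> 0 \<or> 1 \<le> s" for s t
  proof -
    have "(\<integral>\<^sup>+x\<in>{s..t}. m x \<partial>lborel) = (\<integral>\<^sup>+x. 0 \<partial>(lborel::real measure))"
      using that by (intro nn_integral_cong) (auto simp: m_def indicator_def)
    hence "ennreal (M t - M s) = 0" using M[OF that(1)] by simp
    thus ?thesis using Mm[OF that(1)] by (simp add: ennreal_eq_0_iff)
  qed
  have "\<exists>v\<in>borel_measurable borel. \<forall>s t. s \<le> t \<longrightarrow> (\<integral>\<^sup>+x\<in>{s..t}. v x \<partial>lborel) = ennreal (V t - V s)"
  proof (rule mono_absolutely_continuous_density[of V])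
    show "mono V" using V(1) by (auto simp: mono_def)
    show "continuous_on UNIV V" by fact
    show "V x = V 0" if "x \<le> 0" for x using z[of x 0] that by (simp add: V_def clamp01_def)
    show "V x = V 1" if "1 \<le> x" for x using z[of 1 x] that by (simp add: V_def clamp01_def)
    show "small_variation V"
      unfolding small_variation_def
    proof (intro allI impI)
    fix e :: real assume e: "e > 0"
    obtain d where d: "d > 0" "\<And>A. A \<in> sets borel \<Longrightarrow> emeasure lborel A \<le> ennreal d \<Longrightarrow> (\<integral>\<^sup>+x\<in>A. m x \<partial>lborel) \<le> ennreal (e/2)"
      using ac[of "e/2"] e by auto
    have "(\<Sum>K\<in>\<D>. V (Sup K) - V (Inf K)) \<le> e"
      if D: "finite \<D>" "\<forall>K\<in>\<D>. \<exists>a b. 0 \<le> a \<and> a \<le> b \<and> b \<le> 1 \<and> K = {a..b}"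
        "pairwise (\<lambda>A B. interior A \<inter> interior B = {}) \<D>" "measure lebesgue (\<Union>\<D>) < d" for \<D>
    proof -
      have b: "\<Union>\<D> \<in> sets borel" using D(1,2) by (intro sets.finite_Union) auto
      have "emeasure lborel (\<Union>\<D>) \<le> emeasure lborel {0..1::real}"
        using D(2) by (intro emeasure_mono) fastforce+
      hence "emeasure lborel (\<Union>\<D>) \<noteq> \<infinity>" by (auto simp: top_unique)
      hence "emeasure lborel (\<Union>\<D>) \<le> ennreal d"
        using D(4) b by (subst emeasure_eq_ennreal_measure) (auto intro: ennreal_leI)
      note I = d(2)[OF b this]
      have "ennreal (\<Sum>K\<in>\<D>. M (Sup K) - M (Inf K)) = (\<Sum>K\<in>\<D>. ennreal (M (Sup K) - M (Inf K)))"
        using D(2) Mm by (intro sum_ennreal[symmetric]) fastforce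
      also have "\<dots> = (\<Sum>K\<in>\<D>. \<integral>\<^sup>+x\<in>K. m x \<partial>lborel)"
        using D(2) M by (intro sum.cong) auto
      also have "\<dots> \<le> (\<integral>\<^sup>+x\<in>\<Union>\<D>. m x \<partial>lborel)"
        using D by (intro sum_nn_integral_nonoverlapping) fastforce+
      finally have "ennreal (\<Sum>K\<in>\<D>. M (Sup K) - M (Inf K)) \<le> ennreal (e/2)" using I by simp
      hence Me: "(\<Sum>K\<in>\<D>. M (Sup K) - M (Inf K)) \<le> e/2" using e by (simp add: ennreal_le_iff)
      have "(\<Sum>K\<in>\<D>. V (Sup K) - V (Inf K)) \<le> (\<Sum>K\<in>\<D>. 2 * (M (Sup K) - M (Inf K)))"
        using D(2) V(2) by (intro sum_mono) fastforce
      also have "\<dots> = 2 * (\<Sum>K\<in>\<D>. M (Sup K) - M (Inf K))" by (rule sum_distrib_left[symmetric])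
      also have "\<dots> \<le> 2 * (e/2)" using Me by (intro mult_left_mono) auto
      finally show ?thesis by simp
    qed
    thus "\<exists>d>0. \<forall>\<D>. finite \<D> \<longrightarrow>
      (\<forall>K\<in>\<D>. \<exists>a b. 0 \<le> a \<and> a \<le> b \<and> b \<le> 1 \<and> K = {a..b}) \<longrightarrow>
      pairwise (\<lambda>A B. interior A \<inter> interior B = {}) \<D> \<longrightarrow>
      measure lebesgue (\<Union>\<D>) < d \<longrightarrow> (\<Sum>K\<in>\<D>. V (Sup K) - V (Inf K)) \<le> e"
      using d(1) by blast
    qed
  qed blast
  then obtain v where v[measurable]: "v \<in> borel_measurable borel"
    and vI: "\<And>s t. s \<le> t \<Longrightarrow> (\<integral>\<^sup>+x\<in>{s..t}. v x \<partial>lborel) = ennreal (V t - V s)"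
    by blast
  \<comment> \<open>\<open>v\<close> is a density of \<open>F + M\<close>, so that of \<open>M\<close> has to be subtracted again.\<close>
  define \<psi> where "\<psi> x = indicator {0..1} x *\<^sub>R (enn2real (v x) - enn2real (m x))" for x
  have vfin: "(\<integral>\<^sup>+x\<in>{s..t}. v x \<partial>lborel) < \<infinity>" if "s \<le> t" for s t using vI[OF that] by simp
  have si: "set_integrable lborel {s..t} (\<lambda>x. enn2real (v x))" "set_integrable lborel {s..t} (\<lambda>x. enn2real (m x))"
    if "s \<le> t" for s t
    using vfin[OF that] fin' by (auto intro!: LINT_enn2real)
  show ?thesis
  proof
    have "set_integrable lborel {0..1} (\<lambda>x. enn2real (v x) - enn2real (m x))"
      using si[of 0 1] by (intro set_integral_diff) auto
    thus "integrable lborel \<psi>" by (simp add: set_integrable_def \<psi>_def[abs_def])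
    fix s t :: real assume st: "0 \<le> s" "s \<le> t" "t \<le> 1"
    have "(LINT x:{s..t}|lborel. \<psi> x) = (LINT x:{s..t}|lborel. enn2real (v x) - enn2real (m x))"
      using st unfolding set_lebesgue_integral_def
      by (intro Bochner_Integration.integral_cong) (auto simp: \<psi>_def indicator_def)
    also have "\<dots> = (LINT x:{s..t}|lborel. enn2real (v x)) - (LINT x:{s..t}|lborel. enn2real (m x))"
      using si[OF st(2)] by (rule set_integral_diff(2))
    also have "(LINT x:{s..t}|lborel. enn2real (v x)) = V t - V s"
    proof -
      have "ennreal (LINT x:{s..t}|lborel. enn2real (v x)) = ennreal (V t - V s)"
        using LINT_enn2real(2)[OF v _ vfin[OF st(2)]] vI[OF st(2)] by simp
      moreover have "0 \<le> (LINT x:{s..t}|lborel. enn2real (v x))"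
        unfolding set_lebesgue_integral_def by (intro integral_nonneg_AE) auto
      ultimately show ?thesis using V(1)[OF st(2)] by simp
    qed
    also have "(LINT x:{s..t}|lborel. enn2real (m x)) = M t - M s"
    proof -
      have "ennreal (LINT x:{s..t}|lborel. enn2real (m x)) = ennreal (M t - M s)"
        using LINT_enn2real(2)[OF _ _ fin'[of "{s..t}"]] M[OF st(2)] by simp
      moreover have "0 \<le> (LINT x:{s..t}|lborel. enn2real (m x))"
        unfolding set_lebesgue_integral_def by (intro integral_nonneg_AE) auto
      ultimately show ?thesis using Mm[OF st(2)] by simp
    qed
    finally show "F t - F s = (LINT x:{s..t}|lborel. \<psi> x)"
      using st by (simp add: V_def clamp01_id)
  qed
qed

lemma majorant_continuous:
  fixes c :: "real \<Rightarrow> 'a::metric_space"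
  assumes m: "majorant m c" and fin: "(\<integral>\<^sup>+x. m x \<partial>lborel) < \<infinity>"
  shows "continuous_on UNIV (\<lambda>t. c (clamp01 t))"
  unfolding continuous_on_iff
proof (intro ballI allI impI)
  fix x e :: real assume e: "e > 0"
  have [measurable]: "m \<in> borel_measurable borel" using m by (rule majorant_measurable)
  obtain d where d: "d > 0" "\<And>A. A \<in> sets borel \<Longrightarrow> emeasure lborel A \<le> ennreal d \<Longrightarrow> (\<integral>\<^sup>+x\<in>A. m x \<partial>lborel) \<le> ennreal (e/2)"
    using nn_integral_absolutely_continuous[of m lborel, OF _ fin, of "e/2"] e by auto
  have *: "dist (c (clamp01 s)) (c (clamp01 t)) < e" if "s \<le> t" "t - s < d" for s t
  proof -
    have "ennreal (dist (c (clamp01 s)) (c (clamp01 t))) \<le> ennreal (e/2)"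
      using that by (intro order_trans[OF majorant_clamp[OF m] d(2)]) (auto intro: ennreal_leI)
    thus ?thesis using e by (simp add: ennreal_le_iff)
  qed
  show "\<exists>d>0. \<forall>x'\<in>UNIV. dist x' x < d \<longrightarrow> dist (c (clamp01 x')) (c (clamp01 x)) < e"
  proof (intro exI[of _ d] conjI ballI impI d(1))
    fix y assume "dist y x < d"
    thus "dist (c (clamp01 y)) (c (clamp01 x)) < e"
      using *[of x y] *[of y x] by (cases "x \<le> y") (auto simp: dist_real_def dist_commute)
  qed
qed

lemma abs_cont_curve_continuous:
  fixes c :: "real \<Rightarrow> 'a::metric_space"
  assumes "abs_cont_curve c"
  shows "continuous_on UNIV (\<lambda>t. c (clamp01 t))"
  using abs_cont_curve_majorant[OF assms] majorant_continuous by metis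

text \<open>
  The speed can be computed from real functions: the distances \<open>F q\<close> to the points \<open>c q\<close>, \<open>q\<close>
  rational, are absolutely continuous with densities \<open>\<psi> q\<close>, and \<open>w\<close> is the supremum of all
  \<open>\<bar>\<psi> q\<bar>\<close>. By density of the rationals \<open>w\<close> is again a majorant, so at its Lebesgue points it bounds the
  difference quotients of \<open>c\<close> from above in the limit. Each \<open>F q\<close> is \<open>1\<close>-Lipschitz in the distance, so
  at common Lebesgue points each \<open>\<bar>\<psi> q\<bar>\<close> bounds them from below.
\<close>
lemma metric_derivative_exists:
  fixes c :: "real \<Rightarrow> 'a::metric_space"
  assumes ac: "abs_cont_curve c"
  obtains w :: "real \<Rightarrow> real" where "w \<in> borel_measurable borel" "\<And>t. 0 \<le> w t"
    "majorant (\<lambda>t. ennreal (w t)) c" "(\<integral>\<^sup>+t. ennreal (w t) \<partial>lborel) < \<infinity>"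
    "AE t in lborel. t \<in> {0<..<1} \<longrightarrow>
       ((\<lambda>s. dist (c s) (c t) / \<bar>s - t\<bar>) \<longlongrightarrow> w t) (at t) \<and> metric_derivative c t = w t"
proof -
  obtain m where m: "majorant m c" and fin: "(\<integral>\<^sup>+x. m x \<partial>lborel) < \<infinity>"
    using abs_cont_curve_majorant[OF ac] .
  have [measurable]: "m \<in> borel_measurable borel" using m by (rule majorant_measurable)
  have cont: "continuous_on UNIV (\<lambda>t. c (clamp01 t))" by (rule abs_cont_curve_continuous[OF ac])
  define F where "F q t = dist (c t) (c (clamp01 (real_of_rat q)))" for q t
  have maj: "majorant m (F q)" for q
    unfolding majorant_def
  proof (intro conjI allI impI)
    fix s t :: real assume st: "0 \<le> s \<and> s \<le> t \<and> t \<le> 1"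
    have "dist (F q s) (F q t) \<le> dist (c s) (c t)"
      unfolding F_def dist_real_def by (smt (verit) dist_commute dist_triangle)
    hence "ennreal (dist (F q s) (F q t)) \<le> ennreal (dist (c s) (c t))" by (rule ennreal_leI)
    also have "\<dots> \<le> (\<integral>\<^sup>+x\<in>{s..t}. m x \<partial>lborel)" using majorantD[OF m] st by simp
    finally show "ennreal (dist (F q s) (F q t)) \<le> (\<integral>\<^sup>+x\<in>{s..t}. m x \<partial>lborel)" .
  qed simp
  have "\<exists>\<psi>. integrable lborel \<psi> \<and> (\<forall>s t. 0 \<le> s \<longrightarrow> s \<le> t \<longrightarrow> t \<le> 1 \<longrightarrow> F q t - F q s = (LINT x:{s..t}|lborel. \<psi> x))" for q
    using real_absolutely_continuous_primitive[OF maj fin, of q] by metis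
  then obtain \<psi> where \<psi>: "\<And>q. integrable lborel (\<psi> q)"
    "\<And>q s t. 0 \<le> s \<Longrightarrow> s \<le> t \<Longrightarrow> t \<le> 1 \<Longrightarrow> F q t - F q s = (LINT x:{s..t}|lborel. \<psi> q x)"
    by metis
  have [measurable]: "\<psi> q \<in> borel_measurable borel" for q
    using \<psi>(1)[of q] borel_measurable_integrable by fastforce
  have mint: "set_integrable lborel UNIV (\<lambda>x. enn2real (m x))"
    using fin by (intro LINT_enn2real) auto
  hence mint': "integrable lborel (\<lambda>x. enn2real (m x))" by (simp add: set_integrable_def)
  note fin' = set_nn_integral_finite_subset[OF fin]
  have Fm: "\<bar>F q t - F q s\<bar> \<le> (LINT x:{s..t}|lborel. enn2real (m x))" if st: "0 \<le> s" "s \<le> t" "t \<le> 1" for q s t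
  proof -
    have "ennreal \<bar>F q t - F q s\<bar> \<le> ennreal (LINT x:{s..t}|lborel. enn2real (m x))"
      using majorantD[OF maj st, of q] LINT_enn2real(2)[OF _ _ fin', of "{s..t}"]
      by (simp add: dist_real_def abs_minus_commute)
    moreover have "0 \<le> (LINT x:{s..t}|lborel. enn2real (m x))"
      unfolding set_lebesgue_integral_def by (intro integral_nonneg_AE) auto
    ultimately show ?thesis by (simp add: ennreal_le_iff)
  qed
  define W where "W t = (SUP q. ennreal \<bar>\<psi> q t\<bar>) * indicator {0<..<1} t" for t
  have [measurable]: "W \<in> borel_measurable borel" unfolding W_def by measurable
  have near: "eventually (\<lambda>s. s \<in> {0<..<1}) (at t)" if "t \<in> {0<..<1}" for t :: real
    using that by (intro eventually_at_in_open') auto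
  have diff\<psi>: "((\<lambda>s. \<bar>F q s - F q t\<bar> / \<bar>s - t\<bar>) \<longlongrightarrow> \<bar>\<psi> q t\<bar>) (at t)"
    if t: "t \<in> {0<..<1}" and L: "((\<lambda>y. (LINT u:{min t y..max t y}|lborel. \<psi> q u) / \<bar>y - t\<bar>) \<longlongrightarrow> \<psi> q t) (at t)" for q t
  proof (rule Lim_transform_eventually[OF tendsto_rabs[OF L]])
    show "\<forall>\<^sub>F s in at t. \<bar>(LINT u:{min t s..max t s}|lborel. \<psi> q u) / \<bar>s - t\<bar>\<bar> = \<bar>F q s - F q t\<bar> / \<bar>s - t\<bar>"
      using near[OF t]
    proof eventually_elim
      case (elim s)
      show ?case
        using \<psi>(2)[of t s q] \<psi>(2)[of s t q] elim t
        by (cases "s \<le> t") (auto simp: min_def max_def abs_minus_commute abs_divide)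
    qed
  qed
  have AEL: "AE t in lborel. ((\<lambda>y. (LINT u:{min t y..max t y}|lborel. enn2real (m u)) / \<bar>y - t\<bar>) \<longlongrightarrow> enn2real (m t)) (at t)
     \<and> (\<forall>q. ((\<lambda>y. (LINT u:{min t y..max t y}|lborel. \<psi> q u) / \<bar>y - t\<bar>) \<longlongrightarrow> \<psi> q t) (at t))"
    using Lebesgue_differentiation_real[OF mint'] Lebesgue_differentiation_real[OF \<psi>(1)]
    by (simp add: AE_all_countable)
  have \<psi>m: "\<bar>\<psi> q t\<bar> \<le> enn2real (m t)" if t: "t \<in> {0<..<1}"
    and L: "((\<lambda>y. (LINT u:{min t y..max t y}|lborel. enn2real (m u)) / \<bar>y - t\<bar>) \<longlongrightarrow> enn2real (m t)) (at t)"
      "((\<lambda>y. (LINT u:{min t y..max t y}|lborel. \<psi> q u) / \<bar>y - t\<bar>) \<longlongrightarrow> \<psi> q t) (at t)" for q t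
  proof (rule tendsto_le[OF _ L(1) diff\<psi>[OF t L(2)]])
    show "\<forall>\<^sub>F s in at t. \<bar>F q s - F q t\<bar> / \<bar>s - t\<bar> \<le> (LINT u:{min t s..max t s}|lborel. enn2real (m u)) / \<bar>s - t\<bar>"
      using near[OF t]
    proof eventually_elim
      case (elim s)
      show ?case
        using Fm[of t s q] Fm[of s t q] elim t
        by (intro divide_right_mono; cases "s \<le> t") (auto simp: min_def max_def abs_minus_commute)
    qed
  qed auto
  have "AE t in lborel. m t \<noteq> \<infinity>" using fin by (intro nn_integral_PInf_AE) auto
  with AEL have Wm: "AE t in lborel. W t \<le> m t"
  proof eventually_elim
    fix t
    assume A: "((\<lambda>y. (LINT u:{min t y..max t y}|lborel. enn2real (m u)) / \<bar>y - t\<bar>) \<longlongrightarrow> enn2real (m t)) (at t)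
     \<and> (\<forall>q. ((\<lambda>y. (LINT u:{min t y..max t y}|lborel. \<psi> q u) / \<bar>y - t\<bar>) \<longlongrightarrow> \<psi> q t) (at t))" "m t \<noteq> \<infinity>"
    show "W t \<le> m t"
    proof (cases "t \<in> {0<..<1}")
      case True
      have "ennreal \<bar>\<psi> q t\<bar> \<le> ennreal (enn2real (m t))" for q
        using A True by (intro ennreal_leI \<psi>m) auto
      moreover have "ennreal (enn2real (m t)) = m t" using A(2) by (simp add: less_top)
      ultimately have "(SUP q. ennreal \<bar>\<psi> q t\<bar>) \<le> m t" by (intro SUP_least) simp
      thus ?thesis using True by (simp add: W_def)
    qed (simp add: W_def)
  qed
  have Wfin: "(\<integral>\<^sup>+t. W t \<partial>lborel) < \<infinity>"
    using nn_integral_mono_AE[OF Wm] fin by (rule le_less_trans)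
  have Wmaj: "majorant W c"
    unfolding majorant_def
  proof (intro conjI allI impI)
    show "W \<in> borel_measurable borel" by measurable
    fix s t :: real assume st: "0 \<le> s \<and> s \<le> t \<and> t \<le> 1"
    show "ennreal (dist (c s) (c t)) \<le> (\<integral>\<^sup>+x\<in>{s..t}. W x \<partial>lborel)"
    proof (rule ennreal_le_epsilon)
      fix e :: real assume e: "0 < e"
      obtain d where d: "d > 0" "\<And>x. dist x s < d \<Longrightarrow> dist (c (clamp01 x)) (c (clamp01 s)) < e/2"
        using cont e unfolding continuous_on_iff by (meson UNIV_I half_gt_zero)
      \<comment> \<open>If \<open>c q\<close> were \<open>c s\<close>, then \<open>dist (c s) (c t)\<close> would be the increment of \<open>F q\<close>; a rational time close to \<open>s\<close> costs \<open>e\<close>.\<close>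
      obtain q where "s < real_of_rat q" "real_of_rat q < s + d" using of_rat_dense[of s "s+d"] d(1) by auto
      hence q: "dist (c (clamp01 (real_of_rat q))) (c s) < e/2"
        using d(2)[of "real_of_rat q"] st by (simp add: dist_real_def clamp01_id)
      have "dist (c s) (c t) \<le> (F q t - F q s) + e"
        using dist_triangle[of "c s" "c t" "c (clamp01 (real_of_rat q))"] q unfolding F_def
        by (simp add: dist_commute)
      also have "F q t - F q s = (LINT x:{s..t}|lborel. \<psi> q x)" using \<psi>(2) st by simp
      finally have "ennreal (dist (c s) (c t)) \<le> ennreal ((LINT x:{s..t}|lborel. \<psi> q x) + e)"
        by (rule ennreal_leI)
      also have "\<dots> \<le> ennreal (norm (LINT x:{s..t}|lborel. \<psi> q x) + e)" by (intro ennreal_leI) simp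
      also have "\<dots> = ennreal (norm (LINT x:{s..t}|lborel. \<psi> q x)) + ennreal e" using e by (intro ennreal_plus) auto
      also have "ennreal (norm (LINT x:{s..t}|lborel. \<psi> q x)) \<le> (\<integral>\<^sup>+x. norm (indicator {s..t} x *\<^sub>R \<psi> q x) \<partial>lborel)"
        unfolding set_lebesgue_integral_def
        by (intro integral_norm_bound_ennreal integrable_mult_indicator \<psi>(1)) auto
      also have "\<dots> \<le> (\<integral>\<^sup>+x\<in>{s..t}. W x \<partial>lborel)"
      proof (rule nn_integral_mono_AE)
        show "AE x in lborel. ennreal (norm (indicator {s..t} x *\<^sub>R \<psi> q x)) \<le> W x * indicator {s..t} x"
          using AE_lborel_neq[of 0] AE_lborel_neq[of 1]
          by eventually_elim (use st in \<open>auto simp: indicator_def W_def intro: SUP_upper2[of q]\<close>)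
      qed
      finally show "ennreal (dist (c s) (c t)) \<le> (\<integral>\<^sup>+x\<in>{s..t}. W x \<partial>lborel) + ennreal e"
        by (simp add: add_right_mono)
    qed
  qed
  define w where "w t = enn2real (W t)" for t
  have "AE t in lborel. W t \<noteq> \<infinity>" using Wfin by (intro nn_integral_PInf_AE) auto
  hence Ww: "AE t in lborel. ennreal (w t) = W t"
    by eventually_elim (auto simp: w_def less_top)
  have wmeas[measurable]: "w \<in> borel_measurable borel" unfolding w_def by measurable
  have wint: "(\<integral>\<^sup>+x. ennreal (w x) \<partial>lborel) = (\<integral>\<^sup>+x. W x \<partial>lborel)"
    using Ww by (rule nn_integral_cong_AE)
  have "(\<integral>\<^sup>+x\<in>A. ennreal (w x) \<partial>lborel) = (\<integral>\<^sup>+x\<in>A. W x \<partial>lborel)" for A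
    using Ww by (intro nn_integral_cong_AE) auto
  hence wmaj: "majorant (\<lambda>t. ennreal (w t)) c" using Wmaj by (auto simp: majorant_def)
  have w0: "0 \<le> w t" for t by (simp add: w_def)
  have wi: "integrable lborel w"
    using wint Wfin w0 by (intro integrableI_nonneg) auto
  have upper: "dist (c s) (c t) \<le> (LINT x:{min s t..max s t}|lborel. w x)" if "s \<in> {0..1}" "t \<in> {0..1}" for s t
  proof -
    have "ennreal (dist (c s) (c t)) \<le> (\<integral>\<^sup>+x\<in>{min s t..max s t}. ennreal (w x) \<partial>lborel)"
      using majorantD[OF wmaj, of "min s t" "max s t"] that by (auto simp: min_def max_def dist_commute)
    also have "\<dots> = ennreal (LINT x:{min s t..max s t}|lborel. w x)"
    proof -
      have "(\<integral>\<^sup>+x\<in>{min s t..max s t}. ennreal (w x) \<partial>lborel) < \<infinity>"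
        by (rule set_nn_integral_finite_subset) (use wint Wfin in simp)
      from LINT_enn2real(2)[OF _ _ this] show ?thesis by (simp add: w0)
    qed
    finally have "ennreal (dist (c s) (c t)) \<le> ennreal (LINT x:{min s t..max s t}|lborel. w x)" .
    moreover have "0 \<le> (LINT x:{min s t..max s t}|lborel. w x)"
      unfolding set_lebesgue_integral_def by (intro integral_nonneg_AE) (auto simp: w0)
    ultimately show ?thesis by (simp add: ennreal_le_iff)
  qed
  show ?thesis
  proof
    show "w \<in> borel_measurable borel" "\<And>t. 0 \<le> w t" "majorant (\<lambda>t. ennreal (w t)) c" by fact+
    show "(\<integral>\<^sup>+t. ennreal (w t) \<partial>lborel) < \<infinity>" using wint Wfin by simp
    show "AE t in lborel. t \<in> {0<..<1} \<longrightarrow>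
       ((\<lambda>s. dist (c s) (c t) / \<bar>s - t\<bar>) \<longlongrightarrow> w t) (at t) \<and> metric_derivative c t = w t"
      using AEL Lebesgue_differentiation_real[OF wi] Ww
    proof eventually_elim
      fix t
      assume L1: "((\<lambda>y. (LINT u:{min t y..max t y}|lborel. enn2real (m u)) / \<bar>y - t\<bar>) \<longlongrightarrow> enn2real (m t)) (at t)
        \<and> (\<forall>q. ((\<lambda>y. (LINT u:{min t y..max t y}|lborel. \<psi> q u) / \<bar>y - t\<bar>) \<longlongrightarrow> \<psi> q t) (at t))"
        and Lw: "((\<lambda>y. (LINT u:{min t y..max t y}|lborel. w u) / \<bar>y - t\<bar>) \<longlongrightarrow> w t) (at t)"
        and wW: "ennreal (w t) = W t"
      show "t \<in> {0<..<1} \<longrightarrow>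
       ((\<lambda>s. dist (c s) (c t) / \<bar>s - t\<bar>) \<longlongrightarrow> w t) (at t) \<and> metric_derivative c t = w t"
      proof
        assume t: "t \<in> {0<..<1}"
        have lim: "((\<lambda>s. dist (c s) (c t) / \<bar>s - t\<bar>) \<longlongrightarrow> w t) (at t)"
        proof (rule order_tendstoI)
          fix a assume a: "a < w t"
          have "\<exists>q. a < \<bar>\<psi> q t\<bar>"
          proof (cases "a < 0")
            case True
            then show ?thesis by (intro exI[of _ undefined]) linarith
          next
            case False
            have "ennreal a < W t" using a wW False by (metis ennreal_less_iff not_less)
            hence "ennreal a < (SUP q. ennreal \<bar>\<psi> q t\<bar>)" using t by (simp add: W_def)
            then obtain q where "ennreal a < ennreal \<bar>\<psi> q t\<bar>" unfolding less_SUP_iff by auto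
            thus ?thesis using False by (auto simp: ennreal_less_iff)
          qed
          then obtain q where q: "a < \<bar>\<psi> q t\<bar>" by blast
          have "eventually (\<lambda>s. a < \<bar>F q s - F q t\<bar> / \<bar>s - t\<bar>) (at t)"
            using L1 by (intro order_tendstoD(1)[OF diff\<psi>[OF t] q]) auto
          thus "eventually (\<lambda>s. a < dist (c s) (c t) / \<bar>s - t\<bar>) (at t)"
          proof eventually_elim
            case (elim s)
            have "\<bar>F q s - F q t\<bar> \<le> dist (c s) (c t)"
              unfolding F_def by (smt (verit) dist_commute dist_triangle)
            hence "\<bar>F q s - F q t\<bar> / \<bar>s - t\<bar> \<le> dist (c s) (c t) / \<bar>s - t\<bar>" by (rule divide_right_mono) simp
            thus ?case using elim by linarith
          qed
        next
          fix a assume a: "w t < a"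
          show "eventually (\<lambda>s. dist (c s) (c t) / \<bar>s - t\<bar> < a) (at t)"
            using order_tendstoD(2)[OF Lw a] near[OF t]
          proof eventually_elim
            case (elim s)
            have "dist (c s) (c t) / \<bar>s - t\<bar> \<le> (LINT u:{min t s..max t s}|lborel. w u) / \<bar>s - t\<bar>"
              using upper[of t s] elim t by (intro divide_right_mono) (auto simp: dist_commute)
            thus ?case using elim by linarith
          qed
        qed
        have "at t within {0..1} = at t" using t by (intro at_within_interior) auto
        hence "metric_derivative c t = w t"
          unfolding metric_derivative_def using lim by (auto intro!: tendsto_Lim)
        with lim show "((\<lambda>s. dist (c s) (c t) / \<bar>s - t\<bar>) \<longlongrightarrow> w t) (at t) \<and> metric_derivative c t = w t" ..
      qed
    qed
  qed
qed

section \<open>Lower semicontinuity of the kinetic energy\<close>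

definition kinetic :: "(real \<Rightarrow> 'a::metric_space) \<Rightarrow> ennreal" where
  "kinetic c = (\<integral>\<^sup>+t\<in>{0..1}. ennreal ((metric_derivative c t)\<^sup>2) \<partial>lborel)"

text \<open>
  The difference quotient is defined on the whole line, so that no boundary terms appear when a
  translation invariant integral is taken.
\<close>
definition diffq :: "(real \<Rightarrow> 'a::metric_space) \<Rightarrow> real \<Rightarrow> real \<Rightarrow> ennreal" where
  "diffq c h t = ennreal (dist (c (clamp01 t)) (c (clamp01 (t + h))) / h)"

lemma ennreal_power2_le_imp_le:
  assumes "x\<^sup>2 \<le> (ennreal r)\<^sup>2" "0 \<le> r"
  shows "x \<le> ennreal r"
proof (rule ccontr)
  assume "\<not> x \<le> ennreal r"
  hence "ennreal r < x" by simp
  then obtain b where b: "r < b" "ennreal b \<le> x" "0 \<le> b"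
    using assms(2) by (cases x) (auto simp: ennreal_less_iff top_unique intro: that[of "r + 1"])
  have "(ennreal r)\<^sup>2 < (ennreal b)\<^sup>2"
    using b assms(2) by (simp add: ennreal_power ennreal_less_iff power_strict_mono)
  also have "\<dots> \<le> x\<^sup>2" using b by (intro power_mono) auto
  finally show False using assms(1) by simp
qed

lemma set_nn_integral_Cauchy_Schwarz:
  assumes [measurable]: "m \<in> borel_measurable M" "A \<in> sets M"
  shows "(\<integral>\<^sup>+x\<in>A. m x \<partial>M)\<^sup>2 \<le> emeasure M A * (\<integral>\<^sup>+x\<in>A. (m x)\<^sup>2 \<partial>M)"
proof -
  have "(\<integral>\<^sup>+x\<in>A. m x \<partial>M)\<^sup>2 = (\<integral>\<^sup>+x. indicator A x * (m x * indicator A x) \<partial>M)\<^sup>2"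
    by (intro arg_cong[of _ _ "\<lambda>x. x\<^sup>2"] nn_integral_cong) (auto simp: indicator_def)
  also have "\<dots> \<le> (\<integral>\<^sup>+x. (indicator A x)\<^sup>2 \<partial>M) * (\<integral>\<^sup>+x. (m x * indicator A x)\<^sup>2 \<partial>M)"
    by (rule Cauchy_Schwarz_nn_integral) auto
  also have "(\<integral>\<^sup>+x. (indicator A x)\<^sup>2 \<partial>M) = (\<integral>\<^sup>+x. indicator A x \<partial>M)"
    by (intro nn_integral_cong) (auto simp: indicator_def)
  also have "(\<integral>\<^sup>+x. (m x * indicator A x)\<^sup>2 \<partial>M) = (\<integral>\<^sup>+x\<in>A. (m x)\<^sup>2 \<partial>M)"
    by (intro nn_integral_cong) (auto simp: indicator_def)
  finally show ?thesis by simp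
qed

text \<open>
  By the Cauchy--Schwarz inequality the squared quotient at \<open>t\<close> is at most the mean of \<open>m\<^sup>2\<close> over
  \<open>{t..t + h}\<close>; a point \<open>x\<close> lies in these intervals for a set of \<open>t\<close> of measure \<open>h\<close>, so Tonelli's theorem
  gives back the integral of \<open>m\<^sup>2\<close>.
\<close>
lemma diffq_square_integral_le:
  assumes m: "majorant m c" and h: "h > 0"
  shows "(\<integral>\<^sup>+t. (diffq c h t)\<^sup>2 \<partial>lborel) \<le> (\<integral>\<^sup>+x\<in>{0..1}. (m x)\<^sup>2 \<partial>lborel)"
proof -
  define m1 where "m1 = (\<lambda>x. m x * indicator {0<..<1} x)"
  have m1: "majorant m1 c" unfolding m1_def by (rule majorant_restrict[OF m])
  have [measurable]: "m1 \<in> borel_measurable borel" by (rule majorant_measurable[OF m1])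
  have "(diffq c h t)\<^sup>2 \<le> (\<integral>\<^sup>+x. ennreal (1/h) * (m1 x)\<^sup>2 * indicator {t..t+h} x \<partial>lborel)" for t
  proof -
    have "diffq c h t = ennreal (1/h) * ennreal (dist (c (clamp01 t)) (c (clamp01 (t + h))))"
      using h by (simp add: diffq_def ennreal_mult'[symmetric])
    hence "(diffq c h t)\<^sup>2 = (ennreal (1/h))\<^sup>2 * (ennreal (dist (c (clamp01 t)) (c (clamp01 (t + h)))))\<^sup>2"
      by (simp add: power_mult_distrib)
    also have "\<dots> \<le> (ennreal (1/h))\<^sup>2 * (\<integral>\<^sup>+x\<in>{t..t+h}. m1 x \<partial>lborel)\<^sup>2"
      using majorant_clamp[OF m1, of t "t+h"] h by (intro mult_left_mono power_mono) auto
    also have "\<dots> \<le> (ennreal (1/h))\<^sup>2 * (emeasure lborel {t..t+h} * (\<integral>\<^sup>+x\<in>{t..t+h}. (m1 x)\<^sup>2 \<partial>lborel))"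
      by (intro mult_left_mono set_nn_integral_Cauchy_Schwarz) auto
    also have "\<dots> = ((ennreal (1/h))\<^sup>2 * ennreal h) * (\<integral>\<^sup>+x\<in>{t..t+h}. (m1 x)\<^sup>2 \<partial>lborel)"
      using h by (simp add: mult.assoc)
    also have "(ennreal (1/h))\<^sup>2 * ennreal h = ennreal (1/h)"
      using h by (simp add: ennreal_power ennreal_mult'[symmetric] power2_eq_square)
    also have "ennreal (1/h) * (\<integral>\<^sup>+x\<in>{t..t+h}. (m1 x)\<^sup>2 \<partial>lborel) = (\<integral>\<^sup>+x. ennreal (1/h) * (m1 x)\<^sup>2 * indicator {t..t+h} x \<partial>lborel)"
      by (subst nn_integral_cmult[symmetric]) (auto simp: mult.assoc)
    finally show ?thesis .
  qed
  hence "(\<integral>\<^sup>+t. (diffq c h t)\<^sup>2 \<partial>lborel) \<le>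
      (\<integral>\<^sup>+t. \<integral>\<^sup>+x. ennreal (1/h) * (m1 x)\<^sup>2 * indicator {t..t+h} x \<partial>lborel \<partial>lborel)"
    by (intro nn_integral_mono) auto
  also have "\<dots> = (\<integral>\<^sup>+t. \<integral>\<^sup>+x. ennreal (1/h) * (m1 x)\<^sup>2 * indicator {p. fst p \<le> snd p \<and> snd p \<le> fst p + h} (t, x) \<partial>lborel \<partial>lborel)"
    by (intro nn_integral_cong) (auto simp: indicator_def)
  also have "\<dots> = (\<integral>\<^sup>+x. \<integral>\<^sup>+t. ennreal (1/h) * (m1 x)\<^sup>2 * indicator {p. fst p \<le> snd p \<and> snd p \<le> fst p + h} (t, x) \<partial>lborel \<partial>lborel)"
    by (rule lborel_pair.Fubini'[symmetric]) measurable
  also have "\<dots> = (\<integral>\<^sup>+x. ennreal (1/h) * (m1 x)\<^sup>2 * (\<integral>\<^sup>+t. indicator {x-h..x} t \<partial>lborel) \<partial>lborel)"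
    by (subst nn_integral_cmult[symmetric]) (auto intro!: nn_integral_cong simp: indicator_def)
  also have "\<dots> = (\<integral>\<^sup>+x. (m1 x)\<^sup>2 \<partial>lborel)"
  proof (rule nn_integral_cong)
    fix x :: real
    have "ennreal (1/h) * (m1 x)\<^sup>2 * ennreal h = (ennreal (1/h) * ennreal h) * (m1 x)\<^sup>2" by (simp add: ac_simps)
    also have "ennreal (1/h) * ennreal h = 1" using h by (simp add: ennreal_mult'[symmetric])
    finally show "ennreal (1/h) * (m1 x)\<^sup>2 * (\<integral>\<^sup>+t. indicator {x-h..x} t \<partial>lborel) = (m1 x)\<^sup>2" using h by simp
  qed
  also have "\<dots> \<le> (\<integral>\<^sup>+x\<in>{0..1}. (m x)\<^sup>2 \<partial>lborel)"
    by (intro nn_integral_mono) (auto simp: m1_def indicator_def)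
  finally show ?thesis .
qed

lemma diffq_measurable:
  assumes "continuous_on UNIV (\<lambda>t. c (clamp01 t))"
  shows "diffq c h \<in> borel_measurable borel"
proof -
  have "continuous_on UNIV (\<lambda>t. dist (c (clamp01 t)) (c (clamp01 (t + h))))"
    by (intro continuous_on_dist assms continuous_on_compose2[OF assms] continuous_intros) auto
  hence [measurable]: "(\<lambda>t. dist (c (clamp01 t)) (c (clamp01 (t + h)))) \<in> borel_measurable borel"
    by (rule borel_measurable_continuous_onI)
  show ?thesis unfolding diffq_def[abs_def] by measurable
qed

text \<open>
  Fatou's lemma, as the difference quotients converge to the metric derivative almost everywhere.
\<close>
lemma kinetic_le_liminf_diffq:
  assumes ac: "abs_cont_curve c"
  shows "kinetic c \<le> liminf (\<lambda>n. \<integral>\<^sup>+t. (diffq c (1 / real (Suc n)) t)\<^sup>2 \<partial>lborel)"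
proof -
  have [measurable]: "diffq c h \<in> borel_measurable borel" for h
    by (rule diffq_measurable[OF abs_cont_curve_continuous[OF ac]])
  obtain w :: "real \<Rightarrow> real" where w0: "w \<in> borel_measurable borel" "\<And>t. 0 \<le> w t"
    "majorant (\<lambda>t. ennreal (w t)) c" "(\<integral>\<^sup>+t. ennreal (w t) \<partial>lborel) < \<infinity>"
    and w: "AE t in lborel. t \<in> {0<..<1} \<longrightarrow>
       ((\<lambda>s. dist (c s) (c t) / \<bar>s - t\<bar>) \<longlongrightarrow> w t) (at t) \<and> metric_derivative c t = w t"
    by (fact metric_derivative_exists[OF ac])
  have "kinetic c \<le> (\<integral>\<^sup>+t. liminf (\<lambda>n. (diffq c (1 / real (Suc n)) t)\<^sup>2) \<partial>lborel)"
    unfolding kinetic_def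
  proof (rule nn_integral_mono_AE)
    show "AE t in lborel. ennreal ((metric_derivative c t)\<^sup>2) * indicator {0..1} t \<le>
       liminf (\<lambda>n. (diffq c (1 / real (Suc n)) t)\<^sup>2)"
      using w AE_lborel_neq[of 0] AE_lborel_neq[of 1]
    proof eventually_elim
      fix t
      assume A: "t \<in> {0<..<1} \<longrightarrow>
       ((\<lambda>s. dist (c s) (c t) / \<bar>s - t\<bar>) \<longlongrightarrow> w t) (at t) \<and> metric_derivative c t = w t"
        and "t \<noteq> 0" "t \<noteq> 1"
      show "ennreal ((metric_derivative c t)\<^sup>2) * indicator {0..1} t \<le> liminf (\<lambda>n. (diffq c (1 / real (Suc n)) t)\<^sup>2)"
      proof (cases "t \<in> {0<..<1}")
        case True
        have lim0: "(\<lambda>n. t + 1 / real (Suc n)) \<longlonglongrightarrow> t"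
          using tendsto_add[OF tendsto_const[of t] LIMSEQ_inverse_real_of_nat] by (simp add: inverse_eq_divide)
        hence "filterlim (\<lambda>n. t + 1 / real (Suc n)) (at t) sequentially"
          by (auto simp: filterlim_at)
        hence "(\<lambda>n. dist (c (t + 1 / real (Suc n))) (c t) / \<bar>t + 1 / real (Suc n) - t\<bar>) \<longlonglongrightarrow> w t"
          using filterlim_compose[of "\<lambda>s. dist (c s) (c t) / \<bar>s - t\<bar>"] A True by blast
        moreover have "\<forall>\<^sub>F n in sequentially. dist (c (t + 1 / real (Suc n))) (c t) / \<bar>t + 1 / real (Suc n) - t\<bar> =
            dist (c (clamp01 t)) (c (clamp01 (t + 1 / real (Suc n)))) / (1 / real (Suc n))"
        proof -
          have "\<forall>\<^sub>F n in sequentially. t + 1 / real (Suc n) < 1" using order_tendstoD(2)[OF lim0] True by simp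
          thus ?thesis
          proof eventually_elim
            case (elim n)
            have "clamp01 t = t" "clamp01 (t + 1 / real (Suc n)) = t + 1 / real (Suc n)"
              using True elim by (auto intro!: clamp01_id add_nonneg_nonneg)
            thus ?case by (simp add: dist_commute)
          qed
        qed
        ultimately have "(\<lambda>n. dist (c (clamp01 t)) (c (clamp01 (t + 1 / real (Suc n)))) / (1 / real (Suc n))) \<longlonglongrightarrow> w t"
          by (rule Lim_transform_eventually)
        hence "(\<lambda>n. ennreal ((dist (c (clamp01 t)) (c (clamp01 (t + 1 / real (Suc n)))) / (1 / real (Suc n)))\<^sup>2)) \<longlonglongrightarrow> ennreal ((w t)\<^sup>2)"
          by (intro tendsto_ennrealI tendsto_power)
        hence "(\<lambda>n. (diffq c (1 / real (Suc n)) t)\<^sup>2) \<longlonglongrightarrow> ennreal ((w t)\<^sup>2)"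
          unfolding diffq_def by (subst ennreal_power) auto
        hence "liminf (\<lambda>n. (diffq c (1 / real (Suc n)) t)\<^sup>2) = ennreal ((w t)\<^sup>2)"
          by (intro lim_imp_Liminf) auto
        thus ?thesis using A True by simp
      next
        case False
        thus ?thesis using \<open>t \<noteq> 0\<close> \<open>t \<noteq> 1\<close> by (auto simp: indicator_def)
      qed
    qed
  qed
  also have "\<dots> \<le> liminf (\<lambda>n. \<integral>\<^sup>+t. (diffq c (1 / real (Suc n)) t)\<^sup>2 \<partial>lborel)"
    by (rule nn_integral_liminf) measurable
  finally show ?thesis .
qed

text \<open>
  An integrated form of the fact that the metric derivative is the smallest majorant; it bounds the
  energy of curves whose speed is known only through an upper bound.
\<close>
lemma kinetic_le_majorant:
  assumes ac: "abs_cont_curve c" and m: "majorant m c"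
  shows "kinetic c \<le> (\<integral>\<^sup>+x\<in>{0..1}. (m x)\<^sup>2 \<partial>lborel)"
proof -
  have "liminf (\<lambda>n. \<integral>\<^sup>+t. (diffq c (1 / real (Suc n)) t)\<^sup>2 \<partial>lborel) \<le> liminf (\<lambda>n::nat. \<integral>\<^sup>+x\<in>{0..1}. (m x)\<^sup>2 \<partial>lborel)"
    by (intro Liminf_mono always_eventually allI diffq_square_integral_le[OF m]) auto
  thus ?thesis using kinetic_le_liminf_diffq[OF ac] by (simp add: Liminf_const)
qed

lemma speed_majorant:
  fixes c :: "real \<Rightarrow> 'a::metric_space"
  assumes ac: "abs_cont_curve c"
  obtains w :: "real \<Rightarrow> real" where "w \<in> borel_measurable borel" "\<And>t. 0 \<le> w t"
    "majorant (\<lambda>t. ennreal (w t)) c" "(\<integral>\<^sup>+t. ennreal (w t) \<partial>lborel) < \<infinity>"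
    "AE t in lborel. t \<in> {0<..<1} \<longrightarrow> metric_derivative c t = w t"
    "kinetic c = (\<integral>\<^sup>+t\<in>{0..1}. (ennreal (w t))\<^sup>2 \<partial>lborel)"
proof -
  obtain w :: "real \<Rightarrow> real" where w: "w \<in> borel_measurable borel" "\<And>t. 0 \<le> w t"
    "majorant (\<lambda>t. ennreal (w t)) c" "(\<integral>\<^sup>+t. ennreal (w t) \<partial>lborel) < \<infinity>"
    and ae: "AE t in lborel. t \<in> {0<..<1} \<longrightarrow>
       ((\<lambda>s. dist (c s) (c t) / \<bar>s - t\<bar>) \<longlongrightarrow> w t) (at t) \<and> metric_derivative c t = w t"
    by (fact metric_derivative_exists[OF ac])
  have ae': "AE t in lborel. t \<in> {0<..<1} \<longrightarrow> metric_derivative c t = w t"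
    using ae by eventually_elim auto
  have "kinetic c = (\<integral>\<^sup>+t\<in>{0..1}. (ennreal (w t))\<^sup>2 \<partial>lborel)"
    unfolding kinetic_def
  proof (rule nn_integral_cong_AE)
    show "AE t in lborel. ennreal ((metric_derivative c t)\<^sup>2) * indicator {0..1} t = (ennreal (w t))\<^sup>2 * indicator {0..1} t"
      using ae' AE_lborel_neq[of 0] AE_lborel_neq[of 1]
      by eventually_elim (use w(2) in \<open>auto simp: indicator_def ennreal_power\<close>)
  qed
  with w ae' that show ?thesis by blast
qed

text \<open>
  Unlike the metric derivative, difference quotients with a fixed step converge when the curves
  converge pointwise, and their squared integral never exceeds the kinetic energy.
\<close>
lemma kinetic_lsc:
  fixes c :: "real \<Rightarrow> 'a::metric_space"
  assumes ach: "\<And>h. abs_cont_curve (ch h)" and ac: "abs_cont_curve c"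
    and lim: "\<And>t. t \<in> {0..1} \<Longrightarrow> (\<lambda>h. ch h t) \<longlonglongrightarrow> c t"
  shows "kinetic c \<le> liminf (\<lambda>h. kinetic (ch h))"
proof -
  have [measurable]: "diffq (ch h) r \<in> borel_measurable borel" for h r
    by (rule diffq_measurable[OF abs_cont_curve_continuous[OF ach]])
  have *: "(\<integral>\<^sup>+t. (diffq (ch h) r t)\<^sup>2 \<partial>lborel) \<le> kinetic (ch h)" if "r > 0" for h r
  proof -
    obtain w :: "real \<Rightarrow> real" where "w \<in> borel_measurable borel" "\<And>t. 0 \<le> w t" and
      w: "majorant (\<lambda>t. ennreal (w t)) (ch h)" "(\<integral>\<^sup>+t. ennreal (w t) \<partial>lborel) < \<infinity>" and
      "AE t in lborel. t \<in> {0<..<1} \<longrightarrow> metric_derivative (ch h) t = w t" and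
      wk: "kinetic (ch h) = (\<integral>\<^sup>+t\<in>{0..1}. (ennreal (w t))\<^sup>2 \<partial>lborel)"
      by (fact speed_majorant[OF ach[of h]])
    show ?thesis unfolding wk by (rule diffq_square_integral_le[OF w(1) that])
  qed
  have "(\<integral>\<^sup>+t. (diffq c r t)\<^sup>2 \<partial>lborel) \<le> liminf (\<lambda>h. kinetic (ch h))" if r: "r > 0" for r
  proof -
    have "(\<lambda>h. (diffq (ch h) r t)\<^sup>2) \<longlonglongrightarrow> (diffq c r t)\<^sup>2" for t
    proof -
      have "(\<lambda>h. ennreal ((dist (ch h (clamp01 t)) (ch h (clamp01 (t + r))) / r)\<^sup>2)) \<longlonglongrightarrow>
          ennreal ((dist (c (clamp01 t)) (c (clamp01 (t + r))) / r)\<^sup>2)"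
        using r by (intro tendsto_ennrealI tendsto_power tendsto_divide tendsto_dist lim tendsto_const) auto
      thus ?thesis unfolding diffq_def using r by (subst (1 2) ennreal_power) auto
    qed
    hence "liminf (\<lambda>h. (diffq (ch h) r t)\<^sup>2) = (diffq c r t)\<^sup>2" for t
      by (intro lim_imp_Liminf) auto
    hence "(\<integral>\<^sup>+t. (diffq c r t)\<^sup>2 \<partial>lborel) = (\<integral>\<^sup>+t. liminf (\<lambda>h. (diffq (ch h) r t)\<^sup>2) \<partial>lborel)" by simp
    also have "\<dots> \<le> liminf (\<lambda>h. \<integral>\<^sup>+t. (diffq (ch h) r t)\<^sup>2 \<partial>lborel)"
      by (rule nn_integral_liminf) measurable
    also have "\<dots> \<le> liminf (\<lambda>h. kinetic (ch h))"
      by (intro Liminf_mono always_eventually allI * r)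
    finally show ?thesis .
  qed
  hence "liminf (\<lambda>n. \<integral>\<^sup>+t. (diffq c (1 / real (Suc n)) t)\<^sup>2 \<partial>lborel) \<le> liminf (\<lambda>n::nat. liminf (\<lambda>h. kinetic (ch h)))"
    by (intro Liminf_mono always_eventually allI) auto
  thus ?thesis using kinetic_le_liminf_diffq[OF ac] by (simp add: Liminf_const)
qed

text \<open>
  The primitives \<open>V h\<close> of the speeds are bounded and satisfy, on every finite family of nonoverlapping
  intervals of total length \<open>a\<close>, the bound \<open>sqrt (a * E)\<close> on their increments. A pointwise cluster
  point \<open>U\<close> inherits this and therefore has a density, which is a majorant of the limit curve.
\<close>
lemma abs_cont_curve_limit:
  fixes c :: "real \<Rightarrow> 'a::metric_space"
  assumes ach: "\<And>h::nat. abs_cont_curve (ch h)" and E: "\<And>h. kinetic (ch h) \<le> ennreal E"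
    and lim: "\<And>t. t \<in> {0..1} \<Longrightarrow> (\<lambda>h. ch h t) \<longlonglongrightarrow> c t"
  shows "abs_cont_curve c"
proof -
  define E1 where "E1 = max E 0"
  have E1: "E1 \<ge> 0" "\<And>h. kinetic (ch h) \<le> ennreal E1" using E by (auto simp: E1_def max_def ennreal_neg)
  have "\<exists>m. majorant m (ch h) \<and> (\<integral>\<^sup>+t. m t \<partial>lborel) < \<infinity> \<and> (\<integral>\<^sup>+t\<in>{0..1}. (m t)\<^sup>2 \<partial>lborel) \<le> ennreal E1
      \<and> (\<forall>t. t \<notin> {0<..<1} \<longrightarrow> m t = 0)" for h
  proof -
    obtain w :: "real \<Rightarrow> real" where "w \<in> borel_measurable borel" "\<And>t. 0 \<le> w t" and
      w: "majorant (\<lambda>t. ennreal (w t)) (ch h)" "(\<integral>\<^sup>+t. ennreal (w t) \<partial>lborel) < \<infinity>" and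
      "AE t in lborel. t \<in> {0<..<1} \<longrightarrow> metric_derivative (ch h) t = w t" and
      wk: "kinetic (ch h) = (\<integral>\<^sup>+t\<in>{0..1}. (ennreal (w t))\<^sup>2 \<partial>lborel)"
      by (fact speed_majorant[OF ach[of h]])
    let ?m = "\<lambda>t. ennreal (w t) * indicator {0<..<1} t"
    have "(\<integral>\<^sup>+t\<in>{0..1}. (?m t)\<^sup>2 \<partial>lborel) \<le> (\<integral>\<^sup>+t\<in>{0..1}. (ennreal (w t))\<^sup>2 \<partial>lborel)"
      by (intro nn_integral_mono) (auto simp: indicator_def)
    hence "(\<integral>\<^sup>+t\<in>{0..1}. (?m t)\<^sup>2 \<partial>lborel) \<le> ennreal E1" using wk E1(2)[of h] by simp
    thus ?thesis using majorant_restrict[OF w(1)] set_nn_integral_finite_subset[OF w(2), of "{0<..<1}"]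
      by (intro exI[of _ ?m] conjI allI impI) auto
  qed
  hence "\<exists>m. \<forall>h. majorant (m h) (ch h) \<and> (\<integral>\<^sup>+t. m h t \<partial>lborel) < \<infinity>
      \<and> (\<integral>\<^sup>+t\<in>{0..1}. (m h t)\<^sup>2 \<partial>lborel) \<le> ennreal E1 \<and> (\<forall>t. t \<notin> {0<..<1} \<longrightarrow> m h t = 0)"
    by (intro choice allI)
  then obtain m where m: "\<And>h. majorant (m h) (ch h)" "\<And>h. (\<integral>\<^sup>+t. m h t \<partial>lborel) < \<infinity>"
    "\<And>h. (\<integral>\<^sup>+t\<in>{0..1}. (m h t)\<^sup>2 \<partial>lborel) \<le> ennreal E1" "\<And>h t. t \<notin> {0<..<1} \<Longrightarrow> m h t = 0"
    by blast
  have [measurable]: "m h \<in> borel_measurable borel" for h using m(1) by (rule majorant_measurable)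
  \<comment> \<open>The Cauchy--Schwarz inequality makes the speeds uniformly integrable.\<close>
  have bd: "(\<integral>\<^sup>+x\<in>A. m h x \<partial>lborel) \<le> ennreal (sqrt (a * E1))"
    if [measurable]: "A \<in> sets borel" and A: "emeasure lborel (A \<inter> {0..1}) \<le> ennreal a" "a \<ge> 0" for A a h
  proof -
    have "(\<integral>\<^sup>+x\<in>A. m h x \<partial>lborel)\<^sup>2 = (\<integral>\<^sup>+x\<in>A \<inter> {0..1}. m h x \<partial>lborel)\<^sup>2"
      using m(4) by (intro arg_cong[of _ _ "\<lambda>x. x\<^sup>2"] nn_integral_cong) (force simp: indicator_def)
    also have "\<dots> \<le> emeasure lborel (A \<inter> {0..1}) * (\<integral>\<^sup>+x\<in>A \<inter> {0..1}. (m h x)\<^sup>2 \<partial>lborel)"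
      by (rule set_nn_integral_Cauchy_Schwarz) auto
    also have "\<dots> \<le> ennreal a * (\<integral>\<^sup>+x\<in>{0..1}. (m h x)\<^sup>2 \<partial>lborel)"
      by (intro mult_mono A nn_integral_mono) (auto simp: indicator_def)
    also have "\<dots> \<le> ennreal a * ennreal E1" by (intro mult_left_mono m(3)) auto
    also have "\<dots> = (ennreal (sqrt (a * E1)))\<^sup>2" using A(2) E1(1) by (simp add: ennreal_power ennreal_mult)
    finally show ?thesis using A(2) E1(1) by (intro ennreal_power2_le_imp_le) auto
  qed
  define V where "V h t = enn2real (\<integral>\<^sup>+x\<in>{..t}. m h x \<partial>lborel)" for h t
  have V: "ennreal (V h t - V h s) = (\<integral>\<^sup>+x\<in>{s..t}. m h x \<partial>lborel)" "V h s \<le> V h t" if "s \<le> t" for h s t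
    unfolding V_def using primitive_nn_integral[OF _ m(2) that] by auto
  have Vd: "V h t - V h s \<le> sqrt (a * E1)" if "s \<le> t" "a \<ge> 0" "emeasure lborel ({s..t} \<inter> {0..1}) \<le> ennreal a" for h s t a
  proof -
    have "ennreal (V h t - V h s) \<le> ennreal (sqrt (a * E1))"
      unfolding V(1)[OF that(1)] using that by (intro bd) auto
    thus ?thesis using that E1 by (simp add: ennreal_le_iff)
  qed
  have "V h t \<in> {0..sqrt E1}" for h t
  proof -
    have "ennreal (V h t) = (\<integral>\<^sup>+x\<in>{..t}. m h x \<partial>lborel)"
      unfolding V_def using set_nn_integral_finite_subset[OF m(2)] by (simp add: less_top)
    also have "\<dots> \<le> ennreal (sqrt (1 * E1))"
    proof (rule bd)
      have "emeasure lborel ({..t} \<inter> {0..1}) \<le> emeasure lborel {0..1::real}" by (intro emeasure_mono) auto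
      thus "emeasure lborel ({..t} \<inter> {0..1}) \<le> ennreal 1" by simp
    qed auto
    finally show ?thesis using E1 by (simp add: ennreal_le_iff V_def)
  qed
  hence cpt: "\<exists>K. compact K \<and> (\<forall>h. V h t \<in> K)" for t by (intro exI[of _ "{0..sqrt E1}"]) auto
  obtain G U where G: "G \<le> sequentially" "G \<noteq> bot" and U: "\<And>t. ((\<lambda>h. V h t) \<longlongrightarrow> U t) G"
    by (fact pointwise_cluster[OF sequentially_bot cpt])
  have Um: "U s \<le> U t" if "s \<le> t" for s t
    using G(2) U[of t] U[of s] by (rule tendsto_le) (use V(2)[OF that] in auto)
  have Ud: "U t - U s \<le> sqrt (a * E1)" if "s \<le> t" "a \<ge> 0" "emeasure lborel ({s..t} \<inter> {0..1}) \<le> ennreal a" for s t a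
    using G(2) tendsto_const tendsto_diff[OF U[of t] U[of s]] by (rule tendsto_le) (use Vd[OF that] in auto)
  have cont: "continuous_on UNIV U"
    unfolding continuous_on_iff
  proof (intro ballI allI impI)
    fix x e :: real assume e: "e > 0"
    define d where "d = (e/2)\<^sup>2 / (E1 + 1)"
    have d: "d > 0" using e E1 by (simp add: d_def)
    have "d * E1 \<le> (e/2)\<^sup>2" using e E1 by (simp add: d_def divide_simps mult_left_mono)
    hence "sqrt (d * E1) \<le> e/2" using e by (intro real_le_lsqrt) auto
    hence *: "U t - U s < e" if "s \<le> t" "t - s < d" for s t
    proof -
      have "emeasure lborel ({s..t} \<inter> {0..1}) \<le> emeasure lborel {s..t}" by (intro emeasure_mono) auto
      also have "\<dots> \<le> ennreal d" using that by (simp add: ennreal_leI)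
      finally have "U t - U s \<le> sqrt (d * E1)" using that d by (intro Ud) auto
      thus ?thesis using \<open>sqrt (d * E1) \<le> e/2\<close> e by linarith
    qed
    show "\<exists>d>0. \<forall>x'\<in>UNIV. dist x' x < d \<longrightarrow> dist (U x') (U x) < e"
    proof (intro exI[of _ d] conjI ballI impI d)
      fix y assume "dist y x < d"
      thus "dist (U y) (U x) < e"
        using *[of x y] *[of y x] Um[of x y] Um[of y x] by (cases "x \<le> y") (auto simp: dist_real_def)
    qed
  qed
  have "\<exists>v\<in>borel_measurable borel. \<forall>s t. s \<le> t \<longrightarrow> (\<integral>\<^sup>+x\<in>{s..t}. v x \<partial>lborel) = ennreal (U t - U s)"
  proof (rule mono_absolutely_continuous_density[of U])
    show "mono U" using Um by (auto simp: mono_def)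
    show "continuous_on UNIV U" by fact
    show "U x = U 0" if "x \<le> 0" for x
    proof -
      have "{x..0} \<inter> {0..1} = {0}" using that by auto
      hence "U 0 - U x \<le> sqrt (0 * E1)" using that by (intro Ud) auto
      thus ?thesis using Um[OF that] by simp
    qed
    show "U x = U 1" if "1 \<le> x" for x
    proof -
      have "{1..x} \<inter> {0..1} = {1}" using that by auto
      hence "U x - U 1 \<le> sqrt (0 * E1)" using that by (intro Ud) auto
      thus ?thesis using Um[OF that] by simp
    qed
    show "small_variation U"
      unfolding small_variation_def
    proof (intro allI impI)
    fix e :: real assume e: "e > 0"
    define d where "d = e\<^sup>2 / (E1 + 1)"
    have d: "d > 0" using e E1 by (simp add: d_def)
    have "d * E1 \<le> e\<^sup>2" using e E1 by (simp add: d_def divide_simps mult_left_mono)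
    hence de: "sqrt (d * E1) \<le> e" using e by (intro real_le_lsqrt) auto
    have "(\<Sum>K\<in>\<D>. U (Sup K) - U (Inf K)) \<le> e"
      if D: "finite \<D>" "\<forall>K\<in>\<D>. \<exists>a b. 0 \<le> a \<and> a \<le> b \<and> b \<le> 1 \<and> K = {a..b}"
        "pairwise (\<lambda>A B. interior A \<inter> interior B = {}) \<D>" "measure lebesgue (\<Union>\<D>) < d" for \<D>
    proof -
      have b: "\<Union>\<D> \<in> sets borel" using D(1,2) by (intro sets.finite_Union) auto
      have "emeasure lborel (\<Union>\<D>) \<le> emeasure lborel {0..1::real}"
        using D(2) by (intro emeasure_mono) fastforce+
      hence "emeasure lborel (\<Union>\<D>) \<noteq> \<infinity>" by (auto simp: top_unique)
      hence "emeasure lborel (\<Union>\<D>) \<le> ennreal d"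
        using D(4) b by (subst emeasure_eq_ennreal_measure) (auto intro: ennreal_leI)
      moreover have "emeasure lborel (\<Union>\<D> \<inter> {0..1}) \<le> emeasure lborel (\<Union>\<D>)" using b by (intro emeasure_mono) auto
      ultimately have I: "(\<integral>\<^sup>+x\<in>\<Union>\<D>. m h x \<partial>lborel) \<le> ennreal (sqrt (d * E1))" for h
        using b d by (intro bd) auto
      have "(\<Sum>K\<in>\<D>. V h (Sup K) - V h (Inf K)) \<le> e" for h
      proof -
        have "ennreal (\<Sum>K\<in>\<D>. V h (Sup K) - V h (Inf K)) = (\<Sum>K\<in>\<D>. ennreal (V h (Sup K) - V h (Inf K)))"
          using D(2) V(2) by (intro sum_ennreal[symmetric]) fastforce
        also have "\<dots> = (\<Sum>K\<in>\<D>. \<integral>\<^sup>+x\<in>K. m h x \<partial>lborel)"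
          using D(2) V(1) by (intro sum.cong) auto
        also have "\<dots> \<le> (\<integral>\<^sup>+x\<in>\<Union>\<D>. m h x \<partial>lborel)"
          using D by (intro sum_nn_integral_nonoverlapping) fastforce+
        also have "\<dots> \<le> ennreal e" using I[of h] de by (meson ennreal_leI order_trans)
        finally show ?thesis using e by (simp add: ennreal_le_iff)
      qed
      moreover have "((\<lambda>h. \<Sum>K\<in>\<D>. V h (Sup K) - V h (Inf K)) \<longlongrightarrow> (\<Sum>K\<in>\<D>. U (Sup K) - U (Inf K))) G"
        by (intro tendsto_sum tendsto_diff U)
      ultimately show ?thesis using G(2) by (intro tendsto_upperbound[of _ _ G]) auto
    qed
    thus "\<exists>d>0. \<forall>\<D>. finite \<D> \<longrightarrow>
      (\<forall>K\<in>\<D>. \<exists>a b. 0 \<le> a \<and> a \<le> b \<and> b \<le> 1 \<and> K = {a..b}) \<longrightarrow>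
      pairwise (\<lambda>A B. interior A \<inter> interior B = {}) \<D> \<longrightarrow>
      measure lebesgue (\<Union>\<D>) < d \<longrightarrow> (\<Sum>K\<in>\<D>. U (Sup K) - U (Inf K)) \<le> e"
      using d by blast
    qed
  qed blast
  then obtain v where v: "v \<in> borel_measurable borel"
    "\<And>s t. s \<le> t \<Longrightarrow> (\<integral>\<^sup>+x\<in>{s..t}. v x \<partial>lborel) = ennreal (U t - U s)" by blast
  have "majorant v c"
    unfolding majorant_def
  proof (intro conjI allI impI v(1))
    fix s t :: real assume st: "0 \<le> s \<and> s \<le> t \<and> t \<le> 1"
    have "dist (ch h s) (ch h t) \<le> V h t - V h s" for h
    proof -
      have "ennreal (dist (ch h s) (ch h t)) \<le> ennreal (V h t - V h s)"
        using majorantD[OF m(1)[of h], of s t] V(1)[of s t h] st by simp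
      thus ?thesis using V(2)[of s t h] st by (simp add: ennreal_le_iff)
    qed
    hence "dist (c s) (c t) \<le> U t - U s"
      using G st by (intro tendsto_le[OF G(2) tendsto_diff[OF U U] tendsto_dist[OF tendsto_mono[OF G(1) lim] tendsto_mono[OF G(1) lim]]]) auto
    thus "ennreal (dist (c s) (c t)) \<le> (\<integral>\<^sup>+x\<in>{s..t}. v x \<partial>lborel)"
      using st by (simp add: v(2) ennreal_leI)
  qed
  thus ?thesis using v(2)[of 0 1] by (intro abs_cont_curveI) auto
qed

section \<open>Descending slopes of semiconvex functions\<close>

abbreviation rv :: "('a \<Rightarrow> ereal) \<Rightarrow> 'a \<Rightarrow> real" where
  "rv g x \<equiv> real_of_ereal (g x)"

text \<open>
  The convexity condition in terms of real numbers, with a nonpositive constant \<open>-K\<close> and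
  \<open>\<tau> * K < 1\<close> in place of the extended-real bound on \<open>\<tau>\<close>. As in the original condition, the curve is chosen
  before \<open>\<tau>\<close>.
\<close>
definition real_convexity :: "real \<Rightarrow> ('a::metric_space \<Rightarrow> ereal) \<Rightarrow> bool" where
  "real_convexity K g \<longleftrightarrow> (\<forall>x. g x \<noteq> -\<infinity>) \<and>
     (\<forall>y\<in>eff_dom g. \<forall>x0\<in>eff_dom g. \<forall>x1\<in>eff_dom g. \<exists>\<gamma>. \<gamma> 0 = x0 \<and> \<gamma> 1 = x1 \<and>
        (\<forall>\<tau> t. 0 < \<tau> \<and> \<tau> * K < 1 \<and> 0 \<le> t \<and> t \<le> 1 \<longrightarrow> \<gamma> t \<in> eff_dom g \<and>
           rv g (\<gamma> t) + (dist (\<gamma> t) y)\<^sup>2 / (2 * \<tau>) \<le>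
             (1 - t) * (rv g x0 + (dist x0 y)\<^sup>2 / (2 * \<tau>)) + t * (rv g x1 + (dist x1 y)\<^sup>2 / (2 * \<tau>))
             - (1 / \<tau> - K) / 2 * t * (1 - t) * (dist x0 x1)\<^sup>2))"

lemma eff_dom_real: "x \<in> eff_dom g \<Longrightarrow> g x \<noteq> -\<infinity> \<Longrightarrow> g x = ereal (rv g x)"
  by (cases "g x") (auto simp: eff_dom_def)

lemma eff_dom_real': "\<forall>x. g x \<noteq> -\<infinity> \<Longrightarrow> x \<in> eff_dom g \<Longrightarrow> g x = ereal (rv g x)"
  by (rule eff_dom_real) auto

lemma convexity_condition_real:
  assumes cc: "convexity_condition lam g" and ni: "\<forall>x. g x \<noteq> -\<infinity>" and K: "K > 0" "- lam \<le> K"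
  shows "real_convexity K g"
  unfolding real_convexity_def
proof (intro conjI ni ballI)
  fix y x0 x1 assume D: "y \<in> eff_dom g" "x0 \<in> eff_dom g" "x1 \<in> eff_dom g"
  obtain \<gamma> where \<gamma>: "\<gamma> 0 = x0" "\<gamma> 1 = x1"
    "\<And>\<tau>. \<tau> > 0 \<Longrightarrow> ereal \<tau> < 1 / ereal (max (- lam) 0) \<Longrightarrow>
       convex_along (lam + inverse \<tau>) (\<lambda>x. g x + ereal ((dist x y)\<^sup>2 / (2 * \<tau>))) \<gamma>"
    using cc D unfolding convexity_condition_def by blast
  have r: "g x0 = ereal (rv g x0)" "g x1 = ereal (rv g x1)"
    by (rule eff_dom_real'[OF ni], rule D)+
  have "\<gamma> t \<in> eff_dom g \<and> rv g (\<gamma> t) + (dist (\<gamma> t) y)\<^sup>2 / (2 * \<tau>) \<le>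
             (1 - t) * (rv g x0 + (dist x0 y)\<^sup>2 / (2 * \<tau>)) + t * (rv g x1 + (dist x1 y)\<^sup>2 / (2 * \<tau>))
             - (1 / \<tau> - K) / 2 * t * (1 - t) * (dist x0 x1)\<^sup>2"
    if H: "0 < \<tau>" "\<tau> * K < 1" "0 \<le> t" "t \<le> 1" for \<tau> t
  proof -
    have "ereal \<tau> < 1 / ereal (max (- lam) 0)"
    proof (cases "lam < 0")
      case True
      have "\<tau> * (- lam) \<le> \<tau> * K" using H K by (intro mult_left_mono) auto
      hence "\<tau> * (- lam) < 1" using H by linarith
      hence "\<tau> < 1 / (- lam)" using True by (simp add: field_simps)
      thus ?thesis using True by (simp add: max_def divide_ereal_def inverse_eq_divide one_ereal_def)
    next
      case False
      thus ?thesis by (simp add: max_def divide_ereal_def)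
    qed
    hence cv: "convex_along (lam + inverse \<tau>) (\<lambda>x. g x + ereal ((dist x y)\<^sup>2 / (2 * \<tau>))) \<gamma>"
      using \<gamma>(3) H by blast
    define R where "R = (1 - t) * (rv g x0 + (dist x0 y)\<^sup>2 / (2 * \<tau>)) + t * (rv g x1 + (dist x1 y)\<^sup>2 / (2 * \<tau>))
             - (lam + inverse \<tau>) / 2 * t * (1 - t) * (dist x0 x1)\<^sup>2"
    have "g (\<gamma> t) + ereal ((dist (\<gamma> t) y)\<^sup>2 / (2 * \<tau>)) \<le>
       ereal (1 - t) * (g x0 + ereal ((dist x0 y)\<^sup>2 / (2 * \<tau>))) + ereal t * (g x1 + ereal ((dist x1 y)\<^sup>2 / (2 * \<tau>)))
       - ereal ((lam + inverse \<tau>) / 2 * t * (1 - t) * (dist x0 x1)\<^sup>2)"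
      using cv H(3,4) \<gamma>(1,2) unfolding convex_along_def by auto
    also have "\<dots> = ereal R"
      unfolding R_def by (subst r(1), subst r(2)) simp
    finally have *: "g (\<gamma> t) + ereal ((dist (\<gamma> t) y)\<^sup>2 / (2 * \<tau>)) \<le> ereal R" .
    have dom: "\<gamma> t \<in> eff_dom g"
      using * by (cases "g (\<gamma> t)") (auto simp: eff_dom_def)
    have "rv g (\<gamma> t) + (dist (\<gamma> t) y)\<^sup>2 / (2 * \<tau>) \<le> R"
      using * ni by (cases "g (\<gamma> t)") (auto simp: eff_dom_def)
    also have "R \<le> (1 - t) * (rv g x0 + (dist x0 y)\<^sup>2 / (2 * \<tau>)) + t * (rv g x1 + (dist x1 y)\<^sup>2 / (2 * \<tau>))
             - (1 / \<tau> - K) / 2 * t * (1 - t) * (dist x0 x1)\<^sup>2"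
    proof -
      have "(1 / \<tau> - K) / 2 * (t * (1 - t) * (dist x0 x1)\<^sup>2) \<le> (lam + inverse \<tau>) / 2 * (t * (1 - t) * (dist x0 x1)\<^sup>2)"
        using H K(2) by (intro mult_right_mono) (auto simp: inverse_eq_divide)
      thus ?thesis by (simp add: R_def mult.assoc)
    qed
    finally show ?thesis using dom by simp
  qed
  thus "\<exists>\<gamma>. \<gamma> 0 = x0 \<and> \<gamma> 1 = x1 \<and>
        (\<forall>\<tau> t. 0 < \<tau> \<and> \<tau> * K < 1 \<and> 0 \<le> t \<and> t \<le> 1 \<longrightarrow> \<gamma> t \<in> eff_dom g \<and>
           rv g (\<gamma> t) + (dist (\<gamma> t) y)\<^sup>2 / (2 * \<tau>) \<le>
             (1 - t) * (rv g x0 + (dist x0 y)\<^sup>2 / (2 * \<tau>)) + t * (rv g x1 + (dist x1 y)\<^sup>2 / (2 * \<tau>))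
             - (1 / \<tau> - K) / 2 * t * (1 - t) * (dist x0 x1)\<^sup>2)"
    using \<gamma>(1,2) by blast
qed

text \<open>
  The global form of the statement that the descending slope at \<open>x\<close> is at most \<open>M\<close>. It involves the
  values at two points only and is therefore stable under limits, which the descending slope itself
  does not show.
\<close>
definition slope_le :: "real \<Rightarrow> ('a::metric_space \<Rightarrow> ereal) \<Rightarrow> real \<Rightarrow> 'a \<Rightarrow> bool" where
  "slope_le K g M x \<longleftrightarrow> x \<in> eff_dom g \<and>
     (\<forall>y\<in>eff_dom g. rv g x - rv g y \<le> M * dist x y + K / 2 * (dist x y)\<^sup>2)"

lemma slope_leD: "slope_le K g M x \<Longrightarrow> y \<in> eff_dom g \<Longrightarrow> rv g x - rv g y \<le> M * dist x y + K / 2 * (dist x y)\<^sup>2"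
  by (simp add: slope_le_def)

lemma slope_le_dom: "slope_le K g M x \<Longrightarrow> x \<in> eff_dom g"
  by (simp add: slope_le_def)

lemma slope_le_mono: "slope_le K g M x \<Longrightarrow> M \<le> M' \<Longrightarrow> slope_le K g M' x"
  unfolding slope_le_def by (meson add_right_mono mult_right_mono order_trans zero_le_dist)

text \<open>
  Close to \<open>x\<close> the quadratic term is negligible against the linear one.
\<close>
lemma slope_le_imp_descending_slope_le:
  assumes sl: "slope_le K g M x" and M: "M \<ge> 0" and K: "K \<ge> 0" and ni: "\<forall>x. g x \<noteq> -\<infinity>"
  shows "descending_slope g x \<le> ennreal M"
proof (cases "open {x}")
  case True
  thus ?thesis using slope_le_dom[OF sl] by (simp add: descending_slope_def)
next
  case False
  have gx: "g x = ereal (rv g x)" by (rule eff_dom_real'[OF ni slope_le_dom[OF sl]])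
  have "Limsup (at x) (\<lambda>y. e2ennreal (max (- (g y - g x)) 0 / ereal (dist y x))) \<le> ennreal M"
  proof (rule ennreal_le_epsilon)
    fix e :: real assume e: "e > 0"
    have "\<forall>\<^sub>F y in at x. dist y x < e / (K + 1) \<and> y \<noteq> x"
      unfolding eventually_at by (rule exI[of _ "e / (K+1)"]) (use e K in auto)
    hence "\<forall>\<^sub>F y in at x. e2ennreal (max (- (g y - g x)) 0 / ereal (dist y x)) \<le> ennreal (M + e)"
    proof eventually_elim
      fix y assume y: "dist y x < e / (K + 1) \<and> y \<noteq> x"
      show "e2ennreal (max (- (g y - g x)) 0 / ereal (dist y x)) \<le> ennreal (M + e)"
      proof (cases "y \<in> eff_dom g")
        case True
        have gy: "g y = ereal (rv g y)" by (rule eff_dom_real'[OF ni True])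
        have d: "dist y x > 0" using y by simp
        have "max (- (g y - g x)) 0 / ereal (dist y x) = ereal (max (rv g x - rv g y) 0 / dist y x)"
          using d by (subst gy, subst gx) (simp add: max_def zero_ereal_def)
        also have "\<dots> \<le> ereal (M + e)"
        proof -
          have "rv g x - rv g y \<le> M * dist y x + K / 2 * (dist y x)\<^sup>2"
            using slope_leD[OF sl True] by (simp add: dist_commute)
          also have "K / 2 * (dist y x)\<^sup>2 = (K / 2 * dist y x) * dist y x" by (simp add: power2_eq_square)
          also have "K / 2 * dist y x \<le> e"
          proof -
            have "(K + 1) * dist y x < e" using y K by (simp add: field_simps)
            moreover have "K / 2 * dist y x \<le> (K + 1) * dist y x" using K by (intro mult_right_mono) auto
            ultimately show ?thesis by linarith
          qed
          finally have "rv g x - rv g y \<le> (M + e) * dist y x" using d by (simp add: algebra_simps)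
          moreover have "0 \<le> (M + e) * dist y x" using M e by simp
          ultimately show ?thesis using d by (simp add: divide_le_eq)
        qed
        finally have "e2ennreal (max (- (g y - g x)) 0 / ereal (dist y x)) \<le> e2ennreal (ereal (M + e))"
          by (rule e2ennreal_mono)
        thus ?thesis by (simp add: e2ennreal_ereal)
      next
        case False
        hence "g y = \<infinity>" by (auto simp: eff_dom_def)
        hence "- (g y - g x) = -\<infinity>" using gx by (cases "g x") auto
        hence "max (- (g y - g x)) 0 / ereal (dist y x) = 0" by (simp add: max_def)
        thus ?thesis by (simp add: e2ennreal_neg)
      qed
    qed
    hence "Limsup (at x) (\<lambda>y. e2ennreal (max (- (g y - g x)) 0 / ereal (dist y x))) \<le> ennreal (M + e)"
      by (rule Limsup_bounded)
    thus "Limsup (at x) (\<lambda>y. e2ennreal (max (- (g y - g x)) 0 / ereal (dist y x))) \<le> ennreal M + ennreal e"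
      using M e by simp
  qed
  thus ?thesis using False slope_le_dom[OF sl] by (simp add: descending_slope_def)
qed

text \<open>
  A point of a geodesic to another point lies arbitrarily close to its start, so an isolated point is
  the whole space.
\<close>
lemma geodesic_space_isolated:
  fixes x y :: "'a::metric_space"
  assumes geo: "\<forall>x y::'a. \<exists>\<gamma>. constant_speed_geodesic \<gamma> \<and> \<gamma> 0 = x \<and> \<gamma> 1 = y" and "open {x}"
  shows "y = x"
proof (rule ccontr)
  assume "y \<noteq> x"
  obtain \<gamma> where \<gamma>: "constant_speed_geodesic \<gamma>" "\<gamma> 0 = x" "\<gamma> 1 = y" using geo by blast
  obtain e where e: "e > 0" "\<And>z. dist z x < e \<Longrightarrow> z = x"
    using \<open>open {x}\<close> unfolding open_dist by blast
  define t where "t = min 1 (e / (2 * dist x y))"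
  have d: "dist x y > 0" using \<open>y \<noteq> x\<close> by simp
  have t: "0 < t" "t \<le> 1" "t * dist x y < e"
    using e d by (auto simp: t_def min_def field_simps)
  have "dist (\<gamma> t) (\<gamma> 0) = \<bar>t - 0\<bar> * dist (\<gamma> 0) (\<gamma> 1)"
    using \<gamma>(1)[unfolded constant_speed_geodesic_def, rule_format, of t 0] t by simp
  hence "dist (\<gamma> t) x = t * dist x y" using \<gamma> t by simp
  thus False using e(2)[of "\<gamma> t"] t d by auto
qed

lemma real_convexityE:
  assumes cv: "real_convexity K g" and D: "y \<in> eff_dom g" "x0 \<in> eff_dom g" "x1 \<in> eff_dom g"
  obtains \<gamma> where "\<gamma> 0 = x0" "\<gamma> 1 = x1"
    "\<And>\<tau> t. 0 < \<tau> \<Longrightarrow> \<tau> * K < 1 \<Longrightarrow> 0 \<le> t \<Longrightarrow> t \<le> 1 \<Longrightarrow> \<gamma> t \<in> eff_dom g"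
    "\<And>\<tau> t. 0 < \<tau> \<Longrightarrow> \<tau> * K < 1 \<Longrightarrow> 0 \<le> t \<Longrightarrow> t \<le> 1 \<Longrightarrow>
       rv g (\<gamma> t) + (dist (\<gamma> t) y)\<^sup>2 / (2 * \<tau>) \<le>
         (1 - t) * (rv g x0 + (dist x0 y)\<^sup>2 / (2 * \<tau>)) + t * (rv g x1 + (dist x1 y)\<^sup>2 / (2 * \<tau>))
         - (1 / \<tau> - K) / 2 * t * (1 - t) * (dist x0 x1)\<^sup>2"
proof -
  from cv[unfolded real_convexity_def, THEN conjunct2, rule_format, OF D]
  obtain \<gamma> where \<gamma>: "\<gamma> 0 = x0 \<and> \<gamma> 1 = x1 \<and>
        (\<forall>\<tau> t. 0 < \<tau> \<and> \<tau> * K < 1 \<and> 0 \<le> t \<and> t \<le> 1 \<longrightarrow> \<gamma> t \<in> eff_dom g \<and>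
           rv g (\<gamma> t) + (dist (\<gamma> t) y)\<^sup>2 / (2 * \<tau>) \<le>
             (1 - t) * (rv g x0 + (dist x0 y)\<^sup>2 / (2 * \<tau>)) + t * (rv g x1 + (dist x1 y)\<^sup>2 / (2 * \<tau>))
             - (1 / \<tau> - K) / 2 * t * (1 - t) * (dist x0 x1)\<^sup>2)" by (elim exE)
  note I = \<gamma>[THEN conjunct2, THEN conjunct2, rule_format]
  show ?thesis
    by (rule that[of \<gamma>]) (use \<gamma> in blast, use \<gamma> in blast, rule I[THEN conjunct1], blast, rule I[THEN conjunct2], blast)
qed

text \<open>
  Use the convexity condition from \<open>x\<close> to \<open>z\<close> with base point \<open>x\<close> itself. As \<open>\<tau>\<close> tends to \<open>0\<close>, it shows
  that the curve has distance at most \<open>t * dist x z\<close> from \<open>x\<close>; as \<open>\<tau>\<close> tends to \<open>1 / K\<close>, that \<open>g\<close> decreases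
  along it at least at the rate \<open>a = g x - g z - K / 2 * (dist x z)\<^sup>2\<close>. Here it matters that one curve
  serves all \<open>\<tau>\<close>. The slope at \<open>x\<close> is then at least \<open>a / dist x z\<close>.
\<close>
lemma descending_slope_le_imp_slope_le:
  fixes x :: "'a::metric_space"
  assumes cv: "real_convexity K g" and K: "K > 0" and M: "M \<ge> 0"
    and iso: "open {x} \<Longrightarrow> UNIV = {x}"
    and le: "descending_slope g x \<le> ennreal M"
  shows "slope_le K g M x"
  unfolding slope_le_def
proof (intro conjI ballI)
  have ni: "\<forall>x. g x \<noteq> -\<infinity>" using cv by (simp add: real_convexity_def)
  show xD: "x \<in> eff_dom g" using le by (auto simp: descending_slope_def top_unique split: if_splits)
  have gx: "g x = ereal (rv g x)" by (rule eff_dom_real'[OF ni xD])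
  fix z assume zD: "z \<in> eff_dom g"
  define D where "D = dist x z"
  define a where "a = rv g x - rv g z - K / 2 * D\<^sup>2"
  show "rv g x - rv g z \<le> M * dist x z + K / 2 * (dist x z)\<^sup>2"
  proof (rule ccontr)
    assume "\<not> ?thesis"
    hence aM: "a > M * D" by (simp add: a_def D_def)
    hence a0: "a > 0" using M by (smt (verit) D_def mult_nonneg_nonneg zero_le_dist)
    have "z \<noteq> x"
    proof
      assume "z = x"
      hence "a = 0" by (simp add: a_def D_def)
      thus False using a0 by simp
    qed
    hence D0: "D > 0" by (simp add: D_def)
    have no: "\<not> open {x}" using iso \<open>z \<noteq> x\<close> by blast
    obtain \<gamma> where \<gamma>: "\<gamma> 0 = x" "\<gamma> 1 = z"
      "\<And>\<tau> t. 0 < \<tau> \<Longrightarrow> \<tau> * K < 1 \<Longrightarrow> 0 \<le> t \<Longrightarrow> t \<le> 1 \<Longrightarrow> \<gamma> t \<in> eff_dom g"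
      "\<And>\<tau> t. 0 < \<tau> \<Longrightarrow> \<tau> * K < 1 \<Longrightarrow> 0 \<le> t \<Longrightarrow> t \<le> 1 \<Longrightarrow>
         rv g (\<gamma> t) + (dist (\<gamma> t) x)\<^sup>2 / (2 * \<tau>) \<le>
         (1 - t) * (rv g x + (dist x x)\<^sup>2 / (2 * \<tau>)) + t * (rv g z + (dist z x)\<^sup>2 / (2 * \<tau>))
         - (1 / \<tau> - K) / 2 * t * (1 - t) * (dist x z)\<^sup>2"
      by (fact real_convexityE[OF cv xD xD zD])
    have key: "\<gamma> t \<in> eff_dom g \<and> dist (\<gamma> t) x \<le> t * D \<and> rv g (\<gamma> t) \<le> rv g x - t * a"
      if t: "0 \<le> t" "t \<le> 1" for t
    proof -
      define B where "B = (1 - t) * rv g x + t * rv g z - rv g (\<gamma> t) + K / 2 * t * (1 - t) * D\<^sup>2"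
      define q where "q = (dist (\<gamma> t) x)\<^sup>2 - t\<^sup>2 * D\<^sup>2"
      have dom: "\<gamma> t \<in> eff_dom g" using \<gamma>(3)[of "1/(2*K)" t] t K by simp
      have ineq: "q / (2 * \<tau>) \<le> B" if "0 < \<tau>" "\<tau> * K < 1" for \<tau>
      proof -
        have "q / (2 * \<tau>) = (dist (\<gamma> t) x)\<^sup>2 / (2 * \<tau>) - t * D\<^sup>2 / (2 * \<tau>) + (1 / \<tau>) / 2 * t * (1 - t) * D\<^sup>2"
          using that by (simp add: q_def field_simps power2_eq_square)
        moreover have "(1 / \<tau> - K) / 2 * t * (1 - t) * D\<^sup>2 = (1 / \<tau>) / 2 * t * (1 - t) * D\<^sup>2 - K / 2 * t * (1 - t) * D\<^sup>2"
          by (simp add: left_diff_distrib diff_divide_distrib)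
        moreover have "rv g (\<gamma> t) + (dist (\<gamma> t) x)\<^sup>2 / (2 * \<tau>) \<le>
            (1 - t) * rv g x + t * (rv g z + D\<^sup>2 / (2 * \<tau>)) - (1 / \<tau> - K) / 2 * t * (1 - t) * D\<^sup>2"
          using \<gamma>(4)[OF that t] by (simp add: D_def dist_commute)
        moreover have "t * (rv g z + D\<^sup>2 / (2 * \<tau>)) = t * rv g z + t * D\<^sup>2 / (2 * \<tau>)"
          by (simp add: distrib_left)
        ultimately show ?thesis unfolding B_def by linarith
      qed
      \<comment> \<open>\<open>\<tau>\<close> tends to \<open>0\<close>\<close>
      have q0: "q \<le> 0"
      proof (rule ccontr)
        assume "\<not> q \<le> 0"
        hence q: "q > 0" by simp
        define \<tau> where "\<tau> = min (1 / (2 * K)) (q / (4 * (\<bar>B\<bar> + 1)))"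
        have \<tau>: "\<tau> > 0" "\<tau> * K < 1" "2 * \<tau> * \<bar>B\<bar> < q"
        proof -
          show "\<tau> > 0" using K q by (auto simp: \<tau>_def)
          have "\<tau> * K \<le> 1 / (2 * K) * K" using K by (intro mult_right_mono) (auto simp: \<tau>_def)
          thus "\<tau> * K < 1" using K by simp
          have "2 * \<tau> * \<bar>B\<bar> \<le> 2 * (q / (4 * (\<bar>B\<bar> + 1))) * \<bar>B\<bar>"
            by (intro mult_right_mono mult_left_mono) (auto simp: \<tau>_def)
          also have "\<dots> < q" using q by (simp add: divide_simps)
          finally show "2 * \<tau> * \<bar>B\<bar> < q" .
        qed
        have "q \<le> 2 * \<tau> * B" using ineq[OF \<tau>(1,2)] \<tau>(1) by (simp add: divide_le_eq mult.commute)
        also have "\<dots> \<le> 2 * \<tau> * \<bar>B\<bar>" using \<tau>(1) by (intro mult_left_mono) auto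
        finally show False using \<tau>(3) by simp
      qed
      \<comment> \<open>\<open>\<tau> = 1 / (K + \<epsilon>)\<close> tends to \<open>1 / K\<close>\<close>
      have "q * (K / 2) \<le> B"
      proof (rule field_le_epsilon)
        fix e :: real assume e: "e > 0"
        define \<epsilon> where "\<epsilon> = 2 * e / (\<bar>q\<bar> + 1)"
        have \<epsilon>: "\<epsilon> > 0" using e by (simp add: \<epsilon>_def)
        have "q / (2 * (1 / (K + \<epsilon>))) \<le> B" using K \<epsilon> by (intro ineq) (auto simp: divide_simps)
        hence 1: "q * (K / 2) + q * (\<epsilon> / 2) \<le> B" by (simp add: algebra_simps add_divide_distrib)
        have "\<bar>q\<bar> * (\<epsilon> / 2) \<le> e"
          using e by (simp add: \<epsilon>_def divide_simps mult_left_mono)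
        hence "- (q * (\<epsilon> / 2)) \<le> e" using q0 by simp
        thus "q * (K / 2) \<le> B + e" using 1 by linarith
      qed
      moreover have "- (t\<^sup>2 * D\<^sup>2) * (K / 2) \<le> q * (K / 2)" using K by (intro mult_right_mono) (auto simp: q_def)
      ultimately have "- (t\<^sup>2 * D\<^sup>2) * (K / 2) \<le> B" by linarith
      hence "rv g (\<gamma> t) \<le> rv g x - t * a"
        by (simp add: B_def a_def algebra_simps power2_eq_square diff_divide_distrib)
      moreover have "dist (\<gamma> t) x \<le> t * D"
      proof -
        have "(dist (\<gamma> t) x)\<^sup>2 \<le> (t * D)\<^sup>2" using q0 by (simp add: q_def power_mult_distrib)
        thus ?thesis by (rule power2_le_imp_le) (use t D0 in simp)
      qed
      ultimately show ?thesis using dom by blast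
    qed
    have "Limsup (at x) (\<lambda>y. e2ennreal (max (- (g y - g x)) 0 / ereal (dist y x))) \<le> ennreal M"
      using le xD no by (simp add: descending_slope_def)
    also have "ennreal M < ennreal (a / D)" using aM M D0 by (simp add: ennreal_less_iff field_simps)
    finally have "\<forall>\<^sub>F y in at x. e2ennreal (max (- (g y - g x)) 0 / ereal (dist y x)) < ennreal (a / D)"
      by (rule Limsup_lessD)
    then obtain \<delta> where \<delta>: "\<delta> > 0" "\<And>y. y \<noteq> x \<Longrightarrow> dist y x < \<delta> \<Longrightarrow>
        e2ennreal (max (- (g y - g x)) 0 / ereal (dist y x)) < ennreal (a / D)"
      unfolding eventually_at by blast
    define t where "t = min 1 (\<delta> / (2 * D))"
    have t: "0 < t" "t \<le> 1" "t * D < \<delta>" using \<delta>(1) D0 by (auto simp: t_def min_def field_simps)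
    define y where "y = \<gamma> t"
    have y: "y \<in> eff_dom g" "dist y x \<le> t * D" "rv g y \<le> rv g x - t * a"
      using key[of t] t by (auto simp: y_def)
    have yx: "y \<noteq> x" using y(3) mult_pos_pos[OF t(1) a0] by auto
    hence d: "dist y x > 0" by simp
    have gy: "g y = ereal (rv g y)" by (rule eff_dom_real'[OF ni y(1)])
    have eq: "max (- (g y - g x)) 0 / ereal (dist y x) = ereal (max (rv g x - rv g y) 0 / dist y x)"
      using d by (subst gy, subst gx) (simp add: max_def zero_ereal_def)
    have "a / D \<le> max (rv g x - rv g y) 0 / dist y x"
    proof -
      have "a * dist y x \<le> a * (t * D)" using y(2) a0 by (intro mult_left_mono) auto
      also have "\<dots> \<le> (rv g x - rv g y) * D" using mult_right_mono[of "t * a" "rv g x - rv g y" D] y(3) D0 by (simp add: ac_simps)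
      also have "\<dots> \<le> max (rv g x - rv g y) 0 * D" using D0 by (intro mult_right_mono) auto
      finally show ?thesis using d D0 by (simp add: divide_simps mult.commute)
    qed
    hence "ennreal (a / D) \<le> e2ennreal (max (- (g y - g x)) 0 / ereal (dist y x))"
      unfolding eq by (metis e2ennreal_ereal ennreal_leI)
    moreover have "dist y x < \<delta>" using y(2) t(3) by linarith
    ultimately show False using \<delta>(2)[OF yx] by (meson leD)
  qed
qed

section \<open>Gamma-convergence and slopes\<close>

text \<open>
  \<open>\<Gamma>\<close>-convergence along a filter. The lower bound is stated on balls instead of converging families,
  so that it clearly passes to finer filters, and hence holds along the filters provided by
  compactness.
\<close>
definition gamma_along :: "'i filter \<Rightarrow> ('i \<Rightarrow> 'a::metric_space \<Rightarrow> ereal) \<Rightarrow> ('a \<Rightarrow> ereal) \<Rightarrow> bool" where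
  "gamma_along F gn f \<longleftrightarrow>
     (\<forall>x c. c < f x \<longrightarrow> (\<exists>\<delta>>0. \<forall>\<^sub>F n in F. \<forall>z\<in>ball x \<delta>. c < gn n z)) \<and>
     (\<forall>y\<in>eff_dom f. \<exists>yn. (yn \<longlongrightarrow> y) F \<and> (\<forall>e>0. \<forall>\<^sub>F n in F. gn n (yn n) \<le> f y + ereal e))"

lemma gamma_along_mono: "gamma_along F gn f \<Longrightarrow> G \<le> F \<Longrightarrow> gamma_along G gn f"
  unfolding gamma_along_def
  by (elim conjE, intro conjI allI impI ballI)
     (blast dest: filter_leD, (drule (1) bspec, elim exE conjE, intro exI conjI, erule (1) tendsto_mono[rotated], blast dest: filter_leD))

lemma gamma_along_liminf:
  assumes "gamma_along F gn f" "(xn \<longlongrightarrow> x) F" "c < f x"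
  shows "\<forall>\<^sub>F n in F. c < gn n (xn n)"
proof -
  obtain \<delta> where d: "\<delta> > 0" "\<forall>\<^sub>F n in F. \<forall>z\<in>ball x \<delta>. c < gn n z"
    using assms unfolding gamma_along_def by blast
  have "\<forall>\<^sub>F n in F. dist (xn n) x < \<delta>" using assms(2) d(1) by (rule tendstoD)
  with d(2) show ?thesis by eventually_elim (simp add: dist_commute)
qed

text \<open>
  For a constant family this is lower semicontinuity; statements about families thereby also cover
  limits within one function.
\<close>
lemma gamma_along_const:
  fixes g :: "'a::metric_space \<Rightarrow> ereal"
  assumes "lsc g"
  shows "gamma_along F (\<lambda>_. g) g"
  unfolding gamma_along_def
proof (intro conjI allI impI ballI)
  fix x c assume "c < g x"
  moreover have "g x \<le> Liminf (at x) g" using assms by (simp add: lsc_def)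
  ultimately have "\<forall>\<^sub>F y in at x. c < g y" by (metis le_Liminf_iff)
  then obtain d where "d > 0" "\<And>y. y \<noteq> x \<Longrightarrow> dist y x < d \<Longrightarrow> c < g y" unfolding eventually_at by blast
  note d = this
  have "\<forall>z\<in>ball x d. c < g z"
  proof
    fix z assume "z \<in> ball x d"
    thus "c < g z" using d(2)[of z] \<open>c < g x\<close> by (cases "z = x") (auto simp: dist_commute)
  qed
  thus "\<exists>\<delta>>0. \<forall>\<^sub>F n in F. \<forall>z\<in>ball x \<delta>. c < g z"
    using d(1) by (intro exI[of _ d]) simp
next
  fix y assume "y \<in> eff_dom g"
  show "\<exists>yn. (yn \<longlongrightarrow> y) F \<and> (\<forall>e>0. \<forall>\<^sub>F n in F. g (yn n) \<le> g y + ereal e)"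
  proof (intro exI[of _ "\<lambda>_. y"] conjI allI impI)
    fix e :: real assume "e > 0"
    thus "\<forall>\<^sub>F n in F. g y \<le> g y + ereal e" by (cases "g y") auto
  qed simp
qed

text \<open>
  If the lower bound fails on every ball, there are violating points \<open>z k\<close> with indices \<open>hk k\<close> that
  increase and \<open>z k \<longlonglongrightarrow> x\<close>. Filling the other indices with \<open>x\<close> gives a full sequence, to which the
  sequential lower bound applies.
\<close>
lemma Gamma_converges_imp_gamma_along:
  fixes f :: "'a::metric_space \<Rightarrow> ereal"
  assumes G: "Gamma_converges euclidean_metric fh f" and ni: "\<forall>x. f x \<noteq> -\<infinity>"
  shows "gamma_along sequentially fh f"
  unfolding gamma_along_def
proof (intro conjI allI impI ballI)
  have lim: "f y \<le> liminf (\<lambda>h. fh h (yh h))" if "yh \<longlonglongrightarrow> y" for y yh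
    using G that unfolding Gamma_converges_def by simp
  have rec: "\<exists>yh. yh \<longlonglongrightarrow> y \<and> limsup (\<lambda>h. fh h (yh h)) \<le> f y" for y
    using G unfolding Gamma_converges_def by simp
  {
    fix x c assume c: "c < f x"
    show "\<exists>\<delta>>0. \<forall>\<^sub>F n in sequentially. \<forall>z\<in>ball x \<delta>. c < fh n z"
    proof (rule ccontr)
      assume "\<not> ?thesis"
      hence neg: "\<exists>n\<ge>N. \<exists>z\<in>ball x \<delta>. fh n z \<le> c" if "\<delta> > 0" for \<delta> N
        using that unfolding eventually_sequentially by (meson not_less)
      have "\<exists>hk :: nat \<Rightarrow> nat. \<forall>k. (\<exists>z\<in>ball x (1 / real (Suc k)). fh (hk k) z \<le> c) \<and> hk k < hk (Suc k)"
      proof (rule dependent_nat_choice)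
        show "\<exists>n. \<exists>z\<in>ball x (1 / real (Suc 0)). fh n z \<le> c" using neg[of 1 0] by auto
        fix h k
        show "\<exists>y. (\<exists>z\<in>ball x (1 / real (Suc (Suc k))). fh y z \<le> c) \<and> h < y"
          using neg[of "1 / real (Suc (Suc k))" "Suc h"] by (auto simp: Suc_le_eq)
      qed
      then obtain hk z where hz: "\<And>k. z k \<in> ball x (1 / real (Suc k))" "\<And>k. fh (hk k) (z k) \<le> c"
        "\<And>k. hk k < hk (Suc k)" by metis
      have sm: "strict_mono hk" using hz(3) by (simp add: strict_mono_Suc_iff)
      hence inj: "inj hk" by (rule strict_mono_imp_inj_on)
      \<comment> \<open>The violating points, with gaps in the sequence of indices filled by \<open>x\<close>.\<close>
      define y where "y n = (if n \<in> range hk then z (the_inv hk n) else x)" for n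
      have y: "y (hk k) = z k" for k using inj by (simp add: y_def the_inv_f_f)
      have "y \<longlonglongrightarrow> x"
      proof (rule tendstoI)
        fix e :: real assume "e > 0"
        then obtain k where k: "1 / real (Suc k) < e" using nat_approx_posE by metis
        have "dist (y n) x < e" if n: "n \<ge> hk k" for n
        proof (cases "n \<in> range hk")
          case True
          then obtain j where j: "n = hk j" by blast
          have "k \<le> j" using n j sm by (simp add: strict_mono_less_eq)
          hence "1 / real (Suc j) \<le> 1 / real (Suc k)" by (intro divide_left_mono) auto
          thus ?thesis using hz(1)[of j] k j y by (simp add: dist_commute)
        qed (use \<open>e > 0\<close> in \<open>simp add: y_def\<close>)
        thus "\<forall>\<^sub>F n in sequentially. dist (y n) x < e" unfolding eventually_sequentially by blast
      qed
      hence "c < liminf (\<lambda>h. fh h (y h))" using lim c by (meson less_le_trans)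
      hence "\<forall>\<^sub>F h in sequentially. c < fh h (y h)" by (rule less_LiminfD)
      then obtain N where N: "\<And>h. h \<ge> N \<Longrightarrow> c < fh h (y h)" unfolding eventually_sequentially by blast
      have "hk N \<ge> N" using sm by (rule strict_mono_imp_increasing)
      hence "c < fh (hk N) (y (hk N))" by (rule N)
      thus False using hz(2)[of N] y by simp
    qed
  }
  fix y assume yD: "y \<in> eff_dom f"
  obtain yh where yh: "yh \<longlonglongrightarrow> y" "limsup (\<lambda>h. fh h (yh h)) \<le> f y" using rec by blast
  have "\<forall>\<^sub>F n in sequentially. fh n (yh n) \<le> f y + ereal e" if "e > 0" for e
  proof -
    have fy: "f y = ereal (rv f y)" by (rule eff_dom_real'[OF ni yD])
    have "f y < f y + ereal e" by (subst (1 2) fy) (simp add: that)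
    with yh(2) have "limsup (\<lambda>h. fh h (yh h)) < f y + ereal e" by simp
    from Limsup_lessD[OF this] show ?thesis by eventually_elim simp
  qed
  thus "\<exists>yn. yn \<longlonglongrightarrow> y \<and> (\<forall>e>0. \<forall>\<^sub>F n in sequentially. fh n (yn n) \<le> f y + ereal e)"
    using yh(1) by blast
qed

text \<open>
  In the inequality at \<open>x\<close> and \<open>y\<close>, the energy at \<open>x\<close> is bounded below along any sequence and the energy at
  \<open>y\<close> above along a recovery sequence, which are the two halves of \<open>\<Gamma>\<close>-convergence. Finiteness at the
  limit point is part of the conclusion, and the number \<open>c\<close> below \<open>f x\<close> stands in for its value until
  it is known.
\<close>
lemma gamma_along_slope_le:
  assumes ga: "gamma_along F gn f" and F: "F \<noteq> bot" and ni: "\<forall>x. f x \<noteq> -\<infinity>" "\<forall>n x. gn n x \<noteq> -\<infinity>"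
    and ne: "eff_dom f \<noteq> {}" and x: "(xn \<longlongrightarrow> x) F" and M: "(Mn \<longlongrightarrow> M) F"
    and sl: "\<forall>\<^sub>F n in F. slope_le K (gn n) (Mn n) (xn n)"
  shows "slope_le K f M x"
proof -
  have key: "c - rv f y \<le> M * dist x y + K / 2 * (dist x y)\<^sup>2" if c: "ereal c < f x" and y: "y \<in> eff_dom f" for c y
  proof -
    obtain yn where yn: "(yn \<longlongrightarrow> y) F" "\<And>e. e > 0 \<Longrightarrow> \<forall>\<^sub>F n in F. gn n (yn n) \<le> f y + ereal e"
      using ga y unfolding gamma_along_def by meson
    have fy: "f y = ereal (rv f y)" by (rule eff_dom_real'[OF ni(1) y])
    have "c - rv f y \<le> M * dist x y + K / 2 * (dist x y)\<^sup>2 + e" if e: "e > 0" for e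
    proof -
      have "\<forall>\<^sub>F n in F. c - rv f y - e \<le> Mn n * dist (xn n) (yn n) + K / 2 * (dist (xn n) (yn n))\<^sup>2"
        using gamma_along_liminf[OF ga x c] yn(2)[OF e] sl
      proof eventually_elim
        case (elim n)
        have y': "yn n \<in> eff_dom (gn n)" using elim(2) fy by (auto simp: eff_dom_def)
        have x': "xn n \<in> eff_dom (gn n)" by (rule slope_le_dom[OF elim(3)])
        have "gn n (yn n) = ereal (rv (gn n) (yn n))" "gn n (xn n) = ereal (rv (gn n) (xn n))"
          using eff_dom_real[OF y'] eff_dom_real[OF x'] ni(2) by blast+
        hence "c < rv (gn n) (xn n)" "rv (gn n) (yn n) \<le> rv f y + e" using elim fy
          by (metis ereal_less_eq(3) less_ereal.simps(1), metis ereal_less_eq(3) plus_ereal.simps(1))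
        thus ?case using slope_leD[OF elim(3) y'] by linarith
      qed
      moreover have "((\<lambda>n. Mn n * dist (xn n) (yn n) + K / 2 * (dist (xn n) (yn n))\<^sup>2) \<longlongrightarrow> M * dist x y + K / 2 * (dist x y)\<^sup>2) F"
        by (intro tendsto_intros x M yn(1))
      ultimately have "c - rv f y - e \<le> M * dist x y + K / 2 * (dist x y)\<^sup>2"
        using F by (intro tendsto_lowerbound)
      thus ?thesis by linarith
    qed
    thus ?thesis by (rule field_le_epsilon)
  qed
  obtain y0 where y0: "y0 \<in> eff_dom f" using ne by blast
  \<comment> \<open>An infinite value would allow arbitrarily large \<open>c\<close> in \<open>key\<close>.\<close>
  have fx: "f x \<noteq> \<infinity>"
  proof
    assume "f x = \<infinity>"
    hence "(rv f y0 + M * dist x y0 + K / 2 * (dist x y0)\<^sup>2 + 1) - rv f y0 \<le> M * dist x y0 + K / 2 * (dist x y0)\<^sup>2"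
      using y0 by (intro key) auto
    thus False by simp
  qed
  hence xD: "x \<in> eff_dom f" by (auto simp: eff_dom_def)
  have fx': "f x = ereal (rv f x)" by (rule eff_dom_real'[OF ni(1) xD])
  show ?thesis unfolding slope_le_def
  proof (intro conjI xD ballI)
    fix y assume y: "y \<in> eff_dom f"
    show "rv f x - rv f y \<le> M * dist x y + K / 2 * (dist x y)\<^sup>2"
    proof (rule field_le_epsilon)
      fix e :: real assume "e > 0"
      hence "ereal (rv f x - e) < f x" by (subst fx') simp
      from key[OF this y] show "rv f x - rv f y \<le> M * dist x y + K / 2 * (dist x y)\<^sup>2 + e" by linarith
    qed
  qed
qed

lemma slope_le_limit:
  assumes F: "F \<noteq> bot" and l: "lsc g" and ni: "\<forall>x. g x \<noteq> -\<infinity>" and ne: "eff_dom g \<noteq> {}"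
    and "(xn \<longlongrightarrow> x) F" "(Mn \<longlongrightarrow> M) F" "\<forall>\<^sub>F n in F. slope_le K g (Mn n) (xn n)"
  shows "slope_le K g M x"
proof (rule gamma_along_slope_le[OF gamma_along_const[OF l] F ni _ ne assms(5,6,7)])
  show "\<forall>n x. g x \<noteq> -\<infinity>" using ni by simp
qed

lemma ennreal_liminf_sum_le:
  fixes u v :: "nat \<Rightarrow> ennreal"
  assumes "A \<le> liminf u" "B \<le> liminf v" "\<And>n. u n + v n \<le> E"
  shows "A + B \<le> E"
proof -
  have inc: "incseq (\<lambda>n. INF m\<in>{n..}. w m)" for w :: "nat \<Rightarrow> ennreal"
    by (intro incseq_SucI INF_superset_mono) auto
  have "A + B \<le> (SUP n. INF m\<in>{n..}. u m) + (SUP n. INF m\<in>{n..}. v m)"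
    using assms(1,2) unfolding liminf_SUP_INF by (rule add_mono)
  also have "\<dots> = (SUP n. (INF m\<in>{n..}. u m) + (INF m\<in>{n..}. v m))"
    by (rule ennreal_SUP_add[symmetric, OF inc inc])
  also have "\<dots> \<le> E"
  proof (rule SUP_least)
    fix n :: nat
    have "(INF m\<in>{n..}. u m) + (INF m\<in>{n..}. v m) \<le> u n + v n"
      by (intro add_mono INF_lower) auto
    also have "\<dots> \<le> E" by (rule assms(3))
    finally show "(INF m\<in>{n..}. u m) + (INF m\<in>{n..}. v m) \<le> E" .
  qed
  finally show ?thesis .
qed

lemma descending_slope_le_iff:
  fixes x :: "'a::metric_space"
  assumes cv: "real_convexity K g" and K: "K > 0" and M: "M \<ge> 0"
    and iso: "\<And>x::'a. open {x} \<Longrightarrow> UNIV = {x}"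
  shows "descending_slope g x \<le> ennreal M \<longleftrightarrow> slope_le K g M x"
proof
  have ni: "\<forall>x. g x \<noteq> -\<infinity>" using cv by (simp add: real_convexity_def)
  show "slope_le K g M x \<Longrightarrow> descending_slope g x \<le> ennreal M"
    using slope_le_imp_descending_slope_le[OF _ M _ ni] K by simp
  show "descending_slope g x \<le> ennreal M \<Longrightarrow> slope_le K g M x"
    by (rule descending_slope_le_imp_slope_le[OF cv K M iso])
qed

text \<open>
  The sublevel sets of the slope are closed, by \<open>slope_le_limit\<close>.
\<close>
lemma descending_slope_measurable:
  fixes g :: "'a::metric_space \<Rightarrow> ereal"
  assumes cv: "real_convexity K g" and K: "K > 0" and l: "lsc g"
    and iso: "\<And>x::'a. open {x} \<Longrightarrow> UNIV = {x}"
  shows "descending_slope g \<in> borel_measurable borel"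
proof (rule borel_measurableI_le)
  have ni: "\<forall>x. g x \<noteq> -\<infinity>" using cv by (simp add: real_convexity_def)
  fix y :: ennreal
  show "{x \<in> space borel. descending_slope g x \<le> y} \<in> sets borel"
  proof (cases y)
    case (real M)
    have "closed {x. slope_le K g M x}"
      unfolding closed_sequential_limits
    proof (intro allI impI, elim conjE)
      fix xn :: "nat \<Rightarrow> 'a" and x
      assume xn: "\<forall>n. xn n \<in> {x. slope_le K g M x}" and x: "xn \<longlonglongrightarrow> x"
      have "xn 0 \<in> eff_dom g" using xn slope_le_dom by blast
      hence ne: "eff_dom g \<noteq> {}" by blast
      have "slope_le K g M x"
        by (rule slope_le_limit[OF sequentially_bot l ni ne x tendsto_const]) (use xn in auto)
      thus "x \<in> {x. slope_le K g M x}" by simp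
    qed
    moreover have "{x \<in> space borel. descending_slope g x \<le> y} = {x. slope_le K g M x}"
      using descending_slope_le_iff[OF cv K _ iso] real by simp
    ultimately show ?thesis by simp
  next
    case top
    thus ?thesis by simp
  qed
qed

text \<open>
  Otherwise the slopes are below some \<open>y\<close> smaller than the slope of \<open>f\<close> for infinitely many indices. The
  filter of these indices carries the bound \<open>y\<close> to the limit.
\<close>
lemma descending_slope_liminf:
  fixes f :: "'a::metric_space \<Rightarrow> ereal"
  assumes ga: "gamma_along sequentially gn f" and cvn: "\<And>n. real_convexity K (gn n)" and cv: "real_convexity K f"
    and K: "K > 0" and ne: "eff_dom f \<noteq> {}" and iso: "\<And>x::'a. open {x} \<Longrightarrow> UNIV = {x}"
    and x: "xn \<longlonglongrightarrow> x"
  shows "descending_slope f x \<le> liminf (\<lambda>n. descending_slope (gn n) (xn n))"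
proof (rule ccontr)
  assume "\<not> ?thesis"
  hence "liminf (\<lambda>n. descending_slope (gn n) (xn n)) < descending_slope f x" by simp
  then obtain y where y: "liminf (\<lambda>n. descending_slope (gn n) (xn n)) < y" "y < descending_slope f x"
    using dense by blast
  obtain M where M: "y = ennreal M" "M \<ge> 0" using y(2) by (cases y) auto
  define F where "F = inf sequentially (principal {n. descending_slope (gn n) (xn n) < y})"
  have F: "F \<noteq> bot"
  proof
    assume "F = bot"
    hence "eventually (\<lambda>_. False) F" by simp
    hence "eventually (\<lambda>n. y \<le> descending_slope (gn n) (xn n)) sequentially"
      unfolding F_def eventually_inf_principal by (auto elim: eventually_mono simp: not_less)
    hence "y \<le> liminf (\<lambda>n. descending_slope (gn n) (xn n))" by (rule Liminf_bounded)
    thus False using y(1) by simp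
  qed
  have le: "F \<le> sequentially" by (simp add: F_def)
  have ni: "\<forall>x. f x \<noteq> -\<infinity>" "\<forall>n x. gn n x \<noteq> -\<infinity>" using cv cvn by (auto simp: real_convexity_def)
  have "slope_le K f M x"
  proof (rule gamma_along_slope_le[OF gamma_along_mono[OF ga le] F ni ne tendsto_mono[OF le x] tendsto_const])
    have "eventually (\<lambda>n. descending_slope (gn n) (xn n) < y) F"
      unfolding F_def eventually_inf_principal by simp
    thus "\<forall>\<^sub>F n in F. slope_le K (gn n) M (xn n)"
    proof eventually_elim
      fix n assume "descending_slope (gn n) (xn n) < y"
      hence "descending_slope (gn n) (xn n) \<le> ennreal M" using M by simp
      thus "slope_le K (gn n) M (xn n)" using descending_slope_le_iff[OF cvn K M(2) iso] by blast
    qed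
  qed
  hence "descending_slope f x \<le> ennreal M" using descending_slope_le_iff[OF cv K M(2) iso] by blast
  thus False using y(2) M by simp
qed

lemma gamma_along_subseq:
  assumes ga: "gamma_along sequentially gn f" and r: "strict_mono r"
  shows "gamma_along sequentially (\<lambda>k. gn (r k)) f"
  unfolding gamma_along_def
proof (intro conjI allI impI ballI)
  fix x c assume "c < f x"
  then obtain \<delta> where "\<delta> > 0" "\<forall>\<^sub>F n in sequentially. \<forall>z\<in>ball x \<delta>. c < gn n z"
    using ga unfolding gamma_along_def by blast
  thus "\<exists>\<delta>>0. \<forall>\<^sub>F k in sequentially. \<forall>z\<in>ball x \<delta>. c < gn (r k) z"
    using eventually_subseq[OF r] by blast
next
  fix y assume "y \<in> eff_dom f"
  with ga have "\<exists>yn. yn \<longlonglongrightarrow> y \<and> (\<forall>e>0. \<forall>\<^sub>F n in sequentially. gn n (yn n) \<le> f y + ereal e)"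
    unfolding gamma_along_def by blast
  then obtain yn where yn: "yn \<longlonglongrightarrow> y" "\<forall>e>0. \<forall>\<^sub>F n in sequentially. gn n (yn n) \<le> f y + ereal e" by blast
  show "\<exists>yn. yn \<longlonglongrightarrow> y \<and> (\<forall>e>0. \<forall>\<^sub>F k in sequentially. gn (r k) (yn k) \<le> f y + ereal e)"
  proof (intro exI[of _ "yn \<circ> r"] conjI allI impI)
    show "(yn \<circ> r) \<longlonglongrightarrow> y" by (rule LIMSEQ_subseq_LIMSEQ[OF yn(1) r])
    fix e :: real assume "e > 0"
    hence "\<forall>\<^sub>F n in sequentially. gn n (yn n) \<le> f y + ereal e" using yn(2) by blast
    from eventually_subseq[OF r this]
    show "\<forall>\<^sub>F k in sequentially. gn (r k) ((yn \<circ> r) k) \<le> f y + ereal e" by simp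
  qed
qed

section \<open>The lower bound for the functionals\<close>

definition slope_energy :: "('a::metric_space \<Rightarrow> ereal) \<Rightarrow> (real \<Rightarrow> 'a) \<Rightarrow> ennreal" where
  "slope_energy g c = (\<integral>\<^sup>+t\<in>{0..1}. (descending_slope g (c t))\<^sup>2 \<partial>lborel)"

lemma slope_clamp_measurable:
  assumes "descending_slope g \<in> borel_measurable borel" "continuous_on UNIV (\<lambda>t. c (clamp01 t))"
  shows "(\<lambda>t. descending_slope g (c (clamp01 t))) \<in> borel_measurable borel"
  using measurable_compose[OF borel_measurable_continuous_onI[OF assms(2)] assms(1)] .

lemma slope_energy_clamp:
  "slope_energy g c = (\<integral>\<^sup>+t\<in>{0..1}. (descending_slope g (c (clamp01 t)))\<^sup>2 \<partial>lborel)"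
  unfolding slope_energy_def by (intro nn_integral_cong) (auto simp: indicator_def clamp01_id)

text \<open>
  Separating the two terms of the integrand requires measurability, which holds after replacing the
  metric derivative by the measurable function \<open>w\<close> that agrees with it almost everywhere.
\<close>
lemma Theta_eq:
  assumes ac: "abs_cont_curve c" and ends: "c 0 = a" "c 1 = b"
    and sm: "descending_slope g \<in> borel_measurable borel"
  shows "Theta g a b c = kinetic c + slope_energy g c"
proof -
  note [measurable] = slope_clamp_measurable[OF sm abs_cont_curve_continuous[OF ac]]
  obtain w :: "real \<Rightarrow> real" where w: "w \<in> borel_measurable borel" "\<And>t. 0 \<le> w t"
    "majorant (\<lambda>t. ennreal (w t)) c" "(\<integral>\<^sup>+t. ennreal (w t) \<partial>lborel) < \<infinity>" and
    wae: "AE t in lborel. t \<in> {0<..<1} \<longrightarrow> metric_derivative c t = w t" and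
    wk: "kinetic c = (\<integral>\<^sup>+t\<in>{0..1}. (ennreal (w t))\<^sup>2 \<partial>lborel)"
    by (fact speed_majorant[OF ac])
  note [measurable] = w(1)
  have "Theta g a b c = (\<integral>\<^sup>+t. (ennreal (w t))\<^sup>2 * indicator {0..1} t + (descending_slope g (c (clamp01 t)))\<^sup>2 * indicator {0..1} t \<partial>lborel)"
    unfolding Theta_def if_P[OF conjI[OF ac conjI[OF ends]]]
  proof (rule nn_integral_cong_AE)
    show "AE t in lborel. (ennreal ((metric_derivative c t)\<^sup>2) + (descending_slope g (c t))\<^sup>2) * indicator {0..1} t =
       (ennreal (w t))\<^sup>2 * indicator {0..1} t + (descending_slope g (c (clamp01 t)))\<^sup>2 * indicator {0..1} t"
      using wae AE_lborel_neq[of 0] AE_lborel_neq[of 1]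
      by eventually_elim (use w(2) in \<open>auto simp: indicator_def ennreal_power clamp01_id\<close>)
  qed
  also have "\<dots> = kinetic c + slope_energy g c"
    unfolding wk slope_energy_clamp by (intro nn_integral_add) measurable
  finally show ?thesis .
qed

text \<open>
  Bounded functionals rather than a lower limit are assumed: every curve of the sequence is then
  absolutely continuous, and the general case follows on a subsequence.
\<close>
lemma Theta_lower_bound:
  fixes f :: "'a::metric_space \<Rightarrow> ereal"
  assumes ga: "gamma_along sequentially gn f" and cvn: "\<And>n. real_convexity K (gn n)" and cv: "real_convexity K f"
    and K: "K > 0" and ln: "\<And>n. lsc (gn n)" and l: "lsc f" and ne: "eff_dom f \<noteq> {}"
    and iso: "\<And>x::'a. open {x} \<Longrightarrow> UNIV = {x}"
    and a: "an \<longlonglongrightarrow> a" and b: "bn \<longlonglongrightarrow> b" and c: "\<And>t. t \<in> {0..1} \<Longrightarrow> (\<lambda>n. cn n t) \<longlonglongrightarrow> c t"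
    and E: "\<And>n. Theta (gn n) (an n) (bn n) (cn n) \<le> ennreal E"
  shows "Theta f a b c \<le> ennreal E"
proof -
  have ac: "abs_cont_curve (cn n)" "cn n 0 = an n" "cn n 1 = bn n" for n
    using E[of n] unfolding Theta_def by (auto simp: top_unique split: if_splits)
  note smn = descending_slope_measurable[OF cvn K ln iso]
  have sum: "kinetic (cn n) + slope_energy (gn n) (cn n) \<le> ennreal E" for n
    using E[of n] Theta_eq[OF ac smn] by simp
  have kin: "kinetic (cn n) \<le> ennreal E" for n
    by (rule order_trans[OF _ sum[of n]]) simp
  have acc: "abs_cont_curve c" by (rule abs_cont_curve_limit[OF ac(1) kin c])
  have "c 0 = a" using LIMSEQ_unique[OF c[of 0]] a ac(2) by simp
  moreover have "c 1 = b" using LIMSEQ_unique[OF c[of 1]] b ac(3) by simp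
  moreover have sm: "descending_slope f \<in> borel_measurable borel" by (rule descending_slope_measurable[OF cv K l iso])
  ultimately have "Theta f a b c = kinetic c + slope_energy f c" using acc by (intro Theta_eq)
  also have "\<dots> \<le> ennreal E"
  proof (rule ennreal_liminf_sum_le[OF kinetic_lsc[OF ac(1) acc c] _ sum])
    have [measurable]: "(\<lambda>t. descending_slope (gn n) (cn n (clamp01 t))) \<in> borel_measurable borel" for n
      by (rule slope_clamp_measurable[OF smn abs_cont_curve_continuous[OF ac(1)]])
    have "slope_energy f c \<le> (\<integral>\<^sup>+t. liminf (\<lambda>n. (descending_slope (gn n) (cn n (clamp01 t)))\<^sup>2 * indicator {0..1} t) \<partial>lborel)"
      unfolding slope_energy_clamp
    proof (rule nn_integral_mono)
      fix t :: real
      have "descending_slope f (c (clamp01 t)) \<le> liminf (\<lambda>n. descending_slope (gn n) (cn n (clamp01 t)))"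
        by (rule descending_slope_liminf[OF ga cvn cv K ne iso c]) auto
      hence "(descending_slope f (c (clamp01 t)))\<^sup>2 \<le> (liminf (\<lambda>n. descending_slope (gn n) (cn n (clamp01 t))))\<^sup>2"
        by (intro power_mono) auto
      also have "\<dots> = liminf (\<lambda>n. (descending_slope (gn n) (cn n (clamp01 t)))\<^sup>2)"
      proof (rule Liminf_compose_continuous_mono[symmetric])
        show "continuous_on UNIV (\<lambda>x::ennreal. x\<^sup>2)"
          unfolding power2_eq_square continuous_on_def
          by (intro ballI tendsto_mult_ennreal tendsto_ident_at) auto
        show "mono (\<lambda>x::ennreal. x\<^sup>2)" by (intro monoI power_mono) auto
      qed auto
      finally show "(descending_slope f (c (clamp01 t)))\<^sup>2 * indicator {0..1} t \<le>
          liminf (\<lambda>n. (descending_slope (gn n) (cn n (clamp01 t)))\<^sup>2 * indicator {0..1} t)"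
        by (cases "t \<in> {0..1}") auto
    qed
    also have "\<dots> \<le> liminf (\<lambda>n. slope_energy (gn n) (cn n))"
      unfolding slope_energy_clamp by (rule nn_integral_liminf) measurable
    finally show "slope_energy f c \<le> liminf (\<lambda>n. slope_energy (gn n) (cn n))" .
  qed
  finally show ?thesis .
qed

section \<open>Resolvents of semiconvex functions\<close>

text \<open>
  Here \<open>A\<close> and \<open>B\<close> are the distances of \<open>x\<close> from \<open>J\<^sub>t x\<close> and \<open>J\<^sub>s x\<close>, and \<open>D\<close> is the distance of these
  two points. The hypothesis on \<open>D\<^sup>2\<close> comes from the variational inequalities of the two resolvents;
  factoring \<open>A\<^sup>2 - B\<^sup>2\<close> and using \<open>A - B \<le> D\<close> makes the estimate linear in \<open>D\<close>.
\<close>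
lemma descent_arithmetic:
  fixes K \<tau> s t A B D C q :: real
  assumes st: "0 < s" "s < t" "t \<le> \<tau>" and D: "0 \<le> D" and K: "0 \<le> K" and q: "q = 1 - K * \<tau>" "0 < q"
    and AB: "0 \<le> A" "0 \<le> B" "A \<le> B + D" "A \<le> t * C" "B \<le> s * C"
    and main: "(t * (1 - K * s) + s * (1 - K * t)) * D\<^sup>2 \<le> (t - s) * (A\<^sup>2 - B\<^sup>2)"
  shows "D \<le> C / q * (t - s)"
proof (cases "D = 0")
  case True
  have "0 \<le> C" using AB(1,4) st by (smt (verit) mult_neg_pos mult.commute)
  thus ?thesis using True st q by simp
next
  case False
  hence D0: "D > 0" using D by simp
  have "q * (t + s) \<le> t * (1 - K * s) + s * (1 - K * t)"
  proof -
    have "K * (s * t) \<le> K * (s * \<tau>)" "K * (s * t) \<le> K * (\<tau> * t)"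
      using st K by (intro mult_left_mono mult_right_mono; simp)+
    thus ?thesis unfolding q(1) by (simp add: algebra_simps)
  qed
  hence "q * (t + s) * D\<^sup>2 \<le> (t * (1 - K * s) + s * (1 - K * t)) * D\<^sup>2" by (intro mult_right_mono) auto
  also note main
  also have "(t - s) * (A\<^sup>2 - B\<^sup>2) = (t - s) * ((A - B) * (A + B))" by (simp add: power2_eq_square algebra_simps)
  also have "\<dots> \<le> (t - s) * (D * (C * (t + s)))"
  proof -
    have "(A - B) * (A + B) \<le> D * (A + B)" using AB by (intro mult_right_mono) auto
    also have "\<dots> \<le> D * (C * (t + s))" using AB D by (intro mult_left_mono) (auto simp: algebra_simps)
    finally show ?thesis using st by (intro mult_left_mono) auto
  qed
  finally have "(D * (t + s)) * (q * D) \<le> (D * (t + s)) * ((t - s) * C)"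
    by (simp add: power2_eq_square ac_simps)
  hence "q * D \<le> (t - s) * C" using D0 st by (subst (asm) mult_le_cancel_left_pos) auto
  thus ?thesis using q(2) by (simp add: field_simps)
qed

text \<open>
  A curve from \<open>x\<close> to \<open>y\<close> in time \<open>T\<close> whose speed and slope are both at most \<open>C\<close>. Gradient flow curves
  are of this kind, since their speed equals the slope.
\<close>
definition reach :: "real \<Rightarrow> ('a::metric_space \<Rightarrow> ereal) \<Rightarrow> real \<Rightarrow> real \<Rightarrow> 'a \<Rightarrow> 'a \<Rightarrow> bool" where
  "reach K g C T x y \<longleftrightarrow> (\<exists>c. c 0 = x \<and> c T = y \<and>
     (\<forall>s\<in>{0..T}. \<forall>t\<in>{0..T}. s \<le> t \<longrightarrow> dist (c s) (c t) \<le> C * (t - s)) \<and> (\<forall>s\<in>{0..T}. slope_le K g C (c s)))"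

lemma reachI:
  assumes "c 0 = x" "c T = y" "\<And>s t. 0 \<le> s \<Longrightarrow> s \<le> t \<Longrightarrow> t \<le> T \<Longrightarrow> dist (c s) (c t) \<le> C * (t - s)"
    "\<And>s. 0 \<le> s \<Longrightarrow> s \<le> T \<Longrightarrow> slope_le K g C (c s)"
  shows "reach K g C T x y"
  unfolding reach_def using assms by (intro exI[of _ c]) simp

lemma reachE:
  assumes "reach K g C T x y"
  obtains c where "c 0 = x" "c T = y" "\<And>s t. 0 \<le> s \<Longrightarrow> s \<le> t \<Longrightarrow> t \<le> T \<Longrightarrow> dist (c s) (c t) \<le> C * (t - s)"
    "\<And>s. 0 \<le> s \<Longrightarrow> s \<le> T \<Longrightarrow> slope_le K g C (c s)"
proof -
  from assms[unfolded reach_def] obtain c where c: "c 0 = x \<and> c T = y \<and>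
     (\<forall>s\<in>{0..T}. \<forall>t\<in>{0..T}. s \<le> t \<longrightarrow> dist (c s) (c t) \<le> C * (t - s)) \<and> (\<forall>s\<in>{0..T}. slope_le K g C (c s))"
    by (elim exE)
  show ?thesis by (rule that[of c]) (use c in auto)
qed

lemma reach_mono:
  assumes "reach K g C T x y" "C \<le> C'"
  shows "reach K g C' T x y"
proof -
  obtain c where c: "c 0 = x" "c T = y" "\<And>s t. 0 \<le> s \<Longrightarrow> s \<le> t \<Longrightarrow> t \<le> T \<Longrightarrow> dist (c s) (c t) \<le> C * (t - s)"
    "\<And>s. 0 \<le> s \<Longrightarrow> s \<le> T \<Longrightarrow> slope_le K g C (c s)"
    by (fact reachE[OF assms(1)])
  show ?thesis
  proof (rule reachI[OF c(1,2)])
    fix s t assume st: "0 \<le> s" "s \<le> t" "t \<le> T"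
    have "C * (t - s) \<le> C' * (t - s)" using assms(2) st by (intro mult_right_mono) auto
    thus "dist (c s) (c t) \<le> C' * (t - s)" using c(3)[OF st] by simp
  qed (use c(4) slope_le_mono[OF _ assms(2)] in blast)
qed

lemma reach_trans:
  assumes "reach K g C T x y" "reach K g C T' y z" "0 \<le> T" "0 \<le> T'"
  shows "reach K g C (T + T') x z"
proof -
  obtain c where c: "c 0 = x" "c T = y" "\<And>s t. 0 \<le> s \<Longrightarrow> s \<le> t \<Longrightarrow> t \<le> T \<Longrightarrow> dist (c s) (c t) \<le> C * (t - s)"
    "\<And>s. 0 \<le> s \<Longrightarrow> s \<le> T \<Longrightarrow> slope_le K g C (c s)"
    by (fact reachE[OF assms(1)])
  obtain b where b: "b 0 = y" "b T' = z" "\<And>s t. 0 \<le> s \<Longrightarrow> s \<le> t \<Longrightarrow> t \<le> T' \<Longrightarrow> dist (b s) (b t) \<le> C * (t - s)"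
    "\<And>s. 0 \<le> s \<Longrightarrow> s \<le> T' \<Longrightarrow> slope_le K g C (b s)"
    by (fact reachE[OF assms(2)])
  define a where "a s = (if s \<le> T then c s else b (s - T))" for s
  show ?thesis
  proof (rule reachI[of a])
    show "a 0 = x" using c assms by (simp add: a_def)
    show "a (T + T') = z" using c b assms by (cases "T' = 0") (auto simp: a_def)
    fix s t assume st: "0 \<le> s" "s \<le> t" "t \<le> T + T'"
    consider "t \<le> T" | "s \<le> T" "T < t" | "T < s" by linarith
    thus "dist (a s) (a t) \<le> C * (t - s)"
    proof cases
      case 1
      thus ?thesis using st c(3) by (simp add: a_def)
    next
      case 2
      have "dist (a s) (a t) \<le> dist (c s) (c T) + dist (b 0) (b (t - T))"
        using 2 b(1) c(2) by (simp add: a_def dist_triangle)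
      also have "\<dots> \<le> C * (T - s) + C * (t - T - 0)"
        using 2 st assms by (intro add_mono c(3) b(3)) auto
      finally show ?thesis by (simp add: algebra_simps)
    next
      case 3
      thus ?thesis using st b(3)[of "s - T" "t - T"] by (simp add: a_def)
    qed
  next
    fix s assume "0 \<le> s" "s \<le> T + T'"
    thus "slope_le K g C (a s)" using c(4)[of s] b(4)[of "s - T"] by (auto simp: a_def)
  qed
qed

text \<open>
  A point \<open>p\<close> of bounded slope provides the quadratic lower bound on \<open>g\<close> that the existence of resolvents
  requires. In the application it is the initial point of the curves.
\<close>
locale semiconvex =
  fixes K :: real and g :: "'a::metric_space \<Rightarrow> ereal" and p :: 'a and M0 :: real
  assumes K: "K > 0" and cv: "real_convexity K g" and lsc_g: "lsc g"
    and proper_space: "\<forall>S::'a set. closed S \<and> bounded S \<longrightarrow> compact S"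
    and base: "slope_le K g M0 p" and M0: "M0 \<ge> 0"
begin

lemma ni: "\<forall>x. g x \<noteq> -\<infinity>"
  using cv by (simp add: real_convexity_def)

lemma p_dom: "p \<in> eff_dom g"
  by (rule slope_le_dom[OF base])

lemma dom_nonempty: "eff_dom g \<noteq> {}"
  using p_dom by blast

text \<open>
  The curves are equi-Lipschitz from a common point, so a pointwise cluster curve exists and inherits
  both bounds.
\<close>
lemma reach_limit:
  assumes F: "F \<noteq> bot" and T: "0 \<le> T" and C: "0 \<le> C"
    and r: "\<And>n. reach K g C T x (yn n)" and y: "(yn \<longlongrightarrow> y) F"
  shows "reach K g C T x y"
proof -
  have "\<exists>c. c 0 = x \<and> c T = yn n \<and>
     (\<forall>s\<in>{0..T}. \<forall>t\<in>{0..T}. s \<le> t \<longrightarrow> dist (c s) (c t) \<le> C * (t - s)) \<and> (\<forall>s\<in>{0..T}. slope_le K g C (c s))" for n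
    using r[of n] unfolding reach_def .
  hence "\<exists>c. \<forall>n. c n 0 = x \<and> c n T = yn n \<and>
     (\<forall>s\<in>{0..T}. \<forall>t\<in>{0..T}. s \<le> t \<longrightarrow> dist (c n s) (c n t) \<le> C * (t - s)) \<and> (\<forall>s\<in>{0..T}. slope_le K g C (c n s))"
    by (intro choice allI)
  then obtain c where c: "\<And>n. c n 0 = x" "\<And>n. c n T = yn n"
    "\<And>n s t. s \<in> {0..T} \<Longrightarrow> t \<in> {0..T} \<Longrightarrow> s \<le> t \<Longrightarrow> dist (c n s) (c n t) \<le> C * (t - s)"
    "\<And>n s. s \<in> {0..T} \<Longrightarrow> slope_le K g C (c n s)" by blast
  define cl where "cl s = max 0 (min T s)" for s
  have cl: "cl s \<in> {0..T}" for s using T by (auto simp: cl_def)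
  have cpt: "\<exists>Q. compact Q \<and> (\<forall>n. c n (cl s) \<in> Q)" for s
  proof (intro exI[of _ "cball x (C * T)"] conjI allI)
    show "compact (cball x (C * T))" using proper_space by (simp add: bounded_cball)
    fix n
    have "dist (c n 0) (c n (cl s)) \<le> C * (cl s - 0)" using c(3)[of 0 "cl s" n] cl[of s] T by auto
    also have "\<dots> \<le> C * T" using C cl[of s] by (intro mult_left_mono) auto
    finally show "c n (cl s) \<in> cball x (C * T)" using c(1) by simp
  qed
  obtain G b where G: "G \<le> F" "G \<noteq> bot" and b: "\<And>s. ((\<lambda>n. c n (cl s)) \<longlongrightarrow> b s) G"
    by (fact pointwise_cluster[OF F cpt])
  have cl_id: "cl s = s" if "0 \<le> s" "s \<le> T" for s using that by (simp add: cl_def)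
  show ?thesis
  proof (rule reachI[of b])
    have "((\<lambda>n. x) \<longlongrightarrow> b 0) G" using b[of 0] cl_id[of 0] T c(1) by simp
    thus "b 0 = x" using G(2) by (metis tendsto_const_iff)
    have "(yn \<longlongrightarrow> b T) G" using b[of T] cl_id[of T] T c(2) by simp
    thus "b T = y" using tendsto_unique[OF G(2) _ tendsto_mono[OF G(1) y]] by blast
    fix s t assume st: "0 \<le> s" "s \<le> t" "t \<le> T"
    have ids: "cl s = s" "cl t = t" using st by (auto simp: cl_def)
    show "dist (b s) (b t) \<le> C * (t - s)"
    proof (rule tendsto_upperbound[OF tendsto_dist[OF b b] _ G(2)])
      show "\<forall>\<^sub>F n in G. dist (c n (cl s)) (c n (cl t)) \<le> C * (t - s)"
        unfolding ids using c(3) st by (intro always_eventually allI) auto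
    qed
  next
    fix s assume s: "0 \<le> s" "s \<le> T"
    show "slope_le K g C (b s)"
      by (rule slope_le_limit[OF G(2) lsc_g ni dom_nonempty b tendsto_const])
         (use c(4) cl in \<open>intro always_eventually allI, blast\<close>)
  qed
qed

text \<open>
  The identity at \<open>\<tau> = 0\<close> makes \<open>\<tau> \<mapsto> resolvent \<tau> x\<close> a curve that starts at \<open>x\<close>.
\<close>
definition resolvent :: "real \<Rightarrow> 'a \<Rightarrow> 'a" where
  "resolvent \<tau> x = (if \<tau> = 0 then x else SOME z. z \<in> eff_dom g \<and>
     (\<forall>w\<in>eff_dom g. rv g z + (dist x z)\<^sup>2 / (2 * \<tau>) \<le> rv g w + (dist x w)\<^sup>2 / (2 * \<tau>)))"

lemma lower_bound: "w \<in> eff_dom g \<Longrightarrow> rv g w \<ge> rv g p - M0 * dist p w - K / 2 * (dist p w)\<^sup>2"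
  using slope_leD[OF base] by fastforce

text \<open>
  The direct method. Since \<open>4 * K * \<tau> \<le> 1\<close>, half of the term \<open>(dist x w)\<^sup>2 / (2 * \<tau>)\<close> absorbs the quadratic
  part of the lower bound on \<open>g\<close>; the other half makes the functional coercive.
\<close>
lemma resolvent_exists:
  assumes \<tau>: "0 < \<tau>" "4 * K * \<tau> \<le> 1"
  shows "\<exists>z\<in>eff_dom g. \<forall>w\<in>eff_dom g. rv g z + (dist x z)\<^sup>2 / (2 * \<tau>) \<le> rv g w + (dist x w)\<^sup>2 / (2 * \<tau>)"
proof -
  define \<Phi> where "\<Phi> w = rv g w + (dist x w)\<^sup>2 / (2 * \<tau>)" for w
  define a where "a = dist p x"
  define b where "b = rv g p - M0 * a - K * a\<^sup>2"
  \<comment> \<open>the coercive lower bound with remainder \<open>(dist x w)\<^sup>2 / (4 * \<tau>)\<close>\<close>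
  have low: "\<Phi> w \<ge> b - M0 * dist x w + (dist x w)\<^sup>2 / (4 * \<tau>)" if w: "w \<in> eff_dom g" for w
  proof -
    define s where "s = dist x w"
    have tri: "dist p w \<le> a + s" unfolding a_def s_def by (rule dist_triangle)
    have "(dist p w)\<^sup>2 \<le> (a + s)\<^sup>2" using tri by (intro power_mono) auto
    also have "\<dots> \<le> 2 * a\<^sup>2 + 2 * s\<^sup>2" using sum_squares_bound[of a s] by (simp add: power2_sum)
    finally have "K / 2 * (dist p w)\<^sup>2 \<le> K / 2 * (2 * a\<^sup>2 + 2 * s\<^sup>2)" using K by (intro mult_left_mono) auto
    moreover have "M0 * dist p w \<le> M0 * (a + s)" using tri M0 by (intro mult_left_mono)
    moreover have "K * s\<^sup>2 \<le> s\<^sup>2 / (4 * \<tau>)"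
    proof -
      have "K \<le> 1 / (4 * \<tau>)" using \<tau> by (simp add: field_simps)
      hence "K * s\<^sup>2 \<le> 1 / (4 * \<tau>) * s\<^sup>2" by (intro mult_right_mono) auto
      thus ?thesis by simp
    qed
    moreover have "s\<^sup>2 / (2 * \<tau>) = s\<^sup>2 / (4 * \<tau>) + s\<^sup>2 / (4 * \<tau>)" using \<tau> by (simp add: field_simps)
    moreover have "K / 2 * (2 * a\<^sup>2 + 2 * s\<^sup>2) = K * a\<^sup>2 + K * s\<^sup>2" by (simp add: algebra_simps)
    moreover have "M0 * (a + s) = M0 * a + M0 * s" by (rule distrib_left)
    ultimately show ?thesis using lower_bound[OF w] unfolding \<Phi>_def b_def s_def[symmetric] by linarith
  qed
  have bdd: "bdd_below (\<Phi> ` eff_dom g)"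
  proof (rule bdd_belowI2)
    fix w assume w: "w \<in> eff_dom g"
    define s where "s = dist x w"
    have "0 \<le> (s / (2 * sqrt \<tau>) - M0 * sqrt \<tau>)\<^sup>2" by simp
    also have "\<dots> = s\<^sup>2 / (4 * \<tau>) - M0 * s + M0\<^sup>2 * \<tau>"
      using \<tau> by (simp add: power2_diff power_divide power_mult_distrib)
    finally show "b - M0\<^sup>2 * \<tau> \<le> \<Phi> w" using low[OF w] unfolding s_def[symmetric] by linarith
  qed
  define I where "I = Inf (\<Phi> ` eff_dom g)"
  have I: "I \<le> \<Phi> w" if "w \<in> eff_dom g" for w unfolding I_def using bdd that by (intro cInf_lower) auto
  have "\<exists>w\<in>eff_dom g. \<Phi> w < I + 1 / real (Suc n)" for n
  proof -
    have "Inf (\<Phi> ` eff_dom g) < I + 1 / real (Suc n)" by (simp add: I_def)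
    thus ?thesis using cInf_lessD[of "\<Phi> ` eff_dom g"] dom_nonempty by blast
  qed
  then obtain w where w: "\<And>n. w n \<in> eff_dom g" "\<And>n. \<Phi> (w n) < I + 1 / real (Suc n)" by metis
  define R where "R = max (4 * \<tau> * (M0 + 1)) (I + 1 - b)"
  have "w n \<in> cball x R" for n
  proof -
    define s where "s = dist x (w n)"
    have "1 / real (Suc n) \<le> 1" by simp
    hence 1: "s\<^sup>2 / (4 * \<tau>) - M0 * s \<le> I + 1 - b" using low[OF w(1)[of n]] w(2)[of n] unfolding s_def[symmetric] by linarith
    have "s \<le> R"
    proof (cases "s \<le> 4 * \<tau> * (M0 + 1)")
      case False
      hence "M0 + 1 \<le> s / (4 * \<tau>)" using \<tau> by (simp add: field_simps)
      hence "s * (M0 + 1) \<le> s * (s / (4 * \<tau>))" by (intro mult_left_mono) (auto simp: s_def)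
      hence "s \<le> s\<^sup>2 / (4 * \<tau>) - M0 * s" by (simp add: algebra_simps power2_eq_square)
      thus ?thesis using 1 by (simp add: R_def)
    qed (simp add: R_def)
    thus ?thesis by (simp add: s_def)
  qed
  moreover have "compact (cball x R)" using proper_space by (simp add: bounded_cball)
  ultimately obtain z \<phi> where z: "strict_mono (\<phi> :: nat \<Rightarrow> nat)" "(w \<circ> \<phi>) \<longlonglongrightarrow> z"
    using compact_imp_seq_compact seq_compactE by metis
  \<comment> \<open>Lower semicontinuity along the minimizing sequence, with a number \<open>c\<close> in place of the possibly infinite value \<open>g z\<close>.\<close>
  have key: "c + (dist x z)\<^sup>2 / (2 * \<tau>) \<le> I" if c: "ereal c < g z" for c
  proof -
    have "\<forall>\<^sub>F n in sequentially. ereal c < g ((w \<circ> \<phi>) n)"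
      by (rule gamma_along_liminf[OF gamma_along_const[OF lsc_g] z(2) c])
    hence "\<forall>\<^sub>F n in sequentially. c + (dist x ((w \<circ> \<phi>) n))\<^sup>2 / (2 * \<tau>) \<le> I + 1 / real (Suc n)"
    proof eventually_elim
      fix n assume "ereal c < g ((w \<circ> \<phi>) n)"
      moreover have "g (w (\<phi> n)) = ereal (rv g (w (\<phi> n)))" by (rule eff_dom_real'[OF ni w(1)])
      ultimately have "c < rv g (w (\<phi> n))" by (metis comp_apply less_ereal.simps(1))
      moreover have "1 / real (Suc (\<phi> n)) \<le> 1 / real (Suc n)"
        using seq_suble[OF z(1), of n] by (intro divide_left_mono) auto
      ultimately show "c + (dist x ((w \<circ> \<phi>) n))\<^sup>2 / (2 * \<tau>) \<le> I + 1 / real (Suc n)"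
        using w(2)[of "\<phi> n"] by (simp add: \<Phi>_def)
    qed
    moreover have "(\<lambda>n. I + 1 / real (Suc n)) \<longlonglongrightarrow> I + 0"
      using LIMSEQ_inverse_real_of_nat by (intro tendsto_add tendsto_const) (simp add: inverse_eq_divide)
    moreover have "(\<lambda>n. c + (dist x ((w \<circ> \<phi>) n))\<^sup>2 / (2 * \<tau>)) \<longlonglongrightarrow> c + (dist x z)\<^sup>2 / (2 * \<tau>)"
      using \<tau> by (intro tendsto_intros z(2)) auto
    ultimately show ?thesis using tendsto_le[OF sequentially_bot] by fastforce
  qed
  have "g z \<noteq> \<infinity>"
  proof
    assume "g z = \<infinity>"
    hence "(I + 1 - (dist x z)\<^sup>2 / (2 * \<tau>)) + (dist x z)\<^sup>2 / (2 * \<tau>) \<le> I" by (intro key) auto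
    thus False by simp
  qed
  hence zD: "z \<in> eff_dom g" by (auto simp: eff_dom_def)
  have gz: "g z = ereal (rv g z)" by (rule eff_dom_real'[OF ni zD])
  have "\<Phi> z \<le> I"
  proof (rule field_le_epsilon)
    fix e :: real assume "e > 0"
    hence "ereal (rv g z - e) < g z" by (subst gz) simp
    from key[OF this] show "\<Phi> z \<le> I + e" by (simp add: \<Phi>_def)
  qed
  thus ?thesis using zD I unfolding \<Phi>_def by (intro bexI[of _ z]) (meson order_trans, simp)
qed

lemma resolvent_0 [simp]: "resolvent 0 x = x"
  by (simp add: resolvent_def)

lemma resolvent_min:
  assumes \<tau>: "0 < \<tau>" "4 * K * \<tau> \<le> 1"
  shows "resolvent \<tau> x \<in> eff_dom g"
    "w \<in> eff_dom g \<Longrightarrow> rv g (resolvent \<tau> x) + (dist x (resolvent \<tau> x))\<^sup>2 / (2 * \<tau>) \<le> rv g w + (dist x w)\<^sup>2 / (2 * \<tau>)"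
proof -
  have "\<exists>z. z \<in> eff_dom g \<and>
     (\<forall>w\<in>eff_dom g. rv g z + (dist x z)\<^sup>2 / (2 * \<tau>) \<le> rv g w + (dist x w)\<^sup>2 / (2 * \<tau>))"
    using resolvent_exists[OF \<tau>, of x] by blast
  from someI_ex[OF this] \<tau> show "resolvent \<tau> x \<in> eff_dom g"
    "w \<in> eff_dom g \<Longrightarrow> rv g (resolvent \<tau> x) + (dist x (resolvent \<tau> x))\<^sup>2 / (2 * \<tau>) \<le> rv g w + (dist x w)\<^sup>2 / (2 * \<tau>)"
    unfolding resolvent_def by auto
qed

text \<open>
  Compare the minimizer \<open>z\<close> with the points \<open>\<gamma> t\<close> of the convexity curve from \<open>z\<close> to \<open>w\<close> with base point
  \<open>x\<close>, divide by \<open>t\<close> and let \<open>t\<close> tend to \<open>0\<close>. The base point has to lie in the domain; other points are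
  treated later by approximation.
\<close>
lemma resolvent_EVI:
  assumes \<tau>: "0 < \<tau>" "4 * K * \<tau> \<le> 1" and x: "x \<in> eff_dom g" and w: "w \<in> eff_dom g"
  shows "(1 - K * \<tau>) * (dist (resolvent \<tau> x) w)\<^sup>2 + (dist x (resolvent \<tau> x))\<^sup>2 - (dist x w)\<^sup>2
     \<le> 2 * \<tau> * (rv g w - rv g (resolvent \<tau> x))"
proof -
  define z where "z = resolvent \<tau> x"
  have z: "z \<in> eff_dom g" "\<And>w. w \<in> eff_dom g \<Longrightarrow> rv g z + (dist x z)\<^sup>2 / (2 * \<tau>) \<le> rv g w + (dist x w)\<^sup>2 / (2 * \<tau>)"
    unfolding z_def using resolvent_min[OF \<tau>] by auto
  obtain \<gamma> where \<gamma>: "\<gamma> 0 = z" "\<gamma> 1 = w"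
    "\<And>\<tau> t. 0 < \<tau> \<Longrightarrow> \<tau> * K < 1 \<Longrightarrow> 0 \<le> t \<Longrightarrow> t \<le> 1 \<Longrightarrow> \<gamma> t \<in> eff_dom g"
    "\<And>\<tau> t. 0 < \<tau> \<Longrightarrow> \<tau> * K < 1 \<Longrightarrow> 0 \<le> t \<Longrightarrow> t \<le> 1 \<Longrightarrow>
       rv g (\<gamma> t) + (dist (\<gamma> t) x)\<^sup>2 / (2 * \<tau>) \<le>
         (1 - t) * (rv g z + (dist z x)\<^sup>2 / (2 * \<tau>)) + t * (rv g w + (dist w x)\<^sup>2 / (2 * \<tau>))
         - (1 / \<tau> - K) / 2 * t * (1 - t) * (dist z w)\<^sup>2"
    by (fact real_convexityE[OF cv x z(1) w])
  have "4 * (\<tau> * K) \<le> 1" using \<tau>(2) by (simp add: ac_simps)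
  hence \<tau>K: "\<tau> * K < 1" by linarith
  define A where "A = rv g z + (dist x z)\<^sup>2 / (2 * \<tau>)"
  define B where "B = rv g w + (dist x w)\<^sup>2 / (2 * \<tau>)"
  define c where "c = (1 / \<tau> - K) / 2 * (dist z w)\<^sup>2"
  \<comment> \<open>Minimality gives \<open>t * (A - B + c - t * c) \<le> 0\<close>; a small \<open>t\<close> makes the last term harmless.\<close>
  have "A - B + c \<le> 0 + e" if e: "e > 0" for e
  proof -
    define t where "t = min 1 (e / (\<bar>c\<bar> + 1))"
    have t: "0 < t" "t \<le> 1" using e by (auto simp: t_def)
    have "t * \<bar>c\<bar> \<le> e"
    proof -
      have "t * \<bar>c\<bar> \<le> e / (\<bar>c\<bar> + 1) * \<bar>c\<bar>" by (intro mult_right_mono) (auto simp: t_def)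
      also have "\<dots> \<le> e" using e by (simp add: divide_simps mult_left_mono)
      finally show ?thesis .
    qed
    moreover have "t * c \<le> t * \<bar>c\<bar>" using t by (intro mult_left_mono) auto
    ultimately have tc: "t * c \<le> e" by linarith
    have "A \<le> (1 - t) * A + t * B - t * (1 - t) * c"
    proof -
      have "A \<le> rv g (\<gamma> t) + (dist (\<gamma> t) x)\<^sup>2 / (2 * \<tau>)"
        using z(2)[of "\<gamma> t"] \<gamma>(3)[OF \<tau>(1) \<tau>K] t by (simp add: A_def dist_commute)
      also have "\<dots> \<le> (1 - t) * A + t * B - t * (1 - t) * c"
        using \<gamma>(4)[OF \<tau>(1) \<tau>K, of t] t by (simp add: A_def B_def c_def dist_commute ac_simps)
      finally show ?thesis .
    qed
    hence "t * (A - B + c - t * c) \<le> 0" by (simp add: algebra_simps)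
    hence "A - B + c - t * c \<le> 0" using t by (simp add: mult_le_0_iff)
    thus ?thesis using tc by linarith
  qed
  hence "A - B + c \<le> 0" by (rule field_le_epsilon)
  hence "2 * \<tau> * (A - B + c) \<le> 0" using \<tau>(1) by (simp add: mult_le_0_iff)
  moreover have "2 * \<tau> * (A - B + c) = 2 * \<tau> * (rv g z - rv g w) + (dist x z)\<^sup>2 - (dist x w)\<^sup>2 + (1 - K * \<tau>) * (dist z w)\<^sup>2"
    using \<tau>(1) by (simp add: A_def B_def c_def field_simps)
  ultimately show ?thesis unfolding z_def[symmetric] by (simp add: algebra_simps)
qed

text \<open>
  The triangle inequality in the variational inequality.
\<close>
lemma resolvent_slope:
  assumes \<tau>: "0 < \<tau>" "4 * K * \<tau> \<le> 1" and x: "x \<in> eff_dom g"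
  shows "slope_le K g (dist x (resolvent \<tau> x) / \<tau>) (resolvent \<tau> x)"
  unfolding slope_le_def
proof (intro conjI ballI)
  show "resolvent \<tau> x \<in> eff_dom g" using resolvent_min(1)[OF \<tau>] .
  fix w assume w: "w \<in> eff_dom g"
  define z where "z = resolvent \<tau> x"
  have "dist x w \<le> dist x z + dist z w" by (rule dist_triangle)
  hence "(dist x w)\<^sup>2 \<le> (dist x z + dist z w)\<^sup>2" by (intro power_mono) auto
  hence "2 * \<tau> * (rv g z - rv g w) \<le> 2 * dist x z * dist z w + K * \<tau> * (dist z w)\<^sup>2"
    using resolvent_EVI[OF \<tau> x w] unfolding z_def[symmetric] by (simp add: power2_sum algebra_simps)
  also have "\<dots> = 2 * \<tau> * (dist x z / \<tau> * dist z w + K / 2 * (dist z w)\<^sup>2)" using \<tau> by (simp add: field_simps)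
  finally show "rv g (resolvent \<tau> x) - rv g w \<le> dist x (resolvent \<tau> x) / \<tau> * dist (resolvent \<tau> x) w + K / 2 * (dist (resolvent \<tau> x) w)\<^sup>2"
    using \<tau>(1) unfolding z_def[symmetric] by (subst (asm) mult_le_cancel_left_pos) auto
qed

lemma resolvent_descent:
  assumes \<tau>: "0 < \<tau>" "4 * K * \<tau> \<le> 1" and x: "x \<in> eff_dom g"
  shows "(2 - K * \<tau>) * (dist x (resolvent \<tau> x))\<^sup>2 \<le> 2 * \<tau> * (rv g x - rv g (resolvent \<tau> x))"
  using resolvent_EVI[OF \<tau> x x] by (simp add: dist_commute algebra_simps)

text \<open>
  The slope bound at \<open>x\<close> limits the energy that the step can gain. With \<open>resolvent_slope\<close> it follows that
  a step increases the slope at most by the factor \<open>1 / (1 - K * \<tau>)\<close>.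
\<close>
lemma resolvent_dist:
  assumes \<tau>: "0 < \<tau>" "4 * K * \<tau> \<le> 1" and x: "slope_le K g M x" and M: "M \<ge> 0"
  shows "(1 - K * \<tau>) * dist x (resolvent \<tau> x) \<le> \<tau> * M"
proof -
  define d where "d = dist x (resolvent \<tau> x)"
  have xD: "x \<in> eff_dom g" by (rule slope_le_dom[OF x])
  have "(2 - K * \<tau>) * d\<^sup>2 \<le> 2 * \<tau> * (rv g x - rv g (resolvent \<tau> x))"
    unfolding d_def by (rule resolvent_descent[OF \<tau> xD])
  also have "\<dots> \<le> 2 * \<tau> * (M * d + K / 2 * d\<^sup>2)"
    using slope_leD[OF x resolvent_min(1)[OF \<tau>]] \<tau>(1) unfolding d_def by (intro mult_left_mono) auto
  finally have *: "d * ((1 - K * \<tau>) * d) \<le> d * (\<tau> * M)" by (simp add: algebra_simps power2_eq_square)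
  show ?thesis
  proof (cases "d = 0")
    case False
    hence "d > 0" by (simp add: d_def)
    thus ?thesis using * unfolding d_def[symmetric] by simp
  qed (use \<tau> M in \<open>simp add: d_def[symmetric]\<close>)
qed

text \<open>
  The curve is \<open>s \<mapsto> J\<^sub>s x\<close>. For its speed, test the variational inequality of \<open>J\<^sub>s x\<close> with \<open>J\<^sub>t x\<close> and
  conversely; with weights \<open>t\<close> and \<open>s\<close> the energies cancel.
\<close>
lemma reach_resolvent:
  assumes \<tau>: "0 < \<tau>" "4 * K * \<tau> \<le> 1" and x: "slope_le K g M x" and M: "M \<ge> 0"
  shows "reach K g (M / (1 - K * \<tau>)\<^sup>2) \<tau> x (resolvent \<tau> x)"
proof -
  define q where "q = 1 - K * \<tau>"
  have "4 * (K * \<tau>) \<le> 1" "0 \<le> K * \<tau>" using \<tau> K by (simp_all add: ac_simps)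
  hence q: "0 < q" "q \<le> 1" unfolding q_def by linarith+
  \<comment> \<open>One factor \<open>1 / q\<close> bounds the distance travelled from \<open>x\<close>, a second one the speed.\<close>
  define C where "C = M / q"
  have Cq: "M / q\<^sup>2 = C / q" by (simp add: C_def power2_eq_square)
  have C0: "C \<ge> 0" using M q by (simp add: C_def)
  have CC: "M \<le> C / q" "C \<le> C / q"
  proof -
    show "C \<le> C / q" using C0 q by (simp add: le_divide_eq mult_left_le)
    have "M \<le> C" using M q by (simp add: C_def le_divide_eq mult_left_le)
    thus "M \<le> C / q" using \<open>C \<le> C / q\<close> by simp
  qed
  have xD: "x \<in> eff_dom g" by (rule slope_le_dom[OF x])
  have step: "4 * K * s \<le> 1" if "s \<le> \<tau>" for s
  proof -
    have "4 * K * s \<le> 4 * K * \<tau>" using that K by (intro mult_left_mono) auto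
    thus ?thesis using \<tau>(2) by linarith
  qed
  have dC: "dist x (resolvent s x) \<le> s * C" if s: "0 < s" "s \<le> \<tau>" for s
  proof -
    have "q * dist x (resolvent s x) \<le> (1 - K * s) * dist x (resolvent s x)"
      using s K by (intro mult_right_mono) (auto simp: q_def)
    also have "\<dots> \<le> s * M" by (rule resolvent_dist[OF s(1) step[OF s(2)] x M])
    finally show ?thesis using q(1) by (simp add: C_def field_simps)
  qed
  show ?thesis
    unfolding q_def[symmetric] Cq
  proof (rule reachI[of "\<lambda>s. resolvent s x"])
    fix s t assume st: "0 \<le> s" "s \<le> t" "t \<le> \<tau>"
    consider "s = t" | "s = 0" "0 < t" | "0 < s" "s < t" using st by fastforce
    thus "dist (resolvent s x) (resolvent t x) \<le> C / q * (t - s)"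
    proof cases
      case 2
      have "dist x (resolvent t x) \<le> t * C" using dC 2 st by simp
      also have "\<dots> \<le> t * (C / q)" using CC 2 by (intro mult_left_mono) auto
      finally show ?thesis using 2 by (simp add: mult.commute)
    next
      case 3
      define D where "D = dist (resolvent s x) (resolvent t x)"
      define A where "A = dist x (resolvent t x)"
      define B where "B = dist x (resolvent s x)"
      have s: "0 < s" "4 * K * s \<le> 1" "0 < t" "4 * K * t \<le> 1" using 3 st step by auto
      have 1: "(1 - K * s) * D\<^sup>2 + B\<^sup>2 - A\<^sup>2 \<le> 2 * s * (rv g (resolvent t x) - rv g (resolvent s x))"
        using resolvent_EVI[OF s(1,2) xD resolvent_min(1)[OF s(3,4)]] by (simp add: D_def A_def B_def)
      have 2: "(1 - K * t) * D\<^sup>2 + A\<^sup>2 - B\<^sup>2 \<le> 2 * t * (rv g (resolvent s x) - rv g (resolvent t x))"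
        using resolvent_EVI[OF s(3,4) xD resolvent_min(1)[OF s(1,2)]] by (simp add: D_def A_def B_def dist_commute)
      have "t * ((1 - K * s) * D\<^sup>2 + B\<^sup>2 - A\<^sup>2) + s * ((1 - K * t) * D\<^sup>2 + A\<^sup>2 - B\<^sup>2) \<le>
          t * (2 * s * (rv g (resolvent t x) - rv g (resolvent s x))) + s * (2 * t * (rv g (resolvent s x) - rv g (resolvent t x)))"
        using 1 2 s by (intro add_mono mult_left_mono) auto
      also have "\<dots> = 0" by (simp add: algebra_simps)
      finally have main: "(t * (1 - K * s) + s * (1 - K * t)) * D\<^sup>2 \<le> (t - s) * (A\<^sup>2 - B\<^sup>2)"
        by (simp add: algebra_simps)
      have "A \<le> B + D" unfolding A_def B_def D_def by (rule dist_triangle)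
      thus ?thesis
        using descent_arithmetic[OF 3 st(3) _ _ q_def q(1) _ _ _ _ _ main, of C] K dC[of s] dC[of t] 3 st
        by (simp add: A_def B_def D_def)
    qed simp
  next
    fix s assume s: "0 \<le> s" "s \<le> \<tau>"
    show "slope_le K g (C / q) (resolvent s x)"
    proof (cases "s = 0")
      case True
      thus ?thesis using slope_le_mono[OF x CC(1)] by simp
    next
      case False
      hence s0: "0 < s" using s by simp
      have "dist x (resolvent s x) / s \<le> C" using dC[OF s0 s(2)] s0 by (simp add: field_simps)
      hence "dist x (resolvent s x) / s \<le> C / q" using CC by linarith
      thus ?thesis by (rule slope_le_mono[OF resolvent_slope[OF s0 step[OF s(2)] xD]])
    qed
  qed simp_all
qed

end

section \<open>Smoothing maps from iterated resolvents\<close>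

text \<open>
  The slack in an integrated evolution variational inequality for a motion from \<open>x\<close> to \<open>y\<close> in time \<open>t\<close>. The
  factor \<open>1 - 4 * K * t\<close> is smaller than the exact exponential, which allows a single constant to absorb
  all errors of size \<open>K * t\<close>.
\<close>
definition evi_gap :: "real \<Rightarrow> ('a::metric_space \<Rightarrow> ereal) \<Rightarrow> real \<Rightarrow> 'a \<Rightarrow> 'a \<Rightarrow> 'a \<Rightarrow> real" where
  "evi_gap K g t x y z = (dist x z)\<^sup>2 / (1 - 4 * K * t) - (1 - 4 * K * t) * (dist y z)\<^sup>2 - 2 * t * (rv g y - rv g z)"

text \<open>
  The evolution variational inequality together with the regularizing effect
  \<open>\<kappa> * t\<^sup>2 * slope\<^sup>2 \<le> gap\<close>. Both hold for every comparison point \<open>z\<close>, including points that depend on the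
  function when it varies; this freedom is what carries slope bounds through a \<open>\<Gamma>\<close>-limit.
\<close>
definition regularizes :: "real \<Rightarrow> ('a::metric_space \<Rightarrow> ereal) \<Rightarrow> real \<Rightarrow> 'a \<Rightarrow> 'a \<Rightarrow> bool" where
  "regularizes K g t x y \<longleftrightarrow> y \<in> eff_dom g \<and>
     (\<forall>z\<in>eff_dom g. 0 \<le> evi_gap K g t x y z \<and> slope_le K g (sqrt (evi_gap K g t x y z / ((1 - 4 * K * t) * t\<^sup>2))) y)"

lemma quadratic_bound:
  fixes d a b :: real
  assumes "d\<^sup>2 \<le> a * d + b\<^sup>2" "0 \<le> a" "0 \<le> b"
  shows "d \<le> a + b"
proof (rule ccontr)
  assume "\<not> d \<le> a + b"
  hence d: "a + b < d" by simp
  have "a * d + b\<^sup>2 \<le> a * d + b * d"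
    using d assms mult_left_mono[of b d b] by (simp add: power2_eq_square)
  also have "\<dots> = (a + b) * d" by (simp add: distrib_right)
  also have "\<dots> < d * d" using d assms by (intro mult_strict_right_mono) auto
  finally show False using assms(1) by (simp add: power2_eq_square)
qed

lemma sum_odd_numbers: "(\<Sum>k<j. e + 2 * (real n - 1 - real k) * e) = real j * (2 * real n - real j) * e"
  by (induction j) (simp_all add: algebra_simps)

lemma weighted_quadratic_max:
  fixes k t M d :: real
  assumes "1/2 \<le> k"
  shows "2 * t * M * d - k * d\<^sup>2 \<le> 2 * (t * M)\<^sup>2"
proof -
  have "0 \<le> (d - 2 * (t * M))\<^sup>2 / 2" by simp
  also have "\<dots> = d\<^sup>2 / 2 - 2 * t * M * d + 2 * (t * M)\<^sup>2" by (simp add: power2_diff field_simps power2_eq_square)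
  finally have "2 * t * M * d - 1/2 * d\<^sup>2 \<le> 2 * (t * M)\<^sup>2" by simp
  moreover have "1/2 * d\<^sup>2 \<le> k * d\<^sup>2" using assms by (intro mult_right_mono) auto
  ultimately show ?thesis by linarith
qed

text \<open>
  Use a point \<open>q\<close> of bounded slope as comparison point: its slope bound limits how far the energy at
  \<open>y\<close> can lie below that at \<open>q\<close>, and the gap becomes a concave quadratic function of \<open>dist y q\<close>.
  These bounds do not involve the energy of \<open>x\<close>, which may be infinite.
\<close>
lemma regularizes_dist_slope:
  assumes t: "0 < t" "16 * K * t \<le> 1" and K: "K > 0"
    and r: "regularizes K g t x y" and q: "slope_le K g M q" and M: "M \<ge> 0"
  shows "dist y q \<le> 4 * t * M + 2 * dist x q" "slope_le K g (2 * M + 2 * dist x q / t) y"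
proof -
  define \<kappa> where "\<kappa> = 1 - 4 * K * t"
  define d where "d = dist y q"
  define e where "e = dist x q"
  \<comment> \<open>The condition \<open>16 * K * t \<le> 1\<close> keeps every factor that occurs at or above \<open>1/2\<close>.\<close>
  have "16 * (K * t) \<le> 1" using t by (simp add: ac_simps)
  hence \<kappa>: "3/4 \<le> \<kappa>" "\<kappa> \<le> 1" "1/2 \<le> \<kappa> - K * t" using K t by (auto simp: \<kappa>_def)
  have qD: "q \<in> eff_dom g" by (rule slope_le_dom[OF q])
  have yD: "y \<in> eff_dom g" using r by (simp add: regularizes_def)
  have gap: "0 \<le> evi_gap K g t x y q" and sl: "slope_le K g (sqrt (evi_gap K g t x y q / (\<kappa> * t\<^sup>2))) y"
    using r qD unfolding regularizes_def \<kappa>_def by blast+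
  have "2 * t * (rv g q - rv g y) \<le> 2 * t * (M * d + K / 2 * d\<^sup>2)"
    using slope_leD[OF q yD] t unfolding d_def by (intro mult_left_mono) (auto simp: dist_commute)
  also have "\<dots> = 2 * t * M * d + K * t * d\<^sup>2" by (simp add: algebra_simps)
  finally have E: "2 * t * (rv g q - rv g y) \<le> 2 * t * M * d + K * t * d\<^sup>2" .
  have G: "evi_gap K g t x y q \<le> e\<^sup>2 / \<kappa> + 2 * t * M * d - (\<kappa> - K * t) * d\<^sup>2"
    using E unfolding evi_gap_def \<kappa>_def[symmetric] d_def[symmetric] e_def[symmetric] by (simp add: algebra_simps)
  have e1: "e\<^sup>2 / \<kappa> \<le> 4/3 * e\<^sup>2"
  proof -
    have "e\<^sup>2 * 3 \<le> e\<^sup>2 * (4 * \<kappa>)" using \<kappa> by (intro mult_left_mono) auto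
    thus ?thesis using \<kappa> by (simp add: divide_simps ac_simps)
  qed
  have "1/2 * d\<^sup>2 \<le> (\<kappa> - K * t) * d\<^sup>2" using \<kappa> by (intro mult_right_mono) auto
  hence "d\<^sup>2 \<le> (4 * t * M) * d + 8/3 * e\<^sup>2" using gap G e1 by linarith
  moreover have "8/3 * e\<^sup>2 \<le> (2 * e)\<^sup>2" using zero_le_power2[of e] by (simp add: power_mult_distrib)
  ultimately have "d\<^sup>2 \<le> (4 * t * M) * d + (2 * e)\<^sup>2" by linarith
  hence "d \<le> 4 * t * M + 2 * e"
    by (rule quadratic_bound) (use t M in \<open>simp_all add: e_def\<close>)
  thus "dist y q \<le> 4 * t * M + 2 * dist x q" by (simp only: d_def e_def)
  have "evi_gap K g t x y q \<le> 4/3 * e\<^sup>2 + 2 * (t * M)\<^sup>2"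
    using G e1 weighted_quadratic_max[OF \<kappa>(3), of t M d] by linarith
  also have "\<dots> \<le> \<kappa> * t\<^sup>2 * (2 * M + 2 * e / t)\<^sup>2"
  proof -
    have "4/3 * e\<^sup>2 + 2 * (t * M)\<^sup>2 \<le> 3/4 * (2 * t * M + 2 * e)\<^sup>2"
    proof -
      have "0 \<le> t * M * e" using t M by (simp add: e_def)
      moreover have "3/4 * (2 * t * M + 2 * e)\<^sup>2 = 3 * (t * M)\<^sup>2 + 6 * (t * M * e) + 3 * e\<^sup>2"
        by (simp add: power2_eq_square algebra_simps)
      ultimately show ?thesis using zero_le_power2[of "t * M"] zero_le_power2[of e] by linarith
    qed
    also have "\<dots> \<le> \<kappa> * (2 * t * M + 2 * e)\<^sup>2" using \<kappa> by (intro mult_right_mono) auto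
    also have "\<dots> = \<kappa> * t\<^sup>2 * (2 * M + 2 * e / t)\<^sup>2" using t by (simp add: power2_eq_square field_simps)
    finally show ?thesis .
  qed
  finally have "evi_gap K g t x y q / (\<kappa> * t\<^sup>2) \<le> (2 * M + 2 * e / t)\<^sup>2"
    using \<kappa> t by (simp add: divide_le_eq mult.commute)
  hence "sqrt (evi_gap K g t x y q / (\<kappa> * t\<^sup>2)) \<le> 2 * M + 2 * e / t"
    by (intro real_le_lsqrt) (use t M in \<open>simp_all add: e_def\<close>)
  from slope_le_mono[OF sl this] show "slope_le K g (2 * M + 2 * dist x q / t) y" by (simp only: e_def)
qed

context semiconvex begin

text \<open>
  The energy at \<open>yn n\<close> is only lower semicontinuous. Since the gap decreases in it, a number \<open>c\<close> below the
  energy of the limit may take its place; afterwards \<open>c\<close> is increased to that energy.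
\<close>
lemma regularizes_limit:
  assumes t: "0 < t" "16 * K * t \<le> 1" and F: "F \<noteq> bot"
    and r: "\<forall>\<^sub>F n in F. regularizes K g t (xn n) (yn n)" and x: "(xn \<longlongrightarrow> x) F" and y: "(yn \<longlongrightarrow> y) F"
  shows "regularizes K g t x y"
proof -
  define \<kappa> where "\<kappa> = 1 - 4 * K * t"
  have "16 * (K * t) \<le> 1" using t by (simp add: ac_simps)
  hence \<kappa>: "3/4 \<le> \<kappa>" by (simp add: \<kappa>_def)
  define gap where "gap c u v z = (dist u z)\<^sup>2 / \<kappa> - \<kappa> * (dist v z)\<^sup>2 - 2 * t * (c - rv g z)" for c u v z
  have key: "0 \<le> gap c x y z \<and> slope_le K g (sqrt (gap c x y z / (\<kappa> * t\<^sup>2))) y"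
    if z: "z \<in> eff_dom g" and c: "ereal c < g y" for z c
  proof
    have "\<forall>\<^sub>F n in F. ereal c < g (yn n)" by (rule gamma_along_liminf[OF gamma_along_const[OF lsc_g] y c])
    with r have ev: "\<forall>\<^sub>F n in F. 0 \<le> gap c (xn n) (yn n) z \<and> slope_le K g (sqrt (gap c (xn n) (yn n) z / (\<kappa> * t\<^sup>2))) (yn n)"
    proof eventually_elim
      case (elim n)
      have yD: "yn n \<in> eff_dom g" using elim(1) by (simp add: regularizes_def)
      have "g (yn n) = ereal (rv g (yn n))" by (rule eff_dom_real'[OF ni yD])
      with elim(2) have cr: "c < rv g (yn n)" by (metis less_ereal.simps(1))
      have "t * c \<le> t * rv g (yn n)" using cr t by (intro mult_left_mono) auto
      hence le: "evi_gap K g t (xn n) (yn n) z \<le> gap c (xn n) (yn n) z"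
        by (simp add: evi_gap_def gap_def \<kappa>_def algebra_simps)
      have A: "0 \<le> evi_gap K g t (xn n) (yn n) z" "slope_le K g (sqrt (evi_gap K g t (xn n) (yn n) z / (\<kappa> * t\<^sup>2))) (yn n)"
        using elim(1) z unfolding regularizes_def \<kappa>_def by blast+
      have "sqrt (evi_gap K g t (xn n) (yn n) z / (\<kappa> * t\<^sup>2)) \<le> sqrt (gap c (xn n) (yn n) z / (\<kappa> * t\<^sup>2))"
        using le \<kappa> by (intro real_sqrt_le_mono divide_right_mono) auto
      thus ?case using A(1) le slope_le_mono[OF A(2)] by simp
    qed
    have lim: "((\<lambda>n. gap c (xn n) (yn n) z) \<longlongrightarrow> gap c x y z) F"
      unfolding gap_def using \<kappa> by (intro tendsto_intros x y) auto
    show "0 \<le> gap c x y z"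
      by (rule tendsto_lowerbound[OF lim _ F]) (use ev in \<open>auto elim: eventually_mono\<close>)
    have "((\<lambda>n. sqrt (gap c (xn n) (yn n) z / (\<kappa> * t\<^sup>2))) \<longlongrightarrow> sqrt (gap c x y z / (\<kappa> * t\<^sup>2))) F"
      using \<kappa> t by (intro tendsto_real_sqrt tendsto_divide lim tendsto_const) auto
    thus "slope_le K g (sqrt (gap c x y z / (\<kappa> * t\<^sup>2))) y"
      by (rule slope_le_limit[OF F lsc_g ni dom_nonempty y]) (use ev in \<open>auto elim: eventually_mono\<close>)
  qed
  have "\<exists>c. ereal c < g y"
  proof (cases "g y")
    case (real a)
    thus ?thesis by (intro exI[of _ "a - 1"]) simp
  qed (use ni in \<open>auto intro: exI[of _ 0]\<close>)
  then obtain c0 where "ereal c0 < g y" by blast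
  hence yD: "y \<in> eff_dom g" using key[OF p_dom] slope_le_dom by blast
  have gy: "g y = ereal (rv g y)" by (rule eff_dom_real'[OF ni yD])
  have "0 \<le> evi_gap K g t x y z \<and> slope_le K g (sqrt (evi_gap K g t x y z / (\<kappa> * t\<^sup>2))) y" if z: "z \<in> eff_dom g" for z
  proof
    define c where "c n = rv g y - 1 / real (Suc n)" for n
    have c: "ereal (c n) < g y" for n by (subst gy) (simp add: c_def)
    have "c \<longlonglongrightarrow> rv g y - 0"
      unfolding c_def using LIMSEQ_inverse_real_of_nat by (intro tendsto_diff tendsto_const) (simp add: inverse_eq_divide)
    hence "(\<lambda>n. gap (c n) x y z) \<longlonglongrightarrow> gap (rv g y) x y z"
      unfolding gap_def by (intro tendsto_intros) simp
    moreover have gg: "gap (rv g y) x y z = evi_gap K g t x y z" by (simp add: gap_def evi_gap_def \<kappa>_def)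
    ultimately have lim: "(\<lambda>n. gap (c n) x y z) \<longlonglongrightarrow> evi_gap K g t x y z" by simp
    show "0 \<le> evi_gap K g t x y z"
      by (rule tendsto_lowerbound[OF lim]) (use key[OF z c] in auto)
    have "(\<lambda>n. sqrt (gap (c n) x y z / (\<kappa> * t\<^sup>2))) \<longlonglongrightarrow> sqrt (evi_gap K g t x y z / (\<kappa> * t\<^sup>2))"
      using \<kappa> t by (intro tendsto_real_sqrt tendsto_divide lim tendsto_const) auto
    thus "slope_le K g (sqrt (evi_gap K g t x y z / (\<kappa> * t\<^sup>2))) y"
      by (rule slope_le_limit[OF sequentially_bot lsc_g ni dom_nonempty tendsto_const]) (use key[OF z c] in auto)
  qed
  thus ?thesis using yD unfolding regularizes_def \<kappa>_def by blast
qed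

text \<open>
  Implicit Euler steps for the gradient flow.
\<close>
definition flow :: "real \<Rightarrow> nat \<Rightarrow> 'a \<Rightarrow> 'a" where
  "flow \<tau> n x = (resolvent \<tau> ^^ n) x"

lemma flow_simps [simp]: "flow \<tau> 0 x = x" "flow \<tau> (Suc n) x = resolvent \<tau> (flow \<tau> n x)"
  by (simp_all add: flow_def)

lemma flow_dom:
  assumes \<tau>: "0 < \<tau>" "4 * K * \<tau> \<le> 1" and x: "x \<in> eff_dom g"
  shows "flow \<tau> n x \<in> eff_dom g"
  using x resolvent_min(1)[OF \<tau>] by (cases n) auto

text \<open>
  Bernoulli's inequality bounds powers of the factor lost in each step.
\<close>
lemma step_factor:
  assumes \<tau>: "0 < \<tau>" "4 * K * \<tau> \<le> 1"
  shows "0 < 1 - K * \<tau>" "1 - K * \<tau> \<le> 1" "1 - real n * (K * \<tau>) \<le> (1 - K * \<tau>) ^ n"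
proof -
  have "4 * (K * \<tau>) \<le> 1" "0 \<le> K * \<tau>" using \<tau> K by (simp_all add: ac_simps)
  thus *: "0 < 1 - K * \<tau>" "1 - K * \<tau> \<le> 1" by linarith+
  show "1 - real n * (K * \<tau>) \<le> (1 - K * \<tau>) ^ n"
    using Bernoulli_inequality[of "- (K * \<tau>)" n] * by simp
qed

lemma flow_slope:
  assumes \<tau>: "0 < \<tau>" "4 * K * \<tau> \<le> 1" and x: "slope_le K g M x" and M: "M \<ge> 0"
  shows "slope_le K g (M / (1 - K * \<tau>) ^ n) (flow \<tau> n x)"
proof (induction n)
  case 0
  thus ?case using x by simp
next
  case (Suc n)
  note q = step_factor[OF \<tau>]
  have M': "0 \<le> M / (1 - K * \<tau>) ^ n" using M q(1) by simp
  have "(1 - K * \<tau>) * dist (flow \<tau> n x) (flow \<tau> (Suc n) x) \<le> \<tau> * (M / (1 - K * \<tau>) ^ n)"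
    using resolvent_dist[OF \<tau> Suc M'] by simp
  hence "dist (flow \<tau> n x) (flow \<tau> (Suc n) x) / \<tau> \<le> M / (1 - K * \<tau>) ^ Suc n"
    using q(1) \<tau>(1) by (simp add: field_simps)
  thus ?case using slope_le_mono[OF resolvent_slope[OF \<tau> slope_le_dom[OF Suc]]] by simp
qed

lemma flow_reach:
  assumes \<tau>: "0 < \<tau>" "4 * K * \<tau> \<le> 1" and x: "slope_le K g M x" and M: "M \<ge> 0"
  shows "reach K g (M / (1 - K * \<tau>) ^ Suc n) (real n * \<tau>) x (flow \<tau> n x)"
proof (induction n)
  case 0
  note q = step_factor[OF \<tau>]
  have "M \<le> M / (1 - K * \<tau>)" using M q by (simp add: le_divide_eq mult_left_le)
  hence "slope_le K g (M / (1 - K * \<tau>)) x" by (rule slope_le_mono[OF x])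
  thus ?case using M q(1)
    by (intro reachI[of "\<lambda>_. x"]) (auto intro!: divide_nonneg_pos mult_nonneg_nonneg)
next
  case (Suc n)
  note q = step_factor[OF \<tau>]
  let ?C = "M / (1 - K * \<tau>) ^ Suc (Suc n)"
  have M': "0 \<le> M / (1 - K * \<tau>) ^ n" using M q(1) by simp
  have "M / (1 - K * \<tau>) ^ Suc n \<le> ?C"
    using M q by (intro divide_left_mono power_decreasing mult_pos_pos zero_less_power) auto
  hence 1: "reach K g ?C (real n * \<tau>) x (flow \<tau> n x)" by (rule reach_mono[OF Suc])
  have "reach K g (M / (1 - K * \<tau>) ^ n / (1 - K * \<tau>)\<^sup>2) \<tau> (flow \<tau> n x) (flow \<tau> (Suc n) x)"
    using reach_resolvent[OF \<tau> flow_slope[OF \<tau> x M] M'] by simp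
  hence 2: "reach K g ?C \<tau> (flow \<tau> n x) (flow \<tau> (Suc n) x)"
    by (simp add: power2_eq_square ac_simps)
  have "real (Suc n) * \<tau> = real n * \<tau> + \<tau>" by (simp add: algebra_simps)
  thus ?case using reach_trans[OF 1 2] \<tau> by simp
qed

text \<open>
  Multiply the variational inequality of step \<open>k\<close> by \<open>q ^ k\<close>, \<open>q = 1 - K * \<tau>\<close>, and add: the distances to
  \<open>z\<close> telescope. Energies at the intermediate points are replaced by the final one, and the difference
  is the dissipation of the remaining steps. Up to powers of \<open>q\<close>, each step dissipates at least \<open>e\<close>, the
  squared length of the last step. The terms from step \<open>k\<close> add up to \<open>(2 * (n - 1 - k) + 1) * e\<close>, a sum of odd numbers with
  value \<open>n\<^sup>2 * e\<close>, which is \<open>t\<^sup>2\<close> times the squared slope bound \<open>s\<close> at the end point. All powers of \<open>q\<close> that occur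
  are at least \<open>\<kappa>\<close>.
\<close>
lemma flow_regularizes:
  assumes t: "0 < t" "16 * K * t \<le> 1" and n: "n > 0" and x: "x \<in> eff_dom g"
  shows "regularizes K g t x (flow (t / real n) n x)"
proof -
  define \<tau> where "\<tau> = t / real n"
  define \<kappa> where "\<kappa> = 1 - 4 * K * t"
  define q where "q = 1 - K * \<tau>"
  have Kt: "16 * (K * t) \<le> 1" using t by (simp add: ac_simps)
  hence \<kappa>: "3/4 \<le> \<kappa>" "\<kappa> \<le> 1" using K t by (auto simp: \<kappa>_def)
  have nt: "real n * \<tau> = t" using n by (simp add: \<tau>_def)
  have "\<tau> \<le> t" using n t by (simp add: \<tau>_def divide_le_eq mult_right_le_one_le mult_le_cancel_left1)
  hence "K * \<tau> \<le> K * t" using K by (intro mult_left_mono) auto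
  hence \<tau>: "0 < \<tau>" "4 * K * \<tau> \<le> 1" using t n Kt by (auto simp: \<tau>_def)
  have q: "0 < q" "q \<le> 1" "\<And>j. 1 - real j * (K * \<tau>) \<le> q ^ j" unfolding q_def using step_factor[OF \<tau>] by auto
  define X where "X k = flow \<tau> k x" for k
  define d where "d k = dist (X k) (X (Suc k))" for k
  have XS: "X (Suc k) = resolvent \<tau> (X k)" for k by (simp add: X_def)
  have XD: "X k \<in> eff_dom g" for k unfolding X_def by (rule flow_dom[OF \<tau> x])
  have evi: "q * (dist (X (Suc k)) z)\<^sup>2 + (d k)\<^sup>2 - (dist (X k) z)\<^sup>2 \<le> 2 * \<tau> * (rv g z - rv g (X (Suc k)))"
    if "z \<in> eff_dom g" for z k
    using resolvent_EVI[OF \<tau> XD that] unfolding q_def d_def XS .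
  have desc: "q * (d k)\<^sup>2 \<le> \<tau> * (rv g (X k) - rv g (X (Suc k)))" for k
  proof -
    have "2 * q * (d k)\<^sup>2 \<le> (2 - K * \<tau>) * (d k)\<^sup>2" using q(2) by (intro mult_right_mono) (auto simp: q_def)
    also have "\<dots> \<le> 2 * \<tau> * (rv g (X k) - rv g (X (Suc k)))"
      using resolvent_descent[OF \<tau> XD] unfolding d_def XS .
    finally show ?thesis by simp
  qed
  have dstep: "q * d (Suc k) \<le> d k" for k
  proof -
    have "slope_le K g (d k / \<tau>) (X (Suc k))" unfolding d_def XS by (rule resolvent_slope[OF \<tau> XD])
    from resolvent_dist[OF \<tau> this] \<tau> show ?thesis by (simp add: q_def d_def XS)
  qed
  have dpow: "q ^ j * d (k + j) \<le> d k" for j k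
  proof (induction j)
    case (Suc j)
    have "q ^ Suc j * d (k + Suc j) = q ^ j * (q * d (Suc (k + j)))" by simp
    also have "\<dots> \<le> q ^ j * d (k + j)" using dstep q(1) by (intro mult_left_mono) auto
    finally show ?case using Suc by linarith
  qed simp
  define N where "N = n - 1"
  have N: "n = Suc N" using n by (simp add: N_def)
  \<comment> \<open>The step lengths nearly decrease (\<open>dpow\<close>), so up to powers of \<open>q\<close> the last one is the shortest.\<close>
  define e where "e = q ^ (2 * n + 1) * (d N)\<^sup>2"
  have e0: "0 \<le> e" using q(1) by (simp add: e_def)
  have e1: "e \<le> q * (d k)\<^sup>2" if k: "k < n" for k
  proof -
    have "q ^ (N - k) * d N \<le> d k" using dpow[of "N - k" k] k N by simp
    hence "(q ^ (N - k) * d N)\<^sup>2 \<le> (d k)\<^sup>2" using q(1) by (intro power_mono) (auto simp: d_def)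
    hence "q * (q ^ (N - k) * d N)\<^sup>2 \<le> q * (d k)\<^sup>2" using q(1) by (intro mult_left_mono) auto
    moreover have "q * (q ^ (N - k) * d N)\<^sup>2 = q ^ (2 * (N - k) + 1) * (d N)\<^sup>2"
      by (simp add: power_mult_distrib power_mult[symmetric] mult.commute)
    moreover have "e \<le> q ^ (2 * (N - k) + 1) * (d N)\<^sup>2"
      unfolding e_def using q N by (intro mult_right_mono power_decreasing) auto
    ultimately show ?thesis by linarith
  qed
  have e2: "e \<le> (d k)\<^sup>2" if "k < n" for k
    using e1[OF that] q(2) mult_right_mono[of q 1 "(d k)\<^sup>2"] by auto
  \<comment> \<open>energy dissipated in the last \<open>j\<close> steps\<close>
  have en: "real j * e \<le> \<tau> * (rv g (X (n - j)) - rv g (X n))" if "j \<le> n" for j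
    using that
  proof (induction j)
    case (Suc j)
    have S: "Suc (n - Suc j) = n - j" using Suc.prems by simp
    have "e \<le> \<tau> * (rv g (X (n - Suc j)) - rv g (X (n - j)))"
      using e1[of "n - Suc j"] desc[of "n - Suc j"] Suc.prems unfolding S by simp
    with Suc show ?case by (simp add: algebra_simps)
  qed simp
  have sl: "slope_le K g (d N / \<tau>) (X n)" unfolding d_def N XS by (rule resolvent_slope[OF \<tau> XD])
  define s where "s = d N / \<tau>"
  have s0: "0 \<le> s" using \<tau> by (simp add: s_def d_def)
  have main: "\<kappa> * (dist (X n) z)\<^sup>2 + \<kappa> * t\<^sup>2 * s\<^sup>2 + 2 * t * (rv g (X n) - rv g z) \<le> (dist x z)\<^sup>2 / \<kappa>"
    if z: "z \<in> eff_dom g" for z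
  proof -
    have sum: "q ^ j * (dist (X j) z)\<^sup>2 + q ^ n * (\<Sum>k<j. e + 2 * (real n - 1 - real k) * e)
        + 2 * (\<tau> * (\<Sum>k<j. q ^ k)) * (rv g (X n) - rv g z) \<le> (dist x z)\<^sup>2" if "j \<le> n" for j
      using that
    proof (induction j)
      case 0
      thus ?case by (simp add: X_def)
    next
      case (Suc j)
      have qj: "q ^ n \<le> q ^ j" using q Suc.prems by (intro power_decreasing) auto
      have "q ^ j * (q * (dist (X (Suc j)) z)\<^sup>2 + (d j)\<^sup>2 - (dist (X j) z)\<^sup>2) \<le> q ^ j * (2 * \<tau> * (rv g z - rv g (X (Suc j))))"
        using evi[OF z] q(1) by (intro mult_left_mono) auto
      moreover have "q ^ n * e \<le> q ^ j * (d j)\<^sup>2"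
        using e2[of j] Suc.prems qj q(1) e0 by (intro mult_mono) auto
      moreover have "q ^ n * (2 * (real n - 1 - real j) * e) \<le> q ^ j * (2 * \<tau> * (rv g (X (Suc j)) - rv g (X n)))"
      proof (rule mult_mono)
        have "real (n - Suc j) * e \<le> \<tau> * (rv g (X (Suc j)) - rv g (X n))"
          using en[of "n - Suc j"] Suc.prems by simp
        thus "2 * (real n - 1 - real j) * e \<le> 2 * \<tau> * (rv g (X (Suc j)) - rv g (X n))"
          using Suc.prems by (simp add: of_nat_diff algebra_simps)
        show "0 \<le> 2 * (real n - 1 - real j) * e" using e0 Suc.prems by simp
      qed (use qj q in auto)
      ultimately show ?case using Suc by (simp add: algebra_simps)
    qed
    define W where "W = \<tau> * (\<Sum>k<n. q ^ k)"
    define \<Delta> where "\<Delta> = rv g (X n) - rv g z"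
    have S: "(\<Sum>k<n. e + 2 * (real n - 1 - real k) * e) = (real n)\<^sup>2 * e"
      unfolding sum_odd_numbers by (simp add: power2_eq_square)
    have ne: "(real n)\<^sup>2 * e = q ^ (2 * n + 1) * (t\<^sup>2 * s\<^sup>2)"
      using \<tau> unfolding e_def s_def nt[symmetric] by (simp add: power_divide power_mult_distrib)
    have I: "q ^ n * (dist (X n) z)\<^sup>2 + q ^ n * (q ^ (2 * n + 1) * (t\<^sup>2 * s\<^sup>2)) + 2 * W * \<Delta> \<le> (dist x z)\<^sup>2"
      using sum[of n] unfolding S ne W_def[symmetric] \<Delta>_def[symmetric] by simp
    have \<kappa>4: "\<kappa> \<le> q ^ (4 * n)"
    proof -
      have E: "real (4 * n) * (K * \<tau>) = 4 * K * t" unfolding nt[symmetric] by simp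
      show ?thesis using q(3)[of "4 * n"] unfolding E \<kappa>_def .
    qed
    have \<kappa>n: "\<kappa> \<le> q ^ n" using \<kappa>4 power_decreasing[of n "4 * n" q] q by auto
    have "q ^ n * q ^ (2 * n + 1) = q ^ (3 * n + 1)" by (simp add: power_add[symmetric])
    moreover have "q ^ (4 * n) \<le> q ^ (3 * n + 1)" using q n by (intro power_decreasing) auto
    ultimately have \<kappa>3: "\<kappa> \<le> q ^ n * q ^ (2 * n + 1)" using \<kappa>4 by linarith
    have "\<kappa> * (dist (X n) z)\<^sup>2 \<le> q ^ n * (dist (X n) z)\<^sup>2" using \<kappa>n by (intro mult_right_mono) auto
    moreover have "\<kappa> * (t\<^sup>2 * s\<^sup>2) \<le> q ^ n * q ^ (2 * n + 1) * (t\<^sup>2 * s\<^sup>2)" using \<kappa>3 by (intro mult_right_mono) auto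
    ultimately have II: "\<kappa> * (dist (X n) z)\<^sup>2 + \<kappa> * t\<^sup>2 * s\<^sup>2 + 2 * W * \<Delta> \<le> (dist x z)\<^sup>2"
      using I by (simp add: mult.assoc)
    have W: "\<kappa> * t \<le> W" "W \<le> t"
    proof -
      have "(\<Sum>k<n. \<kappa>) \<le> (\<Sum>k<n. q ^ k)"
      proof (rule sum_mono)
        fix k assume "k \<in> {..<n}"
        hence "q ^ n \<le> q ^ k" using q by (intro power_decreasing) auto
        thus "\<kappa> \<le> q ^ k" using \<kappa>n by linarith
      qed
      hence "\<tau> * (real n * \<kappa>) \<le> W" unfolding W_def using \<tau> by (intro mult_left_mono) auto
      thus "\<kappa> * t \<le> W" unfolding nt[symmetric] by (simp add: ac_simps)
      have "(\<Sum>k<n. q ^ k) \<le> (\<Sum>k<n. 1)" using q by (intro sum_mono power_le_one) auto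
      hence "W \<le> \<tau> * real n" unfolding W_def using \<tau> by (intro mult_left_mono) auto
      thus "W \<le> t" unfolding nt[symmetric] by (simp add: ac_simps)
    qed
    \<comment> \<open>The energies carry the total weight \<open>W\<close> instead of \<open>t\<close>. Dividing by \<open>\<omega> = W / t \<in> {\<kappa>..1}\<close> corrects this whatever the sign of \<open>\<Delta>\<close>, and costs the factor \<open>1 / \<kappa>\<close> on the right.\<close>
    define \<omega> where "\<omega> = W / t"
    have "0 < \<kappa> * t" using \<kappa> t by simp
    hence "0 < W" using W by linarith
    hence \<omega>: "\<kappa> \<le> \<omega>" "\<omega> \<le> 1" "0 < \<omega>" "W = \<omega> * t" using W t \<kappa> by (auto simp: \<omega>_def le_divide_eq)
    define P where "P = \<kappa> * (dist (X n) z)\<^sup>2 + \<kappa> * t\<^sup>2 * s\<^sup>2"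
    have P0: "0 \<le> P" using \<kappa> by (simp add: P_def)
    have "P + \<omega> * (2 * t * \<Delta>) \<le> (dist x z)\<^sup>2" using II unfolding P_def \<omega>(4) by (simp add: ac_simps)
    hence "(P + \<omega> * (2 * t * \<Delta>)) / \<omega> \<le> (dist x z)\<^sup>2 / \<omega>" using \<omega>(3) by (intro divide_right_mono) auto
    moreover have "(P + \<omega> * (2 * t * \<Delta>)) / \<omega> = P / \<omega> + 2 * t * \<Delta>" using \<omega>(3) by (simp add: add_divide_distrib)
    moreover have "P \<le> P / \<omega>" using P0 \<omega> by (simp add: le_divide_eq mult_left_le)
    moreover have "(dist x z)\<^sup>2 / \<omega> \<le> (dist x z)\<^sup>2 / \<kappa>" using \<omega> \<kappa> by (intro divide_left_mono) auto
    ultimately show ?thesis unfolding P_def \<Delta>_def by linarith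
  qed
  have "0 \<le> evi_gap K g t x (X n) z \<and> slope_le K g (sqrt (evi_gap K g t x (X n) z / (\<kappa> * t\<^sup>2))) (X n)"
    if z: "z \<in> eff_dom g" for z
  proof -
    have gap: "\<kappa> * t\<^sup>2 * s\<^sup>2 \<le> evi_gap K g t x (X n) z"
      using main[OF z] unfolding evi_gap_def \<kappa>_def[symmetric] by linarith
    have pos: "0 < \<kappa> * t\<^sup>2" using \<kappa> t by simp
    have "s\<^sup>2 \<le> evi_gap K g t x (X n) z / (\<kappa> * t\<^sup>2)" using gap pos by (simp add: pos_le_divide_eq mult.commute)
    hence "s \<le> sqrt (evi_gap K g t x (X n) z / (\<kappa> * t\<^sup>2))" by (rule real_le_rsqrt)
    moreover have "0 \<le> \<kappa> * t\<^sup>2 * s\<^sup>2" using pos by simp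
    ultimately show ?thesis using gap slope_le_mono[OF sl] unfolding s_def by auto
  qed
  thus ?thesis using XD[of n] unfolding regularizes_def \<kappa>_def X_def \<tau>_def by blast
qed

text \<open>
  Test the step from \<open>X j\<close> with \<open>Y (Suc j)\<close> and the step from \<open>Y j\<close> with \<open>X j\<close>. The mixed distance cancels
  and the energies telescope except for terms of size \<open>K * \<tau>\<close>, so the error is proportional to \<open>\<tau>\<close> instead of
  accumulating.
\<close>
lemma flow_contraction:
  assumes t: "0 < t" "16 * K * t \<le> 1" and n: "n > 0" and x: "x \<in> eff_dom g" and y: "y \<in> eff_dom g"
    and L: "0 \<le> L" "rv g x - rv g (flow (t / real n) n x) \<le> L" "rv g x - rv g (flow (t / real n) n y) \<le> L"
  shows "(1 - 4 * K * t) * (dist (flow (t / real n) n x) (flow (t / real n) n y))\<^sup>2 \<le>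
     (dist x y)\<^sup>2 + 2 * t * (L + K * t * L) / real n"
proof -
  define \<tau> where "\<tau> = t / real n"
  define q where "q = 1 - K * \<tau>"
  have Kt: "16 * (K * t) \<le> 1" using t by (simp add: ac_simps)
  have nt: "real n * \<tau> = t" using n by (simp add: \<tau>_def)
  have "\<tau> \<le> t" using n t by (simp add: \<tau>_def divide_le_eq mult_right_le_one_le mult_le_cancel_left1)
  hence "K * \<tau> \<le> K * t" using K by (intro mult_left_mono) auto
  hence \<tau>: "0 < \<tau>" "4 * K * \<tau> \<le> 1" using t n Kt by (auto simp: \<tau>_def)
  have q: "0 < q" "q \<le> 1" "\<And>j. 1 - real j * (K * \<tau>) \<le> q ^ j" unfolding q_def using step_factor[OF \<tau>] by auto
  define X where "X k = flow \<tau> k x" for k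
  define Y where "Y k = flow \<tau> k y" for k
  have XS: "X (Suc k) = resolvent \<tau> (X k)" "Y (Suc k) = resolvent \<tau> (Y k)" for k by (simp_all add: X_def Y_def)
  have XD: "X k \<in> eff_dom g" "Y k \<in> eff_dom g" for k unfolding X_def Y_def by (rule flow_dom[OF \<tau>], fact)+
  have Xdec: "rv g (X (Suc k)) \<le> rv g (X k)" "rv g (Y (Suc k)) \<le> rv g (Y k)" for k
  proof -
    have *: "rv g (resolvent \<tau> w) \<le> rv g w" if w: "w \<in> eff_dom g" for w
    proof -
      have "0 \<le> (2 - K * \<tau>) * (dist w (resolvent \<tau> w))\<^sup>2" using q(1) by (simp add: q_def)
      hence "0 \<le> 2 * \<tau> * (rv g w - rv g (resolvent \<tau> w))" using resolvent_descent[OF \<tau> w] by linarith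
      thus ?thesis using \<tau>(1) by (simp add: zero_le_mult_iff)
    qed
    show "rv g (X (Suc k)) \<le> rv g (X k)" "rv g (Y (Suc k)) \<le> rv g (Y k)" unfolding XS by (intro * XD)+
  qed
  have Xmono: "rv g (X j) \<le> rv g (X i)" "rv g (Y j) \<le> rv g (Y i)" if "i \<le> j" for i j
    using that by (auto intro: lift_Suc_antimono_le[of "\<lambda>k. rv g (X k)"] lift_Suc_antimono_le[of "\<lambda>k. rv g (Y k)"] Xdec)
  have claim: "q ^ (2 * j) * (dist (X j) (Y j))\<^sup>2 \<le> (dist x y)\<^sup>2 + 2 * \<tau> * ((rv g x - rv g (X j)) + K * \<tau> * real j * L)"
    if "j \<le> n" for j
    using that
  proof (induction j)
    case 0
    thus ?case by (simp add: X_def Y_def)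
  next
    case (Suc j)
    define a where "a = rv g (X j) - rv g (X (Suc j))"
    define b where "b = rv g (X j) - rv g (Y (Suc j))"
    have a0: "0 \<le> a" using Xdec by (simp add: a_def)
    have bL: "b \<le> L" using Xmono(1)[of 0 j] Xmono(2)[of "Suc j" n] Suc.prems L(3)
      by (simp add: b_def X_def Y_def \<tau>_def)
    have 1: "q * (dist (X (Suc j)) (Y (Suc j)))\<^sup>2 - (dist (X j) (Y (Suc j)))\<^sup>2 \<le> 2 * \<tau> * (rv g (Y (Suc j)) - rv g (X (Suc j)))"
      using resolvent_EVI[OF \<tau> XD(1)[of j] XD(2)[of "Suc j"]] zero_le_power2[of "dist (X j) (resolvent \<tau> (X j))"]
      unfolding q_def XS(1) by linarith
    have 2: "q * (dist (Y (Suc j)) (X j))\<^sup>2 - (dist (Y j) (X j))\<^sup>2 \<le> 2 * \<tau> * (rv g (X j) - rv g (Y (Suc j)))"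
      using resolvent_EVI[OF \<tau> XD(2)[of j] XD(1)[of j]] zero_le_power2[of "dist (Y j) (resolvent \<tau> (Y j))"]
      unfolding q_def XS(2) by linarith
    have "q * (q * (dist (X (Suc j)) (Y (Suc j)))\<^sup>2 - (dist (X j) (Y (Suc j)))\<^sup>2) \<le> q * (2 * \<tau> * (rv g (Y (Suc j)) - rv g (X (Suc j))))"
      using 1 q(1) by (intro mult_left_mono) auto
    hence "q\<^sup>2 * (dist (X (Suc j)) (Y (Suc j)))\<^sup>2 - (dist (X j) (Y j))\<^sup>2 \<le>
        q * (2 * \<tau> * (rv g (Y (Suc j)) - rv g (X (Suc j)))) + 2 * \<tau> * (rv g (X j) - rv g (Y (Suc j)))"
      using 2 by (simp add: power2_eq_square algebra_simps dist_commute)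
    also have "\<dots> = 2 * \<tau> * (q * a + K * \<tau> * b)"
      by (simp only: a_def b_def q_def) (simp add: algebra_simps)
    also have "\<dots> \<le> 2 * \<tau> * (a + K * \<tau> * L)"
      using \<tau>(1) K q a0 bL by (intro mult_left_mono add_mono) (auto simp: mult_left_le_one_le)
    finally have 3: "q\<^sup>2 * (dist (X (Suc j)) (Y (Suc j)))\<^sup>2 - (dist (X j) (Y j))\<^sup>2 \<le> 2 * \<tau> * (a + K * \<tau> * L)" .
    have pos: "0 \<le> 2 * \<tau> * (a + K * \<tau> * L)" using \<tau>(1) K a0 L(1) by simp
    have "q ^ (2 * j) * (q\<^sup>2 * (dist (X (Suc j)) (Y (Suc j)))\<^sup>2 - (dist (X j) (Y j))\<^sup>2) \<le> q ^ (2 * j) * (2 * \<tau> * (a + K * \<tau> * L))"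
      using 3 q(1) by (intro mult_left_mono) auto
    also have "\<dots> \<le> 1 * (2 * \<tau> * (a + K * \<tau> * L))" using q pos by (intro mult_right_mono power_le_one) auto
    finally have "q ^ (2 * Suc j) * (dist (X (Suc j)) (Y (Suc j)))\<^sup>2 \<le> q ^ (2 * j) * (dist (X j) (Y j))\<^sup>2 + 2 * \<tau> * (a + K * \<tau> * L)"
      by (simp add: power2_eq_square algebra_simps)
    also have "\<dots> \<le> (dist x y)\<^sup>2 + 2 * \<tau> * ((rv g x - rv g (X j)) + K * \<tau> * real j * L) + 2 * \<tau> * (a + K * \<tau> * L)"
      using Suc by simp
    also have "\<dots> = (dist x y)\<^sup>2 + 2 * \<tau> * ((rv g x - rv g (X (Suc j))) + K * \<tau> * real (Suc j) * L)"
      by (simp add: a_def algebra_simps)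
    finally show ?case .
  qed
  have "1 - 4 * K * t \<le> q ^ (2 * n)"
  proof -
    have E: "real (2 * n) * (K * \<tau>) = 2 * K * t" unfolding nt[symmetric] by simp
    have "1 - 2 * K * t \<le> q ^ (2 * n)" using q(3)[of "2 * n"] unfolding E .
    moreover have "0 \<le> K * t" using K t by simp
    ultimately show ?thesis by (simp add: mult.assoc)
  qed
  hence "(1 - 4 * K * t) * (dist (X n) (Y n))\<^sup>2 \<le> q ^ (2 * n) * (dist (X n) (Y n))\<^sup>2" by (intro mult_right_mono) auto
  also have "\<dots> \<le> (dist x y)\<^sup>2 + 2 * \<tau> * ((rv g x - rv g (X n)) + K * \<tau> * real n * L)" by (rule claim) simp
  also have "\<dots> \<le> (dist x y)\<^sup>2 + 2 * \<tau> * (L + K * t * L)"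
  proof -
    have "rv g x - rv g (X n) \<le> L" using L(2) by (simp only: X_def \<tau>_def)
    moreover have "K * \<tau> * real n * L = K * t * L" unfolding nt[symmetric] by simp
    ultimately show ?thesis using \<tau>(1) by (intro add_left_mono mult_left_mono) auto
  qed
  also have "2 * \<tau> * (L + K * t * L) = 2 * t * (L + K * t * L) / real n" by (simp add: \<tau>_def)
  finally show ?thesis unfolding X_def Y_def \<tau>_def .
qed

end

context semiconvex begin

text \<open>
  All three properties hold for the iterates up to errors that vanish, and all three are closed, so a
  pointwise cluster point has them.
\<close>
lemma flow_maps:
  assumes t: "0 < t" "16 * K * t \<le> 1"
  obtains S where
    "\<And>x. x \<in> eff_dom g \<Longrightarrow> regularizes K g t x (S x)"
    "\<And>x y. x \<in> eff_dom g \<Longrightarrow> y \<in> eff_dom g \<Longrightarrow> (1 - 4 * K * t) * (dist (S x) (S y))\<^sup>2 \<le> (dist x y)\<^sup>2"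
    "\<And>q M. slope_le K g M q \<Longrightarrow> 0 \<le> M \<Longrightarrow> reach K g (2 * M) t q (S q)"
proof -
  \<comment> \<open>Outside the domain nothing is claimed; a constant value keeps the family pointwise compact.\<close>
  define T where "T n x = (if x \<in> eff_dom g then flow (t / real (Suc n)) (Suc n) x else x)" for n x
  have Treg: "regularizes K g t x (T n x)" if "x \<in> eff_dom g" for n x
    using flow_regularizes[OF t, of "Suc n" x] that by (simp only: T_def if_True zero_less_Suc)
  have Tdist: "dist (T n x) p \<le> 4 * t * M0 + 2 * dist x p" if "x \<in> eff_dom g" for n x
    by (rule regularizes_dist_slope(1)[OF t K Treg[OF that] base M0])
  have cpt: "\<exists>Q. compact Q \<and> (\<forall>n. T n x \<in> Q)" for x
  proof (cases "x \<in> eff_dom g")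
    case True
    have "compact (cball p (4 * t * M0 + 2 * dist x p))" using proper_space by (simp add: bounded_cball)
    thus ?thesis using Tdist[OF True] by (intro exI[of _ "cball p (4 * t * M0 + 2 * dist x p)"]) (auto simp: dist_commute)
  next
    case False
    thus ?thesis by (intro exI[of _ "{x}"]) (simp add: T_def)
  qed
  obtain G S where G: "G \<le> sequentially" "G \<noteq> bot" and S: "\<And>x. ((\<lambda>n. T n x) \<longlongrightarrow> S x) G"
    by (fact pointwise_cluster[OF sequentially_bot cpt])
  show ?thesis
  proof (rule that[of S])
    show "regularizes K g t x (S x)" if "x \<in> eff_dom g" for x
      by (rule regularizes_limit[OF t G(2) _ tendsto_const S]) (use Treg[OF that] in auto)
  next
    fix x y assume x: "x \<in> eff_dom g" and y: "y \<in> eff_dom g"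
    \<comment> \<open>The iterates of \<open>x\<close> and \<open>y\<close> remain in a ball around \<open>p\<close>, where \<open>g\<close> is bounded below; this bounds the energies in \<open>flow_contraction\<close>.\<close>
    define R where "R = max (4 * t * M0 + 2 * dist x p) (4 * t * M0 + 2 * dist y p)"
    define L where "L = max 0 (rv g x - (rv g p - M0 * R - K / 2 * R\<^sup>2))"
    have low: "rv g x - rv g (T n w) \<le> L" if w: "w = x \<or> w = y" for w n
    proof -
      have wD: "w \<in> eff_dom g" using w x y by blast
      have "dist p (T n w) \<le> R" using Tdist[OF wD, of n] w by (auto simp: R_def dist_commute)
      hence "M0 * dist p (T n w) \<le> M0 * R" "K / 2 * (dist p (T n w))\<^sup>2 \<le> K / 2 * R\<^sup>2"
        using M0 K by (auto intro!: mult_left_mono power_mono)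
      moreover have "T n w \<in> eff_dom g" using Treg[OF wD, of n] by (simp add: regularizes_def)
      ultimately have "rv g (T n w) \<ge> rv g p - M0 * R - K / 2 * R\<^sup>2" using lower_bound[of "T n w"] by linarith
      thus ?thesis by (simp add: L_def)
    qed
    have "(1 - 4 * K * t) * (dist (T n x) (T n y))\<^sup>2 \<le> (dist x y)\<^sup>2 + 2 * t * (L + K * t * L) * (1 / real (Suc n))" for n
      using flow_contraction[OF t, of "Suc n" x y L] low[of x n] low[of y n] x y by (simp add: T_def L_def)
    moreover have "((\<lambda>n. (dist x y)\<^sup>2 + 2 * t * (L + K * t * L) * (1 / real (Suc n))) \<longlongrightarrow> (dist x y)\<^sup>2 + 2 * t * (L + K * t * L) * 0) G"
      using tendsto_mono[OF G(1) LIMSEQ_inverse_real_of_nat]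
      by (intro tendsto_add tendsto_mult tendsto_const) (simp add: inverse_eq_divide)
    moreover have "((\<lambda>n. (1 - 4 * K * t) * (dist (T n x) (T n y))\<^sup>2) \<longlongrightarrow> (1 - 4 * K * t) * (dist (S x) (S y))\<^sup>2) G"
      by (intro tendsto_intros S)
    ultimately have "(1 - 4 * K * t) * (dist (S x) (S y))\<^sup>2 \<le> (dist x y)\<^sup>2 + 2 * t * (L + K * t * L) * 0"
      by (intro tendsto_le[OF G(2)]) auto
    thus "(1 - 4 * K * t) * (dist (S x) (S y))\<^sup>2 \<le> (dist x y)\<^sup>2" by simp
  next
    fix q M assume q: "slope_le K g M q" and M: "0 \<le> M"
    have qD: "q \<in> eff_dom g" by (rule slope_le_dom[OF q])
    have "reach K g (2 * M) t q (T n q)" for n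
    proof -
      define \<tau> where "\<tau> = t / real (Suc n)"
      have nt: "real (Suc n) * \<tau> = t" by (simp add: \<tau>_def)
      have Kt: "16 * (K * t) \<le> 1" using t by (simp add: ac_simps)
      have "\<tau> * 1 \<le> \<tau> * real (Suc n)" using t by (intro mult_left_mono) (auto simp: \<tau>_def)
      hence "\<tau> \<le> t" using nt by (simp add: mult.commute)
      hence "K * \<tau> \<le> K * t" using K by (intro mult_left_mono) auto
      hence \<tau>: "0 < \<tau>" "4 * K * \<tau> \<le> 1" using t Kt by (auto simp: \<tau>_def)
      note st = step_factor[OF \<tau>]
      have "real (Suc (Suc n)) * (K * \<tau>) \<le> (2 * real (Suc n)) * (K * \<tau>)" using K \<tau>(1) by (intro mult_right_mono) auto
      also have "\<dots> = 2 * (K * (real (Suc n) * \<tau>))" by simp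
      also have "\<dots> \<le> 1/2" using Kt unfolding nt by simp
      \<comment> \<open>The number of factors is at most twice the number of steps, so their product is at least \<open>1/2\<close>.\<close>
      finally have half: "1/2 \<le> (1 - K * \<tau>) ^ Suc (Suc n)" using st(3)[of "Suc (Suc n)"] by linarith
      have "M / (1 - K * \<tau>) ^ Suc (Suc n) \<le> M / (1/2)"
        using M half by (intro divide_left_mono mult_pos_pos) auto
      hence "M / (1 - K * \<tau>) ^ Suc (Suc n) \<le> 2 * M" by simp
      from reach_mono[OF flow_reach[OF \<tau> q M] this] have "reach K g (2 * M) (real (Suc n) * \<tau>) q (flow \<tau> (Suc n) q)" .
      hence "reach K g (2 * M) t q (flow \<tau> (Suc n) q)" unfolding nt .
      thus ?thesis using qD by (simp only: T_def \<tau>_def if_True)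
    qed
    thus "reach K g (2 * M) t q (S q)"
      using t M by (intro reach_limit[OF G(2) _ _ _ S]) auto
  qed
qed

text \<open>
  Points outside the domain are approximated from inside. The images stay in a compact set by the
  Lipschitz bound, and the properties again pass to a cluster point. Points of the domain are
  approximated by themselves, so that the map does not change there.
\<close>
lemma smoothing_maps:
  assumes t: "0 < t" "16 * K * t \<le> 1" and dense: "closure (eff_dom g) = UNIV"
  obtains S where "\<And>x. regularizes K g t x (S x)"
    "\<And>x y. (1 - 4 * K * t) * (dist (S x) (S y))\<^sup>2 \<le> (dist x y)\<^sup>2"
    "\<And>q M. slope_le K g M q \<Longrightarrow> 0 \<le> M \<Longrightarrow> reach K g (2 * M) t q (S q)"
proof -
  obtain S1 where S1: "\<And>x. x \<in> eff_dom g \<Longrightarrow> regularizes K g t x (S1 x)"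
    "\<And>x y. x \<in> eff_dom g \<Longrightarrow> y \<in> eff_dom g \<Longrightarrow> (1 - 4 * K * t) * (dist (S1 x) (S1 y))\<^sup>2 \<le> (dist x y)\<^sup>2"
    "\<And>q M. slope_le K g M q \<Longrightarrow> 0 \<le> M \<Longrightarrow> reach K g (2 * M) t q (S1 q)"
    by (fact flow_maps[OF t])
  have "\<exists>z. \<forall>x. z x \<in> eff_dom g \<and> dist (z x) x < 1 / real (Suc m) \<and> (x \<in> eff_dom g \<longrightarrow> z x = x)" for m
  proof (rule choice, rule allI)
    fix x
    have "x \<in> closure (eff_dom g)" using dense by simp
    moreover have "0 < 1 / real (Suc m)" by simp
    ultimately obtain z where "z \<in> eff_dom g" "dist z x < 1 / real (Suc m)"
      unfolding closure_approachable by blast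
    thus "\<exists>z. z \<in> eff_dom g \<and> dist z x < 1 / real (Suc m) \<and> (x \<in> eff_dom g \<longrightarrow> z = x)"
      by (cases "x \<in> eff_dom g") auto
  qed
  hence "\<exists>z. \<forall>m x. z m x \<in> eff_dom g \<and> dist (z m x) x < 1 / real (Suc m) \<and> (x \<in> eff_dom g \<longrightarrow> z m x = x)"
    by (rule choice[OF allI])
  then obtain z where z: "\<And>m x. z m x \<in> eff_dom g" "\<And>m x. dist (z m x) x < 1 / real (Suc m)"
    "\<And>m x. x \<in> eff_dom g \<Longrightarrow> z m x = x" by blast
  have zlim: "(\<lambda>m. z m x) \<longlonglongrightarrow> x" for x
  proof (rule metric_tendsto_imp_tendsto[OF LIMSEQ_inverse_real_of_nat])
    have "dist (z m x) x \<le> dist (inverse (real (Suc m))) 0" for m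
      using z(2)[where m = m and x = x] by (simp add: inverse_eq_divide)
    thus "\<forall>\<^sub>F m in sequentially. dist (z m x) x \<le> dist (inverse (real (Suc m))) 0"
      by (intro always_eventually allI)
  qed
  define \<kappa> where "\<kappa> = 1 - 4 * K * t"
  have "16 * (K * t) \<le> 1" using t by (simp add: ac_simps)
  hence \<kappa>: "3/4 \<le> \<kappa>" by (simp add: \<kappa>_def)
  have cpt: "\<exists>Q. compact Q \<and> (\<forall>m. S1 (z m x) \<in> Q)" for x
  proof (intro exI[of _ "cball (S1 (z 0 x)) 3"] conjI allI)
    show "compact (cball (S1 (z 0 x)) 3)" using proper_space by (simp add: bounded_cball)
    fix m
    have z1: "dist (z m x) x \<le> 1" for m
    proof -
      have "1 / real (Suc m) \<le> 1" by simp
      thus ?thesis using z(2)[where m = m and x = x] by linarith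
    qed
    have "dist (z 0 x) x \<le> 1" "dist (z m x) x \<le> 1" by (rule z1)+
    hence "dist (z 0 x) (z m x) \<le> 2" using dist_triangle2[of "z 0 x" "z m x" x] by (simp add: dist_commute)
    hence "(dist (z 0 x) (z m x))\<^sup>2 \<le> 2\<^sup>2" by (intro power_mono) auto
    hence "\<kappa> * (dist (S1 (z 0 x)) (S1 (z m x)))\<^sup>2 \<le> 4"
      using S1(2)[OF z(1) z(1), of 0 x m x] unfolding \<kappa>_def by simp
    moreover have "3/4 * (dist (S1 (z 0 x)) (S1 (z m x)))\<^sup>2 \<le> \<kappa> * (dist (S1 (z 0 x)) (S1 (z m x)))\<^sup>2"
      using \<kappa> by (intro mult_right_mono) auto
    ultimately have "(dist (S1 (z 0 x)) (S1 (z m x)))\<^sup>2 \<le> 3\<^sup>2" by simp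
    hence "dist (S1 (z 0 x)) (S1 (z m x)) \<le> 3" by (rule power2_le_imp_le) simp
    thus "S1 (z m x) \<in> cball (S1 (z 0 x)) 3" by simp
  qed
  obtain G S where G: "G \<le> sequentially" "G \<noteq> bot" and S: "\<And>x. ((\<lambda>m. S1 (z m x)) \<longlongrightarrow> S x) G"
    by (fact pointwise_cluster[OF sequentially_bot cpt])
  have zG: "((\<lambda>m. z m x) \<longlongrightarrow> x) G" for x by (rule tendsto_mono[OF G(1) zlim])
  have S_eq: "S x = S1 x" if "x \<in> eff_dom g" for x
  proof -
    have "((\<lambda>m. S1 x) \<longlongrightarrow> S x) G" using S[of x] z(3)[OF that] by simp
    thus ?thesis using G(2) by (simp add: tendsto_const_iff)
  qed
  show ?thesis
  proof (rule that[of S])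
    show "regularizes K g t x (S x)" for x
      by (rule regularizes_limit[OF t G(2) _ zG S]) (use S1(1)[OF z(1)] in auto)
    show "(1 - 4 * K * t) * (dist (S x) (S y))\<^sup>2 \<le> (dist x y)\<^sup>2" for x y
    proof (rule tendsto_le[OF G(2)])
      show "((\<lambda>m. (dist (z m x) (z m y))\<^sup>2) \<longlongrightarrow> (dist x y)\<^sup>2) G" by (intro tendsto_intros zG)
      show "((\<lambda>m. (1 - 4 * K * t) * (dist (S1 (z m x)) (S1 (z m y)))\<^sup>2) \<longlongrightarrow> (1 - 4 * K * t) * (dist (S x) (S y))\<^sup>2) G"
        by (intro tendsto_intros S)
      show "\<forall>\<^sub>F m in G. (1 - 4 * K * t) * (dist (S1 (z m x)) (S1 (z m y)))\<^sup>2 \<le> (dist (z m x) (z m y))\<^sup>2"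
        by (intro always_eventually allI S1(2) z(1))
    qed
    show "reach K g (2 * M) t q (S q)" if "slope_le K g M q" "0 \<le> M" for q M
      unfolding S_eq[OF slope_le_dom[OF that(1)]] by (rule S1(3)[OF that])
  qed
qed

end

section \<open>Gluing curves of bounded action\<close>

text \<open>
  A bound on kinetic plus slope energy on an interval \<open>{a..b}\<close>, expressed through a majorant \<open>m\<close> of the distances
  and a measurable bound \<open>\<sigma>\<close> of the slopes. Bounds of this kind can be concatenated without computing
  the metric derivative of the glued curve.
\<close>
definition action_le :: "('a::metric_space \<Rightarrow> ereal) \<Rightarrow> real \<Rightarrow> real \<Rightarrow> (real \<Rightarrow> 'a) \<Rightarrow> ennreal \<Rightarrow> bool" where
  "action_le g a b c E \<longleftrightarrow> (\<exists>m \<sigma>. m \<in> borel_measurable borel \<and> \<sigma> \<in> borel_measurable borel \<and>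
     (\<forall>s t. a \<le> s \<and> s \<le> t \<and> t \<le> b \<longrightarrow> ennreal (dist (c s) (c t)) \<le> (\<integral>\<^sup>+x\<in>{s..t}. m x \<partial>lborel)) \<and>
     (\<forall>t\<in>{a..b}. descending_slope g (c t) \<le> \<sigma> t) \<and>
     (\<integral>\<^sup>+x\<in>{a..b}. ((m x)\<^sup>2 + (\<sigma> x)\<^sup>2) \<partial>lborel) \<le> E)"

lemma action_leI:
  assumes "m \<in> borel_measurable borel" "\<sigma> \<in> borel_measurable borel"
    "\<And>s t. a \<le> s \<Longrightarrow> s \<le> t \<Longrightarrow> t \<le> b \<Longrightarrow> ennreal (dist (c s) (c t)) \<le> (\<integral>\<^sup>+x\<in>{s..t}. m x \<partial>lborel)"
    "\<And>t. a \<le> t \<Longrightarrow> t \<le> b \<Longrightarrow> descending_slope g (c t) \<le> \<sigma> t"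
    "(\<integral>\<^sup>+x\<in>{a..b}. ((m x)\<^sup>2 + (\<sigma> x)\<^sup>2) \<partial>lborel) \<le> E"
  shows "action_le g a b c E"
  unfolding action_le_def using assms by (intro exI[of _ m] exI[of _ \<sigma>]) auto

lemma action_leE:
  assumes "action_le g a b c E"
  obtains m \<sigma> where "m \<in> borel_measurable borel" "\<sigma> \<in> borel_measurable borel"
    "\<And>s t. a \<le> s \<Longrightarrow> s \<le> t \<Longrightarrow> t \<le> b \<Longrightarrow> ennreal (dist (c s) (c t)) \<le> (\<integral>\<^sup>+x\<in>{s..t}. m x \<partial>lborel)"
    "\<And>t. a \<le> t \<Longrightarrow> t \<le> b \<Longrightarrow> descending_slope g (c t) \<le> \<sigma> t"
    "(\<integral>\<^sup>+x\<in>{a..b}. ((m x)\<^sup>2 + (\<sigma> x)\<^sup>2) \<partial>lborel) \<le> E"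
proof -
  from assms[unfolded action_le_def] obtain m \<sigma> where A: "m \<in> borel_measurable borel \<and> \<sigma> \<in> borel_measurable borel \<and>
     (\<forall>s t. a \<le> s \<and> s \<le> t \<and> t \<le> b \<longrightarrow> ennreal (dist (c s) (c t)) \<le> (\<integral>\<^sup>+x\<in>{s..t}. m x \<partial>lborel)) \<and>
     (\<forall>t\<in>{a..b}. descending_slope g (c t) \<le> \<sigma> t) \<and>
     (\<integral>\<^sup>+x\<in>{a..b}. ((m x)\<^sup>2 + (\<sigma> x)\<^sup>2) \<partial>lborel) \<le> E" by (elim exE)
  show ?thesis by (rule that[of m \<sigma>]) (use A in auto)
qed

lemma set_nn_integral_split:
  fixes f1 f2 :: "real \<Rightarrow> ennreal"
  assumes [measurable]: "f1 \<in> borel_measurable borel" "f2 \<in> borel_measurable borel" and "s \<le> b" "b \<le> t"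
  shows "(\<integral>\<^sup>+x\<in>{s..t}. (if x \<le> b then f1 x else f2 x) \<partial>lborel) =
    (\<integral>\<^sup>+x\<in>{s..b}. f1 x \<partial>lborel) + (\<integral>\<^sup>+x\<in>{b..t}. f2 x \<partial>lborel)"
proof -
  have "(\<integral>\<^sup>+x\<in>{s..b}. f1 x \<partial>lborel) + (\<integral>\<^sup>+x\<in>{b..t}. f2 x \<partial>lborel) =
     (\<integral>\<^sup>+x. f1 x * indicator {s..b} x + f2 x * indicator {b..t} x \<partial>lborel)"
    by (intro nn_integral_add[symmetric]) auto
  also have "\<dots> = (\<integral>\<^sup>+x\<in>{s..t}. (if x \<le> b then f1 x else f2 x) \<partial>lborel)"
  proof (rule nn_integral_cong_AE)
    show "AE x in lborel. f1 x * indicator {s..b} x + f2 x * indicator {b..t} x =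
        (if x \<le> b then f1 x else f2 x) * indicator {s..t} x"
      using AE_lborel_neq[of b] by eventually_elim (use assms in \<open>auto simp: indicator_def\<close>)
  qed
  finally show ?thesis ..
qed

lemma action_le_concat:
  assumes 1: "action_le g a b c1 E1" and 2: "action_le g b e c2 E2" and ab: "a \<le> b" "b \<le> e" and eq: "c1 b = c2 b"
  shows "action_le g a e (\<lambda>t. if t \<le> b then c1 t else c2 t) (E1 + E2)"
proof -
  obtain m1 \<sigma>1 where A: "m1 \<in> borel_measurable borel" "\<sigma>1 \<in> borel_measurable borel"
    "\<And>s t. a \<le> s \<Longrightarrow> s \<le> t \<Longrightarrow> t \<le> b \<Longrightarrow> ennreal (dist (c1 s) (c1 t)) \<le> (\<integral>\<^sup>+x\<in>{s..t}. m1 x \<partial>lborel)"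
    "\<And>t. a \<le> t \<Longrightarrow> t \<le> b \<Longrightarrow> descending_slope g (c1 t) \<le> \<sigma>1 t"
    "(\<integral>\<^sup>+x\<in>{a..b}. ((m1 x)\<^sup>2 + (\<sigma>1 x)\<^sup>2) \<partial>lborel) \<le> E1" by (fact action_leE[OF 1])
  obtain m2 \<sigma>2 where B: "m2 \<in> borel_measurable borel" "\<sigma>2 \<in> borel_measurable borel"
    "\<And>s t. b \<le> s \<Longrightarrow> s \<le> t \<Longrightarrow> t \<le> e \<Longrightarrow> ennreal (dist (c2 s) (c2 t)) \<le> (\<integral>\<^sup>+x\<in>{s..t}. m2 x \<partial>lborel)"
    "\<And>t. b \<le> t \<Longrightarrow> t \<le> e \<Longrightarrow> descending_slope g (c2 t) \<le> \<sigma>2 t"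
    "(\<integral>\<^sup>+x\<in>{b..e}. ((m2 x)\<^sup>2 + (\<sigma>2 x)\<^sup>2) \<partial>lborel) \<le> E2" by (fact action_leE[OF 2])
  note [measurable] = A(1,2) B(1,2)
  let ?m = "\<lambda>x. if x \<le> b then m1 x else m2 x"
  let ?\<sigma> = "\<lambda>x. if x \<le> b then \<sigma>1 x else \<sigma>2 x"
  show ?thesis
  proof (rule action_leI[of ?m ?\<sigma>])
    show "?m \<in> borel_measurable borel" "?\<sigma> \<in> borel_measurable borel" by measurable
    fix s t assume st: "a \<le> s" "s \<le> t" "t \<le> e"
    consider "t \<le> b" | "s \<le> b" "b < t" | "b < s" by linarith
    thus "ennreal (dist (if s \<le> b then c1 s else c2 s) (if t \<le> b then c1 t else c2 t)) \<le> (\<integral>\<^sup>+x\<in>{s..t}. ?m x \<partial>lborel)"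
    proof cases
      case 1
      have "(\<integral>\<^sup>+x\<in>{s..t}. ?m x \<partial>lborel) = (\<integral>\<^sup>+x\<in>{s..t}. m1 x \<partial>lborel)"
        using 1 by (intro nn_integral_cong) (auto simp: indicator_def)
      thus ?thesis using A(3)[OF st(1,2) 1] 1 st by simp
    next
      case 2
      have "ennreal (dist (c1 s) (c2 t)) \<le> ennreal (dist (c1 s) (c1 b) + dist (c2 b) (c2 t))"
        by (intro ennreal_leI) (use eq dist_triangle[of "c1 s" "c2 t" "c1 b"] in simp)
      also have "\<dots> = ennreal (dist (c1 s) (c1 b)) + ennreal (dist (c2 b) (c2 t))" by (simp add: ennreal_plus)
      also have "\<dots> \<le> (\<integral>\<^sup>+x\<in>{s..b}. m1 x \<partial>lborel) + (\<integral>\<^sup>+x\<in>{b..t}. m2 x \<partial>lborel)"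
        using A(3)[of s b] B(3)[of b t] 2 st by (intro add_mono) auto
      also have "\<dots> = (\<integral>\<^sup>+x\<in>{s..t}. ?m x \<partial>lborel)"
        using 2 by (intro set_nn_integral_split[symmetric]) auto
      finally show ?thesis using 2 by simp
    next
      case 3
      have "(\<integral>\<^sup>+x\<in>{s..t}. ?m x \<partial>lborel) = (\<integral>\<^sup>+x\<in>{s..t}. m2 x \<partial>lborel)"
        using 3 by (intro nn_integral_cong) (auto simp: indicator_def)
      thus ?thesis using B(3)[of s t] 3 st by simp
    qed
  next
    fix t assume "a \<le> t" "t \<le> e"
    thus "descending_slope g (if t \<le> b then c1 t else c2 t) \<le> ?\<sigma> t" using A(4)[of t] B(4)[of t] by simp
  next
    have "(\<integral>\<^sup>+x\<in>{a..e}. ((?m x)\<^sup>2 + (?\<sigma> x)\<^sup>2) \<partial>lborel) =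
       (\<integral>\<^sup>+x\<in>{a..e}. (if x \<le> b then (m1 x)\<^sup>2 + (\<sigma>1 x)\<^sup>2 else (m2 x)\<^sup>2 + (\<sigma>2 x)\<^sup>2) \<partial>lborel)"
      by (intro nn_integral_cong) auto
    also have "\<dots> = (\<integral>\<^sup>+x\<in>{a..b}. ((m1 x)\<^sup>2 + (\<sigma>1 x)\<^sup>2) \<partial>lborel) + (\<integral>\<^sup>+x\<in>{b..e}. ((m2 x)\<^sup>2 + (\<sigma>2 x)\<^sup>2) \<partial>lborel)"
      using ab by (intro set_nn_integral_split) auto
    also have "\<dots> \<le> E1 + E2" by (rule add_mono[OF A(5) B(5)])
    finally show "(\<integral>\<^sup>+x\<in>{a..e}. ((?m x)\<^sup>2 + (?\<sigma> x)\<^sup>2) \<partial>lborel) \<le> E1 + E2" .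
  qed
qed

lemma set_nn_integral_affine:
  fixes f :: "real \<Rightarrow> ennreal"
  assumes [measurable]: "f \<in> borel_measurable borel" and \<beta>: "\<beta> > 0"
  shows "(\<integral>\<^sup>+x\<in>{s..t}. f ((x - \<alpha>) / \<beta>) \<partial>lborel) = ennreal \<beta> * (\<integral>\<^sup>+y\<in>{(s - \<alpha>) / \<beta>..(t - \<alpha>) / \<beta>}. f y \<partial>lborel)"
proof -
  have "(\<integral>\<^sup>+x\<in>{s..t}. f ((x - \<alpha>) / \<beta>) \<partial>lborel) =
      ennreal \<bar>\<beta>\<bar> * (\<integral>\<^sup>+y. f ((\<alpha> + \<beta> * y - \<alpha>) / \<beta>) * indicator {s..t} (\<alpha> + \<beta> * y) \<partial>lborel)"
    using \<beta> by (intro nn_integral_real_affine) auto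
  also have "(\<integral>\<^sup>+y. f ((\<alpha> + \<beta> * y - \<alpha>) / \<beta>) * indicator {s..t} (\<alpha> + \<beta> * y) \<partial>lborel) =
      (\<integral>\<^sup>+y\<in>{(s - \<alpha>) / \<beta>..(t - \<alpha>) / \<beta>}. f y \<partial>lborel)"
    using \<beta> by (intro nn_integral_cong) (auto simp: indicator_def field_simps)
  finally show ?thesis using \<beta> by simp
qed

lemma set_nn_integral_reflect:
  fixes f :: "real \<Rightarrow> ennreal"
  assumes [measurable]: "f \<in> borel_measurable borel"
  shows "(\<integral>\<^sup>+x\<in>{s..t}. f (r - x) \<partial>lborel) = (\<integral>\<^sup>+y\<in>{r - t..r - s}. f y \<partial>lborel)"
proof -
  have "(\<integral>\<^sup>+x\<in>{s..t}. f (r - x) \<partial>lborel) =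
      ennreal \<bar>-1\<bar> * (\<integral>\<^sup>+y. f (r - (r + (-1) * y)) * indicator {s..t} (r + (-1) * y) \<partial>lborel)"
    by (intro nn_integral_real_affine) auto
  also have "(\<integral>\<^sup>+y. f (r - (r + (-1) * y)) * indicator {s..t} (r + (-1) * y) \<partial>lborel) =
      (\<integral>\<^sup>+y\<in>{r - t..r - s}. f y \<partial>lborel)"
    by (intro nn_integral_cong) (auto simp: indicator_def)
  finally show ?thesis by simp
qed

lemma action_le_reverse:
  assumes 1: "action_le g 0 T b E"
  shows "action_le g (r - T) r (\<lambda>t. b (r - t)) E"
proof -
  obtain m \<sigma> where A: "m \<in> borel_measurable borel" "\<sigma> \<in> borel_measurable borel"
    "\<And>s t. 0 \<le> s \<Longrightarrow> s \<le> t \<Longrightarrow> t \<le> T \<Longrightarrow> ennreal (dist (b s) (b t)) \<le> (\<integral>\<^sup>+x\<in>{s..t}. m x \<partial>lborel)"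
    "\<And>t. 0 \<le> t \<Longrightarrow> t \<le> T \<Longrightarrow> descending_slope g (b t) \<le> \<sigma> t"
    "(\<integral>\<^sup>+x\<in>{0..T}. ((m x)\<^sup>2 + (\<sigma> x)\<^sup>2) \<partial>lborel) \<le> E" by (fact action_leE[OF 1])
  note [measurable] = A(1,2)
  show ?thesis
  proof (rule action_leI[of "\<lambda>x. m (r - x)" "\<lambda>x. \<sigma> (r - x)"])
    show "(\<lambda>x. m (r - x)) \<in> borel_measurable borel" "(\<lambda>x. \<sigma> (r - x)) \<in> borel_measurable borel" by measurable
    show "ennreal (dist (b (r - s)) (b (r - t))) \<le> (\<integral>\<^sup>+x\<in>{s..t}. m (r - x) \<partial>lborel)"
      if "r - T \<le> s" "s \<le> t" "t \<le> r" for s t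
      using A(3)[of "r - t" "r - s"] that by (simp add: set_nn_integral_reflect dist_commute)
    show "descending_slope g (b (r - t)) \<le> \<sigma> (r - t)" if "r - T \<le> t" "t \<le> r" for t
      using A(4)[of "r - t"] that by simp
    show "(\<integral>\<^sup>+x\<in>{r - T..r}. ((m (r - x))\<^sup>2 + (\<sigma> (r - x))\<^sup>2) \<partial>lborel) \<le> E"
    proof -
      have "(\<integral>\<^sup>+x\<in>{r - T..r}. ((m (r - x))\<^sup>2 + (\<sigma> (r - x))\<^sup>2) \<partial>lborel) =
          (\<integral>\<^sup>+y\<in>{r - r..r - (r - T)}. ((m y)\<^sup>2 + (\<sigma> y)\<^sup>2) \<partial>lborel)"
        by (rule set_nn_integral_reflect[where f = "\<lambda>x. (m x)\<^sup>2 + (\<sigma> x)\<^sup>2"]) measurable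
      thus ?thesis using A(5) by simp
    qed
  qed
qed

lemma action_le_Lipschitz:
  assumes C: "0 \<le> C1" "0 \<le> C2" "a \<le> b"
    and lip: "\<And>s t. a \<le> s \<Longrightarrow> s \<le> t \<Longrightarrow> t \<le> b \<Longrightarrow> dist (c s) (c t) \<le> C1 * (t - s)"
    and sl: "\<And>t. a \<le> t \<Longrightarrow> t \<le> b \<Longrightarrow> descending_slope g (c t) \<le> ennreal C2"
  shows "action_le g a b c (ennreal ((b - a) * (C1\<^sup>2 + C2\<^sup>2)))"
proof (rule action_leI[of "\<lambda>_. ennreal C1" "\<lambda>_. ennreal C2"])
  fix s t assume st: "a \<le> s" "s \<le> t" "t \<le> b"
  have "ennreal (dist (c s) (c t)) \<le> ennreal (C1 * (t - s))" using lip[OF st] by (rule ennreal_leI)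
  also have "\<dots> = (\<integral>\<^sup>+x\<in>{s..t}. ennreal C1 \<partial>lborel)"
    using C st by (subst nn_integral_cmult_indicator) (auto simp: ennreal_mult)
  finally show "ennreal (dist (c s) (c t)) \<le> (\<integral>\<^sup>+x\<in>{s..t}. ennreal C1 \<partial>lborel)" .
next
  have "(ennreal C1)\<^sup>2 + (ennreal C2)\<^sup>2 = ennreal (C1\<^sup>2 + C2\<^sup>2)" using C by (simp add: ennreal_power ennreal_plus)
  hence "(\<integral>\<^sup>+x\<in>{a..b}. ((ennreal C1)\<^sup>2 + (ennreal C2)\<^sup>2) \<partial>lborel) = ennreal (C1\<^sup>2 + C2\<^sup>2) * ennreal (b - a)"
    using C by (subst nn_integral_cmult_indicator) auto
  moreover have "ennreal (C1\<^sup>2 + C2\<^sup>2) * ennreal (b - a) = ennreal ((b - a) * (C1\<^sup>2 + C2\<^sup>2))"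
    using C by (subst ennreal_mult[symmetric]) (auto simp: mult.commute)
  ultimately show "(\<integral>\<^sup>+x\<in>{a..b}. ((ennreal C1)\<^sup>2 + (ennreal C2)\<^sup>2) \<partial>lborel) \<le> ennreal ((b - a) * (C1\<^sup>2 + C2\<^sup>2))"
    by (simp only: order_refl)
qed (use sl in auto)

text \<open>
  The Cauchy--Schwarz inequality makes \<open>m\<close> integrable, and \<open>kinetic_le_majorant\<close> compares \<open>m\<close> with the metric
  derivative.
\<close>
lemma Theta_le_action:
  assumes act: "action_le g 0 1 c (ennreal E)" and sm: "descending_slope g \<in> borel_measurable borel"
  shows "Theta g (c 0) (c 1) c \<le> ennreal E" "continuous_on {0..1} c"
proof -
  obtain m \<sigma> where A: "m \<in> borel_measurable borel" "\<sigma> \<in> borel_measurable borel"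
    "\<And>s t. 0 \<le> s \<Longrightarrow> s \<le> t \<Longrightarrow> t \<le> 1 \<Longrightarrow> ennreal (dist (c s) (c t)) \<le> (\<integral>\<^sup>+x\<in>{s..t}. m x \<partial>lborel)"
    "\<And>t. 0 \<le> t \<Longrightarrow> t \<le> 1 \<Longrightarrow> descending_slope g (c t) \<le> \<sigma> t"
    "(\<integral>\<^sup>+x\<in>{0..1}. ((m x)\<^sup>2 + (\<sigma> x)\<^sup>2) \<partial>lborel) \<le> ennreal E" by (fact action_leE[OF act])
  note [measurable] = A(1,2)
  have m: "majorant m c" using A(1,3) by (auto simp: majorant_def)
  have split: "(\<integral>\<^sup>+x\<in>{0..1}. ((m x)\<^sup>2 + (\<sigma> x)\<^sup>2) \<partial>lborel) =
      (\<integral>\<^sup>+x\<in>{0..1}. (m x)\<^sup>2 \<partial>lborel) + (\<integral>\<^sup>+x\<in>{0..1}. (\<sigma> x)\<^sup>2 \<partial>lborel)"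
    by (subst nn_integral_add[symmetric]) (auto intro!: nn_integral_cong simp: distrib_right)
  have "(\<integral>\<^sup>+x\<in>{0..1}. (m x)\<^sup>2 \<partial>lborel) \<le> ennreal E"
    using A(5) unfolding split by (rule order_trans[rotated]) simp
  hence "(\<integral>\<^sup>+x\<in>{0..1}. m x \<partial>lborel)\<^sup>2 \<le> ennreal E"
    using set_nn_integral_Cauchy_Schwarz[of m lborel "{0..1}"] by simp
  hence "(\<integral>\<^sup>+x\<in>{0..1}. m x \<partial>lborel)\<^sup>2 < \<infinity>" by (rule le_less_trans) simp
  hence "(\<integral>\<^sup>+x\<in>{0..1}. m x \<partial>lborel) < \<infinity>" by (simp add: power_less_top_ennreal)
  hence ac: "abs_cont_curve c" by (rule abs_cont_curveI[OF m])
  have "Theta g (c 0) (c 1) c = kinetic c + slope_energy g c" by (rule Theta_eq[OF ac refl refl sm])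
  also have "\<dots> \<le> (\<integral>\<^sup>+x\<in>{0..1}. (m x)\<^sup>2 \<partial>lborel) + (\<integral>\<^sup>+x\<in>{0..1}. (\<sigma> x)\<^sup>2 \<partial>lborel)"
    unfolding slope_energy_def using A(4)
    by (intro add_mono kinetic_le_majorant[OF ac m] nn_integral_mono) (auto simp: indicator_def intro!: power_mono)
  also have "\<dots> \<le> ennreal E" using A(5) by (simp add: split)
  finally show "Theta g (c 0) (c 1) c \<le> ennreal E" .
  have "continuous_on {0..1} (\<lambda>t. c (clamp01 t))"
    by (rule continuous_on_subset[OF abs_cont_curve_continuous[OF ac]]) simp
  thus "continuous_on {0..1} c" by (rule continuous_on_eq) (simp add: clamp01_id)
qed

text \<open>
  During \<open>{0..\<epsilon>}\<close> follow the flow from \<open>q\<close> to \<open>S q\<close>; during \<open>{\<epsilon>..2 * \<epsilon>}\<close> follow the image under \<open>S\<close> of a geodesic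
  from \<open>q\<close> to \<open>x\<close>, along which \<open>regularizes_dist_slope\<close> bounds the slopes. For \<open>q\<close> close to \<open>x\<close> the action is
  close to \<open>12 * C\<^sup>2 * \<epsilon>\<close>. The last property keeps the curve near \<open>x\<close>.
\<close>
lemma connector:
  fixes g :: "'a::metric_space \<Rightarrow> ereal"
  assumes K: "K > 0" and t: "0 < \<epsilon>" "16 * K * \<epsilon> \<le> 1" and ni: "\<forall>x. g x \<noteq> -\<infinity>"
    and geo: "\<forall>x y::'a. \<exists>\<gamma>. constant_speed_geodesic \<gamma> \<and> \<gamma> 0 = x \<and> \<gamma> 1 = y"
    and reg: "\<And>x. regularizes K g \<epsilon> x (S x)" and lip: "\<And>x y. dist (S x) (S y) \<le> 2 * dist x y"
    and q: "slope_le K g C q" and C: "0 \<le> C" and rq: "reach K g (2 * C) \<epsilon> q (S q)"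
  obtains b where "b 0 = q" "b (2 * \<epsilon>) = S x"
    "action_le g 0 (2 * \<epsilon>) b (ennreal (\<epsilon> * (8 * C\<^sup>2 + ((2 * dist q x / \<epsilon>)\<^sup>2 + (2 * C + 2 * dist q x / \<epsilon>)\<^sup>2))))"
    "\<And>s. 0 \<le> s \<Longrightarrow> s \<le> 2 * \<epsilon> \<Longrightarrow> dist (b s) q \<le> 2 * C * \<epsilon> \<or> (\<exists>y. b s = S y \<and> dist y x \<le> dist q x)"
proof -
  obtain c where c: "c 0 = q" "c \<epsilon> = S q" "\<And>s t. 0 \<le> s \<Longrightarrow> s \<le> t \<Longrightarrow> t \<le> \<epsilon> \<Longrightarrow> dist (c s) (c t) \<le> (2 * C) * (t - s)"
    "\<And>s. 0 \<le> s \<Longrightarrow> s \<le> \<epsilon> \<Longrightarrow> slope_le K g (2 * C) (c s)" by (fact reachE[OF rq])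
  obtain \<gamma> where \<gamma>: "constant_speed_geodesic \<gamma>" "\<gamma> 0 = q" "\<gamma> 1 = x" using geo by blast
  have g: "dist (\<gamma> s) (\<gamma> t) = \<bar>s - t\<bar> * dist q x" if "s \<in> {0..1}" "t \<in> {0..1}" for s t
    using \<gamma>(1)[unfolded constant_speed_geodesic_def, rule_format, OF that] \<gamma>(2,3) by simp
  define a where "a s = S (\<gamma> ((s - \<epsilon>) / \<epsilon>))" for s
  have in01: "(s - \<epsilon>) / \<epsilon> \<in> {0..1}" if "\<epsilon> \<le> s" "s \<le> 2 * \<epsilon>" for s using that t by (simp add: divide_le_eq)
  have 1: "action_le g 0 \<epsilon> c (ennreal ((\<epsilon> - 0) * ((2 * C)\<^sup>2 + (2 * C)\<^sup>2)))"
    using C t c(3,4) slope_le_imp_descending_slope_le[OF _ _ _ ni, of K "2 * C"] K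
    by (intro action_le_Lipschitz) auto
  have 2: "action_le g \<epsilon> (2 * \<epsilon>) a (ennreal ((2 * \<epsilon> - \<epsilon>) * ((2 * dist q x / \<epsilon>)\<^sup>2 + (2 * C + 2 * dist q x / \<epsilon>)\<^sup>2)))"
  proof (rule action_le_Lipschitz)
    fix s r assume sr: "\<epsilon> \<le> s" "s \<le> r" "r \<le> 2 * \<epsilon>"
    have "dist (a s) (a r) \<le> 2 * dist (\<gamma> ((s - \<epsilon>) / \<epsilon>)) (\<gamma> ((r - \<epsilon>) / \<epsilon>))" unfolding a_def by (rule lip)
    also have "\<dots> = 2 * (\<bar>(s - \<epsilon>) / \<epsilon> - (r - \<epsilon>) / \<epsilon>\<bar> * dist q x)" 
    proof -
      have "dist (\<gamma> ((s - \<epsilon>) / \<epsilon>)) (\<gamma> ((r - \<epsilon>) / \<epsilon>)) = \<bar>(s - \<epsilon>) / \<epsilon> - (r - \<epsilon>) / \<epsilon>\<bar> * dist q x"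
        by (intro g in01) (use sr in linarith)+
      thus ?thesis by (simp only:)
    qed
    also have "(s - \<epsilon>) / \<epsilon> - (r - \<epsilon>) / \<epsilon> = - ((r - s) / \<epsilon>)" by (simp add: diff_divide_distrib)
    also have "2 * (\<bar>- ((r - s) / \<epsilon>)\<bar> * dist q x) = 2 * dist q x / \<epsilon> * (r - s)" using sr t by simp
    finally show "dist (a s) (a r) \<le> 2 * dist q x / \<epsilon> * (r - s)" .
  next
    fix s assume s: "\<epsilon> \<le> s" "s \<le> 2 * \<epsilon>"
    let ?y = "\<gamma> ((s - \<epsilon>) / \<epsilon>)"
    have "dist ?y q = \<bar>(s - \<epsilon>) / \<epsilon> - 0\<bar> * dist q x" using g[OF in01[OF s], of 0] \<gamma>(2) by simp
    also have "\<dots> \<le> 1 * dist q x" using in01[OF s] by (intro mult_right_mono) auto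
    finally have y: "dist ?y q \<le> dist q x" by simp
    have "slope_le K g (2 * C + 2 * dist ?y q / \<epsilon>) (a s)"
      unfolding a_def by (rule regularizes_dist_slope(2)[OF t K reg q C])
    moreover have "2 * C + 2 * dist ?y q / \<epsilon> \<le> 2 * C + 2 * dist q x / \<epsilon>"
      using y t by (intro add_left_mono divide_right_mono mult_left_mono) auto
    ultimately have "slope_le K g (2 * C + 2 * dist q x / \<epsilon>) (a s)" by (rule slope_le_mono)
    thus "descending_slope g (a s) \<le> ennreal (2 * C + 2 * dist q x / \<epsilon>)"
      by (rule slope_le_imp_descending_slope_le[OF _ _ _ ni]) (use C t K in auto)
  qed (use C t in auto)
  have a\<epsilon>: "a \<epsilon> = S q" by (simp add: a_def \<gamma>(2))
  have "action_le g 0 (2 * \<epsilon>) (\<lambda>s. if s \<le> \<epsilon> then c s else a s)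
     (ennreal ((\<epsilon> - 0) * ((2 * C)\<^sup>2 + (2 * C)\<^sup>2)) + ennreal ((2 * \<epsilon> - \<epsilon>) * ((2 * dist q x / \<epsilon>)\<^sup>2 + (2 * C + 2 * dist q x / \<epsilon>)\<^sup>2)))"
    using t c(2) a\<epsilon> by (intro action_le_concat[OF 1 2]) auto
  also have "ennreal ((\<epsilon> - 0) * ((2 * C)\<^sup>2 + (2 * C)\<^sup>2)) + ennreal ((2 * \<epsilon> - \<epsilon>) * ((2 * dist q x / \<epsilon>)\<^sup>2 + (2 * C + 2 * dist q x / \<epsilon>)\<^sup>2))
    = ennreal (\<epsilon> * (8 * C\<^sup>2 + ((2 * dist q x / \<epsilon>)\<^sup>2 + (2 * C + 2 * dist q x / \<epsilon>)\<^sup>2)))"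
    using t by (subst ennreal_plus[symmetric]) (auto simp: power_mult_distrib distrib_left)
  finally have act: "action_le g 0 (2 * \<epsilon>) (\<lambda>s. if s \<le> \<epsilon> then c s else a s)
    (ennreal (\<epsilon> * (8 * C\<^sup>2 + ((2 * dist q x / \<epsilon>)\<^sup>2 + (2 * C + 2 * dist q x / \<epsilon>)\<^sup>2))))" .
  show ?thesis
  proof (rule that[OF _ _ act])
    show "(if 0 \<le> \<epsilon> then c 0 else a 0) = q" using t c(1) by simp
    have "(2 * \<epsilon> - \<epsilon>) / \<epsilon> = 1" using t by simp
    hence "a (2 * \<epsilon>) = S x" unfolding a_def by (simp only: \<gamma>(3))
    thus "(if 2 * \<epsilon> \<le> \<epsilon> then c (2 * \<epsilon>) else a (2 * \<epsilon>)) = S x" using t by simp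
    fix s assume s: "0 \<le> s" "s \<le> 2 * \<epsilon>"
    show "dist (if s \<le> \<epsilon> then c s else a s) q \<le> 2 * C * \<epsilon> \<or> (\<exists>y. (if s \<le> \<epsilon> then c s else a s) = S y \<and> dist y x \<le> dist q x)"
    proof (cases "s \<le> \<epsilon>")
      case True
      have "dist (c 0) (c s) \<le> 2 * C * (s - 0)" using c(3)[of 0 s] s True by simp
      also have "\<dots> \<le> 2 * C * \<epsilon>" using C True by (intro mult_left_mono) auto
      finally show ?thesis using True c(1) by (simp add: dist_commute)
    next
      case False
      let ?u = "(s - \<epsilon>) / \<epsilon>"
      have u: "?u \<in> {0..1}" using in01 s False by simp
      have "dist (\<gamma> ?u) x = \<bar>?u - 1\<bar> * dist q x" using g[OF u, of 1] \<gamma>(3) by simp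
      also have "\<dots> \<le> 1 * dist q x" using u by (intro mult_right_mono) auto
      finally have "dist (\<gamma> ?u) x \<le> dist q x" by simp
      thus ?thesis using False by (auto simp: a_def)
    qed
  qed
qed

text \<open>
  The map \<open>S\<close> is \<open>1 / sqrt k\<close>-Lipschitz, and running through \<open>c\<close> in time \<open>\<beta>\<close> multiplies the kinetic energy by
  \<open>1 / \<beta>\<close> and the slope energy by \<open>\<beta> \<le> 1\<close>.
\<close>
lemma action_le_smoothed:
  fixes c :: "real \<Rightarrow> 'a::metric_space"
  assumes ac: "abs_cont_curve c" and k: "0 < k" and \<beta>: "0 < \<beta>" "\<beta> \<le> 1"
    and lip: "\<And>x y. k * (dist (S x) (S y))\<^sup>2 \<le> (dist x y)\<^sup>2"
    and sm: "descending_slope g \<in> borel_measurable borel"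
  shows "action_le g \<alpha> (\<alpha> + \<beta>) (\<lambda>t. S (c ((t - \<alpha>) / \<beta>)))
    (ennreal (1 / (k * \<beta>)) * kinetic c + slope_energy g (\<lambda>t. S (c t)))"
proof -
  obtain w :: "real \<Rightarrow> real" where w: "w \<in> borel_measurable borel" "\<And>t. 0 \<le> w t"
    "majorant (\<lambda>t. ennreal (w t)) c" "(\<integral>\<^sup>+t. ennreal (w t) \<partial>lborel) < \<infinity>" and
    wae: "AE t in lborel. t \<in> {0<..<1} \<longrightarrow> metric_derivative c t = w t" and
    wk: "kinetic c = (\<integral>\<^sup>+t\<in>{0..1}. (ennreal (w t))\<^sup>2 \<partial>lborel)"
    by (fact speed_majorant[OF ac])
  note [measurable] = w(1)
  define l where "l = 1 / sqrt k"
  have l: "0 < l" "l\<^sup>2 = 1 / k" using k by (auto simp: l_def power_divide)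
  have lipl: "dist (S x) (S y) \<le> l * dist x y" for x y
  proof -
    have "(dist (S x) (S y))\<^sup>2 \<le> (l * dist x y)\<^sup>2" using lip[of x y] k by (simp add: power_mult_distrib l(2) field_simps)
    thus ?thesis by (rule power2_le_imp_le) (use l(1) in simp)
  qed
  have cont: "continuous_on UNIV (\<lambda>t. c (clamp01 t))" by (rule abs_cont_curve_continuous[OF ac])
  have "continuous_on UNIV (\<lambda>t. S (c (clamp01 t)))"
    unfolding continuous_on_iff
  proof (intro ballI allI impI)
    fix x e :: real assume "e > 0"
    hence "e / l > 0" using l by simp
    then obtain d where d: "d > 0" "\<And>x'. dist x' x < d \<Longrightarrow> dist (c (clamp01 x')) (c (clamp01 x)) < e / l"
      using cont[unfolded continuous_on_iff] by blast
    have "dist (S (c (clamp01 x'))) (S (c (clamp01 x))) < e" if "dist x' x < d" for x'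
    proof -
      have "l * dist (c (clamp01 x')) (c (clamp01 x)) < e" using d(2)[OF that] l(1) by (simp add: field_simps)
      thus ?thesis using lipl[of "c (clamp01 x')" "c (clamp01 x)"] by linarith
    qed
    thus "\<exists>d>0. \<forall>x'\<in>UNIV. dist x' x < d \<longrightarrow> dist (S (c (clamp01 x'))) (S (c (clamp01 x))) < e" using d(1) by blast
  qed
  note [measurable] = measurable_compose[OF borel_measurable_continuous_onI[OF this] sm]
  let ?u = "\<lambda>t. (t - \<alpha>) / \<beta>"
  let ?m = "\<lambda>t. ennreal (l / \<beta>) * ennreal (w (?u t))"
  let ?\<sigma> = "\<lambda>t. descending_slope g (S (c (clamp01 (?u t))))"
  show ?thesis
  proof (rule action_leI[of ?m ?\<sigma>])
    show "?m \<in> borel_measurable borel" by measurable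
    show "?\<sigma> \<in> borel_measurable borel" by measurable
    fix s t assume st: "\<alpha> \<le> s" "s \<le> t" "t \<le> \<alpha> + \<beta>"
    have u: "0 \<le> ?u s" "?u s \<le> ?u t" "?u t \<le> 1" using st \<beta> by (auto simp: divide_right_mono divide_le_eq)
    have "ennreal (dist (S (c (?u s))) (S (c (?u t)))) \<le> ennreal l * ennreal (dist (c (?u s)) (c (?u t)))"
      using lipl[of "c (?u s)" "c (?u t)"] l(1) by (subst ennreal_mult[symmetric]) (auto intro: ennreal_leI)
    also have "\<dots> \<le> ennreal l * (\<integral>\<^sup>+x\<in>{?u s..?u t}. ennreal (w x) \<partial>lborel)"
      by (intro mult_left_mono majorantD[OF w(3)] u) auto
    also have "\<dots> = ennreal (l / \<beta>) * (ennreal \<beta> * (\<integral>\<^sup>+x\<in>{?u s..?u t}. ennreal (w x) \<partial>lborel))"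
      using l \<beta> by (simp add: mult.assoc[symmetric] ennreal_mult[symmetric])
    also have "\<dots> = ennreal (l / \<beta>) * (\<integral>\<^sup>+x\<in>{s..t}. ennreal (w (?u x)) \<partial>lborel)"
      by (subst set_nn_integral_affine[where f = "\<lambda>x. ennreal (w x)", OF _ \<beta>(1)]) auto
    also have "\<dots> = (\<integral>\<^sup>+x\<in>{s..t}. ?m x \<partial>lborel)"
      by (subst nn_integral_cmult[symmetric]) (auto simp: mult.assoc)
    finally show "ennreal (dist (S (c (?u s))) (S (c (?u t)))) \<le> (\<integral>\<^sup>+x\<in>{s..t}. ?m x \<partial>lborel)" .
  next
    fix t assume "\<alpha> \<le> t" "t \<le> \<alpha> + \<beta>"
    hence "?u t \<in> {0..1}" using \<beta> by (simp add: divide_le_eq)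
    thus "descending_slope g (S (c (?u t))) \<le> ?\<sigma> t" by (simp add: clamp01_id)
  next
    define I where "I = (\<integral>\<^sup>+x\<in>{0..1}. (descending_slope g (S (c (clamp01 x))))\<^sup>2 \<partial>lborel)"
    have ends: "(\<alpha> - \<alpha>) / \<beta> = 0" "(\<alpha> + \<beta> - \<alpha>) / \<beta> = 1" using \<beta> by auto
    have "(\<integral>\<^sup>+x\<in>{\<alpha>..\<alpha> + \<beta>}. ((?m x)\<^sup>2 + (?\<sigma> x)\<^sup>2) \<partial>lborel) =
       ennreal \<beta> * (\<integral>\<^sup>+x\<in>{0..1}. ((ennreal (l / \<beta>) * ennreal (w x))\<^sup>2 + (descending_slope g (S (c (clamp01 x))))\<^sup>2) \<partial>lborel)"
    proof -
      have "(\<integral>\<^sup>+x\<in>{\<alpha>..\<alpha> + \<beta>}. ((?m x)\<^sup>2 + (?\<sigma> x)\<^sup>2) \<partial>lborel) = ennreal \<beta> *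
        (\<integral>\<^sup>+x\<in>{(\<alpha> - \<alpha>) / \<beta>..(\<alpha> + \<beta> - \<alpha>) / \<beta>}. ((ennreal (l / \<beta>) * ennreal (w x))\<^sup>2 + (descending_slope g (S (c (clamp01 x))))\<^sup>2) \<partial>lborel)"
        by (rule set_nn_integral_affine[where f = "\<lambda>x. (ennreal (l / \<beta>) * ennreal (w x))\<^sup>2 + (descending_slope g (S (c (clamp01 x))))\<^sup>2"])
           (use \<beta> in measurable)
      thus ?thesis unfolding ends .
    qed
    also have "(\<integral>\<^sup>+x\<in>{0..1}. ((ennreal (l / \<beta>) * ennreal (w x))\<^sup>2 + (descending_slope g (S (c (clamp01 x))))\<^sup>2) \<partial>lborel) =
       (\<integral>\<^sup>+x. (ennreal (l / \<beta>))\<^sup>2 * ((ennreal (w x))\<^sup>2 * indicator {0..1} x) + (descending_slope g (S (c (clamp01 x))))\<^sup>2 * indicator {0..1} x \<partial>lborel)"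
      by (intro nn_integral_cong) (auto simp: indicator_def power_mult_distrib)
    also have "\<dots> = (\<integral>\<^sup>+x. (ennreal (l / \<beta>))\<^sup>2 * ((ennreal (w x))\<^sup>2 * indicator {0..1} x) \<partial>lborel) + I"
      unfolding I_def by (intro nn_integral_add) auto
    also have "(\<integral>\<^sup>+x. (ennreal (l / \<beta>))\<^sup>2 * ((ennreal (w x))\<^sup>2 * indicator {0..1} x) \<partial>lborel) = (ennreal (l / \<beta>))\<^sup>2 * kinetic c"
      unfolding wk by (intro nn_integral_cmult) auto
    also have "ennreal \<beta> * ((ennreal (l / \<beta>))\<^sup>2 * kinetic c + I) = (ennreal \<beta> * (ennreal (l / \<beta>))\<^sup>2) * kinetic c + ennreal \<beta> * I"
      by (simp add: distrib_left mult.assoc)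
    also have "ennreal \<beta> * (ennreal (l / \<beta>))\<^sup>2 = ennreal (1 / (k * \<beta>))"
    proof -
      have "\<beta> * (l / \<beta>)\<^sup>2 = 1 / (k * \<beta>)" using \<beta> by (simp add: power_divide l(2)) (simp add: power2_eq_square)
      thus ?thesis using l \<beta> by (simp add: ennreal_power ennreal_mult[symmetric])
    qed
    also have "ennreal \<beta> * I \<le> 1 * I" using \<beta> by (intro mult_right_mono) (auto simp: ennreal_le_1)
    finally show "(\<integral>\<^sup>+x\<in>{\<alpha>..\<alpha> + \<beta>}. ((?m x)\<^sup>2 + (?\<sigma> x)\<^sup>2) \<partial>lborel) \<le>
        ennreal (1 / (k * \<beta>)) * kinetic c + slope_energy g (\<lambda>t. S (c t))"
      by (simp add: I_def slope_energy_clamp[of g "\<lambda>t. S (c t)"] add_left_mono)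
  qed
qed

section \<open>Smoothing maps along Gamma-converging functions\<close>

text \<open>
  The sequence need not converge. If the bound failed infinitely often, then along a filter of such
  indices the points would cluster at some \<open>p\<close>, where the slope bound of \<open>f\<close> at \<open>x\<close> and the lower bound of
  \<open>\<Gamma>\<close>-convergence contradict the failure.
\<close>
lemma liminf_bounded_sequence:
  fixes f :: "'a::metric_space \<Rightarrow> ereal"
  assumes ga: "gamma_along sequentially gn f" and ni: "\<forall>x. f x \<noteq> -\<infinity>"
    and proper: "\<forall>S::'a set. closed S \<and> bounded S \<longrightarrow> compact S"
    and x: "slope_le K f M x" and B: "\<forall>\<^sub>F n in sequentially. dist (pn n) x \<le> B" and e: "e > 0"
  shows "\<forall>\<^sub>F n in sequentially. ereal (rv f x - M * dist (pn n) x - K / 2 * (dist (pn n) x)\<^sup>2 - e) < gn n (pn n)"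
proof (rule ccontr)
  let ?P = "\<lambda>n. ereal (rv f x - M * dist (pn n) x - K / 2 * (dist (pn n) x)\<^sup>2 - e) < gn n (pn n)"
  assume neg: "\<not> (\<forall>\<^sub>F n in sequentially. ?P n)"
  define F where "F = inf sequentially (principal {n. \<not> ?P n})"
  have F: "F \<noteq> bot"
  proof
    assume "F = bot"
    hence "eventually (\<lambda>_. False) F" by simp
    thus False using neg unfolding F_def eventually_inf_principal by (auto elim: eventually_mono)
  qed
  define B' where "B' = max B 0"
  define p' where "p' n = (if dist (pn n) x \<le> B' then pn n else x)" for n
  have cpt: "\<exists>Q. compact Q \<and> (\<forall>n. p' n \<in> Q)" for u :: unit
  proof (intro exI[of _ "cball x B'"] conjI allI)
    show "compact (cball x B')" using proper by (simp add: bounded_cball)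
    show "p' n \<in> cball x B'" for n by (simp add: p'_def B'_def dist_commute)
  qed
  obtain G and pp :: "unit \<Rightarrow> 'a" where G: "G \<le> F" "G \<noteq> bot" and pp: "\<And>u. ((\<lambda>n. p' n) \<longlongrightarrow> pp u) G"
    by (fact pointwise_cluster[OF F cpt])
  define p where "p = pp ()"
  have GS: "G \<le> sequentially" using G(1) by (simp add: F_def)
  have "\<forall>\<^sub>F n in G. p' n = pn n"
    using filter_leD[OF GS B] by eventually_elim (auto simp: p'_def B'_def)
  hence lim: "(pn \<longlongrightarrow> p) G" unfolding p_def by (rule Lim_transform_eventually[OF pp])
  define c where "c = rv f x - M * dist p x - K / 2 * (dist p x)\<^sup>2 - e / 2"
  have "ereal c < f p"
  proof (cases "p \<in> eff_dom f")
    case True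
    have "f p = ereal (rv f p)" by (rule eff_dom_real'[OF ni True])
    moreover have "c < rv f p" using slope_leD[OF x True] e by (simp add: c_def dist_commute)
    ultimately show ?thesis by (metis less_ereal.simps(1))
  next
    case False
    hence "f p = \<infinity>" by (auto simp: eff_dom_def)
    thus ?thesis by simp
  qed
  hence 1: "\<forall>\<^sub>F n in G. ereal c < gn n (pn n)" by (rule gamma_along_liminf[OF gamma_along_mono[OF ga GS] lim])
  have "((\<lambda>n. rv f x - M * dist (pn n) x - K / 2 * (dist (pn n) x)\<^sup>2 - e) \<longlongrightarrow>
      rv f x - M * dist p x - K / 2 * (dist p x)\<^sup>2 - e) G"
    by (intro tendsto_intros lim)
  hence 2: "\<forall>\<^sub>F n in G. rv f x - M * dist (pn n) x - K / 2 * (dist (pn n) x)\<^sup>2 - e < c"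
    by (rule order_tendstoD(2)) (use e in \<open>simp add: c_def\<close>)
  have "eventually (\<lambda>n. \<not> ?P n) F" unfolding F_def eventually_inf_principal by simp
  hence 3: "\<forall>\<^sub>F n in G. \<not> ?P n" by (rule filter_leD[OF G(1)])
  have "\<forall>\<^sub>F n in G. False"
    using 1 2 3
  proof eventually_elim
    case (elim n)
    have "ereal (rv f x - M * dist (pn n) x - K / 2 * (dist (pn n) x)\<^sup>2 - e) < ereal c" using elim(2) by simp
    thus False using elim(1,3) by (meson less_trans)
  qed
  thus False using G(2) by simp
qed

text \<open>
  Use a recovery sequence \<open>z n\<close> of \<open>x\<close> as comparison points. With \<open>D = dist (pn n) x\<close> and
  \<open>k = 1 - 5 * K * \<epsilon>\<close>, the gap is at most \<open>2 * \<epsilon> * M * D - k * D\<^sup>2\<close> up to a small error, since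
  \<open>liminf_bounded_sequence\<close> bounds the energy at \<open>pn n\<close> from below. Nonnegativity of the gap bounds \<open>D\<close>, and
  maximizing over \<open>D\<close> bounds the gap by \<open>(\<epsilon> * M)\<^sup>2 / k\<close>, hence the slope by \<open>M / k\<close>.
\<close>
lemma smoothing_limit:
  fixes f :: "'a::metric_space \<Rightarrow> ereal"
  assumes ga: "gamma_along sequentially gn f" and ni: "\<forall>x. f x \<noteq> -\<infinity>" and nin: "\<forall>n x. gn n x \<noteq> -\<infinity>"
    and proper: "\<forall>S::'a set. closed S \<and> bounded S \<longrightarrow> compact S"
    and K: "K > 0" and t: "0 < \<epsilon>" "16 * K * \<epsilon> \<le> 1"
    and x: "slope_le K f M x" and M: "M \<ge> 0"
    and reg: "\<forall>\<^sub>F n in sequentially. regularizes K (gn n) \<epsilon> x (pn n)"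
    and B: "\<forall>\<^sub>F n in sequentially. dist (pn n) x \<le> B" and e: "e > 0"
  shows "\<forall>\<^sub>F n in sequentially. dist (pn n) x \<le> 4 * \<epsilon> * M + e \<and>
     descending_slope (gn n) (pn n) \<le> ennreal (sqrt (M\<^sup>2 / (1 - 5 * K * \<epsilon>)\<^sup>2 + e))"
proof -
  define \<kappa> where "\<kappa> = 1 - 4 * K * \<epsilon>"
  define k where "k = 1 - 5 * K * \<epsilon>"
  have "16 * (K * \<epsilon>) \<le> 1" "0 \<le> K * \<epsilon>" using t K by (simp_all add: ac_simps)
  hence k: "1/2 \<le> k" "k \<le> \<kappa>" "\<kappa> \<le> 1" "k = \<kappa> - K * \<epsilon>" by (auto simp: \<kappa>_def k_def)
  define e' where "e' = min (e\<^sup>2 / 2) (e * \<epsilon>\<^sup>2 / 4)"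
  have e': "0 < e'" "e' \<le> e\<^sup>2 / 2" "e' \<le> e * \<epsilon>\<^sup>2 / 4" using e t by (auto simp: e'_def)
  define e0 where "e0 = e' / (8 * \<epsilon>)"
  have e0: "0 < e0" "2 * \<epsilon> * (2 * e0) = e' / 2" using e' t by (auto simp: e0_def)
  define B' where "B' = max B 0"
  have xD: "x \<in> eff_dom f" by (rule slope_le_dom[OF x])
  have fx: "f x = ereal (rv f x)" by (rule eff_dom_real'[OF ni xD])
  have "\<exists>yn. (yn \<longlonglongrightarrow> x) \<and> (\<forall>e>0. \<forall>\<^sub>F n in sequentially. gn n (yn n) \<le> f x + ereal e)"
    using ga xD unfolding gamma_along_def by blast
  then obtain z where z: "z \<longlonglongrightarrow> x" "\<forall>\<^sub>F n in sequentially. gn n (z n) \<le> f x + ereal e0" using e0(1) by blast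
  \<comment> \<open>The images stay within \<open>B\<close> of \<open>x\<close>, so replacing \<open>x\<close> by \<open>z n\<close> in the gap changes it by little.\<close>
  have "(\<lambda>n. (dist x (z n))\<^sup>2 / \<kappa> + 2 * B' * dist x (z n)) \<longlonglongrightarrow> (dist x x)\<^sup>2 / \<kappa> + 2 * B' * dist x x"
    using k by (intro tendsto_intros z(1)) auto
  hence A: "\<forall>\<^sub>F n in sequentially. (dist x (z n))\<^sup>2 / \<kappa> + 2 * B' * dist x (z n) < e' / 2"
    by (rule order_tendstoD(2)) (use e' in simp)
  show ?thesis
    using liminf_bounded_sequence[OF ga ni proper x B e0(1)] z(2) A reg B
  proof eventually_elim
    case (elim n)
    define D where "D = dist (pn n) x"
    define d where "d = dist x (z n)"
    define b where "b = dist (pn n) (z n)"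
    have pD: "pn n \<in> eff_dom (gn n)" using elim(4) by (simp add: regularizes_def)
    have zD: "z n \<in> eff_dom (gn n)" using elim(2) fx by (auto simp: eff_dom_def)
    have nin': "\<forall>x. gn n x \<noteq> -\<infinity>" using nin by simp
    have gp: "gn n (pn n) = ereal (rv (gn n) (pn n))" by (rule eff_dom_real'[OF nin' pD])
    have gz: "gn n (z n) = ereal (rv (gn n) (z n))" by (rule eff_dom_real'[OF nin' zD])
    have "rv f x - M * D - K / 2 * D\<^sup>2 - e0 < rv (gn n) (pn n)" using elim(1) unfolding D_def[symmetric] by (subst (asm) gp) simp
    moreover have "rv (gn n) (z n) \<le> rv f x + e0" using elim(2) by (subst (asm) gz, subst (asm) fx) simp
    ultimately have "rv (gn n) (z n) - rv (gn n) (pn n) \<le> M * D + K / 2 * D\<^sup>2 + 2 * e0" by linarith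
    hence "2 * \<epsilon> * (rv (gn n) (z n) - rv (gn n) (pn n)) \<le> 2 * \<epsilon> * (M * D + K / 2 * D\<^sup>2 + 2 * e0)"
      using t by (intro mult_left_mono) auto
    also have "\<dots> = 2 * \<epsilon> * M * D + K * \<epsilon> * D\<^sup>2 + e' / 2" unfolding e0(2)[symmetric] by (simp add: algebra_simps)
    finally have E: "2 * \<epsilon> * (rv (gn n) (z n) - rv (gn n) (pn n)) \<le> 2 * \<epsilon> * M * D + K * \<epsilon> * D\<^sup>2 + e' / 2" .
    have D0: "0 \<le> D" "0 \<le> d" "0 \<le> b" "D \<le> B'" using elim(5) by (auto simp: D_def d_def b_def B'_def)
    have tri: "D \<le> b + d" unfolding D_def b_def d_def by (rule dist_triangle2)
    have b2: "D\<^sup>2 - 2 * B' * d \<le> b\<^sup>2"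
    proof (cases "d \<le> D")
      case True
      have "(D - d)\<^sup>2 \<le> b\<^sup>2" using tri True by (intro power_mono) auto
      moreover have "(D - d)\<^sup>2 = D\<^sup>2 - 2 * (D * d) + d\<^sup>2" by (simp add: power2_diff)
      moreover have "D * d \<le> B' * d" using D0 by (intro mult_right_mono) auto
      ultimately show ?thesis using zero_le_power2[of d] by linarith
    next
      case False
      have "D * D \<le> D * d" using False D0 by (intro mult_left_mono) auto
      moreover have "D * d \<le> B' * d" "0 \<le> D * d" using D0 by (auto intro: mult_right_mono)
      ultimately show ?thesis using zero_le_power2[of b] unfolding power2_eq_square[of D] mult.assoc by linarith
    qed
    have "\<kappa> * (D\<^sup>2 - 2 * B' * d) \<le> \<kappa> * b\<^sup>2" using b2 k by (intro mult_left_mono) auto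
    moreover have "\<kappa> * (2 * B' * d) \<le> 1 * (2 * B' * d)" using k D0 by (intro mult_right_mono) auto
    ultimately have b3: "\<kappa> * D\<^sup>2 - 2 * B' * d \<le> \<kappa> * b\<^sup>2" by (simp add: algebra_simps)
    define gap where "gap = evi_gap K (gn n) \<epsilon> x (pn n) (z n)"
    have gap0: "0 \<le> gap" and gsl: "slope_le K (gn n) (sqrt (gap / (\<kappa> * \<epsilon>\<^sup>2))) (pn n)"
      using elim(4) zD unfolding regularizes_def gap_def \<kappa>_def by blast+
    have "gap = d\<^sup>2 / \<kappa> - \<kappa> * b\<^sup>2 + 2 * \<epsilon> * (rv (gn n) (z n) - rv (gn n) (pn n))"
      unfolding gap_def evi_gap_def \<kappa>_def[symmetric] d_def[symmetric] b_def[symmetric] by (simp add: algebra_simps)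
    moreover have "d\<^sup>2 / \<kappa> + 2 * B' * d < e' / 2" using elim(3) unfolding d_def[symmetric] .
    moreover have "k * D\<^sup>2 = \<kappa> * D\<^sup>2 - K * \<epsilon> * D\<^sup>2" unfolding k(4) by (simp add: left_diff_distrib)
    ultimately have gap1: "gap \<le> e' + 2 * \<epsilon> * M * D - k * D\<^sup>2" using E b3 by linarith
    have "1/2 * D\<^sup>2 \<le> k * D\<^sup>2" using k by (intro mult_right_mono) auto
    hence "D\<^sup>2 \<le> (4 * \<epsilon> * M) * D + e\<^sup>2" using gap0 gap1 e'(2) by linarith
    hence "D \<le> 4 * \<epsilon> * M + e" by (rule quadratic_bound) (use t M e in simp_all)
    moreover have "descending_slope (gn n) (pn n) \<le> ennreal (sqrt (M\<^sup>2 / k\<^sup>2 + e))"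
    proof -
      have kk: "0 < k" using k by simp
      \<comment> \<open>completing the square in \<open>2 * \<epsilon> * M * D - k * D\<^sup>2\<close>\<close>
      have "0 \<le> (k * D - \<epsilon> * M)\<^sup>2 / k" using kk by simp
      also have "\<dots> = k * D\<^sup>2 - 2 * \<epsilon> * M * D + (\<epsilon> * M)\<^sup>2 / k"
        using kk by (simp add: power2_eq_square field_simps)
      finally have "gap \<le> e' + (\<epsilon> * M)\<^sup>2 / k" using gap1 by linarith
      hence "gap / (\<kappa> * \<epsilon>\<^sup>2) \<le> (e' + (\<epsilon> * M)\<^sup>2 / k) / (\<kappa> * \<epsilon>\<^sup>2)"
        using k t by (intro divide_right_mono) auto
      also have "\<dots> \<le> (e' + (\<epsilon> * M)\<^sup>2 / k) / (k * \<epsilon>\<^sup>2)"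
        using k t kk e' by (intro divide_left_mono mult_right_mono add_nonneg_nonneg) auto
      also have "\<dots> = e' / (k * \<epsilon>\<^sup>2) + M\<^sup>2 / k\<^sup>2"
        using t kk by (simp add: add_divide_distrib power_mult_distrib) (simp add: power2_eq_square)
      also have "e' / (k * \<epsilon>\<^sup>2) \<le> e"
      proof -
        have "e * \<epsilon>\<^sup>2 / 4 \<le> e * (k * \<epsilon>\<^sup>2)"
        proof -
          have "1/4 * (e * \<epsilon>\<^sup>2) \<le> k * (e * \<epsilon>\<^sup>2)" using k e by (intro mult_right_mono) auto
          thus ?thesis by (simp add: ac_simps)
        qed
        hence "e' \<le> e * (k * \<epsilon>\<^sup>2)" using e'(3) by linarith
        thus ?thesis using kk t by (simp add: pos_divide_le_eq)
      qed
      finally have "sqrt (gap / (\<kappa> * \<epsilon>\<^sup>2)) \<le> sqrt (M\<^sup>2 / k\<^sup>2 + e)" by (intro real_sqrt_le_mono) simp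
      hence "slope_le K (gn n) (sqrt (M\<^sup>2 / k\<^sup>2 + e)) (pn n)" by (rule slope_le_mono[OF gsl])
      thus ?thesis by (rule slope_le_imp_descending_slope_le[OF _ _ _ nin']) (use K e in auto)
    qed
    ultimately show ?case unfolding D_def k_def by simp
  qed
qed

text \<open>
  The two properties of the maps \<open>S\<close> that do not refer to starting points of bounded slope.
\<close>
definition smoothing :: "real \<Rightarrow> ('a::metric_space \<Rightarrow> ereal) \<Rightarrow> real \<Rightarrow> ('a \<Rightarrow> 'a) \<Rightarrow> bool" where
  "smoothing K g \<epsilon> S \<longleftrightarrow> (\<forall>x. regularizes K g \<epsilon> x (S x)) \<and>
     (\<forall>x y. (1 - 4 * K * \<epsilon>) * (dist (S x) (S y))\<^sup>2 \<le> (dist x y)\<^sup>2)"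

lemma smoothing_Lipschitz:
  assumes S: "smoothing K g \<epsilon> S" and t: "16 * K * \<epsilon> \<le> 1"
  shows "dist (S x) (S y) \<le> 2 * dist x y"
proof -
  have "16 * (K * \<epsilon>) \<le> 1" using t by (simp add: ac_simps)
  hence "3/4 * (dist (S x) (S y))\<^sup>2 \<le> (1 - 4 * K * \<epsilon>) * (dist (S x) (S y))\<^sup>2"
    by (intro mult_right_mono) auto
  also have "\<dots> \<le> (dist x y)\<^sup>2" using S by (simp add: smoothing_def)
  finally have "3/4 * (dist (S x) (S y))\<^sup>2 \<le> (dist x y)\<^sup>2" .
  moreover have "(2 * dist x y)\<^sup>2 = 4 * (dist x y)\<^sup>2" by (simp add: power_mult_distrib)
  ultimately have "(dist (S x) (S y))\<^sup>2 \<le> (2 * dist x y)\<^sup>2"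
    using zero_le_power2[of "dist x y"] by linarith
  thus ?thesis by (rule power2_le_imp_le) simp
qed

text \<open>
  The points \<open>qn n\<close> of bounded slope confine the images \<open>S n x\<close> to a bounded set.
\<close>
lemma smoothing_point_limit:
  fixes f :: "'a::metric_space \<Rightarrow> ereal"
  assumes ga: "gamma_along sequentially gn f" and ni: "\<forall>x. f x \<noteq> -\<infinity>" and nin: "\<forall>n x. gn n x \<noteq> -\<infinity>"
    and proper: "\<forall>S::'a set. closed S \<and> bounded S \<longrightarrow> compact S"
    and K: "K > 0" and t: "0 < \<epsilon>" "16 * K * \<epsilon> \<le> 1"
    and S: "\<forall>\<^sub>F n in sequentially. smoothing K (gn n) \<epsilon> (S n)"
    and q: "\<forall>\<^sub>F n in sequentially. slope_le K (gn n) C (qn n)" "qn \<longlonglongrightarrow> q" and C: "0 \<le> C"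
    and x: "slope_le K f M x" and M: "M \<ge> 0" and e: "e > 0"
  shows "\<forall>\<^sub>F n in sequentially. dist (S n x) x \<le> 4 * \<epsilon> * M + e \<and>
     descending_slope (gn n) (S n x) \<le> ennreal (sqrt (M\<^sup>2 / (1 - 5 * K * \<epsilon>)\<^sup>2 + e))"
proof (rule smoothing_limit[OF ga ni nin proper K t x M _ _ e])
  show "\<forall>\<^sub>F n in sequentially. regularizes K (gn n) \<epsilon> x (S n x)"
    using S by eventually_elim (simp add: smoothing_def)
  have "\<forall>\<^sub>F n in sequentially. dist (qn n) q < 1" using tendstoD[OF q(2), of 1] by simp
  with S q(1) show "\<forall>\<^sub>F n in sequentially. dist (S n x) x \<le> 4 * \<epsilon> * C + 3 * dist x q + 3"
  proof eventually_elim
    case (elim n)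
    have "regularizes K (gn n) \<epsilon> x (S n x)" using elim(1) by (simp add: smoothing_def)
    from regularizes_dist_slope(1)[OF t K this elim(2) C]
    have "dist (S n x) (qn n) \<le> 4 * \<epsilon> * C + 2 * dist x (qn n)" .
    moreover have "dist (S n x) x \<le> dist (S n x) (qn n) + dist x (qn n)" by (rule dist_triangle2)
    moreover have "dist x (qn n) \<le> dist x q + dist (qn n) q" by (rule dist_triangle2)
    ultimately show ?case using elim(3) by linarith
  qed
qed

text \<open>
  The pointwise bound of \<open>smoothing_point_limit\<close> holds for almost every time, as the slope energy is
  finite. The slopes at smoothed points have a bound \<open>w\<close> that is uniform in time and index
  (\<open>regularizes_dist_slope\<close>), so the reverse Fatou lemma applies.
\<close>
lemma slope_energy_smoothing_limsup:
  fixes f :: "'a::metric_space \<Rightarrow> ereal"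
  assumes ga: "gamma_along sequentially gn f" and cv: "real_convexity K f" and cvn: "\<And>n. real_convexity K (gn n)"
    and ln: "\<And>n. lsc (gn n)" and l: "lsc f" and iso: "\<And>x::'a. open {x} \<Longrightarrow> UNIV = {x}"
    and proper: "\<forall>S::'a set. closed S \<and> bounded S \<longrightarrow> compact S"
    and K: "K > 0" and t: "0 < \<epsilon>" "16 * K * \<epsilon> \<le> 1"
    and S: "\<forall>\<^sub>F n in sequentially. smoothing K (gn n) \<epsilon> (S n)"
    and q: "\<forall>\<^sub>F n in sequentially. slope_le K (gn n) C (qn n)" "qn \<longlonglongrightarrow> q" and C: "0 \<le> C"
    and ac: "abs_cont_curve c" and fin: "slope_energy f c < \<infinity>"
  shows "limsup (\<lambda>n. slope_energy (gn n) (\<lambda>t. S n (c t))) \<le> ennreal (1 / (1 - 5 * K * \<epsilon>)\<^sup>2) * slope_energy f c"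
proof -
  have ni: "\<forall>x. f x \<noteq> -\<infinity>" and nin: "\<forall>n x. gn n x \<noteq> -\<infinity>" using cv cvn by (auto simp: real_convexity_def)
  have cont: "continuous_on UNIV (\<lambda>t. c (clamp01 t))" by (rule abs_cont_curve_continuous[OF ac])
  define good where "good n \<longleftrightarrow> smoothing K (gn n) \<epsilon> (S n) \<and> slope_le K (gn n) C (qn n) \<and> dist (qn n) q < 1" for n
  have "\<forall>\<^sub>F n in sequentially. dist (qn n) q < 1" using tendstoD[OF q(2), of 1] by simp
  with S q(1) have good: "\<forall>\<^sub>F n in sequentially. good n" by eventually_elim (simp add: good_def)
  have "compact (c ` {0..1})"
  proof -
    have "compact ((\<lambda>t. c (clamp01 t)) ` {0..1})"
      by (rule compact_continuous_image[OF continuous_on_subset[OF cont]]) auto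
    moreover have "(\<lambda>t. c (clamp01 t)) ` {0..1} = c ` {0..1}" by (intro image_cong) (auto simp: clamp01_id)
    ultimately show ?thesis by simp
  qed
  hence "bounded (c ` {0..1})" by (rule compact_imp_bounded)
  then obtain R where R: "\<And>t. t \<in> {0..1} \<Longrightarrow> dist q (c t) \<le> R" unfolding bounded_any_center[of _ q] by blast
  have fm: "descending_slope f \<in> borel_measurable borel" by (rule descending_slope_measurable[OF cv K l iso])
  note [measurable] = slope_clamp_measurable[OF fm cont]
  \<comment> \<open>The finitely many indices without the required properties are replaced by \<open>0\<close>, so that \<open>u n \<le> w\<close> holds for every \<open>n\<close>.\<close>
  define u where "u n t = (if good n then (descending_slope (gn n) (S n (c (clamp01 t))))\<^sup>2 * indicator {0..1} t else 0)" for n t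
  define w where "w t = (ennreal (2 * C + 2 * (R + 1) / \<epsilon>))\<^sup>2 * indicator {0..1} t" for t :: real
  have um: "u n \<in> borel_measurable lborel" for n
  proof (cases "good n")
    case True
    hence Sn: "smoothing K (gn n) \<epsilon> (S n)" by (simp add: good_def)
    have "continuous_on UNIV (\<lambda>t. S n (c (clamp01 t)))"
      unfolding continuous_on_iff
    proof (intro ballI allI impI)
      fix x e :: real assume "e > 0"
      hence "e / 2 > 0" by simp
      then obtain d where d: "d > 0" "\<And>x'. dist x' x < d \<Longrightarrow> dist (c (clamp01 x')) (c (clamp01 x)) < e / 2"
        using cont[unfolded continuous_on_iff] by blast
      have "dist (S n (c (clamp01 x'))) (S n (c (clamp01 x))) < e" if "dist x' x < d" for x'
        using d(2)[OF that] smoothing_Lipschitz[OF Sn t(2), of "c (clamp01 x')" "c (clamp01 x)"] by linarith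
      thus "\<exists>d>0. \<forall>x'\<in>UNIV. dist x' x < d \<longrightarrow> dist (S n (c (clamp01 x'))) (S n (c (clamp01 x))) < e" using d(1) by blast
    qed
    note [measurable] = measurable_compose[OF borel_measurable_continuous_onI[OF this] descending_slope_measurable[OF cvn K ln iso]]
    have "(\<lambda>t. (descending_slope (gn n) (S n (c (clamp01 t))))\<^sup>2 * indicator {0..1} t) \<in> borel_measurable lborel" by measurable
    thus ?thesis using True by (simp add: u_def[abs_def])
  next
    case False
    thus ?thesis by (simp add: u_def[abs_def])
  qed
  have wm: "w \<in> borel_measurable lborel" unfolding w_def[abs_def] by measurable
  have uw: "u n t \<le> w t" for n t
  proof (cases "good n \<and> t \<in> {0..1}")
    case True
    have "regularizes K (gn n) \<epsilon> (c t) (S n (c t))" using True by (simp add: good_def smoothing_def)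
    moreover have "slope_le K (gn n) C (qn n)" using True by (simp add: good_def)
    ultimately have sl: "slope_le K (gn n) (2 * C + 2 * dist (c t) (qn n) / \<epsilon>) (S n (c t))"
      by (rule regularizes_dist_slope(2)[OF t K _ _ C])
    have "dist (c t) (qn n) \<le> dist (c t) q + dist (qn n) q" by (rule dist_triangle2)
    also have "\<dots> \<le> R + 1" using R[of t] True by (auto simp: good_def dist_commute)
    finally have dR: "dist (c t) (qn n) \<le> R + 1" .
    hence "2 * C + 2 * dist (c t) (qn n) / \<epsilon> \<le> 2 * C + 2 * (R + 1) / \<epsilon>"
      using t by (intro add_left_mono divide_right_mono mult_left_mono) auto
    hence sl': "slope_le K (gn n) (2 * C + 2 * (R + 1) / \<epsilon>) (S n (c t))" by (rule slope_le_mono[OF sl])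
    have "0 \<le> R + 1" using dR zero_le_dist[of "c t" "qn n"] by linarith
    hence "descending_slope (gn n) (S n (c t)) \<le> ennreal (2 * C + 2 * (R + 1) / \<epsilon>)"
      using K t C nin by (intro slope_le_imp_descending_slope_le[OF sl']) auto
    thus ?thesis using True by (simp add: u_def w_def clamp01_id power_mono)
  qed (auto simp: u_def w_def)
  have wfin: "(\<integral>\<^sup>+t. w t \<partial>lborel) < \<infinity>"
    unfolding w_def by (subst nn_integral_cmult_indicator) (auto simp: ennreal_mult_less_top power_less_top_ennreal)
  have ueq: "(\<integral>\<^sup>+t. u n t \<partial>lborel) = slope_energy (gn n) (\<lambda>t. S n (c t))" if "good n" for n
    using that by (simp add: u_def slope_energy_clamp[of _ "\<lambda>t. S n (c t)"])
  have "limsup (\<lambda>n. slope_energy (gn n) (\<lambda>t. S n (c t))) \<le> limsup (\<lambda>n. \<integral>\<^sup>+t. u n t \<partial>lborel)"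
    using good by (intro Limsup_mono) (auto elim!: eventually_mono simp: ueq)
  also have "\<dots> \<le> (\<integral>\<^sup>+t. limsup (\<lambda>n. u n t) \<partial>lborel)"
    by (rule nn_integral_limsup[OF um wm _ wfin]) (use uw in simp)
  also have "\<dots> \<le> (\<integral>\<^sup>+t. ennreal (1 / (1 - 5 * K * \<epsilon>)\<^sup>2) * ((descending_slope f (c (clamp01 t)))\<^sup>2 * indicator {0..1} t) \<partial>lborel)"
  proof (rule nn_integral_mono_AE)
    have "AE t in lborel. (descending_slope f (c (clamp01 t)))\<^sup>2 * indicator {0..1} t \<noteq> \<infinity>"
      using fin unfolding slope_energy_clamp by (intro nn_integral_PInf_AE) auto
    thus "AE t in lborel. limsup (\<lambda>n. u n t) \<le> ennreal (1 / (1 - 5 * K * \<epsilon>)\<^sup>2) * ((descending_slope f (c (clamp01 t)))\<^sup>2 * indicator {0..1} t)"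
    proof eventually_elim
      fix t :: real
      assume ft: "(descending_slope f (c (clamp01 t)))\<^sup>2 * indicator {0..1} t \<noteq> \<infinity>"
      show "limsup (\<lambda>n. u n t) \<le> ennreal (1 / (1 - 5 * K * \<epsilon>)\<^sup>2) * ((descending_slope f (c (clamp01 t)))\<^sup>2 * indicator {0..1} t)"
      proof (cases "t \<in> {0..1}")
        case True
        define x where "x = c (clamp01 t)"
        have "descending_slope f x \<noteq> \<infinity>" using ft True by (auto simp: x_def power2_eq_square)
        then obtain M where M: "descending_slope f x = ennreal M" "M \<ge> 0" by (cases "descending_slope f x") auto
        have xs: "slope_le K f M x" by (rule iffD1[OF descending_slope_le_iff[OF cv K M(2) iso]]) (simp_all add: M(1))
        have "limsup (\<lambda>n. u n t) \<le> ennreal (M\<^sup>2 / (1 - 5 * K * \<epsilon>)\<^sup>2)"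
        proof (rule ennreal_le_epsilon)
          fix e :: real assume e: "e > 0"
          have "\<forall>\<^sub>F n in sequentially. u n t \<le> ennreal (M\<^sup>2 / (1 - 5 * K * \<epsilon>)\<^sup>2 + e)"
            using smoothing_point_limit[OF ga ni nin proper K t S q C xs M(2) e]
          proof eventually_elim
            case (elim n)
            have "(descending_slope (gn n) (S n x))\<^sup>2 \<le> (ennreal (sqrt (M\<^sup>2 / (1 - 5 * K * \<epsilon>)\<^sup>2 + e)))\<^sup>2"
              using elim by (intro power_mono) auto
            also have "\<dots> = ennreal (M\<^sup>2 / (1 - 5 * K * \<epsilon>)\<^sup>2 + e)"
              using e by (subst ennreal_power) auto
            finally show ?case using True by (simp add: u_def x_def)
          qed
          hence "limsup (\<lambda>n. u n t) \<le> ennreal (M\<^sup>2 / (1 - 5 * K * \<epsilon>)\<^sup>2 + e)" by (rule Limsup_bounded)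
          thus "limsup (\<lambda>n. u n t) \<le> ennreal (M\<^sup>2 / (1 - 5 * K * \<epsilon>)\<^sup>2) + ennreal e" using e by simp
        qed
        also have "\<dots> = ennreal (1 / (1 - 5 * K * \<epsilon>)\<^sup>2) * (descending_slope f x)\<^sup>2"
          using M by (simp add: ennreal_power ennreal_mult'[symmetric])
        finally show ?thesis using True by (simp add: x_def)
      next
        case False
        hence "u n t = 0" for n by (simp add: u_def)
        thus ?thesis by (simp add: Limsup_const)
      qed
    qed
  qed
  also have "\<dots> = ennreal (1 / (1 - 5 * K * \<epsilon>)\<^sup>2) * slope_energy f c"
    unfolding slope_energy_clamp by (rule nn_integral_cmult) measurable
  finally show ?thesis .
qed

lemma AE_lborel_interval_witness:
  assumes "AE t in lborel. P t" "a < (b::real)"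
  obtains t where "a < t" "t < b" "P t"
proof -
  have "\<not> (\<forall>t\<in>{a<..<b}. \<not> P t)"
  proof
    assume A: "\<forall>t\<in>{a<..<b}. \<not> P t"
    have "AE t in lborel. t \<notin> {a<..<b}" using assms(1) by eventually_elim (use A in auto)
    hence "emeasure lborel {a<..<b} = 0" by (subst (asm) AE_iff_measurable[of "{a<..<b}"]) auto
    thus False using assms(2) by simp
  qed
  thus ?thesis using that by auto
qed

text \<open>
  The displacement of \<open>x\<close> by the smoothing map is controlled by the slope of \<open>f\<close> at \<open>x\<close>, which may be unbounded
  along \<open>c\<close>. It suffices to control it at a finite net of times of finite slope; equicontinuity of the
  smoothing maps and of \<open>c\<close> does the rest.
\<close>
lemma smoothing_uniformly_close:
  fixes f :: "'a::metric_space \<Rightarrow> ereal"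
  assumes ga: "gamma_along sequentially gn f" and cv: "real_convexity K f" and nin: "\<forall>n x. gn n x \<noteq> -\<infinity>"
    and l: "lsc f" and iso: "\<And>x::'a. open {x} \<Longrightarrow> UNIV = {x}"
    and proper: "\<forall>S::'a set. closed S \<and> bounded S \<longrightarrow> compact S"
    and K: "K > 0"
    and q: "\<forall>\<^sub>F n in sequentially. slope_le K (gn n) C (qn n)" "qn \<longlonglongrightarrow> q" and C: "0 \<le> C"
    and ac: "abs_cont_curve c" and fin: "slope_energy f c < \<infinity>" and \<delta>: "\<delta> > 0"
  obtains \<epsilon>0 where "\<epsilon>0 > 0"
    "\<And>\<epsilon> S. 0 < \<epsilon> \<Longrightarrow> \<epsilon> \<le> \<epsilon>0 \<Longrightarrow> 16 * K * \<epsilon> \<le> 1 \<Longrightarrow> \<forall>\<^sub>F n in sequentially. smoothing K (gn n) \<epsilon> (S n) \<Longrightarrow>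
       \<forall>\<^sub>F n in sequentially. \<forall>t\<in>{0..1}. dist (S n (c t)) (c t) \<le> \<delta>"
proof -
  have ni: "\<forall>x. f x \<noteq> -\<infinity>" using cv by (auto simp: real_convexity_def)
  have cont: "continuous_on UNIV (\<lambda>t. c (clamp01 t))" by (rule abs_cont_curve_continuous[OF ac])
  have "continuous_on {0..1} (\<lambda>t. c (clamp01 t))" by (rule continuous_on_subset[OF cont]) simp
  hence "continuous_on {0..1} c" by (rule continuous_on_eq) (simp add: clamp01_id)
  hence "uniformly_continuous_on {0..1} c" by (rule compact_uniformly_continuous) simp
  then obtain \<gamma> where \<gamma>: "\<gamma> > 0" "\<And>s t. s \<in> {0..1} \<Longrightarrow> t \<in> {0..1} \<Longrightarrow> dist t s < \<gamma> \<Longrightarrow> dist (c t) (c s) < \<delta> / 8"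
    unfolding uniformly_continuous_on_def using \<delta> by (metis zero_less_divide_iff zero_less_numeral)
  obtain N :: nat where N: "N > 0" "1 / real N < \<gamma>"
    using nat_approx_posE[OF \<gamma>(1)] by (metis zero_less_Suc)
  have fm: "descending_slope f \<in> borel_measurable borel" by (rule descending_slope_measurable[OF cv K l iso])
  note [measurable] = slope_clamp_measurable[OF fm cont]
  have ae: "AE t in lborel. (descending_slope f (c (clamp01 t)))\<^sup>2 * indicator {0..1} t \<noteq> \<infinity>"
    using fin unfolding slope_energy_clamp by (intro nn_integral_PInf_AE) auto
  \<comment> \<open>Finite slope holds almost everywhere, so every interval of the subdivision contains such a time.\<close>
  have "\<exists>\<tau> M. real i / real N < \<tau> \<and> \<tau> < real (Suc i) / real N \<and> (i < N \<longrightarrow> 0 \<le> M \<and> slope_le K f M (c \<tau>))" for i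
  proof -
    have "real i / real N < real (Suc i) / real N" using N(1) by (intro divide_strict_right_mono) auto
    from AE_lborel_interval_witness[OF ae this] obtain \<tau> where \<tau>: "real i / real N < \<tau>" "\<tau> < real (Suc i) / real N"
      "(descending_slope f (c (clamp01 \<tau>)))\<^sup>2 * indicator {0..1} \<tau> \<noteq> \<infinity>" by blast
    show ?thesis
    proof (cases "i < N")
      case True
      have "0 \<le> real i / real N" "real (Suc i) / real N \<le> 1" using True by (auto simp: divide_le_eq)
      hence "0 \<le> \<tau>" "\<tau> \<le> 1" using \<tau>(1,2) by linarith+
      hence \<tau>01: "\<tau> \<in> {0..1}" by simp
      hence "descending_slope f (c \<tau>) \<noteq> \<infinity>" using \<tau>(3) by (auto simp: clamp01_id power2_eq_square)
      then obtain M where M: "descending_slope f (c \<tau>) = ennreal M" "M \<ge> 0" by (cases "descending_slope f (c \<tau>)") auto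
      have "slope_le K f M (c \<tau>)" by (rule iffD1[OF descending_slope_le_iff[OF cv K M(2) iso]]) (simp_all add: M(1))
      thus ?thesis using \<tau>(1,2) M(2) by blast
    qed (use \<tau> in blast)
  qed
  then obtain \<tau> M where \<tau>: "\<And>i. real i / real N < \<tau> i" "\<And>i. \<tau> i < real (Suc i) / real N"
    "\<And>i. i < N \<Longrightarrow> 0 \<le> M i" "\<And>i. i < N \<Longrightarrow> slope_le K f (M i) (c (\<tau> i))" by metis
  define MM where "MM = (\<Sum>i<N. M i)"
  have MM: "M i \<le> MM" if "i < N" for i
    unfolding MM_def using that \<tau>(3) by (intro member_le_sum) auto
  have MM0: "0 \<le> MM" unfolding MM_def by (intro sum_nonneg) (use \<tau>(3) in auto)
  define \<epsilon>0 where "\<epsilon>0 = \<delta> / 32 / (MM + 1)"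
  show ?thesis
  proof (rule that[of \<epsilon>0])
    show "\<epsilon>0 > 0" using \<delta> MM0 by (simp add: \<epsilon>0_def)
    fix \<epsilon> S assume \<epsilon>: "0 < \<epsilon>" "\<epsilon> \<le> \<epsilon>0" "16 * K * \<epsilon> \<le> 1" and S: "\<forall>\<^sub>F n in sequentially. smoothing K (gn n) \<epsilon> (S n)"
    have small: "4 * \<epsilon> * M i \<le> \<delta> / 8" if "i < N" for i
    proof -
      have "\<epsilon> * (M i) \<le> \<epsilon>0 * (MM + 1)" using \<epsilon> MM[OF that] \<tau>(3)[OF that] MM0 by (intro mult_mono) auto
      also have "\<dots> = \<delta> / 32"
      proof -
        have "\<delta> / 32 / w * w = \<delta> / 32" if "w \<noteq> 0" for w :: real using that by simp
        moreover have "MM + 1 \<noteq> 0" using MM0 by linarith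
        ultimately show ?thesis unfolding \<epsilon>0_def by blast
      qed
      finally show ?thesis by simp
    qed
    have "\<forall>\<^sub>F n in sequentially. \<forall>i\<in>{..<N}. dist (S n (c (\<tau> i))) (c (\<tau> i)) \<le> 4 * \<epsilon> * M i + \<delta> / 8"
    proof (rule eventually_ball_finite)
      show "\<forall>i\<in>{..<N}. \<forall>\<^sub>F n in sequentially. dist (S n (c (\<tau> i))) (c (\<tau> i)) \<le> 4 * \<epsilon> * M i + \<delta> / 8"
      proof
        fix i assume "i \<in> {..<N}"
        hence i: "i < N" by simp
        have "\<delta> / 8 > 0" using \<delta> by simp
        from smoothing_point_limit[OF ga ni nin proper K \<epsilon>(1,3) S q C \<tau>(4)[OF i] \<tau>(3)[OF i] this]
        show "\<forall>\<^sub>F n in sequentially. dist (S n (c (\<tau> i))) (c (\<tau> i)) \<le> 4 * \<epsilon> * M i + \<delta> / 8"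
          by eventually_elim simp
      qed
    qed simp
    with S show "\<forall>\<^sub>F n in sequentially. \<forall>t\<in>{0..1}. dist (S n (c t)) (c t) \<le> \<delta>"
    proof eventually_elim
      case (elim n)
      show ?case
      proof
        fix t :: real assume t: "t \<in> {0..1}"
        have "\<exists>i<N. real i / real N \<le> t \<and> t \<le> real (Suc i) / real N"
        proof (cases "t = 1")
          case True
          have "Suc (N - 1) = N" using N(1) by simp
          thus ?thesis using True N(1) by (intro exI[of _ "N - 1"]) (auto simp: divide_le_eq)
        next
          case False
          define i where "i = nat \<lfloor>t * real N\<rfloor>"
          have tN: "0 \<le> t * real N" using t by simp
          have fl: "real i \<le> t * real N" "t * real N < real i + 1" using tN by (auto simp: i_def)
          have "t * real N < 1 * real N" using t False N(1) by (intro mult_strict_right_mono) auto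
          hence "real i < real N" using fl by linarith
          hence "i < N" by simp
          moreover have "real i / real N \<le> t" using fl(1) N(1) by (simp add: divide_le_eq)
          moreover have "t \<le> real (Suc i) / real N" using fl(2) N(1) by (simp add: le_divide_eq)
          ultimately show ?thesis by blast
        qed
        then obtain i where i: "i < N" "real i / real N \<le> t" "t \<le> real (Suc i) / real N" by blast
        have "real (Suc i) / real N - real i / real N = 1 / real N" by (simp add: diff_divide_distrib[symmetric])
        hence "\<bar>\<tau> i - t\<bar> \<le> 1 / real N" using \<tau>(1)[of i] \<tau>(2)[of i] i by (simp only: abs_le_iff) linarith
        hence dt: "dist (\<tau> i) t < \<gamma>" using N(2) by (simp add: dist_real_def)
        have "0 \<le> real i / real N" "real (Suc i) / real N \<le> 1" using i(1) by (auto simp: divide_le_eq)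
        hence "0 \<le> \<tau> i" "\<tau> i \<le> 1" using \<tau>(1)[of i] \<tau>(2)[of i] by linarith+
        hence "\<tau> i \<in> {0..1}" by simp
        hence 1: "dist (c (\<tau> i)) (c t) < \<delta> / 8" using \<gamma>(2)[OF t _ dt] by simp
        have 2: "dist (S n (c t)) (S n (c (\<tau> i))) \<le> 2 * dist (c t) (c (\<tau> i))"
          by (rule smoothing_Lipschitz[OF elim(1) \<epsilon>(3)])
        have 3: "dist (S n (c (\<tau> i))) (c (\<tau> i)) \<le> \<delta> / 8 + \<delta> / 8" using elim(2) i(1) small[OF i(1)] by force
        have "dist (S n (c t)) (c t) \<le> dist (S n (c t)) (S n (c (\<tau> i))) + dist (S n (c (\<tau> i))) (c t)" by (rule dist_triangle)
        also have "dist (S n (c (\<tau> i))) (c t) \<le> dist (S n (c (\<tau> i))) (c (\<tau> i)) + dist (c (\<tau> i)) (c t)" by (rule dist_triangle)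
        finally show "dist (S n (c t)) (c t) \<le> \<delta>" using 1 2 3 \<delta> by (simp add: dist_commute)
      qed
    qed
  qed
qed

lemma action_le_mono: "action_le g a b c E \<Longrightarrow> E \<le> E' \<Longrightarrow> action_le g a b c E'"
  unfolding action_le_def by (meson order_trans)

lemma action_le_cong:
  assumes "action_le g a b c E" "\<And>t. a \<le> t \<Longrightarrow> t \<le> b \<Longrightarrow> c' t = c t"
  shows "action_le g a b c' E"
proof -
  obtain m \<sigma> where A: "m \<in> borel_measurable borel" "\<sigma> \<in> borel_measurable borel"
    "\<And>s t. a \<le> s \<Longrightarrow> s \<le> t \<Longrightarrow> t \<le> b \<Longrightarrow> ennreal (dist (c s) (c t)) \<le> (\<integral>\<^sup>+x\<in>{s..t}. m x \<partial>lborel)"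
    "\<And>t. a \<le> t \<Longrightarrow> t \<le> b \<Longrightarrow> descending_slope g (c t) \<le> \<sigma> t"
    "(\<integral>\<^sup>+x\<in>{a..b}. ((m x)\<^sup>2 + (\<sigma> x)\<^sup>2) \<partial>lborel) \<le> E" by (fact action_leE[OF assms(1)])
  show ?thesis
    by (rule action_leI[of m \<sigma>]) (use A assms(2) in simp_all)
qed

section \<open>Recovery sequences of curves\<close>

text \<open>
  Apart from positivity, all the conditions hold with strict inequality at \<open>\<epsilon> = 0\<close> and are
  continuous there.
\<close>
lemma recovery_parameter:
  fixes K A B C \<eta> r1 r2 :: real
  assumes "K > 0" "\<eta> > 0" "r1 > 0" "r2 > 0"
  obtains \<epsilon> where "0 < \<epsilon>" "\<epsilon> \<le> r1" "16 * K * \<epsilon> \<le> 1" "8 * \<epsilon> \<le> 1" "4 * \<epsilon> < r2" "2 * C * \<epsilon> \<le> \<eta>"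
    "\<epsilon> * (12 * C\<^sup>2) < \<eta>" "A / ((1 - 4 * K * \<epsilon>) * (1 - 4 * \<epsilon>)) + B / (1 - 5 * K * \<epsilon>)\<^sup>2 \<le> A + B + \<eta>"
proof -
  have lim: "((\<lambda>\<epsilon>. h \<epsilon>) \<longlongrightarrow> h 0) (at_right 0)" if "isCont h 0" for h :: "real \<Rightarrow> real"
    using that unfolding isCont_def by (rule filterlim_at_split[THEN iffD1, THEN conjunct2])
  have ev: "\<forall>\<^sub>F \<epsilon> in at_right 0. h \<epsilon> < y" if "isCont h 0" "h 0 < y" for h :: "real \<Rightarrow> real" and y
    using lim[OF that(1)] that(2) by (rule order_tendstoD(2))
  have "\<forall>\<^sub>F \<epsilon> in at_right (0::real). 0 < \<epsilon> \<and> \<epsilon> < r1 \<and> 16 * K * \<epsilon> < 1 \<and> 8 * \<epsilon> < 1 \<and> 4 * \<epsilon> < r2 \<and> 2 * C * \<epsilon> < \<eta> \<and>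
    \<epsilon> * (12 * C\<^sup>2) < \<eta> \<and> A / ((1 - 4 * K * \<epsilon>) * (1 - 4 * \<epsilon>)) + B / (1 - 5 * K * \<epsilon>)\<^sup>2 < A + B + \<eta>"
    using assms
    by (intro eventually_conj ev eventually_at_right_less continuous_intros) auto
  hence "\<exists>\<epsilon>. 0 < \<epsilon> \<and> \<epsilon> < r1 \<and> 16 * K * \<epsilon> < 1 \<and> 8 * \<epsilon> < 1 \<and> 4 * \<epsilon> < r2 \<and> 2 * C * \<epsilon> < \<eta> \<and>
    \<epsilon> * (12 * C\<^sup>2) < \<eta> \<and> A / ((1 - 4 * K * \<epsilon>) * (1 - 4 * \<epsilon>)) + B / (1 - 5 * K * \<epsilon>)\<^sup>2 < A + B + \<eta>"
    by (rule eventually_happens'[OF trivial_limit_at_right_real])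
  then obtain \<epsilon> where "0 < \<epsilon> \<and> \<epsilon> < r1 \<and> 16 * K * \<epsilon> < 1 \<and> 8 * \<epsilon> < 1 \<and> 4 * \<epsilon> < r2 \<and> 2 * C * \<epsilon> < \<eta> \<and>
    \<epsilon> * (12 * C\<^sup>2) < \<eta> \<and> A / ((1 - 4 * K * \<epsilon>) * (1 - 4 * \<epsilon>)) + B / (1 - 5 * K * \<epsilon>)\<^sup>2 < A + B + \<eta>" ..
  thus ?thesis by (intro that[of \<epsilon>]) auto
qed

text \<open>
  The glued curve of the upper bound for a fixed \<open>\<epsilon>\<close>, chosen such that the total error is at most \<open>\<eta>\<close> for
  large indices.
\<close>
lemma Theta_recovery_approx:
  fixes f :: "'a::metric_space \<Rightarrow> ereal"
  assumes ga: "gamma_along sequentially fh f" and cv: "real_convexity K f" and cvn: "\<And>n. real_convexity K (fh n)"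
    and K: "K > 0" and ln: "\<And>n. lsc (fh n)" and l: "lsc f"
    and iso: "\<And>x::'a. open {x} \<Longrightarrow> UNIV = {x}"
    and proper: "\<forall>S::'a set. closed S \<and> bounded S \<longrightarrow> compact S"
    and geo: "\<forall>x y::'a. \<exists>\<gamma>. constant_speed_geodesic \<gamma> \<and> \<gamma> 0 = x \<and> \<gamma> 1 = y"
    and dense: "\<And>n. closure (eff_dom (fh n)) = UNIV"
    and x0: "x0h \<longlonglongrightarrow> x0" and x1: "x1h \<longlonglongrightarrow> x1" and C: "0 \<le> C"
    and s0: "\<forall>\<^sub>F n in sequentially. slope_le K (fh n) C (x0h n)"
    and s1: "\<forall>\<^sub>F n in sequentially. slope_le K (fh n) C (x1h n)"
    and fin: "Theta f x0 x1 c < \<infinity>" and \<eta>: "\<eta> > 0"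
  shows "\<forall>\<^sub>F n in sequentially. \<exists>b\<in>extensional {0..1}. continuous_on {0..1} b \<and> (\<forall>t\<in>{0..1}. dist (b t) (c t) \<le> \<eta>) \<and>
     Theta (fh n) (x0h n) (x1h n) b \<le> Theta f x0 x1 c + ennreal \<eta>"
proof -
  have nin: "\<forall>n x. fh n x \<noteq> -\<infinity>" using cvn by (auto simp: real_convexity_def)
  have ac: "abs_cont_curve c" "c 0 = x0" "c 1 = x1" using fin unfolding Theta_def by (auto split: if_splits)
  have sm: "descending_slope f \<in> borel_measurable borel" by (rule descending_slope_measurable[OF cv K l iso])
  have smn: "descending_slope (fh n) \<in> borel_measurable borel" for n by (rule descending_slope_measurable[OF cvn K ln iso])
  have Th: "Theta f x0 x1 c = kinetic c + slope_energy f c" by (rule Theta_eq[OF ac sm])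
  have "kinetic c < \<infinity>" "slope_energy f c < \<infinity>" using fin unfolding Th by (auto simp: less_top)
  then obtain A B where AB: "kinetic c = ennreal A" "0 \<le> A" "slope_energy f c = ennreal B" "0 \<le> B"
    by (cases "kinetic c"; cases "slope_energy f c") auto
  have sfin: "slope_energy f c < \<infinity>" using AB by simp
  have cont: "continuous_on UNIV (\<lambda>t. c (clamp01 t))" by (rule abs_cont_curve_continuous[OF ac(1)])
  have "continuous_on {0..1} (\<lambda>t. c (clamp01 t))" by (rule continuous_on_subset[OF cont]) simp
  hence "continuous_on {0..1} c" by (rule continuous_on_eq) (simp add: clamp01_id)
  hence "uniformly_continuous_on {0..1} c" by (rule compact_uniformly_continuous) simp
  moreover have \<eta>8: "\<eta> / 8 > 0" using \<eta> by simp
  ultimately obtain \<gamma> where \<gamma>: "\<gamma> > 0" "\<And>s t. s \<in> {0..1} \<Longrightarrow> t \<in> {0..1} \<Longrightarrow> dist t s < \<gamma> \<Longrightarrow> dist (c t) (c s) < \<eta> / 8"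
    unfolding uniformly_continuous_on_def by blast
  have "\<exists>\<epsilon>0>0. \<forall>\<epsilon> S. 0 < \<epsilon> \<and> \<epsilon> \<le> \<epsilon>0 \<and> 16 * K * \<epsilon> \<le> 1 \<and> (\<forall>\<^sub>F n in sequentially. smoothing K (fh n) \<epsilon> (S n)) \<longrightarrow>
       (\<forall>\<^sub>F n in sequentially. \<forall>t\<in>{0..1}. dist (S n (c t)) (c t) \<le> \<eta> / 8)"
  proof (rule smoothing_uniformly_close[OF ga cv nin l iso proper K s0 x0 C ac(1) sfin \<eta>8])
    fix \<epsilon>0 :: real
    assume e0: "\<epsilon>0 > 0" and H: "\<And>\<epsilon> S. 0 < \<epsilon> \<Longrightarrow> \<epsilon> \<le> \<epsilon>0 \<Longrightarrow> 16 * K * \<epsilon> \<le> 1 \<Longrightarrow>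
       \<forall>\<^sub>F n in sequentially. smoothing K (fh n) \<epsilon> (S n) \<Longrightarrow>
       \<forall>\<^sub>F n in sequentially. \<forall>t\<in>{0..1}. dist (S n (c t)) (c t) \<le> \<eta> / 8"
    show ?thesis
      by (intro exI[of _ \<epsilon>0] conjI allI impI e0, elim conjE, rule H)
  qed
  then obtain \<epsilon>0 where \<epsilon>0: "\<epsilon>0 > 0"
    "\<And>\<epsilon> S. 0 < \<epsilon> \<Longrightarrow> \<epsilon> \<le> \<epsilon>0 \<Longrightarrow> 16 * K * \<epsilon> \<le> 1 \<Longrightarrow> \<forall>\<^sub>F n in sequentially. smoothing K (fh n) \<epsilon> (S n) \<Longrightarrow>
       \<forall>\<^sub>F n in sequentially. \<forall>t\<in>{0..1}. dist (S n (c t)) (c t) \<le> \<eta> / 8"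
    by blast
  obtain \<epsilon> where \<epsilon>: "0 < \<epsilon>" "\<epsilon> \<le> \<epsilon>0" "16 * K * \<epsilon> \<le> 1" "8 * \<epsilon> \<le> 1" "4 * \<epsilon> < \<gamma>" "2 * C * \<epsilon> \<le> \<eta> / 8"
    "\<epsilon> * (12 * C\<^sup>2) < \<eta> / 8" "A / ((1 - 4 * K * \<epsilon>) * (1 - 4 * \<epsilon>)) + B / (1 - 5 * K * \<epsilon>)\<^sup>2 \<le> A + B + \<eta> / 8"
    by (fact recovery_parameter[OF K \<eta>8 \<epsilon>0(1) \<gamma>(1)])
  define \<kappa> where "\<kappa> = 1 - 4 * K * \<epsilon>"
  define k where "k = 1 - 5 * K * \<epsilon>"
  define \<beta> where "\<beta> = 1 - 4 * \<epsilon>"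
  have "16 * (K * \<epsilon>) \<le> 1" using \<epsilon> by (simp add: ac_simps)
  hence \<kappa>: "0 < \<kappa>" "0 < k" by (simp_all add: \<kappa>_def k_def)
  have \<beta>: "1/2 \<le> \<beta>" "\<beta> \<le> 1" using \<epsilon> by (auto simp: \<beta>_def)
  have "\<exists>S. slope_le K (fh n) C (x0h n) \<longrightarrow> smoothing K (fh n) \<epsilon> S \<and>
      (\<forall>q M. slope_le K (fh n) M q \<longrightarrow> 0 \<le> M \<longrightarrow> reach K (fh n) (2 * M) \<epsilon> q (S q))" for n
  proof (cases "slope_le K (fh n) C (x0h n)")
    case True
    interpret semiconvex K "fh n" "x0h n" C
      by unfold_locales (fact K cvn ln proper True C)+
    obtain S where S: "\<And>x. regularizes K (fh n) \<epsilon> x (S x)"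
      "\<And>x y. (1 - 4 * K * \<epsilon>) * (dist (S x) (S y))\<^sup>2 \<le> (dist x y)\<^sup>2"
      "\<And>q M. slope_le K (fh n) M q \<Longrightarrow> 0 \<le> M \<Longrightarrow> reach K (fh n) (2 * M) \<epsilon> q (S q)"
      by (fact smoothing_maps[OF \<epsilon>(1,3) dense])
    show ?thesis unfolding smoothing_def using S by (intro exI[of _ S]) simp
  qed simp
  hence "\<exists>S. \<forall>n. slope_le K (fh n) C (x0h n) \<longrightarrow> smoothing K (fh n) \<epsilon> (S n) \<and>
      (\<forall>q M. slope_le K (fh n) M q \<longrightarrow> 0 \<le> M \<longrightarrow> reach K (fh n) (2 * M) \<epsilon> q (S n q))"
    by (intro choice allI)
  then obtain S where S: "\<And>n. slope_le K (fh n) C (x0h n) \<Longrightarrow> smoothing K (fh n) \<epsilon> (S n)"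
    "\<And>n q M. slope_le K (fh n) C (x0h n) \<Longrightarrow> slope_le K (fh n) M q \<Longrightarrow> 0 \<le> M \<Longrightarrow> reach K (fh n) (2 * M) \<epsilon> q (S n q)"
    by blast
  have Sev: "\<forall>\<^sub>F n in sequentially. smoothing K (fh n) \<epsilon> (S n)" using s0 by eventually_elim (rule S(1))
  have close: "\<forall>\<^sub>F n in sequentially. \<forall>t\<in>{0..1}. dist (S n (c t)) (c t) \<le> \<eta> / 8"
    by (rule \<epsilon>0(2)[OF \<epsilon>(1-3) Sev])
  have slopes: "\<forall>\<^sub>F n in sequentially. slope_energy (fh n) (\<lambda>t. S n (c t)) < ennreal (B / k\<^sup>2 + \<eta> / 8)"
  proof (rule Limsup_lessD)
    have "limsup (\<lambda>n. slope_energy (fh n) (\<lambda>t. S n (c t))) \<le> ennreal (1 / k\<^sup>2) * ennreal B"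
      using slope_energy_smoothing_limsup[OF ga cv cvn ln l iso proper K \<epsilon>(1,3) Sev s0 x0 C ac(1) sfin]
      unfolding k_def AB(3) .
    also have "\<dots> = ennreal (B / k\<^sup>2)" using AB(4) by (simp add: ennreal_mult'[symmetric])
    also have "\<dots> < ennreal (B / k\<^sup>2 + \<eta> / 8)" using \<eta> AB(4) by (intro ennreal_lessI) (auto intro: add_nonneg_pos)
    finally show "limsup (\<lambda>n. slope_energy (fh n) (\<lambda>t. S n (c t))) < ennreal (B / k\<^sup>2 + \<eta> / 8)" .
  qed
  \<comment> \<open>The cost of a connecting piece in terms of the distance of the two starting points; at \<open>d = 0\<close> it is \<open>12 * C\<^sup>2 * \<epsilon>\<close>.\<close>
  define cost where "cost d = \<epsilon> * (8 * C\<^sup>2 + ((2 * d / \<epsilon>)\<^sup>2 + (2 * C + 2 * d / \<epsilon>)\<^sup>2))" for d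
  have costlim: "\<forall>\<^sub>F n in sequentially. cost (dist (q n) x) < \<eta> / 8 \<and> dist (q n) x < \<eta> / 16" if "q \<longlonglongrightarrow> x" for q and x :: 'a
  proof (rule eventually_conj)
    have "(\<lambda>n. cost (dist (q n) x)) \<longlonglongrightarrow> cost (dist x x)"
      unfolding cost_def using \<epsilon>(1) by (intro tendsto_intros that) auto
    moreover have "cost (dist x x) = \<epsilon> * (12 * C\<^sup>2)" by (simp add: cost_def power_mult_distrib)
    ultimately show "\<forall>\<^sub>F n in sequentially. cost (dist (q n) x) < \<eta> / 8"
      using \<epsilon>(7) by (intro order_tendstoD(2)) auto
    show "\<forall>\<^sub>F n in sequentially. dist (q n) x < \<eta> / 16" using \<eta> by (intro tendstoD[OF that]) simp
  qed
  show ?thesis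
    using s0 s1 close slopes costlim[OF x0] costlim[OF x1]
  proof eventually_elim
    case (elim n)
    have ni: "\<forall>x. fh n x \<noteq> -\<infinity>" using nin by simp
    have Sn: "smoothing K (fh n) \<epsilon> (S n)" by (rule S(1)[OF elim(1)])
    have reg: "regularizes K (fh n) \<epsilon> x (S n x)" for x using Sn by (simp add: smoothing_def)
    have lip: "dist (S n x) (S n y) \<le> 2 * dist x y" for x y by (rule smoothing_Lipschitz[OF Sn \<epsilon>(3)])
    have lip\<kappa>: "\<kappa> * (dist (S n x) (S n y))\<^sup>2 \<le> (dist x y)\<^sup>2" for x y using Sn by (simp add: smoothing_def \<kappa>_def)
    have cost0: "0 \<le> cost d" for d using \<epsilon>(1) by (simp add: cost_def)
    have con: "\<exists>b. b 0 = q \<and> b (2 * \<epsilon>) = S n x \<and> action_le (fh n) 0 (2 * \<epsilon>) b (ennreal (cost (dist q x))) \<and>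
        (\<forall>s. 0 \<le> s \<longrightarrow> s \<le> 2 * \<epsilon> \<longrightarrow> dist (b s) x < \<eta> / 2)"
      if q: "slope_le K (fh n) C q" and dq: "dist q x < \<eta> / 16" and Sx: "dist (S n x) x \<le> \<eta> / 8" for q x
    proof -
      obtain b where b: "b 0 = q" "b (2 * \<epsilon>) = S n x"
        "action_le (fh n) 0 (2 * \<epsilon>) b (ennreal (\<epsilon> * (8 * C\<^sup>2 + ((2 * dist q x / \<epsilon>)\<^sup>2 + (2 * C + 2 * dist q x / \<epsilon>)\<^sup>2))))"
        "\<And>s. 0 \<le> s \<Longrightarrow> s \<le> 2 * \<epsilon> \<Longrightarrow> dist (b s) q \<le> 2 * C * \<epsilon> \<or> (\<exists>y. b s = S n y \<and> dist y x \<le> dist q x)"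
        by (fact connector[OF K \<epsilon>(1,3) ni geo reg lip q C S(2)[OF elim(1) q C]])
      have "dist (b s) x < \<eta> / 2" if s: "0 \<le> s" "s \<le> 2 * \<epsilon>" for s
        using b(4)[OF s]
      proof
        assume "dist (b s) q \<le> 2 * C * \<epsilon>"
        thus ?thesis using dist_triangle[of "b s" x q] \<epsilon>(6) dq \<eta> by linarith
      next
        assume "\<exists>y. b s = S n y \<and> dist y x \<le> dist q x"
        then obtain y where y: "b s = S n y" "dist y x \<le> dist q x" by blast
        have "dist (S n y) x \<le> dist (S n y) (S n x) + dist (S n x) x" by (rule dist_triangle)
        thus ?thesis using lip[of y x] y dq Sx \<eta> by simp
      qed
      thus ?thesis using b(1-3) unfolding cost_def by blast
    qed
    have Sx0: "dist (S n x0) x0 \<le> \<eta> / 8" "dist (S n x1) x1 \<le> \<eta> / 8" using elim(3) ac(2,3) by force+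
    obtain b0 where b0: "b0 0 = x0h n" "b0 (2 * \<epsilon>) = S n x0" "action_le (fh n) 0 (2 * \<epsilon>) b0 (ennreal (cost (dist (x0h n) x0)))"
      "\<And>s. 0 \<le> s \<Longrightarrow> s \<le> 2 * \<epsilon> \<Longrightarrow> dist (b0 s) x0 < \<eta> / 2"
      using con[OF elim(1) conjunct2[OF elim(5)] Sx0(1)] by blast
    obtain b1 where b1: "b1 0 = x1h n" "b1 (2 * \<epsilon>) = S n x1" "action_le (fh n) 0 (2 * \<epsilon>) b1 (ennreal (cost (dist (x1h n) x1)))"
      "\<And>s. 0 \<le> s \<Longrightarrow> s \<le> 2 * \<epsilon> \<Longrightarrow> dist (b1 s) x1 < \<eta> / 2"
      using con[OF elim(2) conjunct2[OF elim(6)] Sx0(2)] by blast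
    \<comment> \<open>The middle piece runs through \<open>c\<close> during the time \<open>\<beta> = 1 - 4 * \<epsilon>\<close> that the two connecting pieces leave.\<close>
    define mid where "mid t = S n (c ((t - 2 * \<epsilon>) / \<beta>))" for t
    have end\<beta>: "2 * \<epsilon> + \<beta> = 1 - 2 * \<epsilon>" by (simp add: \<beta>_def)
    have mid_act: "action_le (fh n) (2 * \<epsilon>) (1 - 2 * \<epsilon>) mid (ennreal (1 / (\<kappa> * \<beta>)) * kinetic c + slope_energy (fh n) (\<lambda>t. S n (c t)))"
      unfolding mid_def[abs_def] end\<beta>[symmetric]
      by (rule action_le_smoothed[OF ac(1) \<kappa>(1) _ \<beta>(2) lip\<kappa> smn]) (use \<beta> in simp)
    have mid_ends: "mid (2 * \<epsilon>) = S n x0" "mid (1 - 2 * \<epsilon>) = S n x1"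
    proof -
      show "mid (2 * \<epsilon>) = S n x0" by (simp add: mid_def ac(2))
      have "(1 - 2 * \<epsilon> - 2 * \<epsilon>) / \<beta> = 1" using \<beta> unfolding end\<beta>[symmetric] by simp
      thus "mid (1 - 2 * \<epsilon>) = S n x1" unfolding mid_def by (simp only: ac(3))
    qed
    define d1 where "d1 t = (if t \<le> 2 * \<epsilon> then b0 t else mid t)" for t
    define d2 where "d2 t = (if t \<le> 1 - 2 * \<epsilon> then d1 t else b1 (1 - t))" for t
    have act1: "action_le (fh n) 0 (1 - 2 * \<epsilon>) d1 (ennreal (cost (dist (x0h n) x0)) +
        (ennreal (1 / (\<kappa> * \<beta>)) * kinetic c + slope_energy (fh n) (\<lambda>t. S n (c t))))"
      unfolding d1_def[abs_def] using \<epsilon>(1,4) by (intro action_le_concat[OF b0(3) mid_act]) (auto simp: b0(2) mid_ends)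
    have act_rev: "action_le (fh n) (1 - 2 * \<epsilon>) 1 (\<lambda>t. b1 (1 - t)) (ennreal (cost (dist (x1h n) x1)))"
      by (rule action_le_reverse[OF b1(3)])
    have d1_end: "d1 (1 - 2 * \<epsilon>) = S n x1" using \<epsilon>(4) mid_ends by (simp add: d1_def)
    have "action_le (fh n) 0 1 d2 (ennreal (cost (dist (x0h n) x0)) +
        (ennreal (1 / (\<kappa> * \<beta>)) * kinetic c + slope_energy (fh n) (\<lambda>t. S n (c t))) + ennreal (cost (dist (x1h n) x1)))"
      unfolding d2_def[abs_def] using \<epsilon>(1,4) by (intro action_le_concat[OF act1 act_rev]) (auto simp: b1(2) d1_end)
    moreover have "ennreal (cost (dist (x0h n) x0)) +
        (ennreal (1 / (\<kappa> * \<beta>)) * kinetic c + slope_energy (fh n) (\<lambda>t. S n (c t))) + ennreal (cost (dist (x1h n) x1))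
        \<le> ennreal (A + B + \<eta>)"
    proof -
      have pos: "0 \<le> A / (\<kappa> * \<beta>)" "0 \<le> B / k\<^sup>2 + \<eta> / 8" using AB \<kappa> \<beta> \<eta> by auto
      have "ennreal (cost (dist (x0h n) x0)) +
        (ennreal (1 / (\<kappa> * \<beta>)) * kinetic c + slope_energy (fh n) (\<lambda>t. S n (c t))) + ennreal (cost (dist (x1h n) x1))
        \<le> ennreal (\<eta> / 8) + (ennreal (A / (\<kappa> * \<beta>)) + ennreal (B / k\<^sup>2 + \<eta> / 8)) + ennreal (\<eta> / 8)"
      proof (intro add_mono ennreal_leI)
        show "cost (dist (x0h n) x0) \<le> \<eta> / 8" "cost (dist (x1h n) x1) \<le> \<eta> / 8" using elim(5,6) by auto
        show "slope_energy (fh n) (\<lambda>t. S n (c t)) \<le> ennreal (B / k\<^sup>2 + \<eta> / 8)" using elim(4) by simp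
        show "ennreal (1 / (\<kappa> * \<beta>)) * kinetic c \<le> ennreal (A / (\<kappa> * \<beta>))"
          unfolding AB(1) using \<kappa> \<beta> AB(2) by (simp add: ennreal_mult'[symmetric])
      qed
      also have "\<dots> = ennreal (\<eta> / 8 + (A / (\<kappa> * \<beta>) + (B / k\<^sup>2 + \<eta> / 8)) + \<eta> / 8)"
        using pos \<eta> by (simp add: ennreal_plus[symmetric] del: ennreal_plus)
      also have "\<dots> \<le> ennreal (A + B + \<eta>)"
        using \<epsilon>(8) \<eta> unfolding \<kappa>_def[symmetric] k_def[symmetric] \<beta>_def[symmetric] by (intro ennreal_leI) linarith
      finally show ?thesis .
    qed
    ultimately have act2: "action_le (fh n) 0 1 d2 (ennreal (A + B + \<eta>))" by (rule action_le_mono)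
    define b where "b = restrict d2 {0..1}"
    have bact: "action_le (fh n) 0 1 b (ennreal (A + B + \<eta>))"
      by (rule action_le_cong[OF act2]) (simp add: b_def)
    have "b 0 = x0h n" using \<epsilon>(1,4) by (simp add: b_def d2_def d1_def b0(1))
    moreover have "b 1 = x1h n" using \<epsilon>(1) by (simp add: b_def d2_def b1(1))
    ultimately have "Theta (fh n) (x0h n) (x1h n) b \<le> ennreal (A + B + \<eta>)" "continuous_on {0..1} b"
      using Theta_le_action[OF bact smn] by auto
    moreover have "ennreal (A + B + \<eta>) = Theta f x0 x1 c + ennreal \<eta>"
      unfolding Th AB(1,3) using AB \<eta> by simp
    moreover have "dist (b t) (c t) \<le> \<eta>" if t: "t \<in> {0..1}" for t
    proof -
      consider "t \<le> 2 * \<epsilon>" | "2 * \<epsilon> < t" "t \<le> 1 - 2 * \<epsilon>" | "1 - 2 * \<epsilon> < t" by linarith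
      thus ?thesis
      proof cases
        case 1
        have "b t = b0 t" using 1 t \<epsilon>(4) by (simp add: b_def d2_def d1_def)
        moreover have "dist (b0 t) x0 < \<eta> / 2" using b0(4) 1 t by simp
        moreover have "dist (c 0) (c t) < \<eta> / 8" using 1 t \<epsilon>(1,5) by (intro \<gamma>(2)) (auto simp: dist_real_def)
        ultimately show ?thesis using dist_triangle[of "b0 t" "c t" x0] ac(2) \<eta> by simp
      next
        case 2
        define u where "u = (t - 2 * \<epsilon>) / \<beta>"
        have u: "u \<in> {0..1}" using 2 \<beta> end\<beta> by (auto simp: u_def divide_le_eq)
        \<comment> \<open>The reparametrization displaces times by at most \<open>4 * \<epsilon>\<close>.\<close>
        have ut: "u - t = 2 * \<epsilon> * (2 * t - 1) / \<beta>" using \<beta> by (simp add: u_def field_simps) (simp add: \<beta>_def algebra_simps)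
        have "\<bar>u - t\<bar> = 2 * \<epsilon> * \<bar>2 * t - 1\<bar> / \<beta>" unfolding ut using \<epsilon>(1) \<beta> by (simp add: abs_mult)
        also have "\<dots> \<le> 2 * \<epsilon> * 1 / (1/2)" using t \<epsilon>(1) \<beta> by (intro frac_le mult_left_mono) auto
        also have "\<dots> < \<gamma>" using \<epsilon>(5) by simp
        finally have "dist (c u) (c t) < \<eta> / 8" using u t by (intro \<gamma>(2)) (auto simp: dist_real_def)
        moreover have "dist (S n (c u)) (c u) \<le> \<eta> / 8" using elim(3) u by blast
        moreover have "b t = S n (c u)" using 2 t by (simp add: b_def d2_def d1_def mid_def u_def)
        ultimately show ?thesis using dist_triangle[of "S n (c u)" "c t" "c u"] \<eta> by simp
      next
        case 3
        have "b t = b1 (1 - t)" using 3 t by (simp add: b_def d2_def)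
        moreover have "dist (b1 (1 - t)) x1 < \<eta> / 2" using b1(4)[of "1 - t"] 3 t by simp
        moreover have "dist (c 1) (c t) < \<eta> / 8" using 3 t \<epsilon>(1,5) by (intro \<gamma>(2)) (auto simp: dist_real_def)
        ultimately show ?thesis using dist_triangle[of "b1 (1 - t)" "c t" x1] ac(3) \<eta> by simp
      qed
    qed
    moreover have "b \<in> extensional {0..1}" by (simp add: b_def)
    ultimately show ?case by auto
  qed
qed

text \<open>
  Diagonal choice: at index \<open>n\<close> use the largest \<open>k \<le> n\<close> whose threshold \<open>N k\<close> has been passed.
\<close>
lemma diagonal_selection:
  fixes P :: "nat \<Rightarrow> real \<Rightarrow> bool"
  assumes ev: "\<And>e. e > 0 \<Longrightarrow> \<forall>\<^sub>F n in sequentially. P n e"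
  obtains e :: "nat \<Rightarrow> real" where "e \<longlonglongrightarrow> 0" "\<forall>\<^sub>F n in sequentially. P n (e n)" "\<And>n. 0 < e n"
proof -
  have "\<exists>N. \<forall>n\<ge>N. P n (1 / real (Suc k))" for k
    using ev[of "1 / real (Suc k)"] unfolding eventually_sequentially by simp
  then obtain N where N: "\<And>k n. N k \<le> n \<Longrightarrow> P n (1 / real (Suc k))" by metis
  define j where "j n = Max ({0} \<union> {k. k \<le> n \<and> N k \<le> n})" for n
  have finite: "finite ({0} \<union> {k. k \<le> n \<and> N k \<le> n})" for n by simp
  have j: "k \<le> j n" if "k \<le> n" "N k \<le> n" for k n
    unfolding j_def using that finite by (intro Max_ge) auto
  have jin: "j n \<in> {0} \<union> {k. k \<le> n \<and> N k \<le> n}" for n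
    unfolding j_def using finite[of n] by (intro Max_in) auto
  define e where "e n = 1 / real (Suc (j n))" for n
  show ?thesis
  proof (rule that[of e])
    show "0 < e n" for n by (simp add: e_def)
    show "e \<longlonglongrightarrow> 0"
    proof (rule tendstoI)
      fix r :: real assume "r > 0"
      then obtain k where k: "1 / real (Suc k) < r" using nat_approx_posE by metis
      have "dist (e n) 0 < r" if "n \<ge> max k (N k)" for n
      proof -
        have "k \<le> j n" using j that by simp
        hence "1 / real (Suc (j n)) \<le> 1 / real (Suc k)" by (intro divide_left_mono) auto
        thus ?thesis using k by (simp add: e_def)
      qed
      thus "\<forall>\<^sub>F n in sequentially. dist (e n) 0 < r" unfolding eventually_sequentially by blast
    qed
    have "P n (e n)" if "n \<ge> N 0" for n
    proof -
      have "N (j n) \<le> n" using jin[of n] that by auto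
      thus ?thesis unfolding e_def by (rule N)
    qed
    thus "\<forall>\<^sub>F n in sequentially. P n (e n)" unfolding eventually_sequentially by blast
  qed
qed

lemma curve_space_memberI:
  fixes b :: "real \<Rightarrow> 'a::metric_space"
  assumes "b \<in> extensional {0..1}" "continuous_on {0..1} b"
  shows "b \<in> mspace curve_space"
proof -
  have "bounded (b ` {0..1})"
    by (intro compact_imp_bounded compact_continuous_image assms(2)) simp
  thus ?thesis using assms by (simp add: mbounded_iff_bounded)
qed

lemma limitin_curve_spaceI:
  fixes b :: "real \<Rightarrow> 'a::metric_space"
  assumes b: "b \<in> mspace curve_space" and bn: "\<And>n. bn n \<in> mspace curve_space" and e: "e \<longlonglongrightarrow> 0"
    and le: "\<forall>\<^sub>F n in sequentially. \<forall>t\<in>{0..1}. dist (bn n t) (b t) \<le> e n"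
  shows "limitin (mtopology_of curve_space) bn b sequentially"
  unfolding mtopology_of_def Metric_space.limitin_metric[OF Metric_space_mspace_mdist]
proof (intro conjI b allI impI)
  fix r :: real assume r: "r > 0"
  have "\<forall>\<^sub>F n in sequentially. e n < r" using order_tendstoD(2)[OF e r] .
  with le show "\<forall>\<^sub>F n in sequentially. bn n \<in> mspace curve_space \<and> mdist curve_space (bn n) b < r"
  proof eventually_elim
    case (elim n)
    have "mdist curve_space (bn n) b \<le> e n"
      using elim(1) by (subst cfunspace_mdist_le[OF bn b]) auto
    thus ?case using elim(2) bn by simp
  qed
qed

lemma limitin_curve_spaceD:
  fixes b :: "real \<Rightarrow> 'a::metric_space"
  assumes "limitin (mtopology_of curve_space) bn b sequentially" and t: "t \<in> {0..1}"
  shows "(\<lambda>n. bn n t) \<longlonglongrightarrow> b t"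
proof (rule tendstoI)
  fix r :: real assume r: "r > 0"
  have b: "b \<in> mspace curve_space" and ev: "\<forall>\<^sub>F n in sequentially. bn n \<in> mspace curve_space \<and> mdist curve_space (bn n) b < r"
    using assms(1) r unfolding mtopology_of_def Metric_space.limitin_metric[OF Metric_space_mspace_mdist] by blast+
  from ev show "\<forall>\<^sub>F n in sequentially. dist (bn n t) (b t) < r"
  proof eventually_elim
    case (elim n)
    have "\<forall>x\<in>topspace (top_of_set {0..1}). mdist euclidean_metric (bn n x) (b x) \<le> mdist curve_space (bn n) b"
      using elim b by (subst cfunspace_mdist_le[symmetric]) auto
    hence "dist (bn n t) (b t) \<le> mdist curve_space (bn n) b" using t by simp
    thus ?case using elim by linarith
  qed
qed

theorem theorem17:
  fixes fh :: "nat \<Rightarrow> 'a::metric_space \<Rightarrow> ereal"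
    and f :: "'a \<Rightarrow> ereal"
    and lam :: real
    and x0h x1h :: "nat \<Rightarrow> 'a"
    and x0 x1 :: 'a
  assumes proper_space: "\<forall>S::'a set. closed S \<and> bounded S \<longrightarrow> compact S"
    and geodesic_space:
      "\<forall>x y::'a. \<exists>\<gamma>. constant_speed_geodesic \<gamma> \<and> \<gamma> 0 = x \<and> \<gamma> 1 = y"
    and fh_range: "\<forall>h x. fh h x \<noteq> -\<infinity>"
    and fh_lsc: "\<forall>h. lsc (fh h)"
    and f_range: "\<forall>x. f x \<noteq> -\<infinity>"
    and f_proper: "eff_dom f \<noteq> {}"
    and f_lsc: "lsc f"
    and Gamma_f: "Gamma_converges euclidean_metric fh f"
    and convexity: "\<forall>g \<in> range fh \<union> {f}. convexity_condition lam g"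
    and dense_dom: "\<forall>h. closure (eff_dom (fh h)) = UNIV"
    and x0_lim: "x0h \<longlonglongrightarrow> x0"
    and x1_lim: "x1h \<longlonglongrightarrow> x1"
    and slope_x0: "limsup (\<lambda>h. descending_slope (fh h) (x0h h)) < \<infinity>"
    and slope_x1: "limsup (\<lambda>h. descending_slope (fh h) (x1h h)) < \<infinity>"
  shows "Gamma_converges curve_space (\<lambda>h. Theta (fh h) (x0h h) (x1h h)) (Theta f x0 x1)"
proof -
  \<comment> \<open>A positive \<open>K\<close> gives the finite end point \<open>1 / K\<close> to the admissible \<open>\<tau>\<close>.\<close>
  define K where "K = max 1 (- lam)"
  have K: "K > 0" "- lam \<le> K" by (auto simp: K_def)
  have cvn: "real_convexity K (fh n)" for n
    using convexity fh_range by (intro convexity_condition_real[OF _ _ K]) auto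
  have cv: "real_convexity K f"
    using convexity f_range by (intro convexity_condition_real[OF _ _ K]) auto
  have iso: "UNIV = {x}" if "open {x}" for x :: 'a
    using geodesic_space_isolated[OF geodesic_space that] by blast
  have ga: "gamma_along sequentially fh f" by (rule Gamma_converges_imp_gamma_along[OF Gamma_f f_range])
  have ln: "lsc (fh n)" for n using fh_lsc by simp
  have bound: "\<exists>C\<ge>0. \<forall>\<^sub>F n in sequentially. slope_le K (fh n) C (xh n)"
    if xh: "limsup (\<lambda>h. descending_slope (fh h) (xh h)) < \<infinity>" for xh
  proof -
    obtain y where y: "limsup (\<lambda>h. descending_slope (fh h) (xh h)) < y" "y < \<infinity>" using dense[OF xh] by blast
    obtain C where C: "y = ennreal C" "0 \<le> C" using y(2) by (cases y) auto
    have "\<forall>\<^sub>F n in sequentially. slope_le K (fh n) C (xh n)"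
      using Limsup_lessD[OF y(1)]
    proof eventually_elim
      case (elim n)
      hence "descending_slope (fh n) (xh n) \<le> ennreal C" using C by simp
      thus ?case using descending_slope_le_iff[OF cvn K(1) C(2) iso] by blast
    qed
    thus ?thesis using C(2) by blast
  qed
  obtain C0 where C0: "C0 \<ge> 0" "\<forall>\<^sub>F n in sequentially. slope_le K (fh n) C0 (x0h n)" using bound[OF slope_x0] by blast
  obtain C1 where C1: "C1 \<ge> 0" "\<forall>\<^sub>F n in sequentially. slope_le K (fh n) C1 (x1h n)" using bound[OF slope_x1] by blast
  define C where "C = max C0 C1"
  have C: "0 \<le> C" using C0(1) by (simp add: C_def)
  have s0: "\<forall>\<^sub>F n in sequentially. slope_le K (fh n) C (x0h n)"
    using C0(2) by eventually_elim (erule slope_le_mono, simp add: C_def)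
  have s1: "\<forall>\<^sub>F n in sequentially. slope_le K (fh n) C (x1h n)"
    using C1(2) by eventually_elim (erule slope_le_mono, simp add: C_def)
  show ?thesis
    unfolding Gamma_converges_def
  proof (intro conjI ballI allI impI, elim conjE)
    fix c :: "real \<Rightarrow> 'a" and ch
    assume lim: "limitin (mtopology_of curve_space) ch c sequentially"
    show "Theta f x0 x1 c \<le> liminf (\<lambda>h. Theta (fh h) (x0h h) (x1h h) (ch h))"
    proof (rule ccontr)
      assume "\<not> ?thesis"
      hence "liminf (\<lambda>h. Theta (fh h) (x0h h) (x1h h) (ch h)) < Theta f x0 x1 c" by simp
      then obtain y where y: "liminf (\<lambda>h. Theta (fh h) (x0h h) (x1h h) (ch h)) < y" "y < Theta f x0 x1 c"
        using dense by blast
      obtain E where E: "y = ennreal E" using y(2) by (cases y) auto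
      have "infinite {h. Theta (fh h) (x0h h) (x1h h) (ch h) < y}"
      proof
        assume "finite {h. Theta (fh h) (x0h h) (x1h h) (ch h) < y}"
        hence "\<forall>\<^sub>F h in sequentially. y \<le> Theta (fh h) (x0h h) (x1h h) (ch h)"
          unfolding cofinite_eq_sequentially[symmetric] eventually_cofinite by (simp add: not_le)
        hence "y \<le> liminf (\<lambda>h. Theta (fh h) (x0h h) (x1h h) (ch h))" by (rule Liminf_bounded)
        thus False using y(1) by simp
      qed
      then obtain r :: "nat \<Rightarrow> nat" where r: "strict_mono r" "\<And>k. Theta (fh (r k)) (x0h (r k)) (x1h (r k)) (ch (r k)) < y"
        using infinite_enumerate by blast
      have "Theta f x0 x1 c \<le> ennreal E"
      proof (rule Theta_lower_bound[where an = "x0h \<circ> r" and bn = "x1h \<circ> r" and cn = "\<lambda>k. ch (r k)" and gn = "\<lambda>k. fh (r k)" and K = K])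
        show "gamma_along sequentially (\<lambda>k. fh (r k)) f" by (rule gamma_along_subseq[OF ga r(1)])
        show "(x0h \<circ> r) \<longlonglongrightarrow> x0" by (rule LIMSEQ_subseq_LIMSEQ[OF x0_lim r(1)])
        show "(x1h \<circ> r) \<longlonglongrightarrow> x1" by (rule LIMSEQ_subseq_LIMSEQ[OF x1_lim r(1)])
        show "(\<lambda>k. ch (r k) t) \<longlonglongrightarrow> c t" if "t \<in> {0..1}" for t
          using LIMSEQ_subseq_LIMSEQ[OF limitin_curve_spaceD[OF lim that] r(1)] by (simp add: o_def)
        show "Theta (fh (r k)) ((x0h \<circ> r) k) ((x1h \<circ> r) k) (ch (r k)) \<le> ennreal E" for k
          using r(2)[of k] E by simp
      qed (fact cvn cv K(1) ln f_lsc f_proper iso)+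
      thus False using y(2) E by simp
    qed
  next
    fix c :: "real \<Rightarrow> 'a" assume c: "c \<in> mspace curve_space"
    show "\<exists>ch. (\<forall>h. ch h \<in> mspace curve_space) \<and> limitin (mtopology_of curve_space) ch c sequentially \<and>
        limsup (\<lambda>h. Theta (fh h) (x0h h) (x1h h) (ch h)) \<le> Theta f x0 x1 c"
    proof (cases "Theta f x0 x1 c = \<infinity>")
      case True
      have "limitin (mtopology_of curve_space) (\<lambda>_. c) c sequentially"
        by (rule limitin_curve_spaceI[OF c c tendsto_const]) simp
      thus ?thesis using c True by (intro exI[of _ "\<lambda>_. c"]) simp
    next
      case False
      hence fin: "Theta f x0 x1 c < \<infinity>" by (simp add: less_top)
      define Q where "Q n e b \<longleftrightarrow> b \<in> mspace curve_space \<and> (\<forall>t\<in>{0..1}. dist (b t) (c t) \<le> e) \<and>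
         Theta (fh n) (x0h n) (x1h n) b \<le> Theta f x0 x1 c + ennreal e" for n e b
      have "\<forall>\<^sub>F n in sequentially. \<exists>b. Q n e b" if e: "e > 0" for e
        using Theta_recovery_approx[OF ga cv cvn K(1) ln f_lsc iso proper_space geodesic_space _ x0_lim x1_lim C s0 s1 fin e] dense_dom
        by (auto elim!: eventually_mono simp del: mspace_cfunspace simp: Q_def intro: curve_space_memberI)
      then obtain e :: "nat \<Rightarrow> real" where e: "e \<longlonglongrightarrow> 0" "\<forall>\<^sub>F n in sequentially. \<exists>b. Q n (e n) b" "\<And>n. 0 < e n"
        using diagonal_selection[of "\<lambda>n e. \<exists>b. Q n e b"] by metis
      \<comment> \<open>For the finitely many indices without an approximating curve any curve will do.\<close>
      define ch where "ch n = (if \<exists>b. Q n (e n) b then SOME b. Q n (e n) b else c)" for n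
      have chQ: "\<forall>\<^sub>F n in sequentially. Q n (e n) (ch n)"
        using e(2) by eventually_elim (simp add: ch_def someI_ex)
      have chm: "ch n \<in> mspace curve_space" for n
      proof (cases "\<exists>b. Q n (e n) b")
        case True
        hence "Q n (e n) (ch n)" by (simp add: ch_def someI_ex)
        thus ?thesis unfolding Q_def by blast
      next
        case False
        thus ?thesis using c by (simp only: ch_def if_False)
      qed
      have "limitin (mtopology_of curve_space) ch c sequentially"
        using chQ by (intro limitin_curve_spaceI[OF c chm e(1)]) (auto elim!: eventually_mono simp: Q_def)
      moreover have "limsup (\<lambda>h. Theta (fh h) (x0h h) (x1h h) (ch h)) \<le> Theta f x0 x1 c"
      proof -
        have "(\<lambda>n. Theta f x0 x1 c + ennreal (e n)) \<longlonglongrightarrow> Theta f x0 x1 c + ennreal 0"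
          by (intro tendsto_add tendsto_const tendsto_ennrealI e(1))
        hence "limsup (\<lambda>n. Theta f x0 x1 c + ennreal (e n)) = Theta f x0 x1 c"
          by (intro lim_imp_Limsup) auto
        moreover have "limsup (\<lambda>h. Theta (fh h) (x0h h) (x1h h) (ch h)) \<le> limsup (\<lambda>n. Theta f x0 x1 c + ennreal (e n))"
          using chQ by (intro Limsup_mono) (auto elim!: eventually_mono simp: Q_def)
        ultimately show ?thesis by simp
      qed
      ultimately show ?thesis using chm by blast
    qed
  qed
qed

end
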